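(* In the high-dimensional linear model and with the notation of the context, suppose that (A1)--(A5) hold, that $$\max_{1\le j\le p} K_0^2 s_j^2(\log(pn))^3(\log n)^2/n=o(1),\qquad K_0^4 s_0^2(\log p)^3/n=o(1),$$ and that the tuning parameters are suitably chosen such that $$\lambda\asymp K_0\sqrt{\log(p)/n},\qquad \lambda_j\asymp K_0\sqrt{\log(p)/n}\ \text{ uniformly for } j$$ (that is, there is a choice of tuning parameters of these orders for which the following holds). For $\tau>0$ let $$\widehat{\mathcal S}_0(\tau)=\Big\{j\in\{1,\ldots,p\}:|\breve\beta_j|>\sqrt{\tau\,\widehat\omega_{jj}\log(p)/n}\Big\}.$$ Then $$\inf_{\beta^0\in\Psi(2\sqrt2)}P(\widehat{\mathcal S}_0(2)=\mathcal S_0)\to1,$$ where $\Psi(c_0)=\{\beta=(\beta_1,\ldots,\beta_p)^T:\min_{j\in\mathcal S_0}|\beta_j|/\sqrt{\omega_{jj}}>c_0\sqrt{\log(p)/n}\}$ (here $\mathcal S_0=\{j:\beta_j\neq0\}$), $\omega_{jj}=\sigma_\epsilon^2\theta_{jj}$, and the infimum is restricted to those $\beta^0$ in this set having at most $s_0$ nonzero entries. Moreover, for any $0<\tau<2$, $$\sup_{\beta^0\in\mathcal S^*(s_0)}P(\widehat{\mathcal S}_0(\tau)=\mathcal S_0)\to0,$$ where $\mathcal S^*(s_0)=\{\beta\in\mathbb R^p:\sum_{j=1}^p\mathbf I\{\beta_j\ne0\}=s_0\}$.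
   Context: **Asymptotics.** All limits are as $n\to\infty$; $p=p_n$ and all model quantities may depend on $n$, while constants named $c,c',C,C',c_1,C_1,c_2,C_2$ are positive and do not depend on $n$ or $p$. $a_n\asymp b_n$ means the ratio is bounded above and away from $0$. $\|a\|_q$ is the $\ell_q$ norm and $\|a\|_\infty$ the maximum norm; $\mathbf I\{\cdot\}$ is the indicator. **Model.** $Y=\mathbf X\beta^0+\epsilon$ with response $Y=(Y_1,\dots,Y_n)^T$, random $n\times p$ design $\mathbf X=[X_1,\ldots,X_p]=(X_{ij})$, error $\epsilon=(\epsilon_1,\ldots,\epsilon_n)^T$ independent of $\mathbf X$ with i.i.d. mean-zero entries of variance $\sigma_\epsilon^2$, and unknown $\beta^0=(\beta^0_1,\dots,\beta^0_p)^T$. The rows of $\mathbf X$ are i.i.d. with mean zero and covariance $\Sigma=(\sigma_{ij})$; $\Theta=\Sigma^{-1}=(\theta_{ij})$. $\mathbf X_{-j}$ is $\mathbf X$ without its $j$th column. $\mathcal S_0=\{j:\beta^0_j\ne0\}$; $s_0=s_{0,n}$ is the sparsity level (a bound on $|\mathcal S_0|$); for $1\le j\le p$, $s_j=|\{k\neq j:\theta_{jk}\ne0\}|$. $\gamma_j=\arg\min_{\gamma\in\mathbb R^{p-1}}\mathbb E\|X_j-\mathbf X_{-j}\gamma\|_2^2$ and $\eta_j=X_j-\mathbf X_{-j}\gamma_j=(\eta_{1,j},\ldots,\eta_{n,j})^T$. **Estimators.** Lasso: $\widehat\beta=\arg\min_{\beta\in\mathbb R^p}(\|Y-\mathbf X\beta\|_2^2/n+2\lambda\|\beta\|_1)$.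 Nodewise Lasso: $\widehat\gamma_j=\arg\min_{\gamma\in\mathbb R^{p-1}}(\|X_j-\mathbf X_{-j}\gamma\|_2^2/n+2\lambda_j\|\gamma\|_1)$ with components $\widehat\gamma_{j,k}$, $k\ne j$; $\widehat\tau_j^2=\|X_j-\mathbf X_{-j}\widehat\gamma_j\|_2^2/n+\lambda_j\|\widehat\gamma_j\|_1$; $\widehat C=(\widehat c_{i,j})$ with $\widehat c_{i,i}=1$, $\widehat c_{i,j}=-\widehat\gamma_{i,j}$ for $i\neq j$; $\widehat\Theta=\mathrm{diag}(\widehat\tau_1^{2},\ldots,\widehat\tau_p^{2})^{-1}\widehat C$. $\widehat\Theta_j$ is the $j$th row of $\widehat\Theta$, viewed as a column vector. De-sparsifying Lasso estimator: $\breve\beta=\widehat\beta+\widehat\Theta\mathbf X^T(Y-\mathbf X\widehat\beta)/n$. $\widehat\sigma_\epsilon^2$ is an estimator of $\sigma_\epsilon^2$ computed from $(Y,\mathbf X)$. $\widehat\Sigma=\mathbf X^T\mathbf X/n$ and $\widehat\omega_{jj}=\widehat\sigma_\epsilon^2\widehat\Theta_j^T\widehat\Sigma\widehat\Theta_j$. **Assumptions.** (A1) Either (sub-Gaussian case) $\mathbf X$ has i.i.d. sub-Gaussian rows: $\sup_{\|a\|_2\le1}\mathbb E\exp\{|\sum_{j=1}^pa_jX_{ij}|^2/C\}\le2$ for some large enough constant $C$; or (strongly bounded case) the rows are i.i.d. and, for some $K_n\ge1$ (allowed to grow with $n$), $\max_{i,j}|X_{ij}|\le K_n$, $\max_j\|\mathbf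 X_{-j}\gamma_j\|_\infty\le K_n$ and $\max_j\mathbb E\eta_{1,j}^4\le K_n^4$. Put $K_0=1$ in the sub-Gaussian case and $K_0=K_n$ in the strongly bounded case. (A2) The smallest eigenvalue $\Lambda_{\min}^2$ of $\Sigma$ satisfies $c<\Lambda_{\min}^2$, and $\max_j\Sigma_{j,j}\le C$. (A3) In the sub-Gaussian case: $(\log(pn))^7/n\le C_1n^{-c_1}$, and $\{\epsilon_i\}$ are i.i.d. sub-Gaussian with $c'<\sigma_\epsilon^2<c$. In the strongly bounded case: $\max_{1\le j\le p}s_jK_n^2(\log(pn))^7/n\le C_2n^{-c_2}$, and $\{\epsilon_i\}$ are i.i.d. sub-exponential, i.e. $\mathbb E\exp(|\epsilon_i|/C')\le2$, with $c'<\sigma_\epsilon^2<c$. (A4) There is a sequence $\alpha_n\to+\infty$ of positive numbers with $\alpha_n/p=o(1)$, $\alpha_n(\log p)^2\max_j\lambda_j\sqrt{s_j}=o(1)$ and $P(\alpha_n(\log p)^2|\widehat\sigma_\epsilon^2-\sigma_\epsilon^2|>1)\to0$ (uniformly over the $\beta^0$ under consideration). (A5) With $\widetilde\theta_{ij}=\theta_{ij}/\sqrt{\theta_{ii}\theta_{jj}}$, $\max_{1\le i\ne j\le p}|\widetilde\theta_{ij}|\le c<1$ for some constant $c$.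
   Formalization: Two conditions are added: in the strongly bounded case, eventually s_0 > 0 or some s_j > 0 (else the growth conditions are void); and for the second claim, eventually s_0 ≤ ρp for some ρ < 1 (automatic when p is at least of order √n). Without them the claims can fail. *)

theory Defs
  imports "HOL-Probability.Probability" "Jordan_Normal_Form.Char_Poly"
begin

no_notation vec_nth (infixl \<open>$\<close> 90)
no_notation inner (infix \<open>\<bullet>\<close> 70)

(* Conventions.  Indices start at 0: observations are i < n and covariates are j < p.  A quantity
   at sample size n takes n and p = p_n as arguments; a sequence of models is given by functions
   of n (the probability space M n included), and only sample sizes n > 0 are constrained.
   The random entries are X i j and eps i :: 'a => real. *)

definition sq_l2 :: "real vec \<Rightarrow> real" where
  "sq_l2 v = v \<bullet> v"

definition l1 :: "real vec \<Rightarrow> real" where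
  "l1 v = (\<Sum>i<dim_vec v. \<bar>v $ i\<bar>)"

definition supp :: "real vec \<Rightarrow> nat set" where
  "supp \<beta> = {j. j < dim_vec \<beta> \<and> \<beta> $ j \<noteq> 0}"


section \<open>The model at a fixed sample size\<close>

definition design :: "nat \<Rightarrow> nat \<Rightarrow> (nat \<Rightarrow> nat \<Rightarrow> 'a \<Rightarrow> real) \<Rightarrow> 'a \<Rightarrow> real mat" where
  "design n p X \<omega> = mat n p (\<lambda>(i, j). X i j \<omega>)"

definition response ::
  "nat \<Rightarrow> nat \<Rightarrow> (nat \<Rightarrow> nat \<Rightarrow> 'a \<Rightarrow> real) \<Rightarrow> (nat \<Rightarrow> 'a \<Rightarrow> real) \<Rightarrow> real vec \<Rightarrow> 'a \<Rightarrow> real vec" where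
  "response n p X eps \<beta> \<omega> = design n p X \<omega> *\<^sub>v \<beta> + vec n (\<lambda>i. eps i \<omega>)"

definition linear_model ::
  "'a measure \<Rightarrow> nat \<Rightarrow> nat \<Rightarrow> (nat \<Rightarrow> nat \<Rightarrow> 'a \<Rightarrow> real) \<Rightarrow> (nat \<Rightarrow> 'a \<Rightarrow> real)
    \<Rightarrow> real mat \<Rightarrow> real mat \<Rightarrow> real \<Rightarrow> bool" where
  "linear_model M n p X eps \<Sigma> \<Theta> sig2 \<longleftrightarrow>
     prob_space M \<and> 0 < p \<and>
     \<comment> \<open>i.i.d. rows, mean zero, covariance \<open>\<Sigma>\<close>\<close>
     prob_space.indep_vars M (\<lambda>_. \<Pi>\<^sub>M j\<in>{..<p}. borel) (\<lambda>i \<omega>. \<lambda>j\<in>{..<p}. X i j \<omega>) {..<n} \<and>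
     (\<forall>i<n. distr M (\<Pi>\<^sub>M j\<in>{..<p}. borel) (\<lambda>\<omega>. \<lambda>j\<in>{..<p}. X i j \<omega>)
          = distr M (\<Pi>\<^sub>M j\<in>{..<p}. borel) (\<lambda>\<omega>. \<lambda>j\<in>{..<p}. X 0 j \<omega>)) \<and>
     (\<forall>i<n. \<forall>j<p. integrable M (\<lambda>\<omega>. (X i j \<omega>)\<^sup>2) \<and> (\<integral>\<omega>. X i j \<omega> \<partial>M) = 0) \<and>
     \<Sigma> \<in> carrier_mat p p \<and>
     (\<forall>i<n. \<forall>j<p. \<forall>k<p. (\<integral>\<omega>. X i j \<omega> * X i k \<omega> \<partial>M) = \<Sigma> $$ (j, k)) \<and>
     \<Theta> \<in> carrier_mat p p \<and> inverts_mat \<Sigma> \<Theta> \<and> inverts_mat \<Theta> \<Sigma> \<and>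
     \<comment> \<open>i.i.d. errors, mean zero, variance \<open>sig2\<close>\<close>
     prob_space.indep_vars M (\<lambda>_. borel) eps {..<n} \<and>
     (\<forall>i<n. distr M borel (eps i) = distr M borel (eps 0)) \<and>
     (\<forall>i<n. integrable M (\<lambda>\<omega>. (eps i \<omega>)\<^sup>2) \<and> (\<integral>\<omega>. eps i \<omega> \<partial>M) = 0 \<and>
            (\<integral>\<omega>. (eps i \<omega>)\<^sup>2 \<partial>M) = sig2) \<and>
     \<comment> \<open>errors independent of the design\<close>
     prob_space.indep_set M
       (sets (vimage_algebra (space M) (\<lambda>\<omega>. \<lambda>ij\<in>{..<n} \<times> {..<p}. X (fst ij) (snd ij) \<omega>)
         (\<Pi>\<^sub>M ij\<in>{..<n} \<times> {..<p}. borel)))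
       (sets (vimage_algebra (space M) (\<lambda>\<omega>. \<lambda>i\<in>{..<n}. eps i \<omega>) (\<Pi>\<^sub>M i\<in>{..<n}. borel)))"

definition row_sparsity :: "nat \<Rightarrow> real mat \<Rightarrow> nat \<Rightarrow> nat" where
  "row_sparsity p \<Theta> j = card {k. k < p \<and> k \<noteq> j \<and> \<Theta> $$ (j, k) \<noteq> 0}"

(* A coefficient vector of the regression of column j on the other p - 1 columns is encoded as a
   vector of length p whose j-th entry is 0; then X *v g is the product of g with the design
   without its j-th column, and l1 g is the l1 norm of the p - 1 actual coefficients. *)
definition without :: "nat \<Rightarrow> nat \<Rightarrow> real vec set" where
  "without p j = {g \<in> carrier_vec p. g $ j = 0}"

(* The argument of the minimum is unique once the covariance is invertible. *)
definition node_coef ::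
  "'a measure \<Rightarrow> nat \<Rightarrow> nat \<Rightarrow> (nat \<Rightarrow> nat \<Rightarrow> 'a \<Rightarrow> real) \<Rightarrow> nat \<Rightarrow> real vec" where
  "node_coef M n p X j =
     arg_min (\<lambda>g. \<integral>\<omega>. sq_l2 (col (design n p X \<omega>) j - design n p X \<omega> *\<^sub>v g) \<partial>M)
       (\<lambda>g. g \<in> without p j)"

definition node_fit ::
  "'a measure \<Rightarrow> nat \<Rightarrow> nat \<Rightarrow> (nat \<Rightarrow> nat \<Rightarrow> 'a \<Rightarrow> real) \<Rightarrow> nat \<Rightarrow> 'a \<Rightarrow> real vec" where
  "node_fit M n p X j \<omega> = design n p X \<omega> *\<^sub>v node_coef M n p X j"

definition node_error ::
  "'a measure \<Rightarrow> nat \<Rightarrow> nat \<Rightarrow> (nat \<Rightarrow> nat \<Rightarrow> 'a \<Rightarrow> real) \<Rightarrow> nat \<Rightarrow> 'a \<Rightarrow> real vec" where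
  "node_error M n p X j \<omega> = col (design n p X \<omega>) j - node_fit M n p X j \<omega>"


section \<open>Estimators\<close>

definition lasso_objective :: "nat \<Rightarrow> real \<Rightarrow> real vec \<Rightarrow> real mat \<Rightarrow> real vec \<Rightarrow> real" where
  "lasso_objective n lam y x b = sq_l2 (y - x *\<^sub>v b) / n + 2 * lam * l1 b"

(* Lasso minimisers need not be unique, so a Lasso estimator is any function of the data that
   selects a minimiser and is a random vector under the model for every true coefficient. *)
definition is_lasso ::
  "'a measure \<Rightarrow> nat \<Rightarrow> nat \<Rightarrow> (nat \<Rightarrow> nat \<Rightarrow> 'a \<Rightarrow> real) \<Rightarrow> (nat \<Rightarrow> 'a \<Rightarrow> real) \<Rightarrow> real
    \<Rightarrow> (real vec \<Rightarrow> real mat \<Rightarrow> real vec) \<Rightarrow> bool" where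
  "is_lasso M n p X eps lam bhat \<longleftrightarrow>
     (\<forall>y \<in> carrier_vec n. \<forall>x \<in> carrier_mat n p.
        is_arg_min (lasso_objective n lam y x) (\<lambda>b. b \<in> carrier_vec p) (bhat y x)) \<and>
     (\<forall>\<beta> \<in> carrier_vec p. \<forall>j<p.
        (\<lambda>\<omega>. bhat (response n p X eps \<beta> \<omega>) (design n p X \<omega>) $ j) \<in> borel_measurable M)"

definition is_nodewise_lasso ::
  "'a measure \<Rightarrow> nat \<Rightarrow> nat \<Rightarrow> (nat \<Rightarrow> nat \<Rightarrow> 'a \<Rightarrow> real) \<Rightarrow> (nat \<Rightarrow> real)
    \<Rightarrow> (nat \<Rightarrow> real mat \<Rightarrow> real vec) \<Rightarrow> bool" where
  "is_nodewise_lasso M n p X lamN ghat \<longleftrightarrow>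
     (\<forall>j<p. \<forall>x \<in> carrier_mat n p.
        is_arg_min (lasso_objective n (lamN j) (col x j) x) (\<lambda>g. g \<in> without p j) (ghat j x)) \<and>
     (\<forall>j<p. \<forall>k<p. (\<lambda>\<omega>. ghat j (design n p X \<omega>) $ k) \<in> borel_measurable M)"

definition tau_hat_sq ::
  "nat \<Rightarrow> (nat \<Rightarrow> real) \<Rightarrow> (nat \<Rightarrow> real mat \<Rightarrow> real vec) \<Rightarrow> real mat \<Rightarrow> nat \<Rightarrow> real" where
  "tau_hat_sq n lamN ghat x j = sq_l2 (col x j - x *\<^sub>v ghat j x) / n + lamN j * l1 (ghat j x)"

definition C_hat :: "nat \<Rightarrow> (nat \<Rightarrow> real mat \<Rightarrow> real vec) \<Rightarrow> real mat \<Rightarrow> real mat" where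
  "C_hat p ghat x = mat p p (\<lambda>(i, j). if i = j then 1 else - (ghat i x $ j))"

definition Theta_hat ::
  "nat \<Rightarrow> nat \<Rightarrow> (nat \<Rightarrow> real) \<Rightarrow> (nat \<Rightarrow> real mat \<Rightarrow> real vec) \<Rightarrow> real mat \<Rightarrow> real mat" where
  "Theta_hat n p lamN ghat x =
     mat p p (\<lambda>(i, j). if i = j then inverse (tau_hat_sq n lamN ghat x i) else 0) * C_hat p ghat x"

definition Sigma_hat :: "nat \<Rightarrow> real mat \<Rightarrow> real mat" where
  "Sigma_hat n x = (1 / real n) \<cdot>\<^sub>m (transpose_mat x * x)"

definition desparsified ::
  "nat \<Rightarrow> nat \<Rightarrow> (nat \<Rightarrow> real) \<Rightarrow> (real vec \<Rightarrow> real mat \<Rightarrow> real vec) \<Rightarrow> (nat \<Rightarrow> real mat \<Rightarrow> real vec)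
    \<Rightarrow> real vec \<Rightarrow> real mat \<Rightarrow> real vec" where
  "desparsified n p lamN bhat ghat y x =
     bhat y x + (1 / real n) \<cdot>\<^sub>v
       (Theta_hat n p lamN ghat x *\<^sub>v (transpose_mat x *\<^sub>v (y - x *\<^sub>v bhat y x)))"

definition omega_hat ::
  "nat \<Rightarrow> nat \<Rightarrow> (nat \<Rightarrow> real) \<Rightarrow> (nat \<Rightarrow> real mat \<Rightarrow> real vec) \<Rightarrow> (real vec \<Rightarrow> real mat \<Rightarrow> real)
    \<Rightarrow> real vec \<Rightarrow> real mat \<Rightarrow> nat \<Rightarrow> real" where
  "omega_hat n p lamN ghat sig2hat y x j =
     sig2hat y x * (row (Theta_hat n p lamN ghat x) j
                      \<bullet> (Sigma_hat n x *\<^sub>v row (Theta_hat n p lamN ghat x) j))"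

definition S_hat ::
  "nat \<Rightarrow> nat \<Rightarrow> (nat \<Rightarrow> real) \<Rightarrow> (real vec \<Rightarrow> real mat \<Rightarrow> real vec) \<Rightarrow> (nat \<Rightarrow> real mat \<Rightarrow> real vec)
    \<Rightarrow> (real vec \<Rightarrow> real mat \<Rightarrow> real) \<Rightarrow> real \<Rightarrow> real vec \<Rightarrow> real mat \<Rightarrow> nat set" where
  "S_hat n p lamN bhat ghat sig2hat \<tau> y x =
     {j. j < p \<and> \<bar>desparsified n p lamN bhat ghat y x $ j\<bar>
           > sqrt (\<tau> * omega_hat n p lamN ghat sig2hat y x j * ln p / n)}"

definition prob_exact_recovery ::
  "'a measure \<Rightarrow> nat \<Rightarrow> nat \<Rightarrow> (nat \<Rightarrow> nat \<Rightarrow> 'a \<Rightarrow> real) \<Rightarrow> (nat \<Rightarrow> 'a \<Rightarrow> real) \<Rightarrow> (nat \<Rightarrow> real)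
    \<Rightarrow> (real vec \<Rightarrow> real mat \<Rightarrow> real vec) \<Rightarrow> (nat \<Rightarrow> real mat \<Rightarrow> real vec)
    \<Rightarrow> (real vec \<Rightarrow> real mat \<Rightarrow> real) \<Rightarrow> real \<Rightarrow> real vec \<Rightarrow> real" where
  "prob_exact_recovery M n p X eps lamN bhat ghat sig2hat \<tau> \<beta> =
     measure M {\<omega> \<in> space M.
       S_hat n p lamN bhat ghat sig2hat \<tau> (response n p X eps \<beta> \<omega>) (design n p X \<omega>) = supp \<beta>}"


section \<open>Parameter classes\<close>

(* The minimum over an empty support is read as +infinity, so 0 belongs to Psi. *)
definition Psi :: "nat \<Rightarrow> nat \<Rightarrow> real mat \<Rightarrow> real \<Rightarrow> real \<Rightarrow> real vec set" where
  "Psi n p \<Theta> sig2 c0 = {\<beta> \<in> carrier_vec p.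
     \<forall>j \<in> supp \<beta>. \<bar>\<beta> $ j\<bar> / sqrt (sig2 * \<Theta> $$ (j, j)) > c0 * sqrt (ln p / n)}"

definition sparse_upto :: "nat \<Rightarrow> nat \<Rightarrow> real vec set" where
  "sparse_upto p s = {\<beta> \<in> carrier_vec p. card (supp \<beta>) \<le> s}"

definition S_star :: "nat \<Rightarrow> nat \<Rightarrow> real vec set" where
  "S_star p s = {\<beta> \<in> carrier_vec p. card (supp \<beta>) = s}"


section \<open>Assumptions on a sequence of models\<close>

datatype design_case = Sub_Gaussian | Strongly_Bounded "nat \<Rightarrow> real"

primrec K0 :: "design_case \<Rightarrow> nat \<Rightarrow> real" where
  "K0 Sub_Gaussian n = 1"
| "K0 (Strongly_Bounded K) n = K n"

(* Exponential moments are nonnegative integrals: the Bochner integral of a non-integrable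
   function is 0, which would make the bounds hold vacuously. *)

primrec A1 :: "design_case \<Rightarrow> (nat \<Rightarrow> 'a measure) \<Rightarrow> (nat \<Rightarrow> nat)
    \<Rightarrow> (nat \<Rightarrow> nat \<Rightarrow> nat \<Rightarrow> 'a \<Rightarrow> real) \<Rightarrow> bool" where
  "A1 Sub_Gaussian M p X \<longleftrightarrow>
     (\<exists>C>0. \<forall>n>0. \<forall>i<n. \<forall>a :: nat \<Rightarrow> real. (\<Sum>j<p n. (a j)\<^sup>2) \<le> 1 \<longrightarrow>
        (\<integral>\<^sup>+\<omega>. ennreal (exp (\<bar>\<Sum>j<p n. a j * X n i j \<omega>\<bar>\<^sup>2 / C)) \<partial>M n) \<le> 2)"
| "A1 (Strongly_Bounded K) M p X \<longleftrightarrow>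
     (\<forall>n>0. 1 \<le> K n \<and>
        (\<forall>i<n. \<forall>j<p n. (AE \<omega> in M n. \<bar>X n i j \<omega>\<bar> \<le> K n) \<and>
            (AE \<omega> in M n. \<bar>node_fit (M n) n (p n) (X n) j \<omega> $ i\<bar> \<le> K n)) \<and>
        (\<forall>j<p n. (\<integral>\<^sup>+\<omega>. ennreal ((node_error (M n) n (p n) (X n) j \<omega> $ 0) ^ 4) \<partial>M n)
            \<le> ennreal (K n ^ 4)))"

definition A2 :: "(nat \<Rightarrow> nat) \<Rightarrow> (nat \<Rightarrow> real mat) \<Rightarrow> bool" where
  "A2 p \<Sigma> \<longleftrightarrow>
     (\<exists>c>0. \<forall>n>0. c < Min {l. eigenvalue (\<Sigma> n) l}) \<and>
     (\<exists>C>0. \<forall>n>0. \<forall>j<p n. \<Sigma> n $$ (j, j) \<le> C)"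

primrec A3 :: "design_case \<Rightarrow> (nat \<Rightarrow> 'a measure) \<Rightarrow> (nat \<Rightarrow> nat) \<Rightarrow> (nat \<Rightarrow> nat \<Rightarrow> 'a \<Rightarrow> real)
    \<Rightarrow> (nat \<Rightarrow> real mat) \<Rightarrow> (nat \<Rightarrow> real) \<Rightarrow> bool" where
  "A3 Sub_Gaussian M p eps \<Theta> sig2 \<longleftrightarrow>
     (\<exists>C1>0. \<exists>c1>0. \<forall>n>0. ln (real (p n) * real n) ^ 7 / n \<le> C1 * real n powr (- c1)) \<and>
     (\<exists>C>0. \<forall>n>0. \<forall>i<n. (\<integral>\<^sup>+\<omega>. ennreal (exp (\<bar>eps n i \<omega>\<bar>\<^sup>2 / C)) \<partial>M n) \<le> 2) \<and>
     (\<exists>c'>0. \<exists>c>0. \<forall>n>0. c' < sig2 n \<and> sig2 n < c)"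
| "A3 (Strongly_Bounded K) M p eps \<Theta> sig2 \<longleftrightarrow>
     (\<exists>C2>0. \<exists>c2>0. \<forall>n>0. \<forall>j<p n.
        real (row_sparsity (p n) (\<Theta> n) j) * (K n)\<^sup>2 * ln (real (p n) * real n) ^ 7 / n
          \<le> C2 * real n powr (- c2)) \<and>
     (\<exists>C'>0. \<forall>n>0. \<forall>i<n. (\<integral>\<^sup>+\<omega>. ennreal (exp (\<bar>eps n i \<omega>\<bar> / C')) \<partial>M n) \<le> 2) \<and>
     (\<exists>c'>0. \<exists>c>0. \<forall>n>0. c' < sig2 n \<and> sig2 n < c)"

(* The coefficients under consideration: those over which the infimum and the supremum in the
   support recovery result are taken. *)
definition considered ::
  "nat \<Rightarrow> nat \<Rightarrow> real mat \<Rightarrow> real \<Rightarrow> nat \<Rightarrow> real vec set" where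
  "considered n p \<Theta> sig2 s0 = (Psi n p \<Theta> sig2 (2 * sqrt 2) \<inter> sparse_upto p s0) \<union> S_star p s0"

definition A4 :: "(nat \<Rightarrow> 'a measure) \<Rightarrow> (nat \<Rightarrow> nat) \<Rightarrow> (nat \<Rightarrow> nat \<Rightarrow> nat \<Rightarrow> 'a \<Rightarrow> real)
    \<Rightarrow> (nat \<Rightarrow> nat \<Rightarrow> 'a \<Rightarrow> real) \<Rightarrow> (nat \<Rightarrow> real mat) \<Rightarrow> (nat \<Rightarrow> real) \<Rightarrow> (nat \<Rightarrow> nat)
    \<Rightarrow> (nat \<Rightarrow> real vec \<Rightarrow> real mat \<Rightarrow> real) \<Rightarrow> (nat \<Rightarrow> nat \<Rightarrow> real) \<Rightarrow> bool" where
  "A4 M p X eps \<Theta> sig2 s0 sig2hat lamN \<longleftrightarrow>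
     (\<exists>\<alpha> :: nat \<Rightarrow> real. (\<forall>n>0. 0 < \<alpha> n) \<and> filterlim \<alpha> at_top sequentially \<and>
        (\<lambda>n. \<alpha> n / p n) \<longlonglongrightarrow> 0 \<and>
        (\<lambda>n. \<alpha> n * (ln (p n))\<^sup>2 *
             (MAX j\<in>{..<p n}. lamN n j * sqrt (row_sparsity (p n) (\<Theta> n) j))) \<longlonglongrightarrow> 0 \<and>
        (\<lambda>n. SUP \<beta> \<in> considered n (p n) (\<Theta> n) (sig2 n) (s0 n).
             measure (M n) {\<omega> \<in> space (M n).
               \<alpha> n * (ln (p n))\<^sup>2 *
                 \<bar>sig2hat n (response n (p n) (X n) (eps n) \<beta> \<omega>) (design n (p n) (X n) \<omega>) - sig2 n\<bar>
               > 1}) \<longlonglongrightarrow> 0)"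

definition A5 :: "(nat \<Rightarrow> nat) \<Rightarrow> (nat \<Rightarrow> real mat) \<Rightarrow> bool" where
  "A5 p \<Theta> \<longleftrightarrow>
     (\<exists>c<1. \<forall>n>0. \<forall>i<p n. \<forall>j<p n. i \<noteq> j \<longrightarrow>
        \<bar>\<Theta> n $$ (i, j) / sqrt (\<Theta> n $$ (i, i) * \<Theta> n $$ (j, j))\<bar> \<le> c)"

(* Orders of the tuning parameters.  Bounding for all n > 0, not just eventually, keeps the tuning
   parameters nonnegative, without which the Lasso objective may have no minimiser. *)
definition tuning_order :: "design_case \<Rightarrow> (nat \<Rightarrow> nat) \<Rightarrow> (nat \<Rightarrow> real) \<Rightarrow> bool" where
  "tuning_order D p lam \<longleftrightarrow>
     (\<exists>c>0. \<exists>C>0. \<forall>n>0. c * (K0 D n * sqrt (ln (p n) / n)) \<le> lam n \<and>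
                         lam n \<le> C * (K0 D n * sqrt (ln (p n) / n)))"

definition nodewise_tuning_order :: "design_case \<Rightarrow> (nat \<Rightarrow> nat) \<Rightarrow> (nat \<Rightarrow> nat \<Rightarrow> real) \<Rightarrow> bool" where
  "nodewise_tuning_order D p lamN \<longleftrightarrow>
     (\<exists>c>0. \<exists>C>0. \<forall>n>0. \<forall>j<p n. c * (K0 D n * sqrt (ln (p n) / n)) \<le> lamN n j \<and>
                                  lamN n j \<le> C * (K0 D n * sqrt (ln (p n) / n)))"

definition is_variance_estimator ::
  "'a measure \<Rightarrow> nat \<Rightarrow> nat \<Rightarrow> (nat \<Rightarrow> nat \<Rightarrow> 'a \<Rightarrow> real) \<Rightarrow> (nat \<Rightarrow> 'a \<Rightarrow> real)
    \<Rightarrow> (real vec \<Rightarrow> real mat \<Rightarrow> real) \<Rightarrow> bool" where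
  "is_variance_estimator M n p X eps sig2hat \<longleftrightarrow>
     (\<forall>\<beta> \<in> carrier_vec p.
        (\<lambda>\<omega>. sig2hat (response n p X eps \<beta> \<omega>) (design n p X \<omega>)) \<in> borel_measurable M)"

end

theory Submission
  imports Defs "HOL-Real_Asymp.Real_Asymp"
begin

text \<open>Up to a debiasing remainder that is uniformly \<open>o (1 / sqrt (ln p))\<close>, the studentized estimator
  differs from its signal by \<open>W j\<close>, the standardized sum over the observations of the nodewise
  residual times the error; the factor \<open>tau_hat_sq\<close> cancels against the one in \<open>omega_hat\<close>. At
  \<open>\<tau> = 2\<close> the union bound over \<open>p\<close> coordinates is borderline: it needs the factor \<open>1 / sqrt (ln p)\<close>
  of the Gaussian tail, which exponential tilting supplies without a Gaussian approximation of the
  maximum. A signal above \<open>2 sqrt 2\<close> then clears the threshold because \<open>2 sqrt 2 - sqrt 2 = sqrt 2\<close>.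
  For \<open>\<tau> < 2\<close> a false positive is forced by the second moment method. The rows of \<open>\<Theta>\<close> are bounded
  in Euclidean norm, so that each coordinate has a correlation above \<open>e\<close> with boundedly many others,
  and a maximal independent set leaves many almost uncorrelated null coordinates.\<close>

section \<open>Quadratic forms and precision matrices\<close>

text \<open>The error budget is set by the level \<open>sqrt (2 * ln p)\<close>: a relative error
  \<open>d\<close> there shifts the Gaussian exponent by about \<open>2 * d * ln p\<close>, so every
  error has to be o(1 / ln p). All of them are therefore expressed through three null sequences
  \<open>e1\<close>, \<open>e2\<close>, \<open>e3\<close>, each a multiple of (ln p)^(3/2) / sqrt n.
  The same factor governs the cubic error of the moment generating functions, because n times the
  cube of sqrt (ln p) / sqrt n has exactly this form. Second moments enter only through the 2 p
  linear forms given by the columns and the population nodewise residuals, which lets both design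
  cases share one set of moment bounds in \<open>K\<close>. Two hypotheses delimit the claims. False
  positives need null coordinates, and a bound of \<open>s0\<close> by \<rho> p with \<rho> < 1
  leaves a positive fraction of them. For bounded designs with no signals and a diagonal
  \<open>\<Theta>\<close>, the growth conditions would say nothing about \<open>K\<close>;
  \<open>nondegenerate\<close> excludes this case.\<close>

definition bil :: "nat \<Rightarrow> (nat \<Rightarrow> nat \<Rightarrow> real) \<Rightarrow> (nat \<Rightarrow> real) \<Rightarrow> (nat \<Rightarrow> real) \<Rightarrow> real" where
  "bil p S u v = (\<Sum>j<p. u j * (\<Sum>k<p. S j k * v k))"

lemma bil_add_left: "bil p S (\<lambda>j. a * u j + b * v j) w = a * bil p S u w + b * bil p S v w"
proof -
  have "bil p S (\<lambda>j. a * u j + b * v j) w = (\<Sum>j<p. a * (u j * (\<Sum>k<p. S j k * w k)) + b * (v j * (\<Sum>k<p. S j k * w k)))"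
    unfolding bil_def by (intro sum.cong refl) (simp only: distrib_right mult.assoc)
  then show ?thesis by (simp only: bil_def sum.distrib sum_distrib_left[symmetric])
qed

lemma bil_add_right: "bil p S w (\<lambda>j. a * u j + b * v j) = a * bil p S w u + b * bil p S w v"
proof -
  have "(\<Sum>k<p. S j k * (a * u k + b * v k)) = a * (\<Sum>k<p. S j k * u k) + b * (\<Sum>k<p. S j k * v k)" for j
    by (simp add: distrib_left sum.distrib sum_distrib_left mult.left_commute)
  then show ?thesis
    by (simp add: bil_def distrib_left sum.distrib sum_distrib_left mult.left_commute)
qed

lemma bil_sym:
  assumes "\<And>j k. j < p \<Longrightarrow> k < p \<Longrightarrow> S j k = S k j"
  shows "bil p S u v = bil p S v u"
proof -
  have "bil p S u v = (\<Sum>j<p. \<Sum>k<p. u j * S j k * v k)"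
    by (simp add: bil_def sum_distrib_left algebra_simps)
  also have "\<dots> = (\<Sum>k<p. \<Sum>j<p. u j * S j k * v k)" by (rule sum.swap)
  also have "\<dots> = (\<Sum>k<p. \<Sum>j<p. v k * S k j * u j)"
    using assms by (intro sum.cong refl) (auto simp: algebra_simps)
  finally show ?thesis by (simp add: bil_def sum_distrib_left algebra_simps)
qed

text \<open>Only semidefiniteness is available, so the form may vanish at \<open>v\<close>. The
  homogeneous quadratic \<open>q\<close> in two coefficients serves both cases without a
  division.\<close>

lemma bil_Cauchy_Schwarz:
  assumes sym: "\<And>j k. j < p \<Longrightarrow> k < p \<Longrightarrow> S j k = S k j"
    and psd: "\<And>v. bil p S v v \<ge> 0"
  shows "(bil p S u v)\<^sup>2 \<le> bil p S u u * bil p S v v"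
proof -
  let ?a = "bil p S u u" and ?b = "bil p S u v" and ?c = "bil p S v v"
  have q: "s\<^sup>2 * ?a + 2 * s * t * ?b + t\<^sup>2 * ?c \<ge> 0" for s t
  proof -
    have "bil p S (\<lambda>j. s * u j + t * v j) (\<lambda>j. s * u j + t * v j)
      = s\<^sup>2 * ?a + 2 * s * t * ?b + t\<^sup>2 * ?c"
      using bil_sym[of p S v u, OF sym]
      by (simp add: bil_add_left bil_add_right power2_eq_square algebra_simps)
    then show ?thesis using psd by metis
  qed
  show ?thesis
  proof (cases "?c = 0")
    case True
    have "?b = 0"
    proof (rule ccontr)
      assume b: "?b \<noteq> 0"
      \<comment> \<open>With \<open>?c = 0\<close> the quadratic is affine in the second
        coefficient, and this choice would make it equal to -1.\<close>
      have "1\<^sup>2 * ?a + 2 * 1 * (- (?a + 1) / (2 * ?b)) * ?b + (- (?a + 1) / (2 * ?b))\<^sup>2 * ?c \<ge> 0"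
        by (rule q)
      with b True show False by (simp add: field_simps)
    qed
    with True show ?thesis by simp
  next
    case False
    with psd[of v] have c: "?c > 0" by simp
    have "?c\<^sup>2 * ?a + 2 * ?c * (- ?b) * ?b + (- ?b)\<^sup>2 * ?c \<ge> 0" by (rule q)
    then have "?c * (?c * ?a - ?b\<^sup>2) \<ge> 0" by (simp add: power2_eq_square algebra_simps)
    with c have "?c * ?a - ?b\<^sup>2 \<ge> 0" by (simp add: zero_le_mult_iff)
    then show ?thesis by (simp add: mult.commute)
  qed
qed

text \<open>A crude operator norm bound. Its size is irrelevant: it only has to be finite, in order
  to keep the Rayleigh quotient away from its infimum.\<close>

lemma abs_bil_le: "\<bar>bil p S v v\<bar> \<le> (\<Sum>j<p. \<Sum>k<p. \<bar>S j k\<bar>) * (\<Sum>j<p. (v j)\<^sup>2)"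
proof -
  let ?V = "\<Sum>j<p. (v j)\<^sup>2"
  have vv: "\<bar>v j\<bar> * \<bar>v k\<bar> \<le> ?V" if "j < p" "k < p" for j k
  proof -
    have "(v j)\<^sup>2 \<le> ?V" "(v k)\<^sup>2 \<le> ?V" using that by (auto intro!: member_le_sum)
    moreover have "2 * (\<bar>v j\<bar> * \<bar>v k\<bar>) \<le> (v j)\<^sup>2 + (v k)\<^sup>2"
      using sum_squares_bound[of "\<bar>v j\<bar>" "\<bar>v k\<bar>"] by simp
    ultimately show ?thesis by linarith
  qed
  have "\<bar>bil p S v v\<bar> = \<bar>\<Sum>j<p. \<Sum>k<p. S j k * (v j * v k)\<bar>"
    by (simp add: bil_def sum_distrib_left algebra_simps)
  also have "\<dots> \<le> (\<Sum>j<p. \<Sum>k<p. \<bar>S j k * (v j * v k)\<bar>)"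
    by (intro order_trans[OF sum_abs] sum_mono) auto
  also have "\<dots> \<le> (\<Sum>j<p. \<Sum>k<p. \<bar>S j k\<bar> * ?V)"
    using vv by (intro sum_mono) (auto simp: abs_mult intro!: mult_left_mono)
  finally show ?thesis by (simp add: sum_distrib_right)
qed

lemma sum_delta_mult:
  fixes f :: "nat \<Rightarrow> real"
  assumes "j < p"
  shows "(\<Sum>k<p. (if j = k then 1 else 0) * f k) = f j" "(\<Sum>k<p. (if k = j then 1 else 0) * f k) = f j"
    "(\<Sum>k<p. f k * (if j = k then 1 else 0)) = f j" "(\<Sum>k<p. f k * (if k = j then 1 else 0)) = f j"
  using assms by (auto simp: if_distrib if_distribR sum.delta sum.delta' cong: if_cong)

text \<open>The infimum \<open>m\<close> of the Rayleigh quotient is an eigenvalue: if \<open>A - m\<close> were invertible, the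
  Cauchy-Schwarz inequality for the semidefinite form of \<open>A - m\<close> would bound the quotient away
  from \<open>m\<close>. No compactness is needed.\<close>

lemma bil_ge_Min_eigenvalue:
  assumes A: "A \<in> carrier_mat p p"
    and sym: "\<And>j k. j < p \<Longrightarrow> k < p \<Longrightarrow> A $$ (j, k) = A $$ (k, j)"
    and psd: "\<And>v. bil p (\<lambda>j k. A $$ (j, k)) v v \<ge> 0"
    and p: "0 < p"
    and c: "c < Min {l. eigenvalue A l}"
  shows "c * (\<Sum>j<p. (v j)\<^sup>2) \<le> bil p (\<lambda>j k. A $$ (j, k)) v v"
proof -
  define S where "S = (\<lambda>j k. A $$ (j, k))"
  define R where "R = {bil p S w w / (\<Sum>j<p. (w j)\<^sup>2) |w. (\<Sum>j<p. (w j)\<^sup>2) \<noteq> 0}"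
  define m where "m = Inf R"
  have S0: "bil p S w w \<ge> 0" for w using psd by (simp add: S_def)
  have Rne: "R \<noteq> {}"
  proof -
    have "(\<Sum>j<p. ((\<lambda>_. 1::real) j)\<^sup>2) \<noteq> 0" using p by simp
    then have "bil p S (\<lambda>_. 1) (\<lambda>_. 1) / (\<Sum>j<p. ((\<lambda>_. 1::real) j)\<^sup>2) \<in> R"
      unfolding R_def by (intro CollectI exI[of _ "\<lambda>_. 1"]) (rule conjI[OF refl])
    then show ?thesis by (metis empty_iff)
  qed
  have Rbd: "bdd_below R"
    unfolding R_def bdd_below_def by (intro exI[of _ 0]) (auto intro!: divide_nonneg_nonneg S0 sum_nonneg)
  have m_le: "m * (\<Sum>j<p. (w j)\<^sup>2) \<le> bil p S w w" for w
  proof (cases "(\<Sum>j<p. (w j)\<^sup>2) = 0")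
    case True
    then show ?thesis using S0 by simp
  next
    case False
    then have pos: "(\<Sum>j<p. (w j)\<^sup>2) > 0" by (simp add: less_le sum_nonneg)
    have "m \<le> bil p S w w / (\<Sum>j<p. (w j)\<^sup>2)"
      unfolding m_def by (rule cInf_lower[OF _ Rbd]) (use False in \<open>auto simp: R_def\<close>)
    with pos show ?thesis by (simp add: field_simps)
  qed
  define B where "B = char_matrix A m"
  define S' where "S' = (\<lambda>j k. S j k - m * (if j = k then 1 else 0))"
  have B: "B \<in> carrier_mat p p" using A by (simp add: B_def)
  have BS: "B $$ (j, k) = S' j k" if "j < p" "k < p" for j k
    using that A by (auto simp: B_def char_matrix_def S'_def S_def)
  have bilS': "bil p S' u w = bil p S u w - m * (\<Sum>j<p. u j * w j)" for u w
  proof -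
    have "(\<Sum>k<p. S' j k * w k) = (\<Sum>k<p. S j k * w k) - m * w j" if "j < p" for j
    proof -
      have "(\<Sum>k<p. S' j k * w k) = (\<Sum>k<p. S j k * w k) - m * (\<Sum>k<p. (if j = k then 1 else 0) * w k)"
        by (simp add: S'_def algebra_simps sum_subtractf sum_distrib_left)
      with sum_delta_mult(1)[OF that, of w] show ?thesis by simp
    qed
    then show ?thesis
      by (simp add: bil_def right_diff_distrib sum_subtractf sum_distrib_left[of m] mult.left_commute)
  qed
  have S'0: "bil p S' w w \<ge> 0" for w
    using m_le[of w] by (simp add: bilS' power2_eq_square)
  have S'sym: "S' j k = S' k j" if "j < p" "k < p" for j k
    using sym[OF that] by (simp add: S'_def S_def)
  have "det B = 0"
  proof (rule ccontr)
    assume det: "det B \<noteq> 0"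
    define B' where "B' = (1 / det B) \<cdot>\<^sub>m adj_mat B"
    have B': "B' \<in> carrier_mat p p" using adj_mat(1)[OF B] by (simp add: B'_def)
    have "B * B' = (1 / det B) \<cdot>\<^sub>m (B * adj_mat B)"
      unfolding B'_def by (rule mult_smult_distrib[OF B adj_mat(1)[OF B]])
    also have "\<dots> = 1\<^sub>m p" using det unfolding adj_mat(2)[OF B] by (intro eq_matI) auto
    finally have inv: "B * B' = 1\<^sub>m p" .
    have BB': "(\<Sum>l<p. S' j l * B' $$ (l, k)) = (if j = k then 1 else 0)" if "j < p" "k < p" for j k
    proof -
      have "(B * B') $$ (j, k) = (1\<^sub>m p) $$ (j, k)"
        using inv by simp
      then show ?thesis using that B B' by (simp add: scalar_prod_def BS lessThan_atLeast0)
    qed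
    define L where "L = (\<Sum>j<p. \<Sum>k<p. \<bar>B' $$ (j, k)\<bar>)"
    have key: "(\<Sum>j<p. (w j)\<^sup>2) \<le> L * bil p S' w w" for w
    proof (cases "(\<Sum>j<p. (w j)\<^sup>2) = 0")
      case True
      then show ?thesis using S'0 by (simp add: L_def sum_nonneg)
    next
      case False
      let ?W = "\<Sum>j<p. (w j)\<^sup>2"
      have pos: "?W > 0" using False by (simp add: less_le sum_nonneg)
      \<comment> \<open>\<open>u\<close> solves \<open>S' u = w\<close>. Hence pairing
        \<open>w\<close> with \<open>u\<close> in \<open>S'\<close> gives the Euclidean square of
        \<open>w\<close>, while the form at \<open>u\<close> is the form of the inverse at
        \<open>w\<close>; Cauchy-Schwarz then bounds the former by the form at
        \<open>w\<close>.\<close>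
      define u where "u = (\<lambda>l. \<Sum>k<p. B' $$ (l, k) * w k)"
      have Su: "(\<Sum>l<p. S' j l * u l) = w j" if "j < p" for j
      proof -
        have "(\<Sum>l<p. S' j l * u l) = (\<Sum>l<p. \<Sum>k<p. S' j l * B' $$ (l, k) * w k)"
          by (simp add: u_def sum_distrib_left algebra_simps)
        also have "\<dots> = (\<Sum>k<p. \<Sum>l<p. S' j l * B' $$ (l, k) * w k)" by (rule sum.swap)
        also have "\<dots> = (\<Sum>k<p. (if j = k then 1 else 0) * w k)"
          using that by (intro sum.cong refl) (simp add: BB' sum_distrib_right[symmetric])
        also have "\<dots> = w j" by (rule sum_delta_mult(1)[OF that])
        finally show ?thesis .
      qed
      have wu: "bil p S' w u = ?W" by (simp add: bil_def Su power2_eq_square)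
      have uu: "bil p S' u u = bil p (\<lambda>j k. B' $$ (j, k)) w w"
      proof -
        have "bil p S' u u = (\<Sum>j<p. u j * w j)" by (simp add: bil_def Su)
        then show ?thesis by (simp add: u_def bil_def mult.commute)
      qed
      have "?W\<^sup>2 \<le> bil p S' w w * bil p S' u u"
        using bil_Cauchy_Schwarz[of p S' w u, OF S'sym S'0] by (simp add: wu)
      also have "\<dots> \<le> bil p S' w w * (L * ?W)"
        unfolding uu L_def using abs_bil_le[of p "\<lambda>j k. B' $$ (j, k)" w]
        by (intro mult_left_mono S'0) linarith
      finally have "?W * ?W \<le> (L * bil p S' w w) * ?W" by (simp add: power2_eq_square algebra_simps)
      with pos show ?thesis by simp
    qed
    have Lpos: "L > 0"
    proof -
      have "real p \<le> L * bil p S' (\<lambda>_. 1) (\<lambda>_. 1)" using key[of "\<lambda>_. 1"] by simp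
      with p S'0[of "\<lambda>_. 1"] show ?thesis
        by (smt (verit, best) mult_nonpos_nonneg of_nat_0_less_iff)
    qed
    \<comment> \<open>All quotients exceed \<open>m\<close> by at least \<open>1 / L\<close>, which
      contradicts the choice of \<open>m\<close> as their infimum.\<close>
    have "m + 1 / L \<le> r" if r: "r \<in> R" for r
    proof -
      from r obtain w where w: "(\<Sum>j<p. (w j)\<^sup>2) \<noteq> 0" and req: "r = bil p S w w / (\<Sum>j<p. (w j)\<^sup>2)"
        unfolding R_def by blast
      have pos: "(\<Sum>j<p. (w j)\<^sup>2) > 0" using w by (simp add: less_le sum_nonneg)
      have "(\<Sum>j<p. (w j)\<^sup>2) / L \<le> bil p S' w w"
        using key[of w] Lpos by (simp add: field_simps)
      then have "(m + 1 / L) * (\<Sum>j<p. (w j)\<^sup>2) \<le> bil p S w w"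
        by (simp add: bilS' power2_eq_square algebra_simps)
      then show ?thesis using pos by (simp add: req field_simps)
    qed
    then have "m + 1 / L \<le> m" unfolding m_def by (rule cInf_greatest[OF Rne])
    with Lpos show False by simp
  qed
  then have ev: "eigenvalue A m" unfolding B_def using eigenvalue_det[OF A] by blast
  \<comment> \<open>\<open>Min\<close> is meaningful only on finite sets. The spectrum is finite
    because the characteristic polynomial is monic, hence nonzero.\<close>
  have fin: "finite {l. eigenvalue A l}"
  proof -
    have "{l. eigenvalue A l} = {l. poly (char_poly A) l = 0}"
      using eigenvalue_root_char_poly[OF A] by auto
    moreover have "char_poly A \<noteq> 0" using degree_monic_char_poly[OF A] by auto
    ultimately show ?thesis using poly_roots_finite by metis
  qed
  have "c < m" using c Min_le[OF fin, of m] ev by simp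
  then have "c * (\<Sum>j<p. (v j)\<^sup>2) \<le> m * (\<Sum>j<p. (v j)\<^sup>2)"
    by (intro mult_right_mono sum_nonneg) auto
  also have "\<dots> \<le> bil p S v v" by (rule m_le)
  finally show ?thesis by (simp add: S_def)
qed

section \<open>Norm and diagonal bounds for a precision matrix\<close>

locale precision_matrix =
  fixes p :: nat and S T :: "nat \<Rightarrow> nat \<Rightarrow> real" and c0 C :: real
  assumes c0: "0 < c0" and C: "0 < C"
    and S_sym: "\<And>j k. j < p \<Longrightarrow> k < p \<Longrightarrow> S j k = S k j"
    and S_ge: "\<And>v. c0 * (\<Sum>j<p. (v j)\<^sup>2) \<le> bil p S v v"
    and S_diag: "\<And>j. j < p \<Longrightarrow> S j j \<le> C"
    and ST: "\<And>j k. j < p \<Longrightarrow> k < p \<Longrightarrow> (\<Sum>l<p. S j l * T l k) = (if j = k then 1 else 0)"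
begin

lemma S_psd: "bil p S v v \<ge> 0"
  using S_ge[of v] c0 by (meson mult_nonneg_nonneg order_trans less_imp_le sum_nonneg zero_le_power2)

text \<open>In the inner product \<open>S\<close> the columns of \<open>T\<close> represent the
  coordinate functionals. Symmetry of \<open>T\<close> and all bounds on its entries follow from
  this one fact.\<close>

lemma bil_S_T:
  assumes "k < p"
  shows "bil p S u (\<lambda>l. T l k) = u k"
proof -
  have "bil p S u (\<lambda>l. T l k) = (\<Sum>j<p. u j * (if j = k then 1 else 0))"
    unfolding bil_def using assms by (intro sum.cong refl) (simp add: ST)
  then show ?thesis using sum_delta_mult(4)[OF assms, of u] by simp
qed

lemma T_sym: "j < p \<Longrightarrow> k < p \<Longrightarrow> T j k = T k j"
  using bil_S_T[of k "\<lambda>l. T l j"] bil_S_T[of j "\<lambda>l. T l k"] bil_sym[of p S, OF S_sym]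
  by metis

lemma bil_S_T_row:
  assumes "k < p"
  shows "bil p S u (\<lambda>l. T k l) = u k" "bil p S (\<lambda>l. T k l) u = u k"
proof -
  have "bil p S u (\<lambda>l. T k l) = bil p S u (\<lambda>l. T l k)"
    unfolding bil_def using assms by (intro sum.cong refl) (simp add: T_sym)
  then show *: "bil p S u (\<lambda>l. T k l) = u k" using bil_S_T[OF assms] by simp
  show "bil p S (\<lambda>l. T k l) u = u k" using bil_sym[of p S, OF S_sym] * by metis
qed

lemma T_row_sq:
  assumes "j < p"
  shows "(\<Sum>k<p. (T j k)\<^sup>2) \<le> T j j / c0"
  using S_ge[of "\<lambda>k. T j k"] bil_S_T_row[OF assms] c0 by (simp add: field_simps)

text \<open>The bound improves itself: the square of the diagonal entry is one summand of the
  squared row norm, which is at most the diagonal entry over \<open>c0\<close>. The same inequality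
  forces the entry to be nonnegative.\<close>

lemma T_diag_le:
  assumes "j < p"
  shows "T j j \<le> 1 / c0" "0 \<le> T j j"
proof -
  have "(T j j)\<^sup>2 \<le> (\<Sum>k<p. (T j k)\<^sup>2)" using assms by (intro member_le_sum) auto
  also have "\<dots> \<le> T j j / c0" by (rule T_row_sq[OF assms])
  finally have *: "T j j * T j j \<le> T j j / c0" by (simp add: power2_eq_square)
  then show n: "0 \<le> T j j" using c0
    by (smt (verit) divide_less_0_iff mult_neg_neg)
  show "T j j \<le> 1 / c0"
  proof (cases "T j j = 0")
    case True
    then show ?thesis using c0 by simp
  next
    case False
    then have "T j j > 0" using n by simp
    moreover have "T j j * T j j \<le> T j j * (1 / c0)" using * by simp
    ultimately show ?thesis by (simp only: mult_le_cancel_left_pos)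
  qed
qed

text \<open>Cauchy-Schwarz in \<open>S\<close> between the \<open>j\<close>-th unit vector and row
  \<open>j\<close> of \<open>T\<close>: their pairing is 1 and their forms are \<open>S j j\<close>
  and \<open>T j j\<close>.\<close>

lemma T_diag_ge:
  assumes "j < p"
  shows "1 / C \<le> T j j"
proof -
  let ?e = "\<lambda>k. if k = j then 1 else 0 :: real"
  have "(bil p S ?e (\<lambda>l. T j l))\<^sup>2 \<le> bil p S ?e ?e * bil p S (\<lambda>l. T j l) (\<lambda>l. T j l)"
    by (rule bil_Cauchy_Schwarz[OF S_sym S_psd])
  moreover have "bil p S ?e ?e = S j j"
  proof -
    have "bil p S ?e ?e = (\<Sum>i<p. ?e i * S i j)"
      unfolding bil_def by (simp only: sum_delta_mult(4)[OF assms])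
    then show ?thesis using sum_delta_mult(2)[OF assms, of "\<lambda>i. S i j"] by simp
  qed
  ultimately have "1 \<le> S j j * T j j" using bil_S_T_row[OF assms] by simp
  also have "\<dots> \<le> C * T j j"
    using S_diag[OF assms] T_diag_le[OF assms] by (intro mult_right_mono) auto
  finally show ?thesis using C by (simp add: field_simps)
qed

lemma T_diag_pos: "j < p \<Longrightarrow> 0 < T j j"
  using T_diag_ge C by (meson less_le_trans zero_less_divide_1_iff)

lemma T_row_sq_le: "j < p \<Longrightarrow> (\<Sum>k<p. (T j k)\<^sup>2) \<le> 1 / c0\<^sup>2"
  using T_row_sq[of j] divide_right_mono[OF T_diag_le(1)[of j], of c0] c0
  by (simp add: power2_eq_square)

end

section \<open>Deterministic bounds for the Lasso\<close>

text \<open>The deterministic arguments use functions of indices instead of vectors and matrices, so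
  that finite sums can be exchanged freely. \<open>lasso_objective_eq\<close> and the entry lemmas
  for the estimators translate back.\<close>

definition fit :: "nat \<Rightarrow> (nat \<Rightarrow> nat \<Rightarrow> real) \<Rightarrow> (nat \<Rightarrow> real) \<Rightarrow> nat \<Rightarrow> real" where
  "fit p x b i = (\<Sum>j<p. x i j * b j)"

definition objective ::
  "nat \<Rightarrow> nat \<Rightarrow> real \<Rightarrow> (nat \<Rightarrow> real) \<Rightarrow> (nat \<Rightarrow> nat \<Rightarrow> real) \<Rightarrow> (nat \<Rightarrow> real) \<Rightarrow> real" where
  "objective n p lam y x b = (\<Sum>i<n. (y i - fit p x b i)\<^sup>2) / n + 2 * lam * (\<Sum>j<p. \<bar>b j\<bar>)"

lemma fit_add: "fit p x (\<lambda>j. a j + b j) i = fit p x a i + fit p x b i"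
  by (simp add: fit_def distrib_left sum.distrib)

lemma fit_diff: "fit p x (\<lambda>j. a j - b j) i = fit p x a i - fit p x b i"
  by (simp add: fit_def right_diff_distrib sum_subtractf)

lemma fit_scale: "fit p x (\<lambda>j. t * b j) i = t * fit p x b i"
  by (simp add: fit_def sum_distrib_left mult.left_commute)

lemma sum_mult_fit: "(\<Sum>i<n. e i * fit p x b i) = (\<Sum>j<p. b j * (\<Sum>i<n. x i j * e i))"
proof -
  have "(\<Sum>i<n. e i * fit p x b i) = (\<Sum>i<n. \<Sum>j<p. b j * (x i j * e i))"
    by (simp add: fit_def sum_distrib_left mult_ac)
  also have "\<dots> = (\<Sum>j<p. \<Sum>i<n. b j * (x i j * e i))" by (rule sum.swap)
  finally show ?thesis by (simp add: sum_distrib_left)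
qed

lemma abs_sum_mult_le:
  fixes b z :: "nat \<Rightarrow> real"
  assumes "\<And>j. j < p \<Longrightarrow> \<bar>z j\<bar> \<le> c"
  shows "\<bar>\<Sum>j<p. b j * z j\<bar> \<le> (\<Sum>j<p. \<bar>b j\<bar>) * c"
proof -
  have "\<bar>\<Sum>j<p. b j * z j\<bar> \<le> (\<Sum>j<p. \<bar>b j * z j\<bar>)" by (rule sum_abs)
  also have "\<dots> \<le> (\<Sum>j<p. \<bar>b j\<bar> * c)"
    using assms by (intro sum_mono) (auto simp: abs_mult intro!: mult_left_mono)
  finally show ?thesis by (simp add: sum_distrib_right)
qed

lemma gram_form:
  "(\<Sum>i<n. (fit p x v i)\<^sup>2) / n = bil p (\<lambda>j k. (\<Sum>i<n. x i j * x i k) / n) v v"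
proof -
  have "(\<Sum>i<n. (fit p x v i)\<^sup>2) = (\<Sum>j<p. v j * (\<Sum>i<n. x i j * fit p x v i))"
    using sum_mult_fit[of "fit p x v" p x v n] by (simp add: power2_eq_square)
  also have "\<dots> = (\<Sum>j<p. v j * (\<Sum>k<p. v k * (\<Sum>i<n. x i k * x i j)))"
    by (intro sum.cong refl) (simp add: sum_mult_fit)
  finally show ?thesis
    by (simp add: bil_def sum_divide_distrib sum_distrib_left mult_ac)
qed

text \<open>Entrywise closeness costs the squared l1 norm. On the cone of Lasso errors this is at
  most a multiple of the sparsity times the squared Euclidean norm, so that curvature passes from
  the population matrix to the Gram matrix.\<close>

lemma bil_diff_le:
  assumes "\<And>j k. j < p \<Longrightarrow> k < p \<Longrightarrow> \<bar>A j k - S j k\<bar> \<le> d"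
  shows "\<bar>bil p A v v - bil p S v v\<bar> \<le> d * (\<Sum>j<p. \<bar>v j\<bar>)\<^sup>2"
proof -
  have "bil p A v v - bil p S v v = (\<Sum>j<p. v j * (\<Sum>k<p. v k * (A j k - S j k)))"
    by (simp add: bil_def right_diff_distrib sum_subtractf mult.commute)
  moreover have "\<bar>\<Sum>k<p. v k * (A j k - S j k)\<bar> \<le> (\<Sum>j<p. \<bar>v j\<bar>) * d" if "j < p" for j
    using assms that by (intro abs_sum_mult_le) auto
  ultimately have "\<bar>bil p A v v - bil p S v v\<bar> \<le> (\<Sum>j<p. \<bar>v j\<bar>) * ((\<Sum>j<p. \<bar>v j\<bar>) * d)"
    using abs_sum_mult_le[of p "\<lambda>j. \<Sum>k<p. v k * (A j k - S j k)" "(\<Sum>j<p. \<bar>v j\<bar>) * d" v] by simp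
  then show ?thesis by (simp add: power2_eq_square mult_ac)
qed

text \<open>The noise bound is requested only at coordinates where \<open>b\<close> and
  \<open>\<beta>\<close> differ. In the nodewise regression both vanish at coordinate
  \<open>j\<close>, and there the column is strongly correlated with the residual.\<close>

lemma lasso_basic_inequality:
  fixes b \<beta> :: "nat \<Rightarrow> real"
  assumes n: "0 < n"
    and le: "objective n p lam y x b \<le> objective n p lam y x \<beta>"
    and noise: "\<And>k. k < p \<Longrightarrow> b k \<noteq> \<beta> k \<Longrightarrow> \<bar>\<Sum>i<n. x i k * (y i - fit p x \<beta> i)\<bar> / n \<le> lam / 2"
    and lam: "0 \<le> lam"
  defines "D \<equiv> \<lambda>j. b j - \<beta> j"
  shows "(\<Sum>i<n. (fit p x D i)\<^sup>2) / n + lam * (\<Sum>j<p. \<bar>D j\<bar>) \<le> 4 * lam * (\<Sum>j\<in>{j. j < p \<and> \<beta> j \<noteq> 0}. \<bar>D j\<bar>)"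
proof -
  let ?e = "\<lambda>i. y i - fit p x \<beta> i"
  let ?J = "{j. j < p \<and> \<beta> j \<noteq> 0}"
  have res: "y i - fit p x b i = ?e i - fit p x D i" for i
    by (simp add: D_def fit_diff)
  have sq: "(\<Sum>i<n. (y i - fit p x b i)\<^sup>2)
      = (\<Sum>i<n. (?e i)\<^sup>2) - 2 * (\<Sum>i<n. ?e i * fit p x D i) + (\<Sum>i<n. (fit p x D i)\<^sup>2)"
  proof -
    have "(\<Sum>i<n. (y i - fit p x b i)\<^sup>2) = (\<Sum>i<n. (?e i)\<^sup>2 - 2 * (?e i * fit p x D i) + (fit p x D i)\<^sup>2)"
      unfolding res by (intro sum.cong refl) (simp add: power2_eq_square algebra_simps)
    then show ?thesis by (simp only: sum.distrib sum_subtractf sum_distrib_left)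
  qed
  have cross: "(\<Sum>i<n. ?e i * fit p x D i) / n \<le> (lam / 2) * (\<Sum>j<p. \<bar>D j\<bar>)"
  proof -
    have "(\<Sum>i<n. ?e i * fit p x D i) / n = (\<Sum>j<p. D j * ((\<Sum>i<n. x i j * ?e i) / n))"
      by (simp add: sum_mult_fit sum_divide_distrib sum_distrib_left)
    also have "\<dots> \<le> (\<Sum>j<p. \<bar>D j\<bar> * (lam / 2))"
    proof (intro sum_mono)
      fix j assume j: "j \<in> {..<p}"
      show "D j * ((\<Sum>i<n. x i j * ?e i) / n) \<le> \<bar>D j\<bar> * (lam / 2)"
      proof (cases "D j = 0")
        case False
        then have "b j \<noteq> \<beta> j" by (simp add: D_def)
        then have "\<bar>(\<Sum>i<n. x i j * ?e i) / n\<bar> \<le> lam / 2" using noise[of j] j by simp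
        then have "\<bar>D j\<bar> * \<bar>(\<Sum>i<n. x i j * ?e i) / n\<bar> \<le> \<bar>D j\<bar> * (lam / 2)"
          by (rule mult_left_mono) simp
        then show ?thesis unfolding abs_mult[symmetric] by linarith
      qed simp
    qed
    finally show ?thesis by (simp only: mult.commute[of "lam / 2"] sum_distrib_right)
  qed
  have split: "(\<Sum>j<p. f j) = (\<Sum>j\<in>?J. f j) + (\<Sum>j\<in>{..<p} - ?J. f j)" for f :: "nat \<Rightarrow> real"
    using sum.subset_diff[of ?J "{..<p}" f] by (auto simp: add.commute)
  have pen: "(\<Sum>j<p. \<bar>\<beta> j\<bar>) - (\<Sum>j<p. \<bar>b j\<bar>) \<le> (\<Sum>j\<in>?J. \<bar>D j\<bar>) - (\<Sum>j\<in>{..<p} - ?J. \<bar>D j\<bar>)"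
  proof -
    have "(\<Sum>j\<in>?J. \<bar>\<beta> j\<bar>) - (\<Sum>j\<in>?J. \<bar>b j\<bar>) \<le> (\<Sum>j\<in>?J. \<bar>D j\<bar>)"
      unfolding sum_subtractf[symmetric] by (intro sum_mono) (auto simp: D_def)
    moreover have "(\<Sum>j\<in>{..<p} - ?J. \<bar>\<beta> j\<bar>) - (\<Sum>j\<in>{..<p} - ?J. \<bar>b j\<bar>) = - (\<Sum>j\<in>{..<p} - ?J. \<bar>D j\<bar>)"
      unfolding sum_subtractf[symmetric] sum_negf[symmetric] by (intro sum.cong) (auto simp: D_def)
    ultimately show ?thesis using split[of "\<lambda>j. \<bar>\<beta> j\<bar>"] split[of "\<lambda>j. \<bar>b j\<bar>"] by linarith
  qed
  have "(\<Sum>i<n. (fit p x D i)\<^sup>2) / n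
      \<le> 2 * ((\<Sum>i<n. ?e i * fit p x D i) / n) + 2 * lam * ((\<Sum>j<p. \<bar>\<beta> j\<bar>) - (\<Sum>j<p. \<bar>b j\<bar>))"
    using le unfolding objective_def sq by (simp add: add_divide_distrib diff_divide_distrib algebra_simps)
  also have "\<dots> \<le> lam * (\<Sum>j<p. \<bar>D j\<bar>) + 2 * lam * ((\<Sum>j\<in>?J. \<bar>D j\<bar>) - (\<Sum>j\<in>{..<p} - ?J. \<bar>D j\<bar>))"
  proof -
    have "2 * ((\<Sum>i<n. ?e i * fit p x D i) / n) \<le> lam * (\<Sum>j<p. \<bar>D j\<bar>)" using cross by (simp add: mult.commute)
    moreover have "2 * lam * ((\<Sum>j<p. \<bar>\<beta> j\<bar>) - (\<Sum>j<p. \<bar>b j\<bar>))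
        \<le> 2 * lam * ((\<Sum>j\<in>?J. \<bar>D j\<bar>) - (\<Sum>j\<in>{..<p} - ?J. \<bar>D j\<bar>))"
      using pen lam by (intro mult_left_mono) auto
    ultimately show ?thesis by linarith
  qed
  \<comment> \<open>Adding \<open>lam\<close> times the full l1 norm N = M + M' cancels the part M'
    off the support, since 2 N + 2 (M - M') = 4 M.\<close>
  finally show ?thesis
    unfolding split[of "\<lambda>j. \<bar>D j\<bar>"] by (simp add: algebra_simps)
qed

text \<open>No restricted eigenvalue is assumed for the design. The basic inequality gives N \<le> 4
  M and thus N^2 \<le> 16 s Q, so the condition \<open>32 * s * d \<le> c0\<close> lets the Gram
  deviation consume at most half of the curvature \<open>c0\<close>. Then M \<le> 8 s lam / c0, and
  both constants 32 are four times this 8.\<close>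

theorem lasso_oracle_inequality:
  fixes b \<beta> :: "nat \<Rightarrow> real" and s :: real
  assumes n: "0 < n"
    and le: "objective n p lam y x b \<le> objective n p lam y x \<beta>"
    and noise: "\<And>k. k < p \<Longrightarrow> b k \<noteq> \<beta> k \<Longrightarrow> \<bar>\<Sum>i<n. x i k * (y i - fit p x \<beta> i)\<bar> / n \<le> lam / 2"
    and lam: "0 < lam" and c0: "0 < c0"
    and S: "\<And>v. c0 * (\<Sum>j<p. (v j)\<^sup>2) \<le> bil p S v v"
    and gram: "\<And>j k. j < p \<Longrightarrow> k < p \<Longrightarrow> \<bar>(\<Sum>i<n. x i j * x i k) / n - S j k\<bar> \<le> d"
    and s: "real (card {j. j < p \<and> \<beta> j \<noteq> 0}) \<le> s" and d: "32 * s * d \<le> c0" and d0: "0 \<le> d"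
  defines "D \<equiv> \<lambda>j. b j - \<beta> j"
  shows "(\<Sum>j<p. \<bar>D j\<bar>) \<le> 32 * s * lam / c0"
    and "(\<Sum>i<n. (fit p x D i)\<^sup>2) / n \<le> 32 * s * lam\<^sup>2 / c0"
proof -
  let ?J = "{j. j < p \<and> \<beta> j \<noteq> 0}"
  let ?N = "\<Sum>j<p. \<bar>D j\<bar>" and ?M = "\<Sum>j\<in>?J. \<bar>D j\<bar>" and ?Q = "\<Sum>j<p. (D j)\<^sup>2"
  let ?P = "(\<Sum>i<n. (fit p x D i)\<^sup>2) / n"
  have basic: "?P + lam * ?N \<le> 4 * lam * ?M"
    unfolding D_def using lasso_basic_inequality[OF n le noise less_imp_le[OF lam]] by auto
  have P0: "0 \<le> ?P" by (simp add: sum_nonneg)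
  have N0: "0 \<le> ?N" by (simp add: sum_nonneg)
  have s0: "0 \<le> s" using s by linarith
  have MQ: "?M\<^sup>2 \<le> s * ?Q"
  proof -
    have "?M\<^sup>2 \<le> (\<Sum>j\<in>?J. 1\<^sup>2) * (\<Sum>j\<in>?J. \<bar>D j\<bar>\<^sup>2)"
      using Cauchy_Schwarz_ineq_sum[of "\<lambda>_. 1" "\<lambda>j. \<bar>D j\<bar>" ?J] by simp
    also have "\<dots> \<le> s * ?Q"
      using s s0 by (intro mult_mono) (auto intro!: sum_mono2 sum_nonneg)
    finally show ?thesis .
  qed
  have "?N \<le> 32 * s * lam / c0 \<and> ?P \<le> 32 * s * lam\<^sup>2 / c0"
  proof -
    have "lam * ?N \<le> lam * (4 * ?M)" using basic P0 by simp
    then have NM: "?N \<le> 4 * ?M" using lam by simp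
    have "c0 * ?Q \<le> bil p S D D" by (rule S)
    also have "\<dots> \<le> ?P + d * ?N\<^sup>2"
      using bil_diff_le[of p "\<lambda>j k. (\<Sum>i<n. x i j * x i k) / n" S d D, OF gram]
      by (simp add: gram_form abs_le_iff)
    finally have 1: "c0 * ?Q \<le> ?P + d * ?N\<^sup>2" .
    have "?N\<^sup>2 \<le> (4 * ?M)\<^sup>2" using NM N0 by (rule power_mono)
    also have "\<dots> \<le> 16 * (s * ?Q)" using MQ by (simp add: power_mult_distrib)
    finally have "d * ?N\<^sup>2 \<le> d * (16 * (s * ?Q))" using d0 by (rule mult_left_mono)
    moreover have "32 * s * d * ?Q \<le> c0 * ?Q" using d by (intro mult_right_mono) (auto intro: sum_nonneg)
    ultimately have PQ: "c0 * ?Q \<le> 2 * ?P" using 1 by (simp add: algebra_simps)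
    have M0: "0 \<le> ?M" by (simp add: sum_nonneg)
    have "c0 * ?M\<^sup>2 \<le> s * (c0 * ?Q)" using MQ c0 by (simp add: mult.left_commute)
    also have "\<dots> \<le> s * (2 * ?P)" using PQ s0 by (rule mult_left_mono)
    also have "\<dots> \<le> s * (2 * (4 * lam * ?M))"
    proof -
      have "0 \<le> lam * ?N" using lam N0 by simp
      with basic have "?P \<le> 4 * lam * ?M" by linarith
      then show ?thesis using s0 by (intro mult_left_mono) auto
    qed
    finally have "?M * (c0 * ?M) \<le> ?M * (8 * s * lam)" by (simp add: power2_eq_square algebra_simps)
    then have "c0 * ?M \<le> 8 * s * lam"
      using M0 s0 lam by (cases "?M = 0") auto
    then have M: "?M \<le> 8 * s * lam / c0" using c0 by (simp add: field_simps)
    have "?N \<le> 32 * s * lam / c0" using NM M by simp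
    moreover have "?P \<le> 32 * s * lam\<^sup>2 / c0"
    proof -
      have "0 \<le> lam * ?N" using lam N0 by simp
      with basic have "?P \<le> 4 * lam * ?M" by linarith
      also have "\<dots> \<le> 4 * lam * (8 * s * lam / c0)" using M lam by (intro mult_left_mono) auto
      finally show ?thesis by (simp add: power2_eq_square mult_ac)
    qed
    ultimately show ?thesis by simp
  qed
  then show "?N \<le> 32 * s * lam / c0" "?P \<le> 32 * s * lam\<^sup>2 / c0" by auto
qed

text \<open>First-order optimality without differentiation: a small \<open>t\<close> with the sign
  of \<open>c\<close> makes the quadratic term negligible against the linear ones. The range of
  \<open>t\<close> stops at 1 because radial perturbations need \<open>1 + t\<close>
  nonnegative.\<close>

lemma abs_le_of_quadratic_bound:
  fixes a c L :: real
  assumes ineq: "\<And>t. \<bar>t\<bar> \<le> 1 \<Longrightarrow> 2 * t * c \<le> t\<^sup>2 * a + 2 * L * \<bar>t\<bar>" and a: "0 \<le> a" and L: "0 \<le> L"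
  shows "\<bar>c\<bar> \<le> L"
proof (rule field_le_epsilon)
  fix e :: real assume e: "0 < e"
  show "\<bar>c\<bar> \<le> L + e"
  proof (cases "c = 0")
    case True
    then show ?thesis using L e by simp
  next
    case False
    define r where "r = min 1 (2 * e / (a + 1))"
    have r: "0 < r" "r \<le> 1" using e a by (auto simp: r_def)
    have "r \<le> 2 * e / (a + 1)" by (simp add: r_def)
    with a have ra: "r * (a + 1) \<le> 2 * e" by (subst pos_le_divide_eq[symmetric]) auto
    define t where "t = r * sgn c"
    have ta: "\<bar>t\<bar> = r" using False r by (simp add: t_def abs_mult abs_sgn_eq)
    have tc: "t * c = r * \<bar>c\<bar>" by (simp add: t_def abs_sgn mult_ac)
    have t2: "t\<^sup>2 = r * r" using ta by (metis power2_abs power2_eq_square)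
    have "2 * (t * c) \<le> t\<^sup>2 * a + 2 * L * \<bar>t\<bar>" using ineq[of t] ta r by (simp only: mult.assoc)
    then have "r * (2 * \<bar>c\<bar>) \<le> r * (r * a + 2 * L)"
      unfolding tc t2 ta by (simp add: algebra_simps)
    with r have "2 * \<bar>c\<bar> \<le> r * a + 2 * L" by simp
    also have "\<dots> \<le> 2 * e + 2 * L" using r ra by (simp add: algebra_simps)
    finally show ?thesis by simp
  qed
qed

text \<open>Moving a single coordinate by \<open>t\<close> raises the penalty by at most
  \<open>2 * lam * \<bar>t\<bar>\<close>, so the linear coefficient of the squared loss cannot
  exceed \<open>lam\<close>.\<close>

lemma lasso_subgradient:
  fixes g :: "nat \<Rightarrow> real"
  assumes n: "0 < n" and k: "k < p" and lam: "0 \<le> lam"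
    and le: "\<And>t. objective n p lam y x g \<le> objective n p lam y x (g(k := g k + t))"
  shows "\<bar>(\<Sum>i<n. x i k * (y i - fit p x g i)) / n\<bar> \<le> lam"
proof -
  let ?c = "(\<Sum>i<n. x i k * (y i - fit p x g i)) / n" and ?a = "(\<Sum>i<n. (x i k)\<^sup>2) / n"
  have fitk: "fit p x (g(k := g k + t)) i = fit p x g i + t * x i k" for t i
  proof -
    have "fit p x (g(k := g k + t)) i = fit p x (\<lambda>j. g j + t * (if j = k then 1 else 0)) i"
      unfolding fit_def by (intro sum.cong refl) auto
    also have "\<dots> = fit p x g i + t * fit p x (\<lambda>j. if j = k then 1 else 0) i"
      by (simp add: fit_add fit_scale)
    finally show ?thesis using sum_delta_mult(4)[OF k, of "x i"] by (simp add: fit_def)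
  qed
  have ineq: "2 * t * ?c \<le> t\<^sup>2 * ?a + 2 * lam * \<bar>t\<bar>" for t
  proof -
    have "(\<Sum>i<n. (y i - fit p x (g(k := g k + t)) i)\<^sup>2)
      = (\<Sum>i<n. (y i - fit p x g i)\<^sup>2 - 2 * t * (x i k * (y i - fit p x g i)) + t\<^sup>2 * (x i k)\<^sup>2)"
      unfolding fitk power2_eq_square by (intro sum.cong refl) (simp add: algebra_simps)
    also have "\<dots> = (\<Sum>i<n. (y i - fit p x g i)\<^sup>2) - 2 * t * (\<Sum>i<n. x i k * (y i - fit p x g i))
        + t\<^sup>2 * (\<Sum>i<n. (x i k)\<^sup>2)"
      by (simp add: sum.distrib sum_subtractf sum_distrib_left)
    finally have sq: "(\<Sum>i<n. (y i - fit p x (g(k := g k + t)) i)\<^sup>2) / n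
      = (\<Sum>i<n. (y i - fit p x g i)\<^sup>2) / n - 2 * t * ?c + t\<^sup>2 * ?a"
      by (simp add: add_divide_distrib diff_divide_distrib)
    have "(\<Sum>j<p. \<bar>(g(k := g k + t)) j\<bar>) \<le> (\<Sum>j<p. \<bar>g j\<bar> + \<bar>t\<bar> * (if j = k then 1 else 0))"
      by (intro sum_mono) auto
    also have "\<dots> = (\<Sum>j<p. \<bar>g j\<bar>) + \<bar>t\<bar>"
      using sum_delta_mult(4)[OF k, of "\<lambda>_. \<bar>t\<bar>"] by (simp add: sum.distrib)
    finally have "2 * lam * (\<Sum>j<p. \<bar>(g(k := g k + t)) j\<bar>) \<le> 2 * lam * ((\<Sum>j<p. \<bar>g j\<bar>) + \<bar>t\<bar>)"
      using lam by (intro mult_left_mono) auto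
    with le[of t] sq show ?thesis by (simp add: objective_def algebra_simps)
  qed
  show ?thesis by (rule abs_le_of_quadratic_bound[OF ineq _ lam]) (simp add: sum_nonneg)
qed

text \<open>Under rescaling by \<open>1 + t\<close> the penalty is exactly linear in
  \<open>t\<close>, so its slope and that of the loss must cancel. Rescaling also preserves the
  constraint that coordinate \<open>j\<close> is 0. This identity is why the penalty term in
  \<open>tau_hat_sq\<close> produces an exact diagonal after debiasing.\<close>

lemma lasso_radial:
  fixes g :: "nat \<Rightarrow> real"
  assumes n: "0 < n"
    and le: "\<And>t. objective n p lam y x g \<le> objective n p lam y x (\<lambda>j. (1 + t) * g j)"
  shows "(\<Sum>i<n. (y i - fit p x g i) * fit p x g i) / n = lam * (\<Sum>j<p. \<bar>g j\<bar>)"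
proof -
  let ?c = "(\<Sum>i<n. (y i - fit p x g i) * fit p x g i) / n - lam * (\<Sum>j<p. \<bar>g j\<bar>)"
    and ?a = "(\<Sum>i<n. (fit p x g i)\<^sup>2) / n"
  have ineq: "2 * t * ?c \<le> t\<^sup>2 * ?a" if t: "\<bar>t\<bar> \<le> 1" for t
  proof -
    have "(\<Sum>i<n. (y i - fit p x (\<lambda>j. (1 + t) * g j) i)\<^sup>2)
      = (\<Sum>i<n. (y i - fit p x g i)\<^sup>2 - 2 * t * ((y i - fit p x g i) * fit p x g i) + t\<^sup>2 * (fit p x g i)\<^sup>2)"
      unfolding fit_scale by (intro sum.cong refl) (simp add: power2_eq_square algebra_simps)
    also have "\<dots> = (\<Sum>i<n. (y i - fit p x g i)\<^sup>2) - 2 * t * (\<Sum>i<n. (y i - fit p x g i) * fit p x g i)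
        + t\<^sup>2 * (\<Sum>i<n. (fit p x g i)\<^sup>2)"
      by (simp add: sum.distrib sum_subtractf sum_distrib_left)
    finally have sq: "(\<Sum>i<n. (y i - fit p x (\<lambda>j. (1 + t) * g j) i)\<^sup>2) / n
      = (\<Sum>i<n. (y i - fit p x g i)\<^sup>2) / n - 2 * t * ((\<Sum>i<n. (y i - fit p x g i) * fit p x g i) / n)
        + t\<^sup>2 * ?a"
      by (simp add: add_divide_distrib diff_divide_distrib)
    have "(\<Sum>j<p. \<bar>(1 + t) * g j\<bar>) = (1 + t) * (\<Sum>j<p. \<bar>g j\<bar>)"
      using t by (simp add: abs_mult sum_distrib_left)
    with le[of t] sq show ?thesis by (simp add: objective_def algebra_simps)
  qed
  have "\<bar>?c\<bar> \<le> 0"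
    by (rule abs_le_of_quadratic_bound[of _ ?a]) (use ineq in \<open>auto simp: sum_nonneg\<close>)
  then show ?thesis by simp
qed

section \<open>Exponential moments and Gaussian tails\<close>

lemma (in prob_space) prob_le_expectation:
  fixes g :: "'a \<Rightarrow> real"
  assumes "A \<in> events" "integrable M g" "\<And>\<omega>. \<omega> \<in> space M \<Longrightarrow> 0 \<le> g \<omega>" "\<And>\<omega>. \<omega> \<in> A \<Longrightarrow> 1 \<le> g \<omega>"
  shows "prob A \<le> expectation g"
proof -
  have "prob A = expectation (indicator A)" using assms(1) by simp
  also have "\<dots> \<le> expectation g"
  proof (rule integral_mono[OF _ assms(2)])
    show "integrable M (indicator A :: 'a \<Rightarrow> real)"
      using assms(1) by (simp add: integrable_indicator_iff emeasure_eq_measure)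
  qed (use assms(3,4) in \<open>auto simp: indicator_def\<close>)
  finally show ?thesis .
qed

text \<open>Independence is stated for one sigma-algebra per observation rather than for particular
  variables. Every function of row and error, such as a product of a linear form with the error,
  then inherits it at once.\<close>

locale independent_observations = prob_space M for M :: "'a measure" +
  fixes n :: nat and G :: "nat \<Rightarrow> 'a measure"
  assumes space_G: "\<And>i. i < n \<Longrightarrow> space (G i) = space M"
    and sets_G: "\<And>i. i < n \<Longrightarrow> sets (G i) \<subseteq> events"
    and indep_G: "indep_sets (\<lambda>i. sets (G i)) {..<n}"
begin

lemma measurable_G: "i < n \<Longrightarrow> f \<in> borel_measurable (G i) \<Longrightarrow> f \<in> borel_measurable M"
  by (rule borel_measurable_subalgebra[OF sets_G[of i] space_G[of i]])

lemma indep_vars_G: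
  assumes "\<And>i. i < n \<Longrightarrow> f i \<in> borel_measurable (G i)"
  shows "indep_vars (\<lambda>_. borel) f {..<n}"
  unfolding indep_vars_def2
proof (intro conjI ballI)
  show "random_variable borel (f i)" if "i \<in> {..<n}" for i
    using assms[of i] measurable_G[of i] that by simp
  show "indep_sets (\<lambda>i. {f i -` A \<inter> space M |A. A \<in> sets borel}) {..<n}"
    using assms space_G by (intro indep_sets_mono_sets[OF indep_G]) (auto simp: measurable_def)
qed

lemma
  fixes f :: "nat \<Rightarrow> 'a \<Rightarrow> 'b::{real_normed_field, banach, second_countable_topology}"
  assumes "\<And>i. i < n \<Longrightarrow> f i \<in> borel_measurable (G i)" "\<And>i. i < n \<Longrightarrow> integrable M (f i)"
  shows expectation_prod: "(\<integral>\<omega>. (\<Prod>i<n. f i \<omega>) \<partial>M) = (\<Prod>i<n. \<integral>\<omega>. f i \<omega> \<partial>M)"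
    and integrable_prod: "integrable M (\<lambda>\<omega>. \<Prod>i<n. f i \<omega>)"
proof -
  have "indep_vars (\<lambda>_. borel) f {..<n}" using assms(1) by (rule indep_vars_G)
  moreover have "\<And>i. i \<in> {..<n} \<Longrightarrow> integrable M (f i)" using assms(2) by simp
  ultimately show "(\<integral>\<omega>. (\<Prod>i<n. f i \<omega>) \<partial>M) = (\<Prod>i<n. \<integral>\<omega>. f i \<omega> \<partial>M)"
    "integrable M (\<lambda>\<omega>. \<Prod>i<n. f i \<omega>)"
    using indep_vars_lebesgue_integral[of "{..<n}" f] indep_vars_integrable[of "{..<n}" f]
    by (simp_all only: finite_lessThan)
qed

lemma Chernoff_bound:
  fixes f :: "nat \<Rightarrow> 'a \<Rightarrow> real"
  assumes meas: "\<And>i. i < n \<Longrightarrow> f i \<in> borel_measurable (G i)"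
    and int: "\<And>i. i < n \<Longrightarrow> integrable M (\<lambda>\<omega>. exp (t * f i \<omega>))"
    and mgf: "\<And>i. i < n \<Longrightarrow> expectation (\<lambda>\<omega>. exp (t * f i \<omega>)) \<le> exp (v * t\<^sup>2)"
    and t: "0 \<le> t"
  shows "prob {\<omega> \<in> space M. real n * x \<le> (\<Sum>i<n. f i \<omega>)} \<le> exp (real n * (v * t\<^sup>2 - t * x))"
proof -
  have [measurable]: "(\<lambda>\<omega>. f i \<omega>) \<in> borel_measurable M" if "i < n" for i
    using measurable_G[OF that meas[OF that]] .
  have prodexp: "exp (t * (\<Sum>i<n. f i \<omega>)) = (\<Prod>i<n. exp (t * f i \<omega>))" for \<omega>
    by (simp add: sum_distrib_left exp_sum)
  have m: "(\<lambda>\<omega>. exp (t * f i \<omega>)) \<in> borel_measurable (G i)" if "i < n" for i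
    using meas[OF that] by measurable
  have int': "integrable M (\<lambda>\<omega>. exp (t * (\<Sum>i<n. f i \<omega>)))"
    unfolding prodexp by (rule integrable_prod[OF m int])
  have "prob {\<omega> \<in> space M. real n * x \<le> (\<Sum>i<n. f i \<omega>)}
      \<le> expectation (\<lambda>\<omega>. exp (- t * (real n * x)) * exp (t * (\<Sum>i<n. f i \<omega>)))"
  proof (rule prob_le_expectation)
    fix \<omega> assume "\<omega> \<in> {\<omega> \<in> space M. real n * x \<le> (\<Sum>i<n. f i \<omega>)}"
    then have "t * (real n * x) \<le> t * (\<Sum>i<n. f i \<omega>)" using t by (auto intro: mult_left_mono)
    then show "1 \<le> exp (- t * (real n * x)) * exp (t * (\<Sum>i<n. f i \<omega>))" by (simp add: exp_add[symmetric])
  qed (use int' in auto)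
  also have "\<dots> = exp (- t * (real n * x)) * (\<Prod>i<n. expectation (\<lambda>\<omega>. exp (t * f i \<omega>)))"
    unfolding prodexp by (simp add: expectation_prod[OF m int])
  also have "\<dots> \<le> exp (- t * (real n * x)) * (\<Prod>i<n. exp (v * t\<^sup>2))"
    using mgf by (intro mult_left_mono prod_mono) auto
  also have "\<dots> = exp (real n * (v * t\<^sup>2 - t * x))"
    by (simp add: exp_of_nat_mult[symmetric] exp_add[symmetric] algebra_simps)
  finally show ?thesis .
qed

lemma Bernstein_inequality:
  fixes f :: "nat \<Rightarrow> 'a \<Rightarrow> real"
  assumes meas: "\<And>i. i < n \<Longrightarrow> f i \<in> borel_measurable (G i)"
    and int: "\<And>i t. i < n \<Longrightarrow> \<bar>t\<bar> \<le> t0 \<Longrightarrow> integrable M (\<lambda>\<omega>. exp (t * f i \<omega>))"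
    and mgf: "\<And>i t. i < n \<Longrightarrow> \<bar>t\<bar> \<le> t0 \<Longrightarrow> expectation (\<lambda>\<omega>. exp (t * f i \<omega>)) \<le> exp (v * t\<^sup>2)"
    and v: "0 < v" and x: "0 \<le> x" "x \<le> 2 * v * t0"
  shows "prob {\<omega> \<in> space M. real n * x \<le> \<bar>\<Sum>i<n. f i \<omega>\<bar>} \<le> 2 * exp (- real n * x\<^sup>2 / (4 * v))"
proof -
  have [measurable]: "(\<lambda>\<omega>. f i \<omega>) \<in> borel_measurable M" if "i < n" for i
    using measurable_G[OF that meas[OF that]] .
  \<comment> \<open>The minimizer of \<open>v * t\<^sup>2 - t * x\<close>; the upper limit on
    \<open>x\<close> is exactly the requirement that it lies below \<open>t0\<close>.\<close>
  define t where "t = x / (2 * v)"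
  have t: "0 \<le> t" "\<bar>t\<bar> \<le> t0" using v x by (auto simp: t_def field_simps)
  have e: "real n * (v * t\<^sup>2 - t * x) = - real n * x\<^sup>2 / (4 * v)"
    using v by (simp add: t_def power2_eq_square field_simps)
  have 1: "prob {\<omega> \<in> space M. real n * x \<le> (\<Sum>i<n. f i \<omega>)} \<le> exp (- real n * x\<^sup>2 / (4 * v))"
    unfolding e[symmetric] by (rule Chernoff_bound) (use meas int mgf t in auto)
  have 2: "prob {\<omega> \<in> space M. real n * x \<le> (\<Sum>i<n. - f i \<omega>)} \<le> exp (- real n * x\<^sup>2 / (4 * v))"
    unfolding e[symmetric]
    by (rule Chernoff_bound)
      (use meas int[of _ "-t"] mgf[of _ "-t"] t in \<open>auto intro: borel_measurable_uminus\<close>)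
  have "prob {\<omega> \<in> space M. real n * x \<le> \<bar>\<Sum>i<n. f i \<omega>\<bar>}
      \<le> prob ({\<omega> \<in> space M. real n * x \<le> (\<Sum>i<n. f i \<omega>)} \<union> {\<omega> \<in> space M. real n * x \<le> (\<Sum>i<n. - f i \<omega>)})"
    by (intro finite_measure_mono) (auto simp: sum_negf abs_if split: if_splits)
  also have "\<dots> \<le> prob {\<omega> \<in> space M. real n * x \<le> (\<Sum>i<n. f i \<omega>)} + prob {\<omega> \<in> space M. real n * x \<le> (\<Sum>i<n. - f i \<omega>)}"
    by (rule measure_Un_le) auto
  finally show ?thesis using 1 2 by simp
qed

end

text \<open>The weight dominates the third derivative of the moment generating function on
  \<open>[- b, b]\<close>, so that it is Gaussian up to a cubic error with factor \<open>L\<close>.\<close>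

definition (in prob_space) third_exp_moment :: "real \<Rightarrow> real \<Rightarrow> ('a \<Rightarrow> real) \<Rightarrow> bool" where
  "third_exp_moment b L f \<longleftrightarrow> f \<in> borel_measurable M \<and>
     integrable M (\<lambda>\<omega>. \<bar>f \<omega>\<bar> ^ 3 * exp (b * \<bar>f \<omega>\<bar>)) \<and>
     expectation (\<lambda>\<omega>. \<bar>f \<omega>\<bar> ^ 3 * exp (b * \<bar>f \<omega>\<bar>)) \<le> L"

lemma abs_power_le_third_exp:
  fixes y :: real
  assumes "k \<le> 3" "0 \<le> b"
  shows "\<bar>y\<bar> ^ k * exp (b * \<bar>y\<bar>) \<le> exp b + \<bar>y\<bar> ^ 3 * exp (b * \<bar>y\<bar>)"
proof (cases "\<bar>y\<bar> \<le> 1")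
  case True
  have "\<bar>y\<bar> ^ k * exp (b * \<bar>y\<bar>) \<le> 1 * exp b"
    using True assms by (intro mult_mono) (auto intro: power_le_one mult_left_le)
  then show ?thesis by (smt (verit) exp_gt_zero mult_nonneg_nonneg zero_le_power abs_ge_zero)
next
  case False
  then have "\<bar>y\<bar> ^ k \<le> \<bar>y\<bar> ^ 3" using assms by (intro power_increasing) auto
  then have "\<bar>y\<bar> ^ k * exp (b * \<bar>y\<bar>) \<le> \<bar>y\<bar> ^ 3 * exp (b * \<bar>y\<bar>)" by (intro mult_right_mono) auto
  then show ?thesis by (smt (verit) exp_gt_zero)
qed

section \<open>Moment generating functions close to the Gaussian one\<close>

context prob_space begin

lemma third_exp_moment_integrable_power:
  assumes "third_exp_moment b L f" "0 \<le> b" "k \<le> 3"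
  shows "integrable M (\<lambda>\<omega>. \<bar>f \<omega>\<bar> ^ k * exp (b * \<bar>f \<omega>\<bar>))" "integrable M (\<lambda>\<omega>. f \<omega> ^ k)"
proof -
  have [measurable]: "f \<in> borel_measurable M" and int: "integrable M (\<lambda>\<omega>. \<bar>f \<omega>\<bar> ^ 3 * exp (b * \<bar>f \<omega>\<bar>))"
    using assms by (auto simp: third_exp_moment_def)
  show *: "integrable M (\<lambda>\<omega>. \<bar>f \<omega>\<bar> ^ k * exp (b * \<bar>f \<omega>\<bar>))"
    by (rule Bochner_Integration.integrable_bound[of _ "\<lambda>\<omega>. exp b + \<bar>f \<omega>\<bar> ^ 3 * exp (b * \<bar>f \<omega>\<bar>)"])
      (use int abs_power_le_third_exp[OF assms(3,2)] in
        \<open>auto intro!: Bochner_Integration.integrable_add simp: abs_mult power_abs\<close>)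
  show "integrable M (\<lambda>\<omega>. f \<omega> ^ k)"
  proof (rule Bochner_Integration.integrable_bound[OF *])
    show "AE \<omega> in M. norm (f \<omega> ^ k) \<le> norm (\<bar>f \<omega>\<bar> ^ k * exp (b * \<bar>f \<omega>\<bar>))"
      using assms(2) by (auto simp: abs_mult power_abs intro!: mult_le_cancel_left1[THEN iffD2])
  qed simp
qed

text \<open>The argument is complex because the sharp tail bound needs the characteristic function
  of an exponentially tilted law: the real part of \<open>z\<close> tilts and the imaginary part is
  the frequency.\<close>

lemma mgf_expansion:
  fixes z :: complex
  assumes f: "third_exp_moment b L f" and mean: "expectation f = 0"
    and var: "expectation (\<lambda>\<omega>. (f \<omega>)\<^sup>2) = v" and z: "norm z \<le> b"
  shows "integrable M (\<lambda>\<omega>. exp (z * complex_of_real (f \<omega>)))"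
    and "norm ((\<integral>\<omega>. exp (z * complex_of_real (f \<omega>)) \<partial>M) - (1 + z\<^sup>2 * v / 2)) \<le> norm z ^ 3 * L / 2"
proof -
  have b: "0 \<le> b" using z norm_ge_zero order_trans by blast
  have [measurable]: "f \<in> borel_measurable M"
    and int: "integrable M (\<lambda>\<omega>. \<bar>f \<omega>\<bar> ^ 3 * exp (b * \<bar>f \<omega>\<bar>))"
    and L: "expectation (\<lambda>\<omega>. \<bar>f \<omega>\<bar> ^ 3 * exp (b * \<bar>f \<omega>\<bar>)) \<le> L"
    using f by (auto simp: third_exp_moment_def)
  have rez: "\<bar>Re (z * complex_of_real y)\<bar> \<le> b * \<bar>y\<bar>" for y
  proof -
    have "\<bar>Re (z * complex_of_real y)\<bar> = \<bar>Re z\<bar> * \<bar>y\<bar>" by (simp add: abs_mult)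
    also have "\<dots> \<le> b * \<bar>y\<bar>"
      using abs_Re_le_cmod[of z] z by (intro mult_right_mono) auto
    finally show ?thesis .
  qed
  have int0: "integrable M (\<lambda>\<omega>. exp (b * \<bar>f \<omega>\<bar>))"
    using third_exp_moment_integrable_power(1)[OF f b, of 0] by simp
  have "(\<lambda>y. exp (z * complex_of_real y)) \<in> borel_measurable borel"
    by (intro borel_measurable_continuous_onI continuous_intros)
  then have me: "(\<lambda>\<omega>. exp (z * complex_of_real (f \<omega>))) \<in> borel_measurable M"
    by (rule measurable_compose[rotated]) simp
  show inte: "integrable M (\<lambda>\<omega>. exp (z * complex_of_real (f \<omega>)))"
  proof (rule Bochner_Integration.integrable_bound[OF int0])
    show "AE \<omega> in M. norm (exp (z * complex_of_real (f \<omega>))) \<le> norm (exp (b * \<bar>f \<omega>\<bar>))"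
    proof (rule AE_I2)
      fix \<omega>
      have "Re (z * complex_of_real (f \<omega>)) \<le> b * \<bar>f \<omega>\<bar>" using rez[of "f \<omega>"] by linarith
      then show "norm (exp (z * complex_of_real (f \<omega>))) \<le> norm (exp (b * \<bar>f \<omega>\<bar>))"
        unfolding norm_exp_eq_Re by simp
    qed
  qed (rule me)
  have int1: "integrable M f" using third_exp_moment_integrable_power(2)[OF f b, of 1] by simp
  have int2: "integrable M (\<lambda>\<omega>. (f \<omega>)\<^sup>2)" using third_exp_moment_integrable_power(2)[OF f b, of 2] by simp
  define g where "g = (\<lambda>y. exp (z * complex_of_real y) - 1 - z * complex_of_real y - z\<^sup>2 / 2 * complex_of_real (y\<^sup>2))"
  have g: "norm (g y) \<le> norm z ^ 3 / 2 * (\<bar>y\<bar> ^ 3 * exp (b * \<bar>y\<bar>))" for y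
  proof -
    have "norm (g y) \<le> exp \<bar>Re (z * complex_of_real y)\<bar> * norm (z * complex_of_real y) ^ 3 / 2"
      using Taylor_exp[of "z * complex_of_real y" 2]
      by (simp add: g_def numeral_2_eq_2 power_mult_distrib power3_eq_cube algebra_simps)
    also have "\<dots> \<le> exp (b * \<bar>y\<bar>) * norm (z * complex_of_real y) ^ 3 / 2"
      using rez[of y] by (intro divide_right_mono mult_right_mono) auto
    finally show ?thesis by (simp add: norm_mult power_mult_distrib mult_ac)
  qed
  have "(\<integral>\<omega>. exp (z * complex_of_real (f \<omega>)) \<partial>M) - (1 + z\<^sup>2 * v / 2) = (\<integral>\<omega>. g (f \<omega>) \<partial>M)"
    unfolding g_def using inte int1 int2 mean var prob_space
    by (simp del: of_real_power)
  also have "norm \<dots> \<le> expectation (\<lambda>\<omega>. norm (g (f \<omega>)))" by (rule integral_norm_bound)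
  also have "\<dots> \<le> expectation (\<lambda>\<omega>. norm z ^ 3 / 2 * (\<bar>f \<omega>\<bar> ^ 3 * exp (b * \<bar>f \<omega>\<bar>)))"
  proof (rule integral_mono)
    show "integrable M (\<lambda>\<omega>. norm (g (f \<omega>)))"
      unfolding g_def using inte int1 int2
      by (intro integrable_norm Bochner_Integration.integrable_diff integrable_mult_right)
        (auto simp del: of_real_power)
  qed (use g int in auto)
  also have "\<dots> \<le> norm z ^ 3 * L / 2"
    using L by (simp add: mult_left_mono)
  finally show "norm ((\<integral>\<omega>. exp (z * complex_of_real (f \<omega>)) \<partial>M) - (1 + z\<^sup>2 * v / 2)) \<le> norm z ^ 3 * L / 2" .
qed

lemma mgf_near_Gaussian:
  fixes z :: complex
  assumes f: "third_exp_moment b L f" and mean: "expectation f = 0"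
    and var: "expectation (\<lambda>\<omega>. (f \<omega>)\<^sup>2) = v" and z: "norm z \<le> b" "norm z \<le> 1" and v: "0 \<le> v" "v \<le> 4"
  shows "norm ((\<integral>\<omega>. exp (z * complex_of_real (f \<omega>)) \<partial>M) - exp (z\<^sup>2 * v / 2)) \<le> norm z ^ 3 * (L / 2 + 32)"
proof -
  let ?w = "z\<^sup>2 * v / 2"
  have nw: "norm ?w = norm z ^ 2 * v / 2" using v by (simp add: norm_mult norm_power)
  have "norm z ^ 2 \<le> 1" using z by (simp add: power_le_one)
  then have w2: "norm ?w \<le> 2" unfolding nw using v mult_mono[of "norm z ^ 2" 1 v 4] by simp
  have "exp (2::real) \<le> 8"
  proof -
    have "exp (1::real) \<le> 2.8" using e_less_272 by simp
    then have "exp (1::real) ^ 2 \<le> 2.8 ^ 2" by (rule power_mono) simp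
    then show ?thesis by (simp add: power2_eq_square exp_add[symmetric])
  qed
  moreover have "exp \<bar>Re ?w\<bar> \<le> exp 2" using abs_Re_le_cmod[of ?w] w2 by simp
  ultimately have e8: "exp \<bar>Re ?w\<bar> \<le> 8" by linarith
  have "norm (exp ?w - (1 + ?w)) \<le> exp \<bar>Re ?w\<bar> * norm ?w ^ 2"
    using Taylor_exp[of ?w 1] by (simp add: numeral_2_eq_2)
  also have "\<dots> \<le> 8 * norm ?w ^ 2" using e8 by (intro mult_right_mono) auto
  also have "\<dots> = 2 * (norm z ^ 3 * norm z) * v\<^sup>2"
    unfolding nw by (simp add: power2_eq_square power3_eq_cube)
  also have "\<dots> \<le> 2 * (norm z ^ 3 * 1) * 4\<^sup>2"
    using z v by (intro mult_mono power_mono) auto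
  finally have 1: "norm (exp ?w - (1 + ?w)) \<le> 32 * norm z ^ 3" by simp
  have "norm ((\<integral>\<omega>. exp (z * complex_of_real (f \<omega>)) \<partial>M) - exp ?w)
      \<le> norm ((\<integral>\<omega>. exp (z * complex_of_real (f \<omega>)) \<partial>M) - (1 + ?w)) + norm (exp ?w - (1 + ?w))"
    using norm_triangle_ineq4[of "(\<integral>\<omega>. exp (z * complex_of_real (f \<omega>)) \<partial>M) - (1 + ?w)" "exp ?w - (1 + ?w)"]
    by simp
  also have "\<dots> \<le> norm z ^ 3 * L / 2 + 32 * norm z ^ 3"
    using mgf_expansion(2)[OF f mean var z(1)] 1 by simp
  finally show ?thesis by (simp add: algebra_simps)
qed

text \<open>The additive error is turned into a factor, which can be multiplied over the
  observations. This is possible because the Gaussian value has modulus at least 1/8, whence the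
  factor 8 in the exponent.\<close>

lemma norm_mgf_le:
  fixes z :: complex
  assumes f: "third_exp_moment b L f" and mean: "expectation f = 0"
    and var: "expectation (\<lambda>\<omega>. (f \<omega>)\<^sup>2) = v" and z: "norm z \<le> b" "norm z \<le> 1" and v: "0 \<le> v" "v \<le> 4"
    and L: "0 \<le> L"
  shows "norm (\<integral>\<omega>. exp (z * complex_of_real (f \<omega>)) \<partial>M) \<le> exp (Re (z\<^sup>2) * v / 2 + 8 * norm z ^ 3 * (L / 2 + 32))"
proof -
  let ?w = "z\<^sup>2 * v / 2"
  have rw: "Re ?w = Re (z\<^sup>2) * v / 2" by simp
  have nw: "norm ?w = norm z ^ 2 * v / 2" using v by (simp add: norm_mult norm_power)
  have "norm z ^ 2 \<le> 1" using z by (simp add: power_le_one)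
  then have w2: "norm ?w \<le> 2" unfolding nw using v mult_mono[of "norm z ^ 2" 1 v 4] by simp
  have "exp (2::real) \<le> 8"
  proof -
    have "exp (1::real) \<le> 2.8" using e_less_272 by simp
    then have "exp (1::real) ^ 2 \<le> 2.8 ^ 2" by (rule power_mono) simp
    then show ?thesis by (simp add: power2_eq_square exp_add[symmetric])
  qed
  moreover have "exp (- Re ?w) \<le> exp 2" using abs_Re_le_cmod[of ?w] w2 by simp
  ultimately have e8: "exp (- Re ?w) \<le> 8" by linarith
  have ge1: "1 \<le> 8 * exp (Re ?w)"
    using mult_right_mono[OF e8, of "exp (Re ?w)"] by (simp add: exp_add[symmetric])
  let ?d = "norm z ^ 3 * (L / 2 + 32)"
  have d0: "0 \<le> ?d" using L by simp
  have "norm (\<integral>\<omega>. exp (z * complex_of_real (f \<omega>)) \<partial>M) \<le> norm (exp ?w) + ?d"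
    using mgf_near_Gaussian[OF f mean var z v] norm_triangle_sub by (smt (verit))
  also have "norm (exp ?w) = exp (Re ?w)" by (rule norm_exp_eq_Re)
  also have "exp (Re ?w) + ?d \<le> exp (Re ?w) + ?d * (8 * exp (Re ?w))"
    using mult_left_mono[OF ge1 d0] by simp
  also have "\<dots> = exp (Re ?w) * (1 + 8 * ?d)" by (simp add: algebra_simps)
  also have "\<dots> \<le> exp (Re ?w) * exp (8 * ?d)"
    by (intro mult_left_mono exp_ge_add_one_self) auto
  finally show ?thesis unfolding rw by (simp add: exp_add[symmetric] algebra_simps)
qed

lemma mgf_real_eq:
  fixes t :: real
  assumes "integrable M (\<lambda>\<omega>. exp (t * f \<omega>))"
  shows "(\<integral>\<omega>. exp (complex_of_real t * complex_of_real (f \<omega>)) \<partial>M) = complex_of_real (expectation (\<lambda>\<omega>. exp (t * f \<omega>)))"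
  using assms by (simp flip: of_real_mult add: exp_of_real)

lemma integrable_mgf:
  fixes t :: real
  assumes f: "third_exp_moment b L f" and t: "\<bar>t\<bar> \<le> b"
  shows "integrable M (\<lambda>\<omega>. exp (t * f \<omega>))"
proof -
  have b: "0 \<le> b" using t by linarith
  have [measurable]: "f \<in> borel_measurable M" using f by (simp add: third_exp_moment_def)
  have int0: "integrable M (\<lambda>\<omega>. exp (b * \<bar>f \<omega>\<bar>))"
    using third_exp_moment_integrable_power(1)[OF f b, of 0] by simp
  have "t * y \<le> b * \<bar>y\<bar>" for y
    using mult_right_mono[OF t, of "\<bar>y\<bar>"] by (simp add: abs_mult[symmetric])
  then show ?thesis
    by (intro Bochner_Integration.integrable_bound[OF int0]) auto
qed

lemma mgf_lower:
  fixes t :: real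
  assumes f: "third_exp_moment b L f" and mean: "expectation f = 0"
    and var: "expectation (\<lambda>\<omega>. (f \<omega>)\<^sup>2) = 1" and t: "\<bar>t\<bar> \<le> b" "\<bar>t\<bar> \<le> 1"
    and small: "\<bar>t\<bar> ^ 3 * (L / 2 + 32) \<le> 1 / 2" and L: "0 \<le> L"
  shows "exp (t\<^sup>2 / 2 - 2 * (\<bar>t\<bar> ^ 3 * (L / 2 + 32))) \<le> expectation (\<lambda>\<omega>. exp (t * f \<omega>))"
proof -
  let ?d = "\<bar>t\<bar> ^ 3 * (L / 2 + 32)"
  have d0: "0 \<le> ?d" using L by simp
  have "norm (complex_of_real (expectation (\<lambda>\<omega>. exp (t * f \<omega>))) - exp (complex_of_real t ^ 2 * 1 / 2)) \<le> ?d"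
    using mgf_near_Gaussian[OF f mean var, of "complex_of_real t"] t mgf_real_eq[OF integrable_mgf[OF f t(1)]]
    by simp
  moreover have "exp (complex_of_real t ^ 2 * 1 / 2) = complex_of_real (exp (t\<^sup>2 / 2))"
    by (simp add: exp_of_real[symmetric])
  ultimately have "\<bar>expectation (\<lambda>\<omega>. exp (t * f \<omega>)) - exp (t\<^sup>2 / 2)\<bar> \<le> ?d"
    by (simp flip: of_real_diff)
  then have "exp (t\<^sup>2 / 2) - ?d \<le> expectation (\<lambda>\<omega>. exp (t * f \<omega>))" by linarith
  moreover have "exp (t\<^sup>2 / 2) * (1 - ?d) \<le> exp (t\<^sup>2 / 2) - ?d"
    using mult_right_mono[of 1 "exp (t\<^sup>2 / 2)" ?d] d0 by (simp add: algebra_simps)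
  moreover have "exp (t\<^sup>2 / 2) * exp (- 2 * ?d) \<le> exp (t\<^sup>2 / 2) * (1 - ?d)"
  proof (rule mult_left_mono)
    \<comment> \<open>For \<open>?d\<close> at most 1/2 this yields
      \<open>1 - ?d \<ge> exp (- 2 * ?d)\<close>, the multiplicative form of the
      subtraction.\<close>
    have "(1 + 2 * ?d) * (1 - ?d) \<ge> 1"
    proof -
      have "0 \<le> 1 - 2 * ?d" using small by linarith
      then have "?d * (1 - 2 * ?d) \<ge> 0" using d0 by (rule mult_nonneg_nonneg[rotated])
      then show ?thesis by (simp add: algebra_simps)
    qed
    also have "(1 + 2 * ?d) * (1 - ?d) \<le> exp (2 * ?d) * (1 - ?d)"
      using small by (intro mult_right_mono exp_ge_add_one_self) auto
    finally have "exp (- 2 * ?d) * 1 \<le> exp (- 2 * ?d) * (exp (2 * ?d) * (1 - ?d))"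
      by (intro mult_left_mono) auto
    then show "exp (- 2 * ?d) \<le> 1 - ?d" by (simp add: mult.assoc[symmetric] exp_add[symmetric])
  qed simp
  ultimately show ?thesis by (simp add: exp_add[symmetric] algebra_simps)
qed

text \<open>The sum is at most twice the larger summand. This halves the admissible exponential rate
  and costs 2^3 in the cube; adding the two cases gives 16.\<close>

lemma third_exp_moment_add:
  assumes f: "third_exp_moment (2 * b) L f" and g: "third_exp_moment (2 * b) L g" and b: "0 \<le> b"
  shows "third_exp_moment b (16 * L) (\<lambda>\<omega>. f \<omega> + g \<omega>)"
proof -
  have [measurable]: "f \<in> borel_measurable M" "g \<in> borel_measurable M"
    and int: "integrable M (\<lambda>\<omega>. \<bar>f \<omega>\<bar> ^ 3 * exp (2 * b * \<bar>f \<omega>\<bar>))" "integrable M (\<lambda>\<omega>. \<bar>g \<omega>\<bar> ^ 3 * exp (2 * b * \<bar>g \<omega>\<bar>))"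
    and L: "expectation (\<lambda>\<omega>. \<bar>f \<omega>\<bar> ^ 3 * exp (2 * b * \<bar>f \<omega>\<bar>)) \<le> L" "expectation (\<lambda>\<omega>. \<bar>g \<omega>\<bar> ^ 3 * exp (2 * b * \<bar>g \<omega>\<bar>)) \<le> L"
    using f g by (auto simp: third_exp_moment_def)
  let ?h = "\<lambda>\<omega>. 8 * (\<bar>f \<omega>\<bar> ^ 3 * exp (2 * b * \<bar>f \<omega>\<bar>) + \<bar>g \<omega>\<bar> ^ 3 * exp (2 * b * \<bar>g \<omega>\<bar>))"
  have le1: "\<bar>u + w\<bar> ^ 3 * exp (b * \<bar>u + w\<bar>) \<le> 8 * (\<bar>u\<bar> ^ 3 * exp (2 * b * \<bar>u\<bar>))" if "\<bar>w\<bar> \<le> \<bar>u\<bar>" for u w :: real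
  proof -
    have le: "\<bar>u + w\<bar> \<le> 2 * \<bar>u\<bar>" using that by linarith
    have "\<bar>u + w\<bar> ^ 3 * exp (b * \<bar>u + w\<bar>) \<le> (2 * \<bar>u\<bar>) ^ 3 * exp (b * (2 * \<bar>u\<bar>))"
      using le b by (intro mult_mono power_mono) (auto intro: mult_left_mono)
    then show ?thesis by (simp add: power_mult_distrib mult_ac)
  qed
  have le: "\<bar>f \<omega> + g \<omega>\<bar> ^ 3 * exp (b * \<bar>f \<omega> + g \<omega>\<bar>) \<le> ?h \<omega>" for \<omega>
  proof (cases "\<bar>g \<omega>\<bar> \<le> \<bar>f \<omega>\<bar>")
    case True
    show ?thesis using le1[OF True] by (rule order_trans) simp
  next
    case False
    have "0 \<le> \<bar>f \<omega>\<bar> ^ 3 * exp (2 * b * \<bar>f \<omega>\<bar>)" by simp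
    moreover have "\<bar>f \<omega> + g \<omega>\<bar> ^ 3 * exp (b * \<bar>f \<omega> + g \<omega>\<bar>) \<le> 8 * (\<bar>g \<omega>\<bar> ^ 3 * exp (2 * b * \<bar>g \<omega>\<bar>))"
      using le1[of "f \<omega>" "g \<omega>"] False by (simp add: add.commute)
    ultimately show ?thesis unfolding distrib_left by (intro add_increasing) simp_all
  qed
  have int': "integrable M (\<lambda>\<omega>. \<bar>f \<omega> + g \<omega>\<bar> ^ 3 * exp (b * \<bar>f \<omega> + g \<omega>\<bar>))"
    by (rule Bochner_Integration.integrable_bound[of _ ?h]) (use int le in \<open>auto simp: abs_mult power_abs\<close>)
  have "expectation (\<lambda>\<omega>. \<bar>f \<omega> + g \<omega>\<bar> ^ 3 * exp (b * \<bar>f \<omega> + g \<omega>\<bar>)) \<le> expectation ?h"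
    using int le int' by (intro integral_mono) auto
  also have "\<dots> \<le> 16 * L" using int L by simp
  finally show ?thesis using int' by (simp add: third_exp_moment_def)
qed

end

text \<open>The exponential tilt by \<open>x\<close> leaves the factor \<open>exp (- x (S - x))\<close> on \<open>S \<ge> x\<close>, which is
  small unless \<open>S - x\<close> is at most \<open>1 / sqrt x\<close>. The tilted mass of that short interval is bounded
  through the Gaussian kernel \<open>exp (- x (S - x)\<^sup>2 / 2)\<close>, which is the mean of
  \<open>exp (\<i> (S - x) sqrt x g)\<close> over a standard normal \<open>g\<close>. The resulting factor \<open>1 / sqrt x\<close> is what a
  union bound at the level \<open>sqrt (2 ln p)\<close> needs on top of Chernoff's \<open>exp (- x\<^sup>2 / 2)\<close>.\<close>

lemma (in prob_space) sharp_Gaussian_tail: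
  fixes S :: "'a \<Rightarrow> real"
  assumes S[measurable]: "S \<in> borel_measurable M" and x: "1 \<le> x"
    and int: "integrable M (\<lambda>\<omega>. exp (x * S \<omega>))"
    and bound: "\<And>t. \<bar>t\<bar> \<le> x \<Longrightarrow>
      norm (\<integral>\<omega>. exp (Complex x t * complex_of_real (S \<omega>)) \<partial>M) \<le> exp ((x\<^sup>2 - t\<^sup>2) / 2 + R)"
  shows "prob {\<omega> \<in> space M. x \<le> S \<omega>} \<le> exp (R - x\<^sup>2 / 2) * (5 / sqrt x)"
proof -
  let ?N = "std_normal_distribution"
  interpret N: real_distribution ?N by (rule real_dist_normal_dist)
  interpret P: pair_prob_space M ?N ..
  define h where "h = (\<lambda>s. exp (- (x * s\<^sup>2) / 2))"
  have x0: "0 < x" using x by simp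
  have sx: "1 \<le> sqrt x" using x by simp
  have hN: "complex_of_real (h s) = (\<integral>g. iexp (s * sqrt x * g) \<partial>?N)" for s
  proof -
    have "(\<integral>g. iexp (s * sqrt x * g) \<partial>?N) = char ?N (s * sqrt x)" by (simp add: char_def)
    also have "\<dots> = complex_of_real (exp (- ((s * sqrt x)\<^sup>2) / 2))"
      by (simp only: char_std_normal_distribution)
    also have "(s * sqrt x)\<^sup>2 = x * s\<^sup>2" using x by (simp add: power_mult_distrib)
    finally show ?thesis by (simp add: h_def)
  qed
  \<comment> \<open>The tilted weight times one frequency of the Gaussian kernel. Averaging over the
    normal \<open>g\<close> recovers the kernel; averaging over \<omega> first gives a complex
    moment generating function at \<open>Complex x (sqrt x * g)\<close>, to which the hypothesis
    applies.\<close>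
  define F where "F = (\<lambda>\<omega> g. complex_of_real (exp (x * S \<omega>)) * iexp ((S \<omega> - x) * sqrt x * g))"
  have F_split: "F \<omega> g = iexp (- x * sqrt x * g) * exp (Complex x (sqrt x * g) * complex_of_real (S \<omega>))" for \<omega> g
  proof -
    have "Complex x (sqrt x * g) = complex_of_real x + \<i> * complex_of_real (sqrt x * g)"
      by (simp add: complex_eq_iff)
    then show ?thesis unfolding F_def exp_of_real[symmetric] exp_add[symmetric] by (simp add: algebra_simps)
  qed
  have nF: "norm (F \<omega> g) = exp (x * S \<omega>)" for \<omega> g
    unfolding F_def norm_mult by (simp add: norm_exp_eq_Re)
  have F_meas: "case_prod F \<in> borel_measurable (M \<Otimes>\<^sub>M ?N)"
    unfolding F_def by measurable
  have F_int: "integrable (M \<Otimes>\<^sub>M ?N) (case_prod F)"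
  proof (rule P.Fubini_integrable[OF F_meas])
    show "integrable M (\<lambda>\<omega>. \<integral>g. norm (case_prod F (\<omega>, g)) \<partial>?N)"
      using int by (simp add: nF N.prob_space[unfolded])
    show "AE \<omega> in M. integrable ?N (\<lambda>g. case_prod F (\<omega>, g))"
    proof (rule AE_I2)
      fix \<omega> assume "\<omega> \<in> space M"
      have "integrable ?N (\<lambda>g. complex_of_real (exp (x * S \<omega>)) * iexp ((S \<omega> - x) * sqrt x * g))"
        by (intro integrable_mult_right N.integrable_iexp) auto
      then show "integrable ?N (\<lambda>g. case_prod F (\<omega>, g))" by (simp add: F_def)
    qed
  qed
  have hb: "0 \<le> h s" "h s \<le> 1" for s using x by (auto simp: h_def)
  have int_h: "integrable M (\<lambda>\<omega>. exp (x * S \<omega>) * h (S \<omega> - x))"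
  proof (rule Bochner_Integration.integrable_bound[OF int])
    show "AE \<omega> in M. norm (exp (x * S \<omega>) * h (S \<omega> - x)) \<le> norm (exp (x * S \<omega>))"
      using hb by (auto simp: abs_mult intro!: mult_left_le)
  qed (simp add: h_def)
  have "complex_of_real (expectation (\<lambda>\<omega>. exp (x * S \<omega>) * h (S \<omega> - x)))
      = (\<integral>\<omega>. complex_of_real (exp (x * S \<omega>) * h (S \<omega> - x)) \<partial>M)"
    by (simp only: integral_complex_of_real)
  also have "\<dots> = (\<integral>\<omega>. (\<integral>g. F \<omega> g \<partial>?N) \<partial>M)"
    unfolding F_def using hN by simp
  also have "\<dots> = (\<integral>g. (\<integral>\<omega>. F \<omega> g \<partial>M) \<partial>?N)"
    by (rule P.Fubini_integral[OF F_int, symmetric])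
  finally have E_eq: "complex_of_real (expectation (\<lambda>\<omega>. exp (x * S \<omega>) * h (S \<omega> - x)))
      = (\<integral>g. (\<integral>\<omega>. F \<omega> g \<partial>M) \<partial>?N)" .
  \<comment> \<open>The hypothesis covers only frequencies up to \<open>x\<close>. Beyond them the
    trivial bound by the tilted mass is used together with g^2 / x \<ge> 1, whose normal mean 1 / x
    is harmless.\<close>
  define B where "B = (\<lambda>g. exp (x\<^sup>2 / 2 + R) * (exp (- (x * g\<^sup>2) / 2) + g\<^sup>2 / x))"
  have inner: "norm (\<integral>\<omega>. F \<omega> g \<partial>M) \<le> B g" for g
  proof (cases "\<bar>sqrt x * g\<bar> \<le> x")
    case True
    have "norm (\<integral>\<omega>. F \<omega> g \<partial>M) = norm (\<integral>\<omega>. exp (Complex x (sqrt x * g) * complex_of_real (S \<omega>)) \<partial>M)"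
      unfolding F_split by (simp add: norm_mult)
    also have "\<dots> \<le> exp ((x\<^sup>2 - (sqrt x * g)\<^sup>2) / 2 + R)" by (rule bound[OF True])
    also have "\<dots> = exp (x\<^sup>2 / 2 + R) * exp (- (x * g\<^sup>2) / 2)"
      using x by (simp add: exp_add[symmetric] power_mult_distrib diff_divide_distrib)
    also have "\<dots> \<le> B g" unfolding B_def using x by (intro mult_left_mono) auto
    finally show ?thesis .
  next
    case False
    have "x < sqrt x * \<bar>g\<bar>" using False x by (simp add: abs_mult)
    then have "x\<^sup>2 \<le> (sqrt x * \<bar>g\<bar>)\<^sup>2" using x by (intro power_mono) auto
    also have "(sqrt x * \<bar>g\<bar>)\<^sup>2 = x * g\<^sup>2" using x by (simp add: power_mult_distrib)
    finally have "x * x \<le> x * g\<^sup>2" unfolding power2_eq_square[of x] .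
    then have g: "1 \<le> g\<^sup>2 / x" using x0 by simp
    have "norm (\<integral>\<omega>. F \<omega> g \<partial>M) \<le> (\<integral>\<omega>. norm (F \<omega> g) \<partial>M)" by (rule integral_norm_bound)
    also have "\<dots> = expectation (\<lambda>\<omega>. exp (x * S \<omega>))" by (simp add: nF)
    also have "\<dots> \<le> exp (x\<^sup>2 / 2 + R)"
    proof -
      have c: "Complex x 0 * complex_of_real (S \<omega>) = complex_of_real (x * S \<omega>)" for \<omega>
        by (simp add: complex_eq_iff)
      have "(\<integral>\<omega>. exp (Complex x 0 * complex_of_real (S \<omega>)) \<partial>M) = complex_of_real (expectation (\<lambda>\<omega>. exp (x * S \<omega>)))"
        unfolding c exp_of_real by simp
      then show ?thesis using bound[of 0] x by simp
    qed
    also have "\<dots> \<le> B g"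
      unfolding B_def using g by (intro mult_le_cancel_left1[THEN iffD2]) (auto intro: add_increasing)
    finally show ?thesis .
  qed
  have g2: "integrable ?N (\<lambda>g. g\<^sup>2)" "(\<integral>g. g\<^sup>2 \<partial>?N) = 1"
    using integrable_std_normal_distribution_moment[of 2] std_normal_distribution_even_moments[of 1]
    by (auto simp: numeral_2_eq_2)
  have intK: "integrable ?N (\<lambda>g. exp (- (x * g\<^sup>2) / 2))"
    by (rule N.integrable_const_bound[of _ 1]) (use x in auto)
  \<comment> \<open>Dropping the Gaussian factor of the standard density leaves 1 / sqrt x times a
    normal density of standard deviation 1 / sqrt x.\<close>
  have kern: "(\<integral>g. exp (- (x * g\<^sup>2) / 2) \<partial>?N) \<le> 1 / sqrt x"
  proof -
    have "(\<integral>g. exp (- (x * g\<^sup>2) / 2) \<partial>?N) = (\<integral>g. std_normal_density g * exp (- (x * g\<^sup>2) / 2) \<partial>lborel)"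
      by (subst integral_density) (auto simp: normal_density_nonneg)
    also have "\<dots> \<le> (\<integral>g. (1 / sqrt x) * normal_density 0 (1 / sqrt x) g \<partial>lborel)"
    proof (rule integral_mono)
      show "integrable lborel (\<lambda>g. std_normal_density g * exp (- (x * g\<^sup>2) / 2))"
        using intK by (subst (asm) integrable_density) (auto simp: normal_density_nonneg)
      show "integrable lborel (\<lambda>g. (1 / sqrt x) * normal_density 0 (1 / sqrt x) g)"
        using x by (intro integrable_mult_right integrable_normal_density) auto
      fix g :: real
      have "(1 / sqrt x) * normal_density 0 (1 / sqrt x) g = 1 / sqrt (2 * pi) * exp (- (x * g\<^sup>2) / 2)"
        using x by (simp add: normal_density_def power_divide real_sqrt_divide real_sqrt_mult field_simps)
      also have "\<dots> \<ge> std_normal_density g * exp (- (x * g\<^sup>2) / 2)"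
        unfolding std_normal_density_def by (intro mult_right_mono mult_left_le) auto
      finally show "std_normal_density g * exp (- (x * g\<^sup>2) / 2) \<le> (1 / sqrt x) * normal_density 0 (1 / sqrt x) g" .
    qed
    also have "\<dots> = 1 / sqrt x" using x by simp
    finally show ?thesis .
  qed
  have intB: "integrable ?N B" unfolding B_def using g2 intK by simp
  have E_le: "expectation (\<lambda>\<omega>. exp (x * S \<omega>) * h (S \<omega> - x)) \<le> exp (x\<^sup>2 / 2 + R) * (2 / sqrt x)"
  proof -
    have "expectation (\<lambda>\<omega>. exp (x * S \<omega>) * h (S \<omega> - x))
        \<le> norm (complex_of_real (expectation (\<lambda>\<omega>. exp (x * S \<omega>) * h (S \<omega> - x))))" by simp
    also have "\<dots> \<le> (\<integral>g. norm (\<integral>\<omega>. F \<omega> g \<partial>M) \<partial>?N)" unfolding E_eq by (rule integral_norm_bound)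
    also have "\<dots> \<le> (\<integral>g. B g \<partial>?N)"
    proof (rule integral_mono[OF _ intB inner])
      show "integrable ?N (\<lambda>g. norm (\<integral>\<omega>. F \<omega> g \<partial>M))"
        using P.integrable_snd[OF F_int] by (rule integrable_norm)
    qed
    also have "\<dots> = exp (x\<^sup>2 / 2 + R) * ((\<integral>g. exp (- (x * g\<^sup>2) / 2) \<partial>?N) + 1 / x)"
      unfolding B_def using g2 intK by simp
    also have "\<dots> \<le> exp (x\<^sup>2 / 2 + R) * (1 / sqrt x + 1 / sqrt x)"
    proof (intro mult_left_mono add_mono kern)
      have "sqrt x * 1 \<le> sqrt x * sqrt x" using sx by (intro mult_left_mono) auto
      then have "sqrt x \<le> x" using x by simp
      then show "1 / x \<le> 1 / sqrt x" using x by (simp add: frac_le)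
    qed simp
    finally show ?thesis by simp
  qed
  have Ex: "expectation (\<lambda>\<omega>. exp (x * S \<omega>)) \<le> exp (x\<^sup>2 / 2 + R)"
  proof -
    have c: "Complex x 0 * complex_of_real (S \<omega>) = complex_of_real (x * S \<omega>)" for \<omega>
      by (simp add: complex_eq_iff)
    have "(\<integral>\<omega>. exp (Complex x 0 * complex_of_real (S \<omega>)) \<partial>M) = complex_of_real (expectation (\<lambda>\<omega>. exp (x * S \<omega>)))"
      unfolding c exp_of_real by simp
    then show ?thesis using bound[of 0] x by simp
  qed
  have e2: "exp (1 / 2 :: real) \<le> 2"
  proof -
    have "exp (1 / 2 :: real) ^ 2 = exp 1" by (simp add: power2_eq_square exp_add[symmetric])
    also have "\<dots> \<le> 2\<^sup>2" using exp_le by simp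
    finally show ?thesis by (rule power2_le_imp_le) simp
  qed
  \<comment> \<open>A majorant of the event in two pieces. If \<open>S \<omega> - x\<close> is at
    most 1 / sqrt x, the kernel is at least exp (-1/2) and so at least 1/2; beyond that, the factor
    \<open>exp (x * (S \<omega> - x))\<close> exceeds exp (sqrt x) and compensates the second
    weight.\<close>
  let ?g = "\<lambda>\<omega>. exp (- x\<^sup>2) * (2 * (exp (x * S \<omega>) * h (S \<omega> - x)) + exp (- sqrt x) * exp (x * S \<omega>))"
  have "prob {\<omega> \<in> space M. x \<le> S \<omega>} \<le> expectation ?g"
  proof (rule prob_le_expectation)
    show "integrable M ?g" using int_h int by simp
    show "0 \<le> ?g \<omega>" for \<omega> using hb by (intro mult_nonneg_nonneg add_nonneg_nonneg) auto
    fix \<omega> assume "\<omega> \<in> {\<omega> \<in> space M. x \<le> S \<omega>}"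
    then have s: "0 \<le> S \<omega> - x" by simp
    have g_eq: "?g \<omega> = exp (x * (S \<omega> - x)) * (2 * h (S \<omega> - x) + exp (- sqrt x))"
    proof -
      have "exp (x * (S \<omega> - x)) = exp (- x\<^sup>2) * exp (x * S \<omega>)"
        by (simp add: exp_add[symmetric] power2_eq_square algebra_simps)
      then show ?thesis by (simp only:) (simp add: algebra_simps)
    qed
    have e1: "1 \<le> exp (x * (S \<omega> - x))" using s x by simp
    show "1 \<le> ?g \<omega>"
    proof (cases "S \<omega> - x \<le> 1 / sqrt x")
      case True
      have "(S \<omega> - x)\<^sup>2 \<le> (1 / sqrt x)\<^sup>2" using True s by (intro power_mono) auto
      then have "x * (S \<omega> - x)\<^sup>2 \<le> 1" using x0 by (simp add: power_divide field_simps)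
      then have "exp (- (1 / 2)) \<le> h (S \<omega> - x)" by (simp add: h_def)
      then have "exp (1 / 2) * exp (- (1 / 2)) \<le> 2 * h (S \<omega> - x)" using e2 by (intro mult_mono) auto
      then have "1 \<le> 2 * h (S \<omega> - x)" by (simp add: exp_add[symmetric])
      then have "1 \<le> 2 * h (S \<omega> - x) + exp (- sqrt x)" by (simp add: add_increasing2)
      then have "1 * 1 \<le> exp (x * (S \<omega> - x)) * (2 * h (S \<omega> - x) + exp (- sqrt x))"
        using e1 by (intro mult_mono) auto
      then show ?thesis unfolding g_eq by simp
    next
      case False
      have "x * (1 / sqrt x) \<le> x * (S \<omega> - x)" using False x by (intro mult_left_mono) auto
      then have "sqrt x \<le> x * (S \<omega> - x)" using x by (simp add: real_div_sqrt)
      then have "exp (sqrt x) * exp (- sqrt x) \<le> exp (x * (S \<omega> - x)) * (2 * h (S \<omega> - x) + exp (- sqrt x))"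
        using hb[of "S \<omega> - x"] by (intro mult_mono) auto
      then show ?thesis unfolding g_eq by (simp add: exp_add[symmetric])
    qed
  qed auto
  also have "\<dots> = exp (- x\<^sup>2) * (2 * expectation (\<lambda>\<omega>. exp (x * S \<omega>) * h (S \<omega> - x))
      + exp (- sqrt x) * expectation (\<lambda>\<omega>. exp (x * S \<omega>)))"
    using int_h int by simp
  \<comment> \<open>The kernel contributes 2 times 2 / sqrt x. The second weight is turned into 1 /
    sqrt x by exp (sqrt x) \<ge> sqrt x, and together they give the 5.\<close>
  also have "\<dots> \<le> exp (- x\<^sup>2) * (2 * (exp (x\<^sup>2 / 2 + R) * (2 / sqrt x)) + (1 / sqrt x) * exp (x\<^sup>2 / 2 + R))"
  proof (intro mult_left_mono add_mono mult_mono)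
    have "sqrt x \<le> exp (sqrt x)" using exp_ge_add_one_self[of "sqrt x"] by linarith
    then show "exp (- sqrt x) \<le> 1 / sqrt x" using sx by (simp add: exp_minus inverse_eq_divide frac_le)
  qed (use E_le Ex x in auto)
  also have "\<dots> = (exp (- x\<^sup>2) * exp (x\<^sup>2 / 2 + R)) * (5 / sqrt x)" using x by (simp add: field_simps)
  also have "exp (- x\<^sup>2) * exp (x\<^sup>2 / 2 + R) = exp (R - x\<^sup>2 / 2)"
    by (simp add: exp_add[symmetric] algebra_simps)
  finally show ?thesis .
qed

text \<open>Second moment method with the tilted counts \<open>exp (l W - l\<^sup>2 / 2)\<close>, truncated to
  \<open>x < W \<le> y\<close>: under the tilt \<open>W\<close> is near \<open>l\<close>, so that the truncation costs nothing in the mean,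
  whereas it keeps the diagonal of the second moment below \<open>m\<close>.\<close>

lemma (in prob_space) max_lower_bound:
  fixes W :: "nat \<Rightarrow> 'a \<Rightarrow> real"
  assumes J: "finite J" "J \<noteq> {}"
    and W[measurable]: "\<And>j. j \<in> J \<Longrightarrow> W j \<in> borel_measurable M"
    and xly: "x < l" "l < y" "0 \<le> x"
    and int: "\<And>j s. j \<in> J \<Longrightarrow> s \<in> {x, l, y} \<Longrightarrow> integrable M (\<lambda>\<omega>. exp (s * W j \<omega>))"
    and upper: "\<And>j s. j \<in> J \<Longrightarrow> s \<in> {x, l, y} \<Longrightarrow> expectation (\<lambda>\<omega>. exp (s * W j \<omega>)) \<le> exp (s\<^sup>2 / 2 + R)"
    and lower: "\<And>j. j \<in> J \<Longrightarrow> exp (l\<^sup>2 / 2 - R) \<le> expectation (\<lambda>\<omega>. exp (l * W j \<omega>))"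
    and int2: "\<And>j k. j \<in> J \<Longrightarrow> k \<in> J \<Longrightarrow> j \<noteq> k \<Longrightarrow> integrable M (\<lambda>\<omega>. exp (l * (W j \<omega> + W k \<omega>)))"
    and cross: "\<And>j k. j \<in> J \<Longrightarrow> k \<in> J \<Longrightarrow> j \<noteq> k \<Longrightarrow>
      expectation (\<lambda>\<omega>. exp (l * (W j \<omega> + W k \<omega>))) \<le> exp (l\<^sup>2 * (1 + e) + R)"
  shows "prob {\<omega> \<in> space M. \<forall>j\<in>J. W j \<omega> \<le> x}
    \<le> exp (l\<^sup>2 * e + R) + exp (l * y - l\<^sup>2 / 2 + R) / card J
      - 2 * (exp (- R) - exp (R - (l - x)\<^sup>2 / 2) - exp (R - (y - l)\<^sup>2 / 2)) + 1"
proof -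
  let ?m = "real (card J)"
  have m: "0 < ?m" using J by (simp add: card_gt_0_iff)
  define Z where "Z = (\<lambda>j \<omega>. exp (l * W j \<omega> - l\<^sup>2 / 2) * indicator {\<omega>. x < W j \<omega> \<and> W j \<omega> \<le> y} \<omega>)"
  have Zm[measurable]: "Z j \<in> borel_measurable M" if "j \<in> J" for j
  proof -
    have [measurable]: "W j \<in> borel_measurable M" using W[OF that] .
    have "Z j = (\<lambda>\<omega>. if x < W j \<omega> \<and> W j \<omega> \<le> y then exp (l * W j \<omega> - l\<^sup>2 / 2) else 0)"
      by (auto simp: Z_def fun_eq_iff)
    then show ?thesis by simp
  qed
  have Z0: "0 \<le> Z j \<omega>" "Z j \<omega> \<le> exp (l * y - l\<^sup>2 / 2)" "Z j \<omega> \<le> exp (l * W j \<omega> - l\<^sup>2 / 2)" for j \<omega>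
    using xly by (auto simp: Z_def indicator_def intro: mult_left_mono)
  have intZ: "integrable M (Z j)" if "j \<in> J" for j
    by (rule integrable_const_bound[of _ "exp (l * y - l\<^sup>2 / 2)"]) (use that Z0 in auto)
  have intZZ: "integrable M (\<lambda>\<omega>. Z j \<omega> * Z k \<omega>)" if "j \<in> J" "k \<in> J" for j k
    by (rule integrable_const_bound[of _ "exp (l * y - l\<^sup>2 / 2) * exp (l * y - l\<^sup>2 / 2)"])
      (use that Z0 in \<open>auto simp: abs_mult intro!: mult_mono\<close>)
  have EZ_lower: "exp (- R) - exp (R - (l - x)\<^sup>2 / 2) - exp (R - (y - l)\<^sup>2 / 2) \<le> expectation (Z j)" if j: "j \<in> J" for j
  proof -
    have i: "integrable M (\<lambda>\<omega>. exp (x * W j \<omega>))" "integrable M (\<lambda>\<omega>. exp (l * W j \<omega>))" "integrable M (\<lambda>\<omega>. exp (y * W j \<omega>))"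
      using int[OF j] by auto
    have u: "expectation (\<lambda>\<omega>. exp (x * W j \<omega>)) \<le> exp (x\<^sup>2 / 2 + R)" "expectation (\<lambda>\<omega>. exp (y * W j \<omega>)) \<le> exp (y\<^sup>2 / 2 + R)"
      using upper[OF j] by auto
    let ?a = "exp ((l - x) * x - l\<^sup>2 / 2)" and ?b = "exp (- (y - l) * y - l\<^sup>2 / 2)" and ?c = "exp (- (l\<^sup>2) / 2)"
    \<comment> \<open>Chernoff bounds for both truncations, applied inside the tilted weight: each
      correction is again a pure exponential, with rate \<open>x\<close> or \<open>y\<close> in
      place of \<open>l\<close>. This is why exactly the three rates \<open>x\<close>,
      \<open>l\<close>, \<open>y\<close> occur in the hypotheses.\<close>
    have pw: "?c * exp (l * w) - ?a * exp (x * w) - ?b * exp (y * w)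
        \<le> exp (l * w - l\<^sup>2 / 2) * (if x < w \<and> w \<le> y then 1 else 0)" for w
    proof -
      have ea: "?a * exp (x * w) = ?c * exp (l * w) * exp ((l - x) * (x - w))"
        by (simp add: exp_add[symmetric] algebra_simps)
      have eb: "?b * exp (y * w) = ?c * exp (l * w) * exp ((y - l) * (w - y))"
        by (simp add: exp_add[symmetric] algebra_simps)
      have ec: "exp (l * w - l\<^sup>2 / 2) = ?c * exp (l * w)"
        by (simp add: exp_add[symmetric])
      have "1 - exp ((l - x) * (x - w)) - exp ((y - l) * (w - y)) \<le> (if x < w \<and> w \<le> y then 1 else 0)"
      proof -
        have p: "0 < exp ((l - x) * (x - w))" "0 < exp ((y - l) * (w - y))" by simp_all
        have 1: "1 \<le> exp ((l - x) * (x - w))" if "\<not> x < w" using that xly by simp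
        have 2: "1 \<le> exp ((y - l) * (w - y))" if "\<not> w \<le> y" using that xly by simp
        show ?thesis using p 1 2 by (smt (verit))
      qed
      then have "?c * exp (l * w) * (1 - exp ((l - x) * (x - w)) - exp ((y - l) * (w - y)))
          \<le> ?c * exp (l * w) * (if x < w \<and> w \<le> y then 1 else 0)"
        by (intro mult_left_mono) auto
      then show ?thesis unfolding ea eb ec by (simp only: right_diff_distrib mult_1_right)
    qed
    have "exp (- R) - exp (R - (l - x)\<^sup>2 / 2) - exp (R - (y - l)\<^sup>2 / 2)
        = ?c * exp (l\<^sup>2 / 2 - R) - ?a * exp (x\<^sup>2 / 2 + R) - ?b * exp (y\<^sup>2 / 2 + R)"
    proof -
      have "- l\<^sup>2 / 2 + (l\<^sup>2 / 2 - R) = - R"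
        "(l - x) * x - l\<^sup>2 / 2 + (x\<^sup>2 / 2 + R) = R - (l - x)\<^sup>2 / 2"
        "- (y - l) * y - l\<^sup>2 / 2 + (y\<^sup>2 / 2 + R) = R - (y - l)\<^sup>2 / 2"
        by (simp_all add: power2_eq_square field_simps)
      then show ?thesis by (simp only: exp_add[symmetric])
    qed
    also have "\<dots> \<le> ?c * expectation (\<lambda>\<omega>. exp (l * W j \<omega>)) - ?a * expectation (\<lambda>\<omega>. exp (x * W j \<omega>))
        - ?b * expectation (\<lambda>\<omega>. exp (y * W j \<omega>))"
      using lower[OF j] u by (intro diff_mono mult_left_mono) auto
    also have "\<dots> = expectation (\<lambda>\<omega>. ?c * exp (l * W j \<omega>) - ?a * exp (x * W j \<omega>) - ?b * exp (y * W j \<omega>))"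
      using i by simp
    also have "\<dots> \<le> expectation (Z j)"
    proof (rule integral_mono)
      show "?c * exp (l * W j \<omega>) - ?a * exp (x * W j \<omega>) - ?b * exp (y * W j \<omega>) \<le> Z j \<omega>" for \<omega>
      proof -
        have "Z j \<omega> = exp (l * W j \<omega> - l\<^sup>2 / 2) * (if x < W j \<omega> \<and> W j \<omega> \<le> y then 1 else 0)"
          by (simp add: Z_def indicator_def)
        then show ?thesis using pw[of "W j \<omega>"] by (simp only:)
      qed
    qed (use i intZ j in auto)
    finally show ?thesis .
  qed
  have EZZ: "expectation (\<lambda>\<omega>. Z j \<omega> * Z k \<omega>)
      \<le> exp (l\<^sup>2 * e + R) + (if j = k then exp (l * y - l\<^sup>2 / 2 + R) else 0)" if j: "j \<in> J" and k: "k \<in> J" for j k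
  proof (cases "j = k")
    case True
    have i: "integrable M (\<lambda>\<omega>. exp (l * W j \<omega>))" using int[OF j] by auto
    \<comment> \<open>On the diagonal one factor is replaced by its supremum, which is finite only
      because of the truncation at \<open>y\<close>; the other keeps mean close to 1.\<close>
    have "expectation (\<lambda>\<omega>. Z j \<omega> * Z k \<omega>) \<le> expectation (\<lambda>\<omega>. exp (l * y - l\<^sup>2 / 2) * (exp (- (l\<^sup>2) / 2) * exp (l * W j \<omega>)))"
    proof (rule integral_mono)
      fix \<omega>
      have "Z j \<omega> * Z k \<omega> \<le> exp (l * y - l\<^sup>2 / 2) * exp (l * W j \<omega> - l\<^sup>2 / 2)"
        unfolding True[symmetric] using Z0 by (intro mult_mono) auto
      then show "Z j \<omega> * Z k \<omega> \<le> exp (l * y - l\<^sup>2 / 2) * (exp (- (l\<^sup>2) / 2) * exp (l * W j \<omega>))"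
        by (simp add: exp_add[symmetric])
    qed (use i intZZ j k in auto)
    also have "\<dots> \<le> exp (l * y - l\<^sup>2 / 2) * (exp (- (l\<^sup>2) / 2) * exp (l\<^sup>2 / 2 + R))"
      using upper[OF j, of l] i by (simp add: mult_left_mono)
    also have "\<dots> = exp (l * y - l\<^sup>2 / 2 + R)" by (simp add: exp_add[symmetric])
    finally show ?thesis using True by (simp add: add_increasing)
  next
    case False
    have i: "integrable M (\<lambda>\<omega>. exp (l * (W j \<omega> + W k \<omega>)))" using int2[OF j k False] .
    have "expectation (\<lambda>\<omega>. Z j \<omega> * Z k \<omega>) \<le> expectation (\<lambda>\<omega>. exp (- (l\<^sup>2)) * exp (l * (W j \<omega> + W k \<omega>)))"
    proof (rule integral_mono)
      fix \<omega>
      have "Z j \<omega> * Z k \<omega> \<le> exp (l * W j \<omega> - l\<^sup>2 / 2) * exp (l * W k \<omega> - l\<^sup>2 / 2)"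
        using Z0 by (intro mult_mono) auto
      then show "Z j \<omega> * Z k \<omega> \<le> exp (- (l\<^sup>2)) * exp (l * (W j \<omega> + W k \<omega>))"
        by (simp add: exp_add[symmetric] algebra_simps)
    qed (use i intZZ j k in auto)
    also have "\<dots> \<le> exp (- (l\<^sup>2)) * exp (l\<^sup>2 * (1 + e) + R)"
      using cross[OF j k False] i by (simp add: mult_left_mono)
    also have "\<dots> = exp (l\<^sup>2 * e + R)" by (simp add: exp_add[symmetric] algebra_simps)
    finally show ?thesis using False by simp
  qed
  \<comment> \<open>The average is compared with 1 instead of its exact mean, which is only
    approximately 1. If no score exceeds \<open>x\<close>, all counts vanish and the squared
    distance is 1.\<close>
  define A where "A = (\<lambda>\<omega>. (\<Sum>j\<in>J. Z j \<omega>) / ?m)"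
  have A2: "(A \<omega> - 1)\<^sup>2 = (\<Sum>j\<in>J. \<Sum>k\<in>J. Z j \<omega> * Z k \<omega>) / ?m\<^sup>2 - 2 * ((\<Sum>j\<in>J. Z j \<omega>) / ?m) + 1" for \<omega>
  proof -
    have "(a / ?m - 1)\<^sup>2 = a * a / ?m\<^sup>2 - 2 * (a / ?m) + 1" for a
      using m by (simp add: power2_eq_square field_simps)
    then show ?thesis unfolding A_def sum_product[symmetric] .
  qed
  have intA: "integrable M (\<lambda>\<omega>. (A \<omega> - 1)\<^sup>2)"
    unfolding A2 using intZ intZZ by (intro Bochner_Integration.integrable_add Bochner_Integration.integrable_diff) auto
  have "prob {\<omega> \<in> space M. \<forall>j\<in>J. W j \<omega> \<le> x} \<le> expectation (\<lambda>\<omega>. (A \<omega> - 1)\<^sup>2)"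
  proof (rule prob_le_expectation[OF _ intA])
    show "{\<omega> \<in> space M. \<forall>j\<in>J. W j \<omega> \<le> x} \<in> events" using J by measurable
    fix \<omega> assume "\<omega> \<in> {\<omega> \<in> space M. \<forall>j\<in>J. W j \<omega> \<le> x}"
    then have "Z j \<omega> = 0" if "j \<in> J" for j using that by (auto simp: Z_def indicator_def)
    then have "A \<omega> = 0" by (simp add: A_def)
    then show "1 \<le> (A \<omega> - 1)\<^sup>2" by simp
  qed simp
  also have "\<dots> = (\<Sum>j\<in>J. \<Sum>k\<in>J. expectation (\<lambda>\<omega>. Z j \<omega> * Z k \<omega>)) / ?m\<^sup>2 - 2 * ((\<Sum>j\<in>J. expectation (Z j)) / ?m) + 1"
    unfolding A2 using intZ intZZ by (simp add: prob_space)
  also have "\<dots> \<le> (?m\<^sup>2 * exp (l\<^sup>2 * e + R) + ?m * exp (l * y - l\<^sup>2 / 2 + R)) / ?m\<^sup>2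
      - 2 * ((?m * (exp (- R) - exp (R - (l - x)\<^sup>2 / 2) - exp (R - (y - l)\<^sup>2 / 2))) / ?m) + 1"
  proof -
    have "(\<Sum>j\<in>J. \<Sum>k\<in>J. expectation (\<lambda>\<omega>. Z j \<omega> * Z k \<omega>))
        \<le> (\<Sum>j\<in>J. \<Sum>k\<in>J. exp (l\<^sup>2 * e + R) + (if j = k then exp (l * y - l\<^sup>2 / 2 + R) else 0))"
      using EZZ by (intro sum_mono) auto
    also have "\<dots> = ?m\<^sup>2 * exp (l\<^sup>2 * e + R) + ?m * exp (l * y - l\<^sup>2 / 2 + R)"
      using J by (simp add: sum.distrib power2_eq_square sum.delta distrib_left)
    finally have 1: "(\<Sum>j\<in>J. \<Sum>k\<in>J. expectation (\<lambda>\<omega>. Z j \<omega> * Z k \<omega>)) \<le> ?m\<^sup>2 * exp (l\<^sup>2 * e + R) + ?m * exp (l * y - l\<^sup>2 / 2 + R)" .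
    have 2: "?m * (exp (- R) - exp (R - (l - x)\<^sup>2 / 2) - exp (R - (y - l)\<^sup>2 / 2)) \<le> (\<Sum>j\<in>J. expectation (Z j))"
      using sum_mono[of J "\<lambda>_. exp (- R) - exp (R - (l - x)\<^sup>2 / 2) - exp (R - (y - l)\<^sup>2 / 2)" "\<lambda>j. expectation (Z j)"] EZ_lower
      by simp
    show ?thesis using 1 2 m by (intro add_mono diff_mono mult_left_mono divide_right_mono) auto
  qed
  also have "\<dots> = exp (l\<^sup>2 * e + R) + exp (l * y - l\<^sup>2 / 2 + R) / ?m
      - 2 * (exp (- R) - exp (R - (l - x)\<^sup>2 / 2) - exp (R - (y - l)\<^sup>2 / 2)) + 1"
    using m by (simp add: add_divide_distrib power2_eq_square)
  finally show ?thesis .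
qed

text \<open>This makes the pairs of row and error independent across observations, given
  independence among the rows, among the errors, and between design and errors. Intersections of the
  two kinds of events form a generating family closed under intersection, and on it all
  probabilities factor.\<close>

lemma (in prob_space) indep_sets_Int:
  fixes MA MB :: "'a measure"
  assumes A: "indep_sets A I" and B: "indep_sets B I"
    and sA: "\<And>i. i \<in> I \<Longrightarrow> A i \<subseteq> sets MA" and sB: "\<And>i. i \<in> I \<Longrightarrow> B i \<subseteq> sets MB"
    and AB: "indep_set (sets MA) (sets MB)"
    and stA: "\<And>i. i \<in> I \<Longrightarrow> Int_stable (A i)" and stB: "\<And>i. i \<in> I \<Longrightarrow> Int_stable (B i)"
  shows "indep_sets (\<lambda>i. sigma_sets (space M) {a \<inter> b |a b. a \<in> A i \<and> b \<in> B i}) I"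
proof (rule indep_sets_sigma)
  have evA: "A i \<subseteq> events" and evB: "B i \<subseteq> events" if "i \<in> I" for i
    using A B that by (auto simp: indep_sets_def)
  show "indep_sets (\<lambda>i. {a \<inter> b |a b. a \<in> A i \<and> b \<in> B i}) I"
  proof (rule indep_setsI)
    show "{a \<inter> b |a b. a \<in> A i \<and> b \<in> B i} \<subseteq> events" if "i \<in> I" for i
      using evA[OF that] evB[OF that] by auto
    fix F J assume J: "J \<noteq> {}" "J \<subseteq> I" "finite J" and F: "\<forall>j\<in>J. F j \<in> {a \<inter> b |a b. a \<in> A j \<and> b \<in> B j}"
    from F have "\<forall>j\<in>J. \<exists>ab. F j = fst ab \<inter> snd ab \<and> fst ab \<in> A j \<and> snd ab \<in> B j" by fastforce
    then obtain ab where ab: "\<And>j. j \<in> J \<Longrightarrow> F j = fst (ab j) \<inter> snd (ab j) \<and> fst (ab j) \<in> A j \<and> snd (ab j) \<in> B j"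
      by (metis bchoice)
    define a b where "a = (\<lambda>j. fst (ab j))" and "b = (\<lambda>j. snd (ab j))"
    have F': "F j = a j \<inter> b j" "a j \<in> A j" "b j \<in> B j" if "j \<in> J" for j
      using ab[OF that] by (auto simp: a_def b_def)
    have aA: "a j \<in> sets MA" and bB: "b j \<in> sets MB" if "j \<in> J" for j
      using F'(2,3)[OF that] sA[of j] sB[of j] J that by blast+
    have inA: "(\<Inter>j\<in>J. a j) \<in> sets MA" using J aA by (intro sets.finite_INT) auto
    have inB: "(\<Inter>j\<in>J. b j) \<in> sets MB" using J bB by (intro sets.finite_INT) auto
    have "(\<Inter>j\<in>J. F j) = (\<Inter>j\<in>J. a j) \<inter> (\<Inter>j\<in>J. b j)" using F' J by auto
    then have "prob (\<Inter>j\<in>J. F j) = prob (\<Inter>j\<in>J. a j) * prob (\<Inter>j\<in>J. b j)"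
      using indep_setD[OF AB inA inB] by simp
    also have "\<dots> = (\<Prod>j\<in>J. prob (a j)) * (\<Prod>j\<in>J. prob (b j))"
      using indep_setsD[OF A J(2,1,3), of a] indep_setsD[OF B J(2,1,3), of b] F' by simp
    also have "\<dots> = (\<Prod>j\<in>J. prob (a j) * prob (b j))" by (simp add: prod.distrib)
    also have "\<dots> = (\<Prod>j\<in>J. prob (F j))"
    proof (rule prod.cong[OF refl])
      fix j assume j: "j \<in> J"
      show "prob (a j) * prob (b j) = prob (F j)" using indep_setD[OF AB aA bB] F'(1) j by simp
    qed
    finally show "prob (\<Inter>j\<in>J. F j) = (\<Prod>j\<in>J. prob (F j))" .
  qed
  show "Int_stable {a \<inter> b |a b. a \<in> A i \<and> b \<in> B i}" if i: "i \<in> I" for i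
  proof (rule Int_stableI)
    fix x y assume "x \<in> {a \<inter> b |a b. a \<in> A i \<and> b \<in> B i}" "y \<in> {a \<inter> b |a b. a \<in> A i \<and> b \<in> B i}"
    then obtain a b a' b' where "x = a \<inter> b" "y = a' \<inter> b'" "a \<in> A i" "a' \<in> A i" "b \<in> B i" "b' \<in> B i" by auto
    moreover have "a \<inter> a' \<in> A i" "b \<inter> b' \<in> B i"
      using stA[OF i] stB[OF i] calculation by (auto dest: Int_stableD)
    moreover have "(a \<inter> b) \<inter> (a' \<inter> b') = (a \<inter> a') \<inter> (b \<inter> b')" by auto
    ultimately show "x \<inter> y \<in> {a \<inter> b |a b. a \<in> A i \<and> b \<in> B i}" by blast
  qed
qed

lemma Int_stable_vimage: "Int_stable {f -` A \<inter> \<Omega> |A. A \<in> sets N}"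
proof (rule Int_stableI)
  fix x y assume "x \<in> {f -` A \<inter> \<Omega> |A. A \<in> sets N}" "y \<in> {f -` A \<inter> \<Omega> |A. A \<in> sets N}"
  then obtain A B where "x = f -` A \<inter> \<Omega>" "y = f -` B \<inter> \<Omega>" "A \<in> sets N" "B \<in> sets N" by auto
  then have "x \<inter> y = f -` (A \<inter> B) \<inter> \<Omega>" "A \<inter> B \<in> sets N" by auto
  then show "x \<inter> y \<in> {f -` A \<inter> \<Omega> |A. A \<in> sets N}" by blast
qed

section \<open>The random design model\<close>

definition lin :: "nat \<Rightarrow> (nat \<Rightarrow> nat \<Rightarrow> 'a \<Rightarrow> real) \<Rightarrow> (nat \<Rightarrow> real) \<Rightarrow> nat \<Rightarrow> 'a \<Rightarrow> real" where
  "lin p X u i \<omega> = fit p (\<lambda>i k. X i k \<omega>) u i"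

definition unit_coef :: "nat \<Rightarrow> nat \<Rightarrow> real" where
  "unit_coef j k = (if k = j then 1 else 0)"

text \<open>The coefficients of the population nodewise residual, as the projection of column
  \<open>j\<close> on the others has coefficients \<open>- (T j k / T j j)\<close>.
  \<open>node_target\<close> is that projection, padded by 0 at position \<open>j\<close>.\<close>

definition eta_coef :: "(nat \<Rightarrow> nat \<Rightarrow> real) \<Rightarrow> nat \<Rightarrow> nat \<Rightarrow> real" where
  "eta_coef T j k = T j k / T j j"

definition node_target :: "(nat \<Rightarrow> nat \<Rightarrow> real) \<Rightarrow> nat \<Rightarrow> nat \<Rightarrow> real" where
  "node_target T j k = (if k = j then 0 else - (T j k / T j j))"

context precision_matrix begin

lemma bil_eta:
  assumes "j < p"
  shows "bil p S u (eta_coef T j) = u j / T j j" "bil p S (eta_coef T j) u = u j / T j j"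
proof -
  have "bil p S u (\<lambda>k. (1 / T j j) * T j k + 0 * T j k) = u j / T j j"
    unfolding bil_add_right by (simp add: bil_S_T_row[OF assms])
  then show *: "bil p S u (eta_coef T j) = u j / T j j" by (simp add: eta_coef_def[abs_def])
  show "bil p S (eta_coef T j) u = u j / T j j" using bil_sym[of p S, OF S_sym] * by metis
qed

lemma eta_coef_diag: "j < p \<Longrightarrow> eta_coef T j j = 1"
  using T_diag_pos[of j] by (simp add: eta_coef_def)

end

lemma fit_unit: "j < p \<Longrightarrow> fit p x (unit_coef j) i = x i j"
  using sum_delta_mult(4)[of j p "x i"] by (simp add: fit_def unit_coef_def)

lemma lin_unit: "j < p \<Longrightarrow> lin p X (unit_coef j) i \<omega> = X i j \<omega>"
  by (simp add: lin_def fit_unit)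

locale regression_model = prob_space M for M :: "'a measure" +
  fixes n p :: nat and X :: "nat \<Rightarrow> nat \<Rightarrow> 'a \<Rightarrow> real" and eps :: "nat \<Rightarrow> 'a \<Rightarrow> real"
    and \<Sigma> \<Theta> :: "real mat" and sig2 c0 C0 :: real
  assumes n: "0 < n" and model: "linear_model M n p X eps \<Sigma> \<Theta> sig2"
    and c0: "0 < c0" and eig: "c0 < Min {l. eigenvalue \<Sigma> l}"
    and C0: "0 < C0" and diag: "\<And>j. j < p \<Longrightarrow> \<Sigma> $$ (j, j) \<le> C0"
    and sig2: "0 < sig2"
begin

abbreviation S where "S j k \<equiv> \<Sigma> $$ (j, k)"
abbreviation T where "T j k \<equiv> \<Theta> $$ (j, k)"

text \<open>\<open>MA\<close> is generated by the whole design, \<open>MB\<close> by all errors and \<open>G i\<close> by the \<open>i\<close>-th observation.\<close>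

definition MA where "MA = vimage_algebra (space M) (\<lambda>\<omega>. \<lambda>ij\<in>{..<n} \<times> {..<p}. X (fst ij) (snd ij) \<omega>)
         (\<Pi>\<^sub>M ij\<in>{..<n} \<times> {..<p}. borel)"
definition MB where "MB = vimage_algebra (space M) (\<lambda>\<omega>. \<lambda>i\<in>{..<n}. eps i \<omega>) (\<Pi>\<^sub>M i\<in>{..<n}. borel)"
definition A where "A i = {(\<lambda>\<omega>. \<lambda>j\<in>{..<p}. X i j \<omega>) -` B \<inter> space M |B. B \<in> sets (\<Pi>\<^sub>M j\<in>{..<p}. borel)}"
definition E where "E i = {eps i -` B \<inter> space M |B. B \<in> sets borel}"
definition G where "G i = sigma (space M) {a \<inter> b |a b. a \<in> A i \<and> b \<in> E i}"

lemma
  shows p: "0 < p" and Sc: "\<Sigma> \<in> carrier_mat p p" and Tc: "\<Theta> \<in> carrier_mat p p"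
    and X2: "i < n \<Longrightarrow> j < p \<Longrightarrow> integrable M (\<lambda>\<omega>. (X i j \<omega>)\<^sup>2)"
    and X_mean: "i < n \<Longrightarrow> j < p \<Longrightarrow> expectation (X i j) = 0"
    and X_cov: "i < n \<Longrightarrow> j < p \<Longrightarrow> k < p \<Longrightarrow> expectation (\<lambda>\<omega>. X i j \<omega> * X i k \<omega>) = S j k"
    and eps2: "i < n \<Longrightarrow> integrable M (\<lambda>\<omega>. (eps i \<omega>)\<^sup>2)"
    and eps_mean: "i < n \<Longrightarrow> expectation (eps i) = 0"
    and eps_var: "i < n \<Longrightarrow> expectation (\<lambda>\<omega>. (eps i \<omega>)\<^sup>2) = sig2"
    and inv_ST: "inverts_mat \<Sigma> \<Theta>"
    and rows_indep: "indep_vars (\<lambda>_. \<Pi>\<^sub>M j\<in>{..<p}. borel) (\<lambda>i \<omega>. \<lambda>j\<in>{..<p}. X i j \<omega>) {..<n}"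
    and eps_indep: "indep_vars (\<lambda>_. borel) eps {..<n}"
    and AB: "indep_set (sets MA) (sets MB)"
  using model unfolding linear_model_def MA_def MB_def by auto

lemma X_meas[measurable]: assumes "i < n" "j < p" shows "X i j \<in> borel_measurable M"
proof -
  have "(\<lambda>\<omega>. \<lambda>j\<in>{..<p}. X i j \<omega>) \<in> measurable M (\<Pi>\<^sub>M j\<in>{..<p}. borel)"
    using rows_indep assms by (auto simp: indep_vars_def2)
  then have "(\<lambda>\<omega>. (\<lambda>j\<in>{..<p}. X i j \<omega>) j) \<in> borel_measurable M"
    by (rule measurable_compose) (use assms in \<open>auto intro: measurable_component_singleton\<close>)
  then show ?thesis using assms by simp
qed

lemma eps_meas[measurable]: assumes "i < n" shows "eps i \<in> borel_measurable M"
  using eps_indep assms by (auto simp: indep_vars_def2)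

lemma space_MA[simp]: "space MA = space M" and space_MB[simp]: "space MB = space M"
  by (simp_all add: MA_def MB_def)

lemma X_MA: assumes "i < n" "j < p" shows "X i j \<in> borel_measurable MA"
proof -
  have "(\<lambda>\<omega>. \<lambda>ij\<in>{..<n} \<times> {..<p}. X (fst ij) (snd ij) \<omega>) \<in> measurable MA (\<Pi>\<^sub>M ij\<in>{..<n} \<times> {..<p}. borel)"
    unfolding MA_def by (rule measurable_vimage_algebra1) (auto simp: space_PiM)
  then have "(\<lambda>\<omega>. (\<lambda>ij\<in>{..<n} \<times> {..<p}. X (fst ij) (snd ij) \<omega>) (i, j)) \<in> borel_measurable MA"
    by (rule measurable_compose) (use assms in \<open>auto intro: measurable_component_singleton\<close>)
  then show ?thesis using assms by simp
qed

lemma eps_MB: assumes "i < n" shows "eps i \<in> borel_measurable MB"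
proof -
  have "(\<lambda>\<omega>. \<lambda>i\<in>{..<n}. eps i \<omega>) \<in> measurable MB (\<Pi>\<^sub>M i\<in>{..<n}. borel)"
    unfolding MB_def by (rule measurable_vimage_algebra1) (auto simp: space_PiM)
  then have "(\<lambda>\<omega>. (\<lambda>i\<in>{..<n}. eps i \<omega>) i) \<in> borel_measurable MB"
    by (rule measurable_compose) (use assms in \<open>auto intro: measurable_component_singleton\<close>)
  then show ?thesis using assms by simp
qed

lemma A_MA: assumes "i < n" shows "A i \<subseteq> sets MA"
proof -
  have "(\<lambda>\<omega>. \<lambda>j\<in>{..<p}. X i j \<omega>) \<in> measurable MA (\<Pi>\<^sub>M j\<in>{..<p}. borel)"
    by (rule measurable_restrict) (use X_MA assms in auto)
  from measurable_sets[OF this] show ?thesis by (auto simp: A_def)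
qed

lemma E_MB: assumes "i < n" shows "E i \<subseteq> sets MB"
  unfolding E_def using measurable_sets[OF eps_MB[OF assms]] by auto

lemma MA_events: "sets MA \<subseteq> events" and MB_events: "sets MB \<subseteq> events"
  using AB unfolding indep_set_def indep_sets_def by (auto split: bool.splits)

lemma gen_Pow: "{a \<inter> b |a b. a \<in> A i \<and> b \<in> E i} \<subseteq> Pow (space M)"
  by (auto simp: A_def E_def)

lemma sets_G': "sets (G i) = sigma_sets (space M) {a \<inter> b |a b. a \<in> A i \<and> b \<in> E i}"
  unfolding G_def using gen_Pow by (rule sets_measure_of)

lemma space_G': "space (G i) = space M"
  unfolding G_def using gen_Pow by (rule space_measure_of)

sublocale independent_observations M n G
proof unfold_locales
  show "space (G i) = space M" for i by (rule space_G')
  show "sets (G i) \<subseteq> events" if "i < n" for i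
  proof -
    have "{a \<inter> b |a b. a \<in> A i \<and> b \<in> E i} \<subseteq> events"
      using A_MA[OF that] E_MB[OF that] MA_events MB_events by blast
    then show ?thesis unfolding sets_G' by (rule sets.sigma_sets_subset)
  qed
  show "indep_sets (\<lambda>i. sets (G i)) {..<n}"
    unfolding sets_G'
  proof (rule indep_sets_Int[OF _ _ _ _ AB])
    show "indep_sets A {..<n}" using rows_indep unfolding indep_vars_def2 A_def by simp
    show "indep_sets E {..<n}" using eps_indep unfolding indep_vars_def2 E_def by simp
  qed (use A_MA E_MB in \<open>auto simp: A_def E_def intro: Int_stable_vimage\<close>)
qed

lemma X_G: assumes "i < n" "j < p" shows "X i j \<in> borel_measurable (G i)"
proof (rule measurableI)
  fix B :: "real set" assume B: "B \<in> sets borel"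
  have "(\<lambda>f. f j) \<in> measurable (\<Pi>\<^sub>M j\<in>{..<p}. (borel :: real measure)) borel"
    by (rule measurable_component_singleton) (use assms in auto)
  then have C: "(\<lambda>f. f j) -` B \<inter> space (\<Pi>\<^sub>M j\<in>{..<p}. (borel :: real measure)) \<in> sets (\<Pi>\<^sub>M j\<in>{..<p}. borel)"
    using B by (rule measurable_sets)
  have "X i j -` B \<inter> space M = (\<lambda>\<omega>. \<lambda>j\<in>{..<p}. X i j \<omega>) -` ((\<lambda>f. f j) -` B \<inter> space (\<Pi>\<^sub>M j\<in>{..<p}. (borel :: real measure))) \<inter> space M"
    using assms by (auto simp: space_PiM)
  then have "X i j -` B \<inter> space M \<in> A i" unfolding A_def using C by blast
  moreover have "space M \<in> E i" unfolding E_def by (rule CollectI, rule exI[of _ UNIV]) auto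
  moreover have "X i j -` B \<inter> space M = (X i j -` B \<inter> space M) \<inter> space M" by auto
  ultimately have "X i j -` B \<inter> space M \<in> {a \<inter> b |a b. a \<in> A i \<and> b \<in> E i}" by blast
  then show "X i j -` B \<inter> space (G i) \<in> sets (G i)" unfolding space_G' sets_G' by (rule sigma_sets.Basic)
qed simp

lemma eps_G: assumes "i < n" shows "eps i \<in> borel_measurable (G i)"
proof (rule measurableI)
  fix B :: "real set" assume B: "B \<in> sets borel"
  have "eps i -` B \<inter> space M \<in> E i" unfolding E_def using B by blast
  moreover have "space M \<in> A i" unfolding A_def
    by (rule CollectI, rule exI[of _ "space (\<Pi>\<^sub>M j\<in>{..<p}. borel)"]) (auto simp: space_PiM)
  moreover have "eps i -` B \<inter> space M = space M \<inter> (eps i -` B \<inter> space M)" by auto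
  ultimately have "eps i -` B \<inter> space M \<in> {a \<inter> b |a b. a \<in> A i \<and> b \<in> E i}" by blast
  then show "eps i -` B \<inter> space (G i) \<in> sets (G i)" unfolding space_G' sets_G' by (rule sigma_sets.Basic)
qed simp

lemma lin_meas: "i < n \<Longrightarrow> lin p X u i \<in> borel_measurable (G i)"
  and lin_MA: "i < n \<Longrightarrow> lin p X u i \<in> borel_measurable MA"
  and lin_M[measurable]: "i < n \<Longrightarrow> lin p X u i \<in> borel_measurable M"
  using X_G X_MA X_meas unfolding lin_def fit_def
  by (auto intro!: borel_measurable_sum borel_measurable_times)

lemma product_expectation:
  fixes f g :: "'a \<Rightarrow> real"
  assumes f: "f \<in> borel_measurable MA" and g: "g \<in> borel_measurable MB"
    and int: "integrable M f" "integrable M g"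
  shows "expectation (\<lambda>\<omega>. f \<omega> * g \<omega>) = expectation f * expectation g"
    and "integrable M (\<lambda>\<omega>. f \<omega> * g \<omega>)"
proof -
  have "indep_var borel f borel g"
    unfolding indep_var_eq
  proof (intro conjI)
    show "random_variable borel f" "random_variable borel g" using int by simp_all
    have fs: "sigma_sets (space M) {f -` A \<inter> space M |A. A \<in> sets borel} \<subseteq> sets MA"
    proof -
      have "{f -` A \<inter> space M |A. A \<in> sets borel} \<subseteq> sets MA" using measurable_sets[OF f] by auto
      from sets.sigma_sets_subset[OF this] show ?thesis by simp
    qed
    have gs: "sigma_sets (space M) {g -` A \<inter> space M |A. A \<in> sets borel} \<subseteq> sets MB"
    proof -
      have "{g -` A \<inter> space M |A. A \<in> sets borel} \<subseteq> sets MB" using measurable_sets[OF g] by auto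
      from sets.sigma_sets_subset[OF this] show ?thesis by simp
    qed
    show "indep_set (sigma_sets (space M) {f -` A \<inter> space M |A. A \<in> sets borel})
        (sigma_sets (space M) {g -` A \<inter> space M |A. A \<in> sets borel})"
      using fs gs MA_events MB_events indep_setD[OF AB] by (intro indep_setI) blast+
  qed
  then show "expectation (\<lambda>\<omega>. f \<omega> * g \<omega>) = expectation f * expectation g"
    "integrable M (\<lambda>\<omega>. f \<omega> * g \<omega>)"
    using indep_var_lebesgue_integral indep_var_integrable int by blast+
qed

lemma integrable_XX:
  assumes "i < n" "j < p" "k < p"
  shows "integrable M (\<lambda>\<omega>. X i j \<omega> * X i k \<omega>)"
proof (rule Bochner_Integration.integrable_bound[of _ "\<lambda>\<omega>. (X i j \<omega>)\<^sup>2 + (X i k \<omega>)\<^sup>2"])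
  show "AE \<omega> in M. norm (X i j \<omega> * X i k \<omega>) \<le> norm ((X i j \<omega>)\<^sup>2 + (X i k \<omega>)\<^sup>2)"
  proof (rule AE_I2)
    fix \<omega>
    have "2 * (\<bar>X i j \<omega>\<bar> * \<bar>X i k \<omega>\<bar>) \<le> (X i j \<omega>)\<^sup>2 + (X i k \<omega>)\<^sup>2"
      using sum_squares_bound[of "\<bar>X i j \<omega>\<bar>" "\<bar>X i k \<omega>\<bar>"] by simp
    moreover have "0 \<le> \<bar>X i j \<omega>\<bar> * \<bar>X i k \<omega>\<bar>" by simp
    moreover have "norm ((X i j \<omega>)\<^sup>2 + (X i k \<omega>)\<^sup>2) = (X i j \<omega>)\<^sup>2 + (X i k \<omega>)\<^sup>2" by simp
    ultimately show "norm (X i j \<omega> * X i k \<omega>) \<le> norm ((X i j \<omega>)\<^sup>2 + (X i k \<omega>)\<^sup>2)"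
      unfolding real_norm_def abs_mult by linarith
  qed
qed (use X2 assms X_meas in auto)

lemma integrable_X: assumes "i < n" "j < p" shows "integrable M (X i j)"
proof (rule Bochner_Integration.integrable_bound[of _ "\<lambda>\<omega>. 1 + (X i j \<omega>)\<^sup>2"])
  show "AE \<omega> in M. norm (X i j \<omega>) \<le> norm (1 + (X i j \<omega>)\<^sup>2)"
  proof (rule AE_I2)
    fix \<omega>
    show "norm (X i j \<omega>) \<le> norm (1 + (X i j \<omega>)\<^sup>2)"
      using sum_squares_bound[of "\<bar>X i j \<omega>\<bar>" 1] by simp
  qed
qed (use X2 assms X_meas in auto)

lemma integrable_eps: assumes "i < n" shows "integrable M (eps i)"
proof (rule Bochner_Integration.integrable_bound[of _ "\<lambda>\<omega>. 1 + (eps i \<omega>)\<^sup>2"])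
  show "AE \<omega> in M. norm (eps i \<omega>) \<le> norm (1 + (eps i \<omega>)\<^sup>2)"
  proof (rule AE_I2)
    fix \<omega>
    show "norm (eps i \<omega>) \<le> norm (1 + (eps i \<omega>)\<^sup>2)"
      using sum_squares_bound[of "\<bar>eps i \<omega>\<bar>" 1] by simp
  qed
qed (use eps2 assms eps_meas in auto)

lemma lin_lin:
  assumes i: "i < n"
  shows "integrable M (\<lambda>\<omega>. lin p X u i \<omega> * lin p X v i \<omega>)"
    and "expectation (\<lambda>\<omega>. lin p X u i \<omega> * lin p X v i \<omega>) = bil p S u v"
proof -
  have eq: "lin p X u i \<omega> * lin p X v i \<omega> = (\<Sum>j<p. \<Sum>k<p. u j * v k * (X i j \<omega> * X i k \<omega>))" for \<omega>
    by (simp add: lin_def fit_def sum_product mult_ac)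
  have int: "integrable M (\<lambda>\<omega>. u j * v k * (X i j \<omega> * X i k \<omega>))" if "j < p" "k < p" for j k
    using integrable_XX[OF i that] by simp
  show "integrable M (\<lambda>\<omega>. lin p X u i \<omega> * lin p X v i \<omega>)" unfolding eq
    by (intro Bochner_Integration.integrable_sum int) auto
  have "expectation (\<lambda>\<omega>. lin p X u i \<omega> * lin p X v i \<omega>) = (\<Sum>j<p. \<Sum>k<p. u j * v k * S j k)"
  proof -
    have "expectation (\<lambda>\<omega>. \<Sum>j<p. \<Sum>k<p. u j * v k * (X i j \<omega> * X i k \<omega>))
        = (\<Sum>j<p. expectation (\<lambda>\<omega>. \<Sum>k<p. u j * v k * (X i j \<omega> * X i k \<omega>)))"
      by (intro Bochner_Integration.integral_sum Bochner_Integration.integrable_sum int) auto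
    also have "\<dots> = (\<Sum>j<p. \<Sum>k<p. expectation (\<lambda>\<omega>. u j * v k * (X i j \<omega> * X i k \<omega>)))"
      by (intro sum.cong refl Bochner_Integration.integral_sum int) auto
    also have "\<dots> = (\<Sum>j<p. \<Sum>k<p. u j * v k * S j k)"
      by (intro sum.cong refl) (simp add: X_cov[OF i])
    finally show ?thesis unfolding eq .
  qed
  then show "expectation (\<lambda>\<omega>. lin p X u i \<omega> * lin p X v i \<omega>) = bil p S u v"
    by (simp add: bil_def sum_distrib_left mult_ac)
qed

lemma lin_mean: assumes i: "i < n" shows "integrable M (lin p X u i)" "expectation (lin p X u i) = 0"
  unfolding lin_def[abs_def] fit_def using integrable_X[OF i] X_mean[OF i] by auto

sublocale precision_matrix p "\<lambda>j k. \<Sigma> $$ (j, k)" "\<lambda>j k. \<Theta> $$ (j, k)" c0 C0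
proof
  show sym: "S j k = S k j" if "j < p" "k < p" for j k
    using X_cov[OF n that] X_cov[OF n that(2,1)] by (simp add: mult.commute)
  \<comment> \<open>The form is the second moment of a linear form in the first row. Strict
    positivity then comes from the smallest eigenvalue.\<close>
  have psd: "bil p (\<lambda>j k. S j k) v v \<ge> 0" for v
    using lin_lin(2)[OF n, of v v] by (metis integral_nonneg_AE AE_I2 zero_le_square)
  show "c0 * (\<Sum>j<p. (v j)\<^sup>2) \<le> bil p (\<lambda>j k. S j k) v v" for v
    by (rule bil_ge_Min_eigenvalue[OF Sc sym psd p eig])
  show "(\<Sum>l<p. S j l * T l k) = (if j = k then 1 else 0)" if "j < p" "k < p" for j k
  proof -
    have "(\<Sigma> * \<Theta>) $$ (j, k) = (1\<^sub>m p) $$ (j, k)" using inv_ST Sc by (simp add: inverts_mat_def)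
    then show ?thesis using that Sc Tc by (simp add: scalar_prod_def lessThan_atLeast0)
  qed
qed (use c0 C0 diag in auto)

lemma lin_eta: "j < p \<Longrightarrow> lin p X (eta_coef T j) i \<omega> = X i j \<omega> - fit p (\<lambda>i k. X i k \<omega>) (node_target T j) i"
proof -
  assume j: "j < p"
  have "eta_coef T j = (\<lambda>k. unit_coef j k - node_target T j k)"
    using eta_coef_diag[OF j] by (auto simp: eta_coef_def unit_coef_def node_target_def)
  then show ?thesis using j by (simp add: lin_def fit_diff fit_unit)
qed

lemma lin_eps:
  assumes i: "i < n"
  shows "integrable M (\<lambda>\<omega>. lin p X u i \<omega> * eps i \<omega>)" "expectation (\<lambda>\<omega>. lin p X u i \<omega> * eps i \<omega>) = 0"
    and "expectation (\<lambda>\<omega>. (lin p X u i \<omega> * eps i \<omega>) * (lin p X v i \<omega> * eps i \<omega>)) = bil p S u v * sig2"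
    and "integrable M (\<lambda>\<omega>. (lin p X u i \<omega> * eps i \<omega>) * (lin p X v i \<omega> * eps i \<omega>))"
proof -
  show "integrable M (\<lambda>\<omega>. lin p X u i \<omega> * eps i \<omega>)" "expectation (\<lambda>\<omega>. lin p X u i \<omega> * eps i \<omega>) = 0"
    using product_expectation[OF lin_MA[OF i] eps_MB[OF i] lin_mean(1)[OF i] integrable_eps[OF i], of u] eps_mean[OF i]
    by auto
  have eq: "(lin p X u i \<omega> * eps i \<omega>) * (lin p X v i \<omega> * eps i \<omega>) = (lin p X u i \<omega> * lin p X v i \<omega>) * (eps i \<omega>)\<^sup>2" for \<omega>
    by (simp add: power2_eq_square)
  have m: "(\<lambda>\<omega>. lin p X u i \<omega> * lin p X v i \<omega>) \<in> borel_measurable MA" "(\<lambda>\<omega>. (eps i \<omega>)\<^sup>2) \<in> borel_measurable MB"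
    using lin_MA[OF i] eps_MB[OF i] by auto
  show "expectation (\<lambda>\<omega>. (lin p X u i \<omega> * eps i \<omega>) * (lin p X v i \<omega> * eps i \<omega>)) = bil p S u v * sig2"
    "integrable M (\<lambda>\<omega>. (lin p X u i \<omega> * eps i \<omega>) * (lin p X v i \<omega> * eps i \<omega>))"
    unfolding eq using product_expectation[OF m lin_lin(1)[OF i] eps2[OF i]] lin_lin(2)[OF i] eps_var[OF i] by auto
qed

text \<open>\<open>arg_min\<close> is a choice operator, so its value is determined only through
  uniqueness. The residual coefficients are \<open>S\<close>-orthogonal to every vector with zero
  \<open>j\<close>-th entry; by Pythagoras any other candidate loses at least \<open>c0\<close>
  times its squared distance. The identification transfers the boundedness assumption on
  \<open>node_fit\<close> to the explicit residual.\<close>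

lemma node_coef_eq:
  assumes j: "j < p"
  shows "node_coef M n p X j = vec p (node_target T j)"
proof -
  let ?f = "\<lambda>g. \<integral>\<omega>. sq_l2 (col (design n p X \<omega>) j - design n p X \<omega> *\<^sub>v g) \<partial>M"
  let ?w = "\<lambda>g k. unit_coef j k - (g :: real vec) $ k"
  have f: "?f g = n * bil p S (?w g) (?w g)" if g: "g \<in> carrier_vec p" for g
  proof -
    have "sq_l2 (col (design n p X \<omega>) j - design n p X \<omega> *\<^sub>v g) = (\<Sum>i<n. lin p X (?w g) i \<omega> * lin p X (?w g) i \<omega>)" for \<omega>
    proof -
      have "(col (design n p X \<omega>) j - design n p X \<omega> *\<^sub>v g) $ i = lin p X (?w g) i \<omega>" if "i < n" for i
        using that g j by (simp add: design_def lin_def fit_diff fit_unit)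
          (simp add: fit_def scalar_prod_def lessThan_atLeast0)
      then show ?thesis
        by (simp add: sq_l2_def scalar_prod_def lessThan_atLeast0 design_def)
    qed
    then show ?thesis using lin_lin[of _ "?w g" "?w g"] by simp
  qed
  have t: "vec p (node_target T j) \<in> without p j" using j by (simp add: without_def node_target_def)
  have wt: "bil p S (?w (vec p (node_target T j))) v = bil p S (eta_coef T j) v"
    "bil p S v (?w (vec p (node_target T j))) = bil p S v (eta_coef T j)" for v
    using eta_coef_diag[OF j]
    by (auto simp: bil_def unit_coef_def node_target_def eta_coef_def intro!: sum.cong arg_cong2[where f="(*)"])
  have best: "bil p S (?w g) (?w g) \<ge> 1 / T j j + c0 * (\<Sum>k<p. (g $ k - node_target T j k)\<^sup>2)" if "g \<in> without p j" for g
  proof -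
    let ?d = "\<lambda>k. ?w g k - eta_coef T j k"
    have gj: "?w g j = 1" using that by (simp add: without_def unit_coef_def)
    have "bil p S (\<lambda>k. 1 * ?w g k + (-1) * eta_coef T j k) (\<lambda>k. 1 * ?w g k + (-1) * eta_coef T j k)
      = bil p S (?w g) (?w g) - 1 / T j j"
      unfolding bil_add_left bil_add_right bil_eta[OF j] using gj eta_coef_diag[OF j] by simp
    then have "bil p S ?d ?d = bil p S (?w g) (?w g) - 1 / T j j" by simp
    moreover have "(\<Sum>k<p. (?d k)\<^sup>2) = (\<Sum>k<p. (g $ k - node_target T j k)\<^sup>2)"
      using eta_coef_diag[OF j]
      by (intro sum.cong refl) (auto simp: unit_coef_def node_target_def eta_coef_def power2_commute power2_eq_square algebra_simps)
    then have "c0 * (\<Sum>k<p. (g $ k - node_target T j k)\<^sup>2) \<le> bil p S ?d ?d" using S_ge[of ?d] by simp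
    ultimately show ?thesis by linarith
  qed
  have ft: "?f (vec p (node_target T j)) = n * (1 / T j j)"
    using f[of "vec p (node_target T j)"] by (simp add: wt bil_eta[OF j] eta_coef_diag[OF j])
  have min: "is_arg_min ?f (\<lambda>g. g \<in> without p j) (vec p (node_target T j))"
    unfolding is_arg_min_def
  proof (intro conjI notI t)
    assume "\<exists>y. y \<in> without p j \<and> ?f y < ?f (vec p (node_target T j))"
    then obtain g where g: "g \<in> without p j" "?f g < ?f (vec p (node_target T j))" by blast
    have "n * bil p S (?w g) (?w g) < n * (1 / T j j)" using g f[of g] ft by (simp add: without_def)
    then have "bil p S (?w g) (?w g) < 1 / T j j"
      using n by (simp only: mult_less_cancel_left_pos of_nat_0_less_iff)
    moreover have "0 \<le> c0 * (\<Sum>k<p. (g $ k - node_target T j k)\<^sup>2)" using c0 by (simp add: sum_nonneg)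
    ultimately show False using best[OF g(1)] by linarith
  qed
  have uniq: "g = vec p (node_target T j)" if g: "is_arg_min ?f (\<lambda>g. g \<in> without p j) g" for g
  proof -
    have gw: "g \<in> without p j" and "\<not> ?f (vec p (node_target T j)) < ?f g"
      using g t by (auto simp: is_arg_min_def)
    then have "n * bil p S (?w g) (?w g) \<le> n * (1 / T j j)" using f[of g] ft by (simp add: without_def)
    then have "bil p S (?w g) (?w g) \<le> 1 / T j j"
      using n by (simp only: mult_le_cancel_left_pos of_nat_0_less_iff)
    then have "c0 * (\<Sum>k<p. (g $ k - node_target T j k)\<^sup>2) \<le> 0" using best[OF gw] by linarith
    then have "(\<Sum>k<p. (g $ k - node_target T j k)\<^sup>2) \<le> 0" using c0 by (simp add: mult_le_0_iff)
    then have "(\<Sum>k<p. (g $ k - node_target T j k)\<^sup>2) = 0" by (simp add: antisym sum_nonneg)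
    then have "g $ k = node_target T j k" if "k < p" for k using that by (simp add: sum_nonneg_eq_0_iff)
    then show ?thesis using gw by (intro eq_vecI) (auto simp: without_def)
  qed
  show ?thesis unfolding node_coef_def arg_min_def
    using min uniq by (rule some_equality)
qed

end

section \<open>The nodewise Lasso and debiasing\<close>

text \<open>Covariances of these forms comprise all that the deterministic analysis needs: entries
  of the Gram matrix, correlations of a residual with the other columns, and residual
  variances.\<close>

definition forms :: "nat \<Rightarrow> (nat \<Rightarrow> nat \<Rightarrow> real) \<Rightarrow> (nat \<Rightarrow> real) set" where
  "forms p T = unit_coef ` {..<p} \<union> eta_coef T ` {..<p}"

definition gram_close ::
  "nat \<Rightarrow> nat \<Rightarrow> (nat \<Rightarrow> nat \<Rightarrow> real) \<Rightarrow> (nat \<Rightarrow> nat \<Rightarrow> real) \<Rightarrow> (nat \<Rightarrow> nat \<Rightarrow> real) \<Rightarrow> real \<Rightarrow> bool" where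
  "gram_close n p S T x d \<longleftrightarrow> (\<forall>u\<in>forms p T. \<forall>v\<in>forms p T.
     \<bar>(\<Sum>i<n. fit p x u i * fit p x v i) / n - bil p S u v\<bar> \<le> d)"

lemma bil_unit_unit: "j < p \<Longrightarrow> k < p \<Longrightarrow> bil p S (unit_coef j) (unit_coef k) = S j k"
  unfolding bil_def unit_coef_def by (simp only: sum_delta_mult(2) sum_delta_mult(4))

lemma gram_close_entry:
  assumes "gram_close n p S T x d" "j < p" "k < p"
  shows "\<bar>(\<Sum>i<n. x i j * x i k) / n - S j k\<bar> \<le> d"
proof -
  have "unit_coef j \<in> forms p T" "unit_coef k \<in> forms p T" using assms by (auto simp: forms_def)
  then have "\<bar>(\<Sum>i<n. fit p x (unit_coef j) i * fit p x (unit_coef k) i) / n - bil p S (unit_coef j) (unit_coef k)\<bar> \<le> d"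
    using assms(1) unfolding gram_close_def by blast
  then show ?thesis using assms by (simp add: fit_unit bil_unit_unit)
qed

lemma sum_mult_fit_divide:
  "(\<Sum>i<n. e i * fit p x b i) / real n = (\<Sum>j<p. b j * ((\<Sum>i<n. x i j * e i) / real n))"
  unfolding sum_mult_fit by (simp only: sum_divide_distrib[of _ "{..<p}"] times_divide_eq_right)

locale nodewise_regression = precision_matrix +
  fixes n j :: nat and x :: "nat \<Rightarrow> nat \<Rightarrow> real" and g :: "nat \<Rightarrow> real" and lamN d s :: real
  assumes n: "0 < n" and j: "j < p"
    and gj: "g j = 0"
    and g_min: "\<And>h. h j = 0 \<Longrightarrow> objective n p lamN (\<lambda>i. x i j) x g \<le> objective n p lamN (\<lambda>i. x i j) x h"
    and lamN: "0 < lamN"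
    and gram: "gram_close n p S T x d" and d: "0 \<le> d" "d \<le> lamN / 2"
    and s: "real (card {k. k < p \<and> k \<noteq> j \<and> T j k \<noteq> 0}) \<le> s" and sd: "32 * s * d \<le> c0"
begin

text \<open>\<open>r\<close> is the fitted nodewise residual, \<open>q2\<close> its mean square,
  \<open>t2\<close> the squared tau estimate, \<open>dev\<close> the coefficient error and
  \<open>eta\<close> the population residual.\<close>

definition r where "r i = x i j - fit p x g i"
definition q2 where "q2 = (\<Sum>i<n. (r i)\<^sup>2) / n"
definition t2 where "t2 = q2 + lamN * (\<Sum>k<p. \<bar>g k\<bar>)"
definition dev where "dev k = g k - node_target T j k"
definition eta where "eta i = fit p x (eta_coef T j) i"

lemma eta_eq: "eta i = x i j - fit p x (node_target T j) i"
proof -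
  have "eta_coef T j = (\<lambda>k. unit_coef j k - node_target T j k)"
    using eta_coef_diag[OF j] by (auto simp: eta_coef_def unit_coef_def node_target_def)
  then show ?thesis using j by (simp add: eta_def fit_diff fit_unit)
qed

lemma r_eq: "r i = eta i - fit p x dev i"
  by (simp add: r_def eta_eq dev_def[abs_def] fit_diff)

text \<open>The population residual is uncorrelated with every other column, so its empirical
  correlation is a pure Gram deviation. In the nodewise regression this deviation plays the role of
  noise.\<close>

lemma noise: assumes "k < p" "k \<noteq> j" shows "\<bar>\<Sum>i<n. x i k * eta i\<bar> / n \<le> lamN / 2"
proof -
  have "unit_coef k \<in> forms p T" "eta_coef T j \<in> forms p T" using assms j by (auto simp: forms_def)
  then have "\<bar>(\<Sum>i<n. fit p x (unit_coef k) i * fit p x (eta_coef T j) i) / n - bil p S (unit_coef k) (eta_coef T j)\<bar> \<le> d"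
    using gram unfolding gram_close_def by blast
  then have "\<bar>\<Sum>i<n. x i k * eta i\<bar> / n \<le> d"
    using assms j by (simp add: fit_unit bil_eta unit_coef_def eta_def)
  then show ?thesis using d by linarith
qed

lemma dev_bounds:
  shows "(\<Sum>k<p. \<bar>dev k\<bar>) \<le> 32 * s * lamN / c0" and "(\<Sum>i<n. (fit p x dev i)\<^sup>2) / n \<le> 32 * s * lamN\<^sup>2 / c0"
proof -
  have le: "objective n p lamN (\<lambda>i. x i j) x g \<le> objective n p lamN (\<lambda>i. x i j) x (node_target T j)"
    by (rule g_min) (simp add: node_target_def)
  have ns: "\<bar>\<Sum>i<n. x i k * (x i j - fit p x (node_target T j) i)\<bar> / n \<le> lamN / 2"
    if "k < p" "g k \<noteq> node_target T j k" for k
  proof -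
    have "k \<noteq> j" using that gj by (auto simp: node_target_def)
    then show ?thesis using noise that by (simp add: eta_eq)
  qed
  have "{k. k < p \<and> node_target T j k \<noteq> 0} = {k. k < p \<and> k \<noteq> j \<and> T j k \<noteq> 0}"
    using T_diag_pos[OF j] by (auto simp: node_target_def)
  then have sc: "real (card {k. k < p \<and> node_target T j k \<noteq> 0}) \<le> s" using s by simp
  show "(\<Sum>k<p. \<bar>dev k\<bar>) \<le> 32 * s * lamN / c0" "(\<Sum>i<n. (fit p x dev i)\<^sup>2) / n \<le> 32 * s * lamN\<^sup>2 / c0"
    unfolding dev_def[abs_def]
    by (rule lasso_oracle_inequality[OF n le ns lamN c0 S_ge gram_close_entry[OF gram] sc sd d(1)]; assumption)+
qed

lemma q2_close: "\<bar>q2 - 1 / T j j\<bar> \<le> d + 64 * s * lamN\<^sup>2 / c0"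
proof -
  have "(\<Sum>i<n. (r i)\<^sup>2) = (\<Sum>i<n. eta i * eta i - 2 * (eta i * fit p x dev i) + (fit p x dev i)\<^sup>2)"
    unfolding r_eq by (intro sum.cong refl) (simp add: power2_eq_square algebra_simps)
  also have "\<dots> = (\<Sum>i<n. eta i * eta i) - 2 * (\<Sum>i<n. eta i * fit p x dev i) + (\<Sum>i<n. (fit p x dev i)\<^sup>2)"
    by (simp only: sum.distrib sum_subtractf sum_distrib_left)
  finally have q: "q2 = (\<Sum>i<n. eta i * eta i) / n - 2 * ((\<Sum>i<n. eta i * fit p x dev i) / n) + (\<Sum>i<n. (fit p x dev i)\<^sup>2) / n"
    unfolding q2_def by (simp add: add_divide_distrib diff_divide_distrib)
  have "eta_coef T j \<in> forms p T" using j by (auto simp: forms_def)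
  then have "\<bar>(\<Sum>i<n. fit p x (eta_coef T j) i * fit p x (eta_coef T j) i) / n - bil p S (eta_coef T j) (eta_coef T j)\<bar> \<le> d"
    using gram unfolding gram_close_def by blast
  then have 1: "\<bar>(\<Sum>i<n. eta i * eta i) / n - 1 / T j j\<bar> \<le> d"
    using j by (simp add: bil_eta eta_coef_diag eta_def)
  have 2: "\<bar>(\<Sum>i<n. eta i * fit p x dev i) / n\<bar> \<le> 16 * s * lamN\<^sup>2 / c0"
  proof -
    \<comment> \<open>Coordinate \<open>j\<close> is removed from the sum: there \<open>dev\<close>
      is 0, whereas the correlation of column \<open>j\<close> with the residual is not small. The
      resulting 16 is doubled and added to the 32 of the quadratic term, which gives 64.\<close>
    define z where "z k = (if k = j then 0 else (\<Sum>i<n. x i k * eta i) / n)" for k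
    have "(\<Sum>i<n. eta i * fit p x dev i) / n = (\<Sum>k<p. dev k * ((\<Sum>i<n. x i k * eta i) / n))"
      by (rule sum_mult_fit_divide)
    also have "\<dots> = (\<Sum>k<p. dev k * z k)"
      by (intro sum.cong refl) (simp add: z_def dev_def gj node_target_def)
    finally have "\<bar>(\<Sum>i<n. eta i * fit p x dev i) / n\<bar> = \<bar>\<Sum>k<p. dev k * z k\<bar>" by simp
    also have "\<dots> \<le> (\<Sum>k<p. \<bar>dev k\<bar>) * (lamN / 2)"
      using noise lamN by (intro abs_sum_mult_le) (auto simp: z_def)
    also have "\<dots> \<le> (32 * s * lamN / c0) * (lamN / 2)"
      using dev_bounds(1) lamN by (intro mult_right_mono) auto
    finally show ?thesis by (simp add: power2_eq_square mult_ac)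
  qed
  have 3: "0 \<le> (\<Sum>i<n. (fit p x dev i)\<^sup>2) / n" by (simp add: sum_nonneg)
  show ?thesis using q 1 2 3 dev_bounds(2) by linarith
qed

lemma t2_ge: "q2 \<le> t2"
  using lamN by (simp add: t2_def sum_nonneg)

text \<open>The optimality conditions say that the estimated row inverts the Gram matrix
  approximately. Off the diagonal the error is the subgradient bound; on the diagonal the radial
  identity makes the product exactly \<open>t2\<close>.\<close>

lemma gram_row:
  assumes k: "k < p"
  shows "\<bar>(\<Sum>i<n. x i k * r i) / n - (if k = j then t2 else 0)\<bar> \<le> lamN"
proof (cases "k = j")
  case False
  have "\<bar>(\<Sum>i<n. x i k * (x i j - fit p x g i)) / n\<bar> \<le> lamN"
    by (rule lasso_subgradient[OF n k]) (use lamN False gj in \<open>auto intro!: g_min\<close>)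
  then show ?thesis using False by (simp add: r_def)
next
  case True
  have "(\<Sum>i<n. (x i j - fit p x g i) * fit p x g i) / n = lamN * (\<Sum>k<p. \<bar>g k\<bar>)"
    by (rule lasso_radial[OF n]) (use gj in \<open>auto intro!: g_min\<close>)
  moreover have "(\<Sum>i<n. x i j * r i) = (\<Sum>i<n. (r i)\<^sup>2) + (\<Sum>i<n. (x i j - fit p x g i) * fit p x g i)"
    unfolding sum.distrib[symmetric] by (intro sum.cong refl) (simp add: r_def power2_eq_square algebra_simps)
  ultimately have "(\<Sum>i<n. x i j * r i) / n = t2" by (simp add: t2_def q2_def add_divide_distrib)
  then show ?thesis using True lamN by simp
qed

text \<open>Everything is multiplied by \<open>t2\<close>, so no division by the random tau estimate
  occurs. Two remainders are left: the nodewise coefficient error against the noise, and the Lasso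
  error against the inexact inversion in \<open>gram_row\<close>. Each is an l1 norm times a maximum
  norm, hence a product of two small quantities.\<close>

lemma debias:
  fixes b \<beta> e :: "nat \<Rightarrow> real" and lam s0 dE :: real
  assumes b_min: "objective n p lam (\<lambda>i. fit p x \<beta> i + e i) x b \<le> objective n p lam (\<lambda>i. fit p x \<beta> i + e i) x \<beta>"
    and lam: "0 < lam" and dE: "\<And>k. k < p \<Longrightarrow> \<bar>\<Sum>i<n. x i k * e i\<bar> / n \<le> dE" and dE_lam: "dE \<le> lam / 2" "0 \<le> dE"
    and s0: "real (card {k. k < p \<and> \<beta> k \<noteq> 0}) \<le> s0" and s0d: "32 * s0 * d \<le> c0"
  defines "db \<equiv> t2 * b j + (\<Sum>i<n. r i * (fit p x \<beta> i + e i - fit p x b i)) / n"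
  shows "\<bar>db - t2 * \<beta> j - (\<Sum>i<n. eta i * e i) / n\<bar> \<le> 32 * lamN * (s * dE + s0 * lam) / c0"
proof -
  let ?D = "\<lambda>k. b k - \<beta> k"
  have ns: "\<bar>\<Sum>i<n. x i k * (fit p x \<beta> i + e i - fit p x \<beta> i)\<bar> / n \<le> lam / 2" if "k < p" "b k \<noteq> \<beta> k" for k
  proof -
    have "\<bar>\<Sum>i<n. x i k * (fit p x \<beta> i + e i - fit p x \<beta> i)\<bar> / n \<le> dE" using dE[OF that(1)] by simp
    then show ?thesis using dE_lam by linarith
  qed
  have D: "(\<Sum>k<p. \<bar>?D k\<bar>) \<le> 32 * s0 * lam / c0"
    by (rule lasso_oracle_inequality(1)[OF n b_min ns lam c0 S_ge gram_close_entry[OF gram] s0 s0d d(1)]; assumption)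
  have "(\<Sum>i<n. r i * (fit p x \<beta> i + e i - fit p x b i)) = (\<Sum>i<n. eta i * e i - e i * fit p x dev i - r i * fit p x ?D i)"
    by (intro sum.cong refl) (simp add: r_eq fit_diff algebra_simps)
  also have "\<dots> = (\<Sum>i<n. eta i * e i) - (\<Sum>i<n. e i * fit p x dev i) - (\<Sum>i<n. r i * fit p x ?D i)"
    by (simp only: sum_subtractf)
  finally have "(\<Sum>i<n. r i * (fit p x \<beta> i + e i - fit p x b i)) / n
      = (\<Sum>i<n. eta i * e i) / n - (\<Sum>k<p. dev k * ((\<Sum>i<n. x i k * e i) / n)) - (\<Sum>k<p. ?D k * ((\<Sum>i<n. x i k * r i) / n))"
    by (simp only: diff_divide_distrib sum_mult_fit_divide)
  moreover have "(\<Sum>k<p. ?D k * ((\<Sum>i<n. x i k * r i) / n))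
      = t2 * ?D j + (\<Sum>k<p. ?D k * ((\<Sum>i<n. x i k * r i) / n - (if k = j then t2 else 0)))"
  proof -
    have "(\<Sum>k<p. ?D k * (if k = j then t2 else 0)) = t2 * ?D j"
      using j by (simp add: if_distrib[of "\<lambda>z. _ * z"] mult.commute cong: if_cong)
    then show ?thesis by (simp add: right_diff_distrib sum_subtractf)
  qed
  ultimately have eq: "db - t2 * \<beta> j - (\<Sum>i<n. eta i * e i) / n
      = - (\<Sum>k<p. dev k * ((\<Sum>i<n. x i k * e i) / n))
        - (\<Sum>k<p. ?D k * ((\<Sum>i<n. x i k * r i) / n - (if k = j then t2 else 0)))"
    by (simp add: db_def algebra_simps)
  have 1: "\<bar>\<Sum>k<p. dev k * ((\<Sum>i<n. x i k * e i) / n)\<bar> \<le> (32 * s * lamN / c0) * dE"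
  proof -
    have "\<bar>\<Sum>k<p. dev k * ((\<Sum>i<n. x i k * e i) / n)\<bar> \<le> (\<Sum>k<p. \<bar>dev k\<bar>) * dE"
      using dE by (intro abs_sum_mult_le) auto
    also have "\<dots> \<le> (32 * s * lamN / c0) * dE" using dev_bounds(1) dE_lam by (intro mult_right_mono) auto
    finally show ?thesis .
  qed
  have 2: "\<bar>\<Sum>k<p. ?D k * ((\<Sum>i<n. x i k * r i) / n - (if k = j then t2 else 0))\<bar> \<le> (32 * s0 * lam / c0) * lamN"
  proof -
    have "\<bar>\<Sum>k<p. ?D k * ((\<Sum>i<n. x i k * r i) / n - (if k = j then t2 else 0))\<bar> \<le> (\<Sum>k<p. \<bar>?D k\<bar>) * lamN"
      using gram_row by (intro abs_sum_mult_le) auto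
    also have "\<dots> \<le> (32 * s0 * lam / c0) * lamN" using D lamN by (intro mult_right_mono) auto
    finally show ?thesis .
  qed
  have "32 * lamN * (s * dE + s0 * lam) / c0 = (32 * s * lamN / c0) * dE + (32 * s0 * lam / c0) * lamN"
    by (simp add: add_divide_distrib algebra_simps)
  then show ?thesis unfolding eq using 1 2 by linarith
qed

end

section \<open>The matrix estimators as sums over indices\<close>

lemma lasso_objective_eq:
  assumes "y \<in> carrier_vec n" "x \<in> carrier_mat n p" "b \<in> carrier_vec p"
  shows "lasso_objective n lam y x b = objective n p lam (\<lambda>i. y $ i) (\<lambda>i k. x $$ (i, k)) (\<lambda>k. b $ k)"
proof -
  have "(y - x *\<^sub>v b) $ i = y $ i - fit p (\<lambda>i k. x $$ (i, k)) (\<lambda>k. b $ k) i" if "i < n" for i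
    using that assms by (simp add: fit_def scalar_prod_def lessThan_atLeast0)
  then show ?thesis
    using assms by (simp add: lasso_objective_def objective_def sq_l2_def l1_def scalar_prod_def lessThan_atLeast0 power2_eq_square)
qed

lemma is_arg_min_objective:
  assumes "is_arg_min (lasso_objective n lam y x) (\<lambda>b. b \<in> F) b" "F \<subseteq> carrier_vec p"
    "y \<in> carrier_vec n" "x \<in> carrier_mat n p" "vec p h \<in> F"
  shows "objective n p lam (\<lambda>i. y $ i) (\<lambda>i k. x $$ (i, k)) (\<lambda>k. b $ k)
    \<le> objective n p lam (\<lambda>i. y $ i) (\<lambda>i k. x $$ (i, k)) h"
proof -
  have b: "b \<in> F" and "\<not> lasso_objective n lam y x (vec p h) < lasso_objective n lam y x b"
    using assms(1,5) by (auto simp: is_arg_min_def)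
  then have "lasso_objective n lam y x b \<le> lasso_objective n lam y x (vec p h)" by simp
  moreover have "objective n p lam (\<lambda>i. y $ i) (\<lambda>i k. x $$ (i, k)) (\<lambda>k. vec p h $ k)
      = objective n p lam (\<lambda>i. y $ i) (\<lambda>i k. x $$ (i, k)) h"
    by (simp add: objective_def fit_def)
  ultimately show ?thesis using assms(2-5) b lasso_objective_eq[of y n x p] by (metis subsetD)
qed

lemma Theta_hat_entry:
  assumes "j < p" "k < p"
  shows "Theta_hat n p lamN ghat x $$ (j, k) = inverse (tau_hat_sq n lamN ghat x j) * (if j = k then 1 else - (ghat j x $ k))"
proof -
  let ?t = "inverse (tau_hat_sq n lamN ghat x j)"
  have "Theta_hat n p lamN ghat x $$ (j, k)
      = (\<Sum>l<p. (if l = j then 1 else 0) * (?t * C_hat p ghat x $$ (l, k)))"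
    using assms by (auto simp: Theta_hat_def C_hat_def scalar_prod_def lessThan_atLeast0 intro!: sum.cong)
  also have "\<dots> = ?t * C_hat p ghat x $$ (j, k)" by (rule sum_delta_mult(2)[OF assms(1)])
  finally show ?thesis using assms by (simp add: C_hat_def)
qed

text \<open>Applied to the design, the estimated row is the nodewise residual over the squared tau
  estimate. Both the debiasing correction and \<open>omega_hat\<close> are functions of this
  residual, which is why tau cancels from their ratio.\<close>

lemma fit_Theta_hat_row:
  assumes j: "j < p" and gj: "ghat j x $ j = 0"
  shows "fit p (\<lambda>i k. x $$ (i, k)) (\<lambda>k. Theta_hat n p lamN ghat x $$ (j, k)) i
    = inverse (tau_hat_sq n lamN ghat x j) * (x $$ (i, j) - fit p (\<lambda>i k. x $$ (i, k)) (\<lambda>k. ghat j x $ k) i)"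
proof -
  have "fit p (\<lambda>i k. x $$ (i, k)) (\<lambda>k. Theta_hat n p lamN ghat x $$ (j, k)) i
    = fit p (\<lambda>i k. x $$ (i, k)) (\<lambda>k. inverse (tau_hat_sq n lamN ghat x j) * (unit_coef j k - ghat j x $ k)) i"
    unfolding fit_def using j gj by (intro sum.cong refl) (auto simp: Theta_hat_entry unit_coef_def)
  then show ?thesis by (simp add: fit_scale fit_diff fit_unit j)
qed

lemma desparsified_entry:
  assumes y: "y \<in> carrier_vec n" and x: "x \<in> carrier_mat n p" and b: "bhat y x \<in> carrier_vec p" and j: "j < p"
  shows "desparsified n p lamN bhat ghat y x $ j = bhat y x $ j
    + (\<Sum>k<p. Theta_hat n p lamN ghat x $$ (j, k)
        * (\<Sum>i<n. x $$ (i, k) * (y $ i - fit p (\<lambda>i k. x $$ (i, k)) (\<lambda>k. bhat y x $ k) i))) / n"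
proof -
  have res: "(y - x *\<^sub>v bhat y x) $ i = y $ i - fit p (\<lambda>i k. x $$ (i, k)) (\<lambda>k. bhat y x $ k) i" if "i < n" for i
    using that y x b by (simp add: fit_def scalar_prod_def lessThan_atLeast0)
  have rd: "dim_vec (y - x *\<^sub>v bhat y x) = n" using y x by simp
  have xt: "(transpose_mat x *\<^sub>v (y - x *\<^sub>v bhat y x)) $ k
      = (\<Sum>i<n. x $$ (i, k) * (y $ i - fit p (\<lambda>i k. x $$ (i, k)) (\<lambda>k. bhat y x $ k) i))" if "k < p" for k
  proof -
    have "(transpose_mat x *\<^sub>v (y - x *\<^sub>v bhat y x)) $ k = (\<Sum>i<n. x $$ (i, k) * (y - x *\<^sub>v bhat y x) $ i)"
      using that x rd by (simp add: scalar_prod_def lessThan_atLeast0)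
    then show ?thesis using res by simp
  qed
  have Td: "Theta_hat n p lamN ghat x \<in> carrier_mat p p" by (intro carrier_matI) (auto simp: Theta_hat_def C_hat_def)
  have "(Theta_hat n p lamN ghat x *\<^sub>v (transpose_mat x *\<^sub>v (y - x *\<^sub>v bhat y x))) $ j
      = (\<Sum>k<p. Theta_hat n p lamN ghat x $$ (j, k) * (transpose_mat x *\<^sub>v (y - x *\<^sub>v bhat y x)) $ k)"
    using Td j x by (simp add: scalar_prod_def lessThan_atLeast0)
  then show ?thesis
    using j b Td x xt unfolding desparsified_def by (simp add: sum_divide_distrib)
qed

lemma omega_hat_entry:
  assumes x: "x \<in> carrier_mat n p" and j: "j < p"
  shows "omega_hat n p lamN ghat sig2hat y x j = sig2hat y x *
    ((\<Sum>i<n. (fit p (\<lambda>i k. x $$ (i, k)) (\<lambda>k. Theta_hat n p lamN ghat x $$ (j, k)) i)\<^sup>2) / n)"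
proof -
  let ?t = "\<lambda>k. Theta_hat n p lamN ghat x $$ (j, k)"
  have Td: "Theta_hat n p lamN ghat x \<in> carrier_mat p p" by (intro carrier_matI) (auto simp: Theta_hat_def C_hat_def)
  have S: "Sigma_hat n x $$ (k, l) = (\<Sum>i<n. x $$ (i, k) * x $$ (i, l)) / n" if "k < p" "l < p" for k l
    using that x by (simp add: Sigma_hat_def scalar_prod_def lessThan_atLeast0)
  have Sd: "Sigma_hat n x \<in> carrier_mat p p" using x by (intro carrier_matI) (auto simp: Sigma_hat_def)
  have "row (Theta_hat n p lamN ghat x) j \<bullet> (Sigma_hat n x *\<^sub>v row (Theta_hat n p lamN ghat x) j)
      = bil p (\<lambda>k l. Sigma_hat n x $$ (k, l)) ?t ?t"
    using Td Sd j by (simp add: bil_def scalar_prod_def lessThan_atLeast0)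
  also have "\<dots> = bil p (\<lambda>k l. (\<Sum>i<n. x $$ (i, k) * x $$ (i, l)) / n) ?t ?t"
    unfolding bil_def using S by (intro sum.cong arg_cong2[where f="(*)"] refl) auto
  also have "\<dots> = (\<Sum>i<n. (fit p (\<lambda>i k. x $$ (i, k)) ?t i)\<^sup>2) / n" by (rule gram_form[symmetric])
  finally show ?thesis by (simp add: omega_hat_def)
qed

section \<open>Tails of the standardized scores\<close>

text \<open>Only moments of the uncentred variable are used. The first-order Taylor bound leaves the
  mean linearly in \<open>1 + t * m + L * t\<^sup>2\<close>, and after exponentiating that
  expression the centring factor removes it without any loss.\<close>

lemma (in prob_space) centered_mgf_le:
  fixes Z :: "'a \<Rightarrow> real"
  assumes Z[measurable]: "Z \<in> borel_measurable M"
    and int: "integrable M (\<lambda>\<omega>. (Z \<omega>)\<^sup>2 * exp (b * \<bar>Z \<omega>\<bar>))"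
    and L: "expectation (\<lambda>\<omega>. (Z \<omega>)\<^sup>2 * exp (b * \<bar>Z \<omega>\<bar>)) \<le> L" and t: "\<bar>t\<bar> \<le> b"
  shows "integrable M (\<lambda>\<omega>. exp (t * (Z \<omega> - expectation Z)))"
    and "expectation (\<lambda>\<omega>. exp (t * (Z \<omega> - expectation Z))) \<le> exp (L * t\<^sup>2)"
proof -
  have b: "0 \<le> b" using t by linarith
  have le: "exp (b * \<bar>y\<bar>) \<le> exp b + y\<^sup>2 * exp (b * \<bar>y\<bar>)" for y
  proof (cases "\<bar>y\<bar> \<le> 1")
    case True
    then have "exp (b * \<bar>y\<bar>) \<le> exp b" using b by (simp add: mult_left_le)
    then show ?thesis by (simp add: add_increasing2)
  next
    case False
    then have "1 * exp (b * \<bar>y\<bar>) \<le> y\<^sup>2 * exp (b * \<bar>y\<bar>)"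
      using one_le_power[of "\<bar>y\<bar>" 2] by (intro mult_right_mono) auto
    then show ?thesis by (smt (verit) exp_gt_zero)
  qed
  have int0: "integrable M (\<lambda>\<omega>. exp (b * \<bar>Z \<omega>\<bar>))"
    by (rule Bochner_Integration.integrable_bound[of _ "\<lambda>\<omega>. exp b + (Z \<omega>)\<^sup>2 * exp (b * \<bar>Z \<omega>\<bar>)"])
      (use int le in auto)
  have ty: "\<bar>t * y\<bar> \<le> b * \<bar>y\<bar>" for y using mult_right_mono[OF t, of "\<bar>y\<bar>"] by (simp add: abs_mult)
  have intt: "integrable M (\<lambda>\<omega>. exp (t * Z \<omega>))"
    by (rule Bochner_Integration.integrable_bound[OF int0]) (use ty abs_le_D1 in auto)
  have intZ: "integrable M Z"
  proof (rule Bochner_Integration.integrable_bound[of _ "\<lambda>\<omega>. 1 + (Z \<omega>)\<^sup>2 * exp (b * \<bar>Z \<omega>\<bar>)"])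
    show "AE \<omega> in M. norm (Z \<omega>) \<le> norm (1 + (Z \<omega>)\<^sup>2 * exp (b * \<bar>Z \<omega>\<bar>))"
    proof (rule AE_I2)
      fix \<omega>
      have "2 * \<bar>Z \<omega>\<bar> \<le> 1 + (Z \<omega>)\<^sup>2" using sum_squares_bound[of 1 "\<bar>Z \<omega>\<bar>"] by simp
      moreover have "(Z \<omega>)\<^sup>2 * 1 \<le> (Z \<omega>)\<^sup>2 * exp (b * \<bar>Z \<omega>\<bar>)" using b by (intro mult_left_mono) auto
      ultimately show "norm (Z \<omega>) \<le> norm (1 + (Z \<omega>)\<^sup>2 * exp (b * \<bar>Z \<omega>\<bar>))" by simp
    qed
  qed (use int in auto)
  let ?m = "expectation Z"
  have e_eq: "exp (t * (y - ?m)) = exp (- t * ?m) * exp (t * y)" for y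
    by (simp add: exp_add[symmetric] algebra_simps)
  show "integrable M (\<lambda>\<omega>. exp (t * (Z \<omega> - ?m)))" unfolding e_eq using intt by simp
  have pw: "exp (t * y) \<le> 1 + t * y + t\<^sup>2 * (y\<^sup>2 * exp (b * \<bar>y\<bar>))" for y
  proof -
    have "norm (exp (complex_of_real (t * y)) - (1 + complex_of_real (t * y))) \<le> exp \<bar>t * y\<bar> * \<bar>t * y\<bar>\<^sup>2"
      using Taylor_exp[of "complex_of_real (t * y)" 1] by (simp add: numeral_2_eq_2 abs_mult norm_mult)
    moreover have "exp (complex_of_real (t * y)) - (1 + complex_of_real (t * y)) = complex_of_real (exp (t * y) - (1 + t * y))"
      unfolding exp_of_real by simp
    ultimately have "\<bar>exp (t * y) - (1 + t * y)\<bar> \<le> exp \<bar>t * y\<bar> * \<bar>t * y\<bar>\<^sup>2" by (simp only: norm_of_real)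
    also have "\<dots> \<le> exp (b * \<bar>y\<bar>) * \<bar>t * y\<bar>\<^sup>2" using ty by (intro mult_right_mono) auto
    also have "\<dots> = t\<^sup>2 * (y\<^sup>2 * exp (b * \<bar>y\<bar>))" by (simp add: power_mult_distrib)
    finally show ?thesis by linarith
  qed
  have "expectation (\<lambda>\<omega>. exp (t * Z \<omega>)) \<le> expectation (\<lambda>\<omega>. 1 + t * Z \<omega> + t\<^sup>2 * ((Z \<omega>)\<^sup>2 * exp (b * \<bar>Z \<omega>\<bar>)))"
    using intt intZ int pw by (intro integral_mono) auto
  also have "\<dots> = 1 + t * ?m + t\<^sup>2 * expectation (\<lambda>\<omega>. (Z \<omega>)\<^sup>2 * exp (b * \<bar>Z \<omega>\<bar>))"
    using intZ int by (simp add: prob_space)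
  also have "\<dots> \<le> 1 + (t * ?m + L * t\<^sup>2)" using mult_left_mono[OF L, of "t\<^sup>2"] by (simp add: mult.commute)
  also have "\<dots> \<le> exp (t * ?m + L * t\<^sup>2)" by (rule exp_ge_add_one_self)
  finally have "exp (- t * ?m) * expectation (\<lambda>\<omega>. exp (t * Z \<omega>)) \<le> exp (- t * ?m) * exp (t * ?m + L * t\<^sup>2)"
    by (intro mult_left_mono) auto
  moreover have "expectation (\<lambda>\<omega>. exp (t * (Z \<omega> - ?m))) = exp (- t * ?m) * expectation (\<lambda>\<omega>. exp (t * Z \<omega>))"
    unfolding e_eq using intt by simp
  ultimately show "expectation (\<lambda>\<omega>. exp (t * (Z \<omega> - ?m))) \<le> exp (L * t\<^sup>2)"
    by (simp add: exp_add[symmetric])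
qed

lemma (in prob_space) third_exp_moment_scale:
  assumes f: "third_exp_moment b L f" and c: "\<bar>c\<bar> \<le> k" and k: "0 < k" and b: "0 \<le> b"
  shows "third_exp_moment (b / k) (k ^ 3 * L) (\<lambda>\<omega>. c * f \<omega>)"
proof -
  have [measurable]: "f \<in> borel_measurable M"
    and int: "integrable M (\<lambda>\<omega>. \<bar>f \<omega>\<bar> ^ 3 * exp (b * \<bar>f \<omega>\<bar>))"
    and L: "expectation (\<lambda>\<omega>. \<bar>f \<omega>\<bar> ^ 3 * exp (b * \<bar>f \<omega>\<bar>)) \<le> L"
    using f by (auto simp: third_exp_moment_def)
  have le: "\<bar>c * y\<bar> ^ 3 * exp (b / k * \<bar>c * y\<bar>) \<le> k ^ 3 * (\<bar>y\<bar> ^ 3 * exp (b * \<bar>y\<bar>))" for y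
  proof -
    have cy: "\<bar>c * y\<bar> \<le> k * \<bar>y\<bar>" unfolding abs_mult using c by (intro mult_right_mono) auto
    then have "b / k * \<bar>c * y\<bar> \<le> b / k * (k * \<bar>y\<bar>)" using b k by (intro mult_left_mono) auto
    then have "b / k * \<bar>c * y\<bar> \<le> b * \<bar>y\<bar>" using k by simp
    then have "\<bar>c * y\<bar> ^ 3 * exp (b / k * \<bar>c * y\<bar>) \<le> (k * \<bar>y\<bar>) ^ 3 * exp (b * \<bar>y\<bar>)"
      using cy k by (intro mult_mono power_mono) auto
    then show ?thesis by (simp add: power_mult_distrib mult.assoc)
  qed
  have i: "integrable M (\<lambda>\<omega>. \<bar>c * f \<omega>\<bar> ^ 3 * exp (b / k * \<bar>c * f \<omega>\<bar>))"
    by (rule Bochner_Integration.integrable_bound[of _ "\<lambda>\<omega>. k ^ 3 * (\<bar>f \<omega>\<bar> ^ 3 * exp (b * \<bar>f \<omega>\<bar>))"])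
      (use int le k in \<open>auto simp del: abs_mult simp: abs_of_nonneg\<close>)
  have "expectation (\<lambda>\<omega>. \<bar>c * f \<omega>\<bar> ^ 3 * exp (b / k * \<bar>c * f \<omega>\<bar>)) \<le> expectation (\<lambda>\<omega>. k ^ 3 * (\<bar>f \<omega>\<bar> ^ 3 * exp (b * \<bar>f \<omega>\<bar>)))"
    using i int le by (intro integral_mono) auto
  also have "\<dots> \<le> k ^ 3 * L" using L k by simp
  finally show ?thesis using i by (simp add: third_exp_moment_def)
qed

context independent_observations begin

lemma mgf_sum:
  fixes f :: "nat \<Rightarrow> 'a \<Rightarrow> real" and z :: complex
  assumes meas: "\<And>i. i < n \<Longrightarrow> f i \<in> borel_measurable (G i)"
    and f: "\<And>i. i < n \<Longrightarrow> third_exp_moment b L (f i)"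
    and mean: "\<And>i. i < n \<Longrightarrow> expectation (f i) = 0"
    and var: "\<And>i. i < n \<Longrightarrow> expectation (\<lambda>\<omega>. (f i \<omega>)\<^sup>2) = v"
    and v: "0 \<le> v" "v \<le> 4" and L: "0 \<le> L" and z: "norm z \<le> b" "norm z \<le> 1"
  shows "norm (\<integral>\<omega>. exp (z * complex_of_real (\<Sum>i<n. f i \<omega>)) \<partial>M)
      \<le> exp (n * (Re (z\<^sup>2) * v / 2 + 8 * norm z ^ 3 * (L / 2 + 32)))"
proof -
  have e: "exp (z * complex_of_real (\<Sum>i<n. f i \<omega>)) = (\<Prod>i<n. exp (z * complex_of_real (f i \<omega>)))" for \<omega>
    by (simp add: sum_distrib_left exp_sum)
  have m: "(\<lambda>\<omega>. exp (z * complex_of_real (f i \<omega>))) \<in> borel_measurable (G i)" if "i < n" for i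
  proof -
    have "(\<lambda>y. exp (z * complex_of_real y)) \<in> borel_measurable borel"
      by (intro borel_measurable_continuous_onI continuous_intros)
    then show ?thesis by (rule measurable_compose[OF meas[OF that]])
  qed
  have "norm (\<integral>\<omega>. exp (z * complex_of_real (\<Sum>i<n. f i \<omega>)) \<partial>M)
      = (\<Prod>i<n. norm (\<integral>\<omega>. exp (z * complex_of_real (f i \<omega>)) \<partial>M))"
    unfolding e using expectation_prod[OF m mgf_expansion(1)[OF f mean var z(1)]]
    by (simp add: prod_norm)
  also have "\<dots> \<le> (\<Prod>i<n. exp (Re (z\<^sup>2) * v / 2 + 8 * norm z ^ 3 * (L / 2 + 32)))"
    using norm_mgf_le[OF f mean var z v L] by (intro prod_mono) auto
  also have "\<dots> = exp (n * (Re (z\<^sup>2) * v / 2 + 8 * norm z ^ 3 * (L / 2 + 32)))"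
    by (simp add: exp_of_nat_mult[symmetric])
  finally show ?thesis .
qed

lemma mgf_sum_real:
  fixes f :: "nat \<Rightarrow> 'a \<Rightarrow> real" and t :: real
  assumes meas: "\<And>i. i < n \<Longrightarrow> f i \<in> borel_measurable (G i)"
    and f: "\<And>i. i < n \<Longrightarrow> third_exp_moment b L (f i)" and t: "\<bar>t\<bar> \<le> b"
  shows "integrable M (\<lambda>\<omega>. exp (t * (\<Sum>i<n. f i \<omega>)))"
    and "expectation (\<lambda>\<omega>. exp (t * (\<Sum>i<n. f i \<omega>))) = (\<Prod>i<n. expectation (\<lambda>\<omega>. exp (t * f i \<omega>)))"
proof -
  have e: "exp (t * (\<Sum>i<n. f i \<omega>)) = (\<Prod>i<n. exp (t * f i \<omega>))" for \<omega>
    by (simp add: sum_distrib_left exp_sum)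
  have m: "(\<lambda>\<omega>. exp (t * f i \<omega>)) \<in> borel_measurable (G i)" if "i < n" for i
    using meas[OF that] by measurable
  show "integrable M (\<lambda>\<omega>. exp (t * (\<Sum>i<n. f i \<omega>)))"
    "expectation (\<lambda>\<omega>. exp (t * (\<Sum>i<n. f i \<omega>))) = (\<Prod>i<n. expectation (\<lambda>\<omega>. exp (t * f i \<omega>)))"
    unfolding e using integrable_prod[OF m integrable_mgf[OF f t]] expectation_prod[OF m integrable_mgf[OF f t]]
    by auto
qed

lemma mgf_sum_upper:
  fixes f :: "nat \<Rightarrow> 'a \<Rightarrow> real" and t :: real
  assumes meas: "\<And>i. i < n \<Longrightarrow> f i \<in> borel_measurable (G i)"
    and f: "\<And>i. i < n \<Longrightarrow> third_exp_moment b L (f i)"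
    and mean: "\<And>i. i < n \<Longrightarrow> expectation (f i) = 0"
    and var: "\<And>i. i < n \<Longrightarrow> expectation (\<lambda>\<omega>. (f i \<omega>)\<^sup>2) = v"
    and v: "0 \<le> v" "v \<le> 4" and L: "0 \<le> L" and t: "\<bar>t\<bar> \<le> b" "\<bar>t\<bar> \<le> 1"
  shows "expectation (\<lambda>\<omega>. exp (t * (\<Sum>i<n. f i \<omega>))) \<le> exp (n * (t\<^sup>2 * v / 2 + 8 * \<bar>t\<bar> ^ 3 * (L / 2 + 32)))"
proof -
  have "norm (\<integral>\<omega>. exp (complex_of_real t * complex_of_real (\<Sum>i<n. f i \<omega>)) \<partial>M)
      \<le> exp (n * (Re ((complex_of_real t)\<^sup>2) * v / 2 + 8 * norm (complex_of_real t) ^ 3 * (L / 2 + 32)))"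
    by (rule mgf_sum[OF meas f mean var v L]) (use t in auto)
  moreover have "(\<integral>\<omega>. exp (complex_of_real t * complex_of_real (\<Sum>i<n. f i \<omega>)) \<partial>M)
      = complex_of_real (expectation (\<lambda>\<omega>. exp (t * (\<Sum>i<n. f i \<omega>))))"
    by (rule mgf_real_eq[OF mgf_sum_real(1)[OF meas f t(1)]])
  moreover have "Re ((complex_of_real t)\<^sup>2) = t\<^sup>2" by (simp flip: of_real_power)
  ultimately show ?thesis by simp
qed

lemma mgf_sum_lower:
  fixes f :: "nat \<Rightarrow> 'a \<Rightarrow> real" and t :: real
  assumes meas: "\<And>i. i < n \<Longrightarrow> f i \<in> borel_measurable (G i)"
    and f: "\<And>i. i < n \<Longrightarrow> third_exp_moment b L (f i)"
    and mean: "\<And>i. i < n \<Longrightarrow> expectation (f i) = 0"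
    and var: "\<And>i. i < n \<Longrightarrow> expectation (\<lambda>\<omega>. (f i \<omega>)\<^sup>2) = 1"
    and L: "0 \<le> L" and t: "\<bar>t\<bar> \<le> b" "\<bar>t\<bar> \<le> 1" and small: "\<bar>t\<bar> ^ 3 * (L / 2 + 32) \<le> 1 / 2"
  shows "exp (n * (t\<^sup>2 / 2 - 2 * (\<bar>t\<bar> ^ 3 * (L / 2 + 32)))) \<le> expectation (\<lambda>\<omega>. exp (t * (\<Sum>i<n. f i \<omega>)))"
proof -
  have "exp (n * (t\<^sup>2 / 2 - 2 * (\<bar>t\<bar> ^ 3 * (L / 2 + 32)))) = (\<Prod>i<n. exp (t\<^sup>2 / 2 - 2 * (\<bar>t\<bar> ^ 3 * (L / 2 + 32))))"
    by (simp add: exp_of_nat_mult[symmetric])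
  also have "\<dots> \<le> (\<Prod>i<n. expectation (\<lambda>\<omega>. exp (t * f i \<omega>)))"
    using mgf_lower[OF f mean var t small L] by (intro prod_mono) auto
  also have "\<dots> = expectation (\<lambda>\<omega>. exp (t * (\<Sum>i<n. f i \<omega>)))"
    by (rule mgf_sum_real(2)[OF meas f t(1), symmetric])
  finally show ?thesis .
qed

lemma sum_tail:
  fixes f :: "nat \<Rightarrow> 'a \<Rightarrow> real"
  assumes n: "0 < n" and meas: "\<And>i. i < n \<Longrightarrow> f i \<in> borel_measurable (G i)"
    and f: "\<And>i. i < n \<Longrightarrow> third_exp_moment b L (f i)"
    and mean: "\<And>i. i < n \<Longrightarrow> expectation (f i) = 0"
    and var: "\<And>i. i < n \<Longrightarrow> expectation (\<lambda>\<omega>. (f i \<omega>)\<^sup>2) = 1"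
    and L: "0 \<le> L" and x: "1 \<le> x" "2 * x / sqrt n \<le> b" "2 * x / sqrt n \<le> 1"
  shows "prob {\<omega> \<in> space M. x \<le> (\<Sum>i<n. f i \<omega>) / sqrt n}
    \<le> exp (8 * (2 * x) ^ 3 * (L / 2 + 32) / sqrt n - x\<^sup>2 / 2) * (5 / sqrt x)"
proof (rule sharp_Gaussian_tail)
  have [measurable]: "f i \<in> borel_measurable M" if "i < n" for i using measurable_G[OF that meas[OF that]] .
  have sn: "0 < sqrt n" using n by simp
  have sn3: "n / (sqrt n) ^ 3 = 1 / sqrt n"
    using sn by (simp add: power3_eq_cube field_simps)
  show "(\<lambda>\<omega>. (\<Sum>i<n. f i \<omega>) / sqrt n) \<in> borel_measurable M" by measurable
  show "1 \<le> x" by fact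
  have xb: "\<bar>x / sqrt n\<bar> \<le> b" using x sn by (simp add: field_simps)
  show "integrable M (\<lambda>\<omega>. exp (x * ((\<Sum>i<n. f i \<omega>) / sqrt n)))"
    using mgf_sum_real(1)[OF meas f xb] by simp
  fix t :: real assume t: "\<bar>t\<bar> \<le> x"
  \<comment> \<open>The modulus is at most \<open>2 * x / sqrt n\<close>, so the cubic errors of
    \<open>n\<close> factors add up to a multiple of x^3 / sqrt n. With \<open>x\<close> of order
    sqrt (ln p) this is the source of the rate (ln p)^(3/2) / sqrt n.\<close>
  let ?z = "Complex x t / complex_of_real (sqrt n)"
  have cn: "norm (Complex x t) \<le> 2 * x" using cmod_le[of "Complex x t"] t x by simp
  have nz: "norm ?z = norm (Complex x t) / sqrt n" using sn by (simp add: norm_divide)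
  have zb: "norm ?z \<le> b" "norm ?z \<le> 1"
    unfolding nz using cn x sn divide_right_mono[OF cn, of "sqrt n"] by linarith+
  have "norm (\<integral>\<omega>. exp (Complex x t * complex_of_real ((\<Sum>i<n. f i \<omega>) / sqrt n)) \<partial>M)
      = norm (\<integral>\<omega>. exp (?z * complex_of_real (\<Sum>i<n. f i \<omega>)) \<partial>M)"
    by simp
  also have "\<dots> \<le> exp (n * (Re (?z\<^sup>2) * 1 / 2 + 8 * norm ?z ^ 3 * (L / 2 + 32)))"
    by (rule mgf_sum[OF meas f mean var _ _ L zb]) auto
  also have "\<dots> \<le> exp ((x\<^sup>2 - t\<^sup>2) / 2 + 8 * (2 * x) ^ 3 * (L / 2 + 32) / sqrt n)"
  proof -
    have "Re (?z\<^sup>2) = (x\<^sup>2 - t\<^sup>2) / n"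
    proof -
      have "?z\<^sup>2 = (Complex x t)\<^sup>2 / complex_of_real n"
        using n by (simp add: power_divide flip: of_real_power)
      then show ?thesis by (simp add: power2_eq_square)
    qed
    then have 1: "n * (Re (?z\<^sup>2) * 1 / 2) = (x\<^sup>2 - t\<^sup>2) / 2" using n by simp
    have "norm ?z ^ 3 \<le> (2 * x / sqrt n) ^ 3" unfolding nz using cn sn by (intro power_mono divide_right_mono) auto
    then have "n * (8 * norm ?z ^ 3 * (L / 2 + 32)) \<le> n * (8 * (2 * x / sqrt n) ^ 3 * (L / 2 + 32))"
      using L by (intro mult_left_mono mult_right_mono) auto
    also have "\<dots> = 8 * (2 * x) ^ 3 * (L / 2 + 32) * (n / (sqrt n) ^ 3)" by (simp add: power_divide)
    also have "\<dots> = 8 * (2 * x) ^ 3 * (L / 2 + 32) / sqrt n" unfolding sn3 by simp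
    finally show ?thesis using 1 by (simp add: distrib_left)
  qed
  finally show "norm (\<integral>\<omega>. exp (Complex x t * complex_of_real ((\<Sum>i<n. f i \<omega>) / sqrt n)) \<partial>M)
      \<le> exp ((x\<^sup>2 - t\<^sup>2) / 2 + 8 * (2 * x) ^ 3 * (L / 2 + 32) / sqrt n)" .
qed

end

text \<open>The common ground of the two design cases. The exponential rates scale as if the forms
  were bounded by a multiple of \<open>K\<close>, but the moments grow more slowly than such a bound
  alone suggests: one factor of bounded variance is kept, so squared products cost
  \<open>K\<^sup>2\<close> rather than K^4, and cubes of score terms cost only
  \<open>K\<close>.\<close>

locale regression_moments = regression_model +
  fixes K a B cs Cs :: real
  assumes K: "1 \<le> K" and a: "0 < a" and B: "0 < B" and cs: "0 < cs" "cs \<le> sig2" "sig2 \<le> Cs"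
    and M1_int: "\<And>u v i. u \<in> forms p T \<Longrightarrow> v \<in> forms p T \<Longrightarrow> i < n \<Longrightarrow>
      integrable M (\<lambda>\<omega>. (lin p X u i \<omega> * lin p X v i \<omega>)\<^sup>2 * exp (a / K\<^sup>2 * \<bar>lin p X u i \<omega> * lin p X v i \<omega>\<bar>))"
    and M1: "\<And>u v i. u \<in> forms p T \<Longrightarrow> v \<in> forms p T \<Longrightarrow> i < n \<Longrightarrow>
      expectation (\<lambda>\<omega>. (lin p X u i \<omega> * lin p X v i \<omega>)\<^sup>2 * exp (a / K\<^sup>2 * \<bar>lin p X u i \<omega> * lin p X v i \<omega>\<bar>)) \<le> B * K\<^sup>2"
    and M2: "\<And>u i. u \<in> forms p T \<Longrightarrow> i < n \<Longrightarrow> third_exp_moment (a / K) (B * K) (\<lambda>\<omega>. lin p X u i \<omega> * eps i \<omega>)"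
begin

abbreviation dsg where "dsg \<omega> \<equiv> (\<lambda>i k. X i k \<omega>)"

section \<open>Concentration of the Gram matrix and of the noise\<close>

lemma gram_close_meas[measurable]: "{\<omega> \<in> space M. \<not> gram_close n p S T (dsg \<omega>) x} \<in> events"
proof -
  have f: "finite (forms p T)" by (simp add: forms_def)
  have m: "(\<lambda>\<omega>. fit p (dsg \<omega>) u i) \<in> borel_measurable M" if "i < n" for u i
    using lin_M[OF that, of u] by (simp add: lin_def[abs_def])
  have "{\<omega> \<in> space M. \<not> gram_close n p S T (dsg \<omega>) x}
    = (\<Union>u\<in>forms p T. \<Union>v\<in>forms p T. {\<omega> \<in> space M. \<not> \<bar>(\<Sum>i<n. fit p (dsg \<omega>) u i * fit p (dsg \<omega>) v i) / n - bil p S u v\<bar> \<le> x})"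
    by (auto simp: gram_close_def)
  also have "\<dots> \<in> events" using m f by (intro sets.finite_UN) (auto intro!: borel_measurable_sum)
  finally show ?thesis .
qed

lemma prob_not_gram_close:
  assumes x: "0 \<le> x" "x \<le> 2 * a * B"
  shows "prob {\<omega> \<in> space M. \<not> gram_close n p S T (dsg \<omega>) x} \<le> 8 * (real p)\<^sup>2 * exp (- real n * x\<^sup>2 / (4 * (B * K\<^sup>2)))"
proof -
  let ?e = "exp (- real n * x\<^sup>2 / (4 * (B * K\<^sup>2)))"
  let ?A = "\<lambda>u v. {\<omega> \<in> space M. real n * x \<le> \<bar>\<Sum>i<n. lin p X u i \<omega> * lin p X v i \<omega> - bil p S u v\<bar>}"
  have f: "finite (forms p T)" by (simp add: forms_def)
  have K0: "0 < K" using K by simp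
  have each: "prob (?A u v) \<le> 2 * ?e" if u: "u \<in> forms p T" and v: "v \<in> forms p T" for u v
  proof (rule Bernstein_inequality)
    fix i assume i: "i < n"
    show "(\<lambda>\<omega>. lin p X u i \<omega> * lin p X v i \<omega> - bil p S u v) \<in> borel_measurable (G i)"
      using lin_meas[OF i] by measurable
    fix t :: real assume t: "\<bar>t\<bar> \<le> a / K\<^sup>2"
    have m: "(\<lambda>\<omega>. lin p X u i \<omega> * lin p X v i \<omega>) \<in> borel_measurable M" using lin_M[OF i] by measurable
    show "integrable M (\<lambda>\<omega>. exp (t * (lin p X u i \<omega> * lin p X v i \<omega> - bil p S u v)))"
      "expectation (\<lambda>\<omega>. exp (t * (lin p X u i \<omega> * lin p X v i \<omega> - bil p S u v))) \<le> exp (B * K\<^sup>2 * t\<^sup>2)"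
      using centered_mgf_le[OF m M1_int[OF u v i] M1[OF u v i] t] lin_lin(2)[OF i, of u v] by auto
  qed (use x B K0 in \<open>auto simp: mult_ac\<close>)
  have meas: "?A u v \<in> events" for u v
    using lin_M by (intro borel_measurable_le borel_measurable_abs borel_measurable_sum
      borel_measurable_diff borel_measurable_times borel_measurable_const) auto
  have "{\<omega> \<in> space M. \<not> gram_close n p S T (dsg \<omega>) x} \<subseteq> (\<Union>uv\<in>forms p T \<times> forms p T. ?A (fst uv) (snd uv))"
  proof
    fix \<omega> assume "\<omega> \<in> {\<omega> \<in> space M. \<not> gram_close n p S T (dsg \<omega>) x}"
    then obtain u v where \<omega>: "\<omega> \<in> space M" and u: "u \<in> forms p T" and v: "v \<in> forms p T"
      and gt: "x < \<bar>(\<Sum>i<n. lin p X u i \<omega> * lin p X v i \<omega>) / n - bil p S u v\<bar>"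
      by (auto simp: gram_close_def lin_def not_le)
    have "(\<Sum>i<n. lin p X u i \<omega> * lin p X v i \<omega> - bil p S u v) = n * ((\<Sum>i<n. lin p X u i \<omega> * lin p X v i \<omega>) / n - bil p S u v)"
      using n by (simp add: sum_subtractf field_simps)
    then have "\<bar>\<Sum>i<n. lin p X u i \<omega> * lin p X v i \<omega> - bil p S u v\<bar> = n * \<bar>(\<Sum>i<n. lin p X u i \<omega> * lin p X v i \<omega>) / n - bil p S u v\<bar>"
      by (simp add: abs_mult)
    then have "\<omega> \<in> ?A u v" using gt \<omega> by (simp add: mult_left_mono)
    then show "\<omega> \<in> (\<Union>uv\<in>forms p T \<times> forms p T. ?A (fst uv) (snd uv))" using u v by force
  qed
  then have "prob {\<omega> \<in> space M. \<not> gram_close n p S T (dsg \<omega>) x} \<le> prob (\<Union>uv\<in>forms p T \<times> forms p T. ?A (fst uv) (snd uv))"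
    using f meas by (intro finite_measure_mono) auto
  also have "\<dots> \<le> (\<Sum>uv\<in>forms p T \<times> forms p T. prob (?A (fst uv) (snd uv)))"
    using f meas by (intro measure_UNION_le) auto
  also have "\<dots> \<le> (\<Sum>uv\<in>forms p T \<times> forms p T. 2 * ?e)" using each by (intro sum_mono) auto
  also have "\<dots> = real (card (forms p T) * card (forms p T)) * (2 * ?e)" by (simp add: card_cartesian_product)
  also have "\<dots> \<le> ((2 * real p) * (2 * real p)) * (2 * ?e)"
  proof -
    have "card (forms p T) \<le> card (unit_coef ` {..<p}) + card (eta_coef T ` {..<p})"
      unfolding forms_def by (rule card_Un_le)
    also have "\<dots> \<le> p + p" by (intro add_mono) (metis card_image_le card_lessThan finite_lessThan)+
    finally have "real (card (forms p T)) \<le> 2 * real p" by simp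
    then have "real (card (forms p T)) * real (card (forms p T)) \<le> (2 * real p) * (2 * real p)"
      by (intro mult_mono) auto
    then show ?thesis unfolding of_nat_mult by (intro mult_right_mono) auto
  qed
  finally show ?thesis by (simp add: power2_eq_square)
qed

text \<open>A variance proxy without \<open>K\<close>: the cubic remainder carries a factor
  \<open>K\<close>, but it is used only for arguments up to \<open>a / K\<close>, where the two
  cancel.\<close>

definition v1 where "v1 = (C0 * Cs + a * B) / 2"

lemma v1_pos: "0 < v1" using C0 cs a B by (simp add: v1_def add_pos_pos)

lemma prob_noise:
  assumes x: "0 \<le> x" "x \<le> 2 * v1 * (a / K)"
  shows "prob {\<omega> \<in> space M. \<exists>k<p. real n * x \<le> \<bar>\<Sum>i<n. X i k \<omega> * eps i \<omega>\<bar>} \<le> 2 * real p * exp (- real n * x\<^sup>2 / (4 * v1))"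
proof -
  let ?A = "\<lambda>k. {\<omega> \<in> space M. real n * x \<le> \<bar>\<Sum>i<n. lin p X (unit_coef k) i \<omega> * eps i \<omega>\<bar>}"
  have K0: "0 < K" using K by simp
  have each: "prob (?A k) \<le> 2 * exp (- real n * x\<^sup>2 / (4 * v1))" if k: "k < p" for k
  proof (rule Bernstein_inequality)
    fix i assume i: "i < n"
    let ?f = "\<lambda>\<omega>. lin p X (unit_coef k) i \<omega> * eps i \<omega>"
    have u: "unit_coef k \<in> forms p T" using k by (auto simp: forms_def)
    show "?f \<in> borel_measurable (G i)" using lin_meas[OF i] eps_G[OF i] by measurable
    fix t :: real assume t: "\<bar>t\<bar> \<le> a / K"
    show "integrable M (\<lambda>\<omega>. exp (t * ?f \<omega>))" by (rule integrable_mgf[OF M2[OF u i] t])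
    have var: "expectation (\<lambda>\<omega>. (?f \<omega>)\<^sup>2) = S k k * sig2"
      using lin_eps(3)[OF i, of "unit_coef k" "unit_coef k"] k by (simp add: power2_eq_square bil_unit_unit)
    have "norm ((\<integral>\<omega>. exp (complex_of_real t * complex_of_real (?f \<omega>)) \<partial>M) - (1 + (complex_of_real t)\<^sup>2 * (S k k * sig2) / 2))
        \<le> norm (complex_of_real t) ^ 3 * (B * K) / 2"
      using mgf_expansion(2)[OF M2[OF u i] lin_eps(2)[OF i] var, of "complex_of_real t"] t by simp
    moreover have "(\<integral>\<omega>. exp (complex_of_real t * complex_of_real (?f \<omega>)) \<partial>M) - (1 + (complex_of_real t)\<^sup>2 * (S k k * sig2) / 2)
        = complex_of_real (expectation (\<lambda>\<omega>. exp (t * ?f \<omega>)) - (1 + t\<^sup>2 * (S k k * sig2) / 2))"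
      using mgf_real_eq[OF integrable_mgf[OF M2[OF u i] t]] by simp
    ultimately have "\<bar>expectation (\<lambda>\<omega>. exp (t * ?f \<omega>)) - (1 + t\<^sup>2 * (S k k * sig2) / 2)\<bar> \<le> \<bar>t\<bar> ^ 3 * (B * K) / 2"
      by (simp only: norm_of_real)
    then have "expectation (\<lambda>\<omega>. exp (t * ?f \<omega>)) \<le> 1 + (t\<^sup>2 * (S k k * sig2) / 2 + \<bar>t\<bar> ^ 3 * (B * K) / 2)" by linarith
    also have "\<bar>t\<bar> ^ 3 * (B * K) / 2 \<le> t\<^sup>2 * (a / K) * (B * K) / 2"
    proof -
      have "\<bar>t\<bar> ^ 3 = t\<^sup>2 * \<bar>t\<bar>" by (simp add: power3_eq_cube power2_eq_square)
      also have "\<dots> \<le> t\<^sup>2 * (a / K)" using t by (intro mult_left_mono) auto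
      finally show ?thesis using B K0 by (intro divide_right_mono mult_right_mono) auto
    qed
    also have "t\<^sup>2 * (S k k * sig2) / 2 \<le> t\<^sup>2 * (C0 * Cs) / 2"
      using diag[OF k] cs C0 by (intro divide_right_mono mult_left_mono mult_mono) auto
    also have "1 + (t\<^sup>2 * (C0 * Cs) / 2 + t\<^sup>2 * (a / K) * (B * K) / 2) = 1 + v1 * t\<^sup>2"
      using K0 by (simp add: v1_def field_simps)
    also have "\<dots> \<le> exp (v1 * t\<^sup>2)" by (rule exp_ge_add_one_self)
    finally show "expectation (\<lambda>\<omega>. exp (t * ?f \<omega>)) \<le> exp (v1 * t\<^sup>2)" by simp
  qed (use x v1_pos in auto)
  have meas: "?A k \<in> events" for k
    using lin_M eps_meas by (intro borel_measurable_le borel_measurable_abs borel_measurable_sum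
      borel_measurable_times borel_measurable_const) auto
  have "{\<omega> \<in> space M. \<exists>k<p. real n * x \<le> \<bar>\<Sum>i<n. X i k \<omega> * eps i \<omega>\<bar>} = (\<Union>k<p. ?A k)"
    by (auto simp: lin_unit)
  then have "prob {\<omega> \<in> space M. \<exists>k<p. real n * x \<le> \<bar>\<Sum>i<n. X i k \<omega> * eps i \<omega>\<bar>} \<le> (\<Sum>k<p. prob (?A k))"
    using meas by (simp only:) (intro measure_UNION_le; auto)
  also have "\<dots> \<le> (\<Sum>k<p. 2 * exp (- real n * x\<^sup>2 / (4 * v1)))" using each by (intro sum_mono) auto
  finally show ?thesis by simp
qed

section \<open>Standardized scores and their correlations\<close>

definition kap where "kap = sqrt (1 / (c0 * cs))"
definition kj where "kj j = sqrt (T j j / sig2)"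
text \<open>The product of residual and error has variance \<open>sig2 / T j j\<close>, which
  \<open>kj\<close> normalizes to 1. \<open>kap\<close> is a bound on \<open>kj\<close> uniform in
  \<open>j\<close>; \<open>bx\<close> and \<open>Lx\<close> are the rate and the third moment after
  this scaling.\<close>

definition xi where "xi j i \<omega> = kj j * (lin p X (eta_coef T j) i \<omega> * eps i \<omega>)"
definition W where "W j \<omega> = (\<Sum>i<n. xi j i \<omega>) / sqrt n"
definition bx where "bx = a / K / kap"
definition Lx where "Lx = kap ^ 3 * (B * K)"

lemma kap_pos: "0 < kap" using c0 cs by (simp add: kap_def)

lemma bx_pos: "0 < bx" using a K kap_pos by (simp add: bx_def)

lemma Lx_nonneg: "0 \<le> Lx" using B K kap_pos by (simp add: Lx_def)

lemma kj_pos: "j < p \<Longrightarrow> 0 < kj j" using T_diag_pos sig2 by (simp add: kj_def)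

lemma kj_le: assumes "j < p" shows "\<bar>kj j\<bar> \<le> kap"
proof -
  have "T j j / sig2 \<le> (1 / c0) / cs" using T_diag_le[OF assms] cs c0 by (intro frac_le) auto
  then have "kj j \<le> kap" by (simp add: kj_def kap_def)
  then show ?thesis using kj_pos[OF assms] by simp
qed

lemma xi_G: "i < n \<Longrightarrow> xi j i \<in> borel_measurable (G i)"
  using lin_meas[of i] eps_G[of i] unfolding xi_def[abs_def] by measurable

lemma xi_moment: assumes "i < n" "j < p" shows "third_exp_moment bx Lx (xi j i)"
proof -
  have "eta_coef T j \<in> forms p T" using assms by (auto simp: forms_def)
  then show ?thesis
    using third_exp_moment_scale[OF M2[OF _ assms(1)] kj_le[OF assms(2)] kap_pos] a K
    by (simp add: xi_def[abs_def] bx_def Lx_def)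
qed

lemma xi_mean: "i < n \<Longrightarrow> expectation (xi j i) = 0"
  unfolding xi_def[abs_def] using lin_eps(2)[of i] by simp

text \<open>Residuals have covariance \<open>T j k / (T j j * T k k)\<close>. Standardization leaves
  the normalized entry of the precision matrix, so the Euclidean bounds on its rows control how many
  scores are strongly correlated.\<close>

lemma xi_cov:
  assumes i: "i < n" and j: "j < p" and k: "k < p"
  shows "expectation (\<lambda>\<omega>. xi j i \<omega> * xi k i \<omega>) = T j k / sqrt (T j j * T k k)"
    and "integrable M (\<lambda>\<omega>. xi j i \<omega> * xi k i \<omega>)"
proof -
  have eq: "xi j i \<omega> * xi k i \<omega> = (kj j * kj k) * ((lin p X (eta_coef T j) i \<omega> * eps i \<omega>) * (lin p X (eta_coef T k) i \<omega> * eps i \<omega>))" for \<omega>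
    by (simp add: xi_def)
  show "integrable M (\<lambda>\<omega>. xi j i \<omega> * xi k i \<omega>)" unfolding eq using lin_eps(4)[OF i] by simp
  have "expectation (\<lambda>\<omega>. xi j i \<omega> * xi k i \<omega>) = (kj j * kj k) * (eta_coef T j k / T k k * sig2)"
    unfolding eq using lin_eps(3)[OF i] by (simp add: bil_eta[OF k])
  also have "kj j * kj k = sqrt (T j j * T k k) / sig2"
    using sig2 by (simp add: kj_def real_sqrt_mult real_sqrt_divide)
  also have "sqrt (T j j * T k k) / sig2 * (eta_coef T j k / T k k * sig2)
      = T j k * sqrt (T j j * T k k) / (T j j * T k k)"
    using sig2 by (simp add: eta_coef_def)
  also have "\<dots> = T j k / sqrt (T j j * T k k)"
  proof -
    define w where "w = sqrt (T j j * T k k)"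
    have w: "0 < w" "T j j * T k k = w * w" using T_diag_pos[OF j] T_diag_pos[OF k] by (auto simp: w_def)
    show ?thesis unfolding w_def[symmetric] using w by simp
  qed
  finally show "expectation (\<lambda>\<omega>. xi j i \<omega> * xi k i \<omega>) = T j k / sqrt (T j j * T k k)" .
qed

lemma xi_var: "i < n \<Longrightarrow> j < p \<Longrightarrow> expectation (\<lambda>\<omega>. (xi j i \<omega>)\<^sup>2) = 1"
  using xi_cov(1)[of i j j] T_diag_pos[of j] by (simp add: power2_eq_square)

lemma W_meas[measurable]: "W j \<in> borel_measurable M"
  unfolding W_def[abs_def] using measurable_G[OF _ xi_G] by measurable

lemma W_tail:
  assumes j: "j < p" and x: "1 \<le> x" "2 * x / sqrt n \<le> bx" "2 * x / sqrt n \<le> 1"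
  shows "prob {\<omega> \<in> space M. x \<le> \<bar>W j \<omega>\<bar>} \<le> 2 * (exp (8 * (2 * x) ^ 3 * (Lx / 2 + 32) / sqrt n - x\<^sup>2 / 2) * (5 / sqrt x))"
proof -
  let ?b = "exp (8 * (2 * x) ^ 3 * (Lx / 2 + 32) / sqrt n - x\<^sup>2 / 2) * (5 / sqrt x)"
  have 1: "prob {\<omega> \<in> space M. x \<le> (\<Sum>i<n. xi j i \<omega>) / sqrt n} \<le> ?b"
    by (rule sum_tail[OF n xi_G xi_moment xi_mean xi_var Lx_nonneg x]) (use j in auto)
  have neg: "third_exp_moment bx Lx (\<lambda>\<omega>. - xi j i \<omega>)" if "i < n" for i
    using xi_moment[OF that j] by (simp add: third_exp_moment_def)
  have 2: "prob {\<omega> \<in> space M. x \<le> (\<Sum>i<n. - xi j i \<omega>) / sqrt n} \<le> ?b"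
    by (rule sum_tail[OF n _ neg _ _ Lx_nonneg x])
      (use xi_G xi_mean xi_var j in \<open>auto intro: borel_measurable_uminus\<close>)
  have [measurable]: "xi j i \<in> borel_measurable M" if "i < n" for i using measurable_G[OF that xi_G[OF that]] .
  have "prob {\<omega> \<in> space M. x \<le> \<bar>W j \<omega>\<bar>} \<le> prob ({\<omega> \<in> space M. x \<le> (\<Sum>i<n. xi j i \<omega>) / sqrt n}
      \<union> {\<omega> \<in> space M. x \<le> (\<Sum>i<n. - xi j i \<omega>) / sqrt n})"
    by (intro finite_measure_mono) (auto simp: W_def sum_negf abs_if split: if_splits)
  also have "\<dots> \<le> prob {\<omega> \<in> space M. x \<le> (\<Sum>i<n. xi j i \<omega>) / sqrt n}
      + prob {\<omega> \<in> space M. x \<le> (\<Sum>i<n. - xi j i \<omega>) / sqrt n}"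
    by (rule measure_Un_le) auto
  finally show ?thesis using 1 2 by linarith
qed

text \<open>The worst errors come from sums of two scores: their third moment is bounded by
  \<open>16 * Lx\<close> at half the rate \<open>bx\<close>. The factor 128 is this 16 times the 8
  of the moment generating function bound, and the limit on \<open>y\<close> is
  \<open>bx / 2\<close> for the same reason.\<close>

lemma W_max_lower:
  assumes J: "J \<subseteq> {..<p}" "J \<noteq> {}"
    and rho: "\<And>j k. j \<in> J \<Longrightarrow> k \<in> J \<Longrightarrow> j \<noteq> k \<Longrightarrow> T j k / sqrt (T j j * T k k) \<le> e"
    and xly: "0 \<le> x" "x < l" "l < y" and y: "y / sqrt n \<le> bx / 2" "y / sqrt n \<le> 1"
    and small: "(y / sqrt n) ^ 3 * (Lx / 2 + 32) \<le> 1 / 2"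
    and R: "128 * y ^ 3 * (Lx / 2 + 32) / sqrt n \<le> R"
  shows "prob {\<omega> \<in> space M. \<forall>j\<in>J. W j \<omega> \<le> x}
    \<le> exp (l\<^sup>2 * e + R) + exp (l * y - l\<^sup>2 / 2 + R) / card J
      - 2 * (exp (- R) - exp (R - (l - x)\<^sup>2 / 2) - exp (R - (y - l)\<^sup>2 / 2)) + 1"
proof (rule max_lower_bound)
  have fin: "finite J" using J finite_subset by blast
  have sn: "0 < sqrt n" using n by simp
  have sn3: "n / (sqrt n) ^ 3 = 1 / sqrt n" using sn by (simp add: power3_eq_cube field_simps)
  have Lp: "0 \<le> Lx / 2 + 32" using Lx_nonneg by simp
  have nR: "n * (c * (s / sqrt n) ^ 3 * (Lx / 2 + 32)) \<le> R" if "0 \<le> s" "s \<le> y" "0 \<le> c" "c \<le> 128" for c s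
  proof -
    have "n * (c * (s / sqrt n) ^ 3 * (Lx / 2 + 32)) = c * s ^ 3 * (Lx / 2 + 32) * (n / (sqrt n) ^ 3)"
      by (simp add: power_divide)
    also have "\<dots> = c * s ^ 3 * (Lx / 2 + 32) / sqrt n" unfolding sn3 by simp
    also have "\<dots> \<le> 128 * y ^ 3 * (Lx / 2 + 32) / sqrt n"
      using that Lp by (intro divide_right_mono mult_right_mono mult_mono power_mono) auto
    also note R
    finally show ?thesis .
  qed
  have nsq: "n * ((s / sqrt n)\<^sup>2 * c) = s\<^sup>2 * c" for s c using n by (simp add: power_divide)
  have tb: "\<bar>s / sqrt n\<bar> \<le> bx" "\<bar>s / sqrt n\<bar> \<le> bx / 2" "\<bar>s / sqrt n\<bar> \<le> 1" if "0 \<le> s" "s \<le> y" for s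
  proof -
    have "\<bar>s / sqrt n\<bar> \<le> y / sqrt n" using that sn by (simp add: divide_right_mono)
    then show "\<bar>s / sqrt n\<bar> \<le> bx" "\<bar>s / sqrt n\<bar> \<le> bx / 2" "\<bar>s / sqrt n\<bar> \<le> 1" using y bx_pos by linarith+
  qed
  have sW: "s * W j \<omega> = (s / sqrt n) * (\<Sum>i<n. xi j i \<omega>)" for s j \<omega> by (simp add: W_def)
  show "finite J" "J \<noteq> {}" "x < l" "l < y" "0 \<le> x" using fin J xly by auto
  show "W j \<in> borel_measurable M" for j by measurable
  fix j assume jJ: "j \<in> J"
  then have j: "j < p" using J by auto
  have mom: "third_exp_moment bx Lx (xi j i)" "expectation (\<lambda>\<omega>. (xi j i \<omega>)\<^sup>2) = 1" if "i < n" for i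
    using xi_moment xi_var that j by auto
  {
    fix s assume "s \<in> {x, l, y}"
    then have s: "0 \<le> s" "s \<le> y" using xly by auto
    show "integrable M (\<lambda>\<omega>. exp (s * W j \<omega>))"
      unfolding sW by (rule mgf_sum_real(1)[OF xi_G mom(1) tb(1)[OF s]])
    have "expectation (\<lambda>\<omega>. exp (s * W j \<omega>)) \<le> exp (n * ((s / sqrt n)\<^sup>2 * 1 / 2 + 8 * \<bar>s / sqrt n\<bar> ^ 3 * (Lx / 2 + 32)))"
      unfolding sW by (rule mgf_sum_upper[OF xi_G mom(1) xi_mean mom(2) _ _ Lx_nonneg tb(1)[OF s] tb(3)[OF s]]) auto
    also have "\<dots> \<le> exp (s\<^sup>2 / 2 + R)"
      using nR[OF s, of 8] nsq[of s "1 / 2"] s sn by (simp add: distrib_left)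
    finally show "expectation (\<lambda>\<omega>. exp (s * W j \<omega>)) \<le> exp (s\<^sup>2 / 2 + R)" .
  }
  have l: "0 \<le> l" "l \<le> y" using xly by auto
  have sml: "\<bar>l / sqrt n\<bar> ^ 3 * (Lx / 2 + 32) \<le> 1 / 2"
  proof -
    have "\<bar>l / sqrt n\<bar> ^ 3 * (Lx / 2 + 32) \<le> (y / sqrt n) ^ 3 * (Lx / 2 + 32)"
      using l sn Lp by (intro mult_right_mono power_mono) (auto intro: divide_right_mono)
    then show ?thesis using small by linarith
  qed
  have "exp (l\<^sup>2 / 2 - R) \<le> exp (n * ((l / sqrt n)\<^sup>2 / 2 - 2 * (\<bar>l / sqrt n\<bar> ^ 3 * (Lx / 2 + 32))))"
    using nR[OF l, of 2] nsq[of l "1 / 2"] l sn by (simp add: right_diff_distrib mult.assoc)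
  also have "\<dots> \<le> expectation (\<lambda>\<omega>. exp (l * W j \<omega>))"
    unfolding sW by (rule mgf_sum_lower[OF xi_G mom(1) xi_mean mom(2) Lx_nonneg tb(1)[OF l] tb(3)[OF l] sml])
  finally show "exp (l\<^sup>2 / 2 - R) \<le> expectation (\<lambda>\<omega>. exp (l * W j \<omega>))" .
  fix k assume kJ: "k \<in> J" and jk: "j \<noteq> k"
  then have k: "k < p" using J by auto
  let ?r = "T j k / sqrt (T j j * T k k)"
  have int2: "integrable M (\<lambda>\<omega>. (xi m i \<omega>)\<^sup>2)" if "i < n" "m < p" for m i
    using xi_cov(2)[OF that that(2)] by (simp add: power2_eq_square)
  have var2: "expectation (\<lambda>\<omega>. (xi j i \<omega> + xi k i \<omega>)\<^sup>2) = 2 + 2 * ?r" if i: "i < n" for i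
  proof -
    have "expectation (\<lambda>\<omega>. (xi j i \<omega> + xi k i \<omega>)\<^sup>2) = expectation (\<lambda>\<omega>. (xi j i \<omega>)\<^sup>2 + (xi k i \<omega>)\<^sup>2 + 2 * (xi j i \<omega> * xi k i \<omega>))"
      by (simp add: power2_sum mult.assoc)
    also have "\<dots> = 1 + 1 + 2 * ?r"
      using int2[OF i j] int2[OF i k] xi_cov[OF i j k] xi_var[OF i j] xi_var[OF i k] by simp
    finally show ?thesis by simp
  qed
  have "0 \<le> expectation (\<lambda>\<omega>. (xi j 0 \<omega> + xi k 0 \<omega>)\<^sup>2)" by (intro integral_nonneg_AE) auto
  then have v0: "0 \<le> 2 + 2 * ?r" using var2[OF n] by simp
  \<comment> \<open>The variance of a sum of two scores is at most 4 because the variance of their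
    difference is nonnegative.\<close>
  have v4: "2 + 2 * ?r \<le> 4"
  proof -
    have "expectation (\<lambda>\<omega>. (xi j 0 \<omega> - xi k 0 \<omega>)\<^sup>2) = expectation (\<lambda>\<omega>. (xi j 0 \<omega>)\<^sup>2 + (xi k 0 \<omega>)\<^sup>2 - 2 * (xi j 0 \<omega> * xi k 0 \<omega>))"
      by (simp add: power2_diff mult.assoc)
    also have "\<dots> = 1 + 1 - 2 * ?r"
      using int2[OF n j] int2[OF n k] xi_cov[OF n j k] xi_var[OF n j] xi_var[OF n k] by simp
    moreover have "0 \<le> expectation (\<lambda>\<omega>. (xi j 0 \<omega> - xi k 0 \<omega>)\<^sup>2)" by (intro integral_nonneg_AE) auto
    ultimately show ?thesis by simp
  qed
  have mom2: "third_exp_moment (bx / 2) (16 * Lx) (\<lambda>\<omega>. xi j i \<omega> + xi k i \<omega>)" if "i < n" for i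
    by (rule third_exp_moment_add) (use xi_moment[OF that j] xi_moment[OF that k] bx_pos in auto)
  have m2: "(\<lambda>\<omega>. xi j i \<omega> + xi k i \<omega>) \<in> borel_measurable (G i)" if "i < n" for i
    using xi_G[OF that] by measurable
  have int1: "integrable M (xi m i)" if "i < n" "m < p" for m i
    using third_exp_moment_integrable_power(2)[OF xi_moment[OF that], of 1] bx_pos by simp
  have mean2: "expectation (\<lambda>\<omega>. xi j i \<omega> + xi k i \<omega>) = 0" if "i < n" for i
    using int1[OF that j] int1[OF that k] xi_mean[OF that] by simp
  have sW2: "l * (W j \<omega> + W k \<omega>) = (l / sqrt n) * (\<Sum>i<n. xi j i \<omega> + xi k i \<omega>)" for \<omega>
    by (simp add: W_def sum.distrib algebra_simps add_divide_distrib)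
  show "integrable M (\<lambda>\<omega>. exp (l * (W j \<omega> + W k \<omega>)))"
    unfolding sW2 by (rule mgf_sum_real(1)[OF m2 mom2 tb(2)[OF l]])
  have "expectation (\<lambda>\<omega>. exp (l * (W j \<omega> + W k \<omega>)))
      \<le> exp (n * ((l / sqrt n)\<^sup>2 * (2 + 2 * ?r) / 2 + 8 * \<bar>l / sqrt n\<bar> ^ 3 * (16 * Lx / 2 + 32)))"
    unfolding sW2 using Lx_nonneg
    by (intro mgf_sum_upper[OF m2 mom2 mean2 var2 v0 v4 _ tb(2)[OF l] tb(3)[OF l]]) auto
  also have "\<dots> \<le> exp (l\<^sup>2 * (1 + e) + R)"
  proof -
    have "n * (8 * \<bar>l / sqrt n\<bar> ^ 3 * (16 * Lx / 2 + 32)) \<le> n * (8 * \<bar>l / sqrt n\<bar> ^ 3 * (16 * (Lx / 2 + 32)))"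
      by (intro mult_left_mono) auto
    also have "\<dots> = n * (128 * (l / sqrt n) ^ 3 * (Lx / 2 + 32))" using l sn by (simp add: algebra_simps)
    also have "\<dots> \<le> R" using nR[OF l, of 128] by simp
    finally have 1: "n * (8 * \<bar>l / sqrt n\<bar> ^ 3 * (16 * Lx / 2 + 32)) \<le> R" .
    have "n * ((l / sqrt n)\<^sup>2 * (2 + 2 * ?r) / 2) = l\<^sup>2 * (1 + ?r)"
    proof -
      have e: "z * (2 + 2 * r) / 2 = z * (1 + r)" for z r :: real by (simp add: distrib_left)
      show ?thesis unfolding e by (rule nsq)
    qed
    also have "\<dots> \<le> l\<^sup>2 * (1 + e)" using rho[OF jJ kJ jk] by (intro mult_left_mono) auto
    finally have 2: "n * ((l / sqrt n)\<^sup>2 * (2 + 2 * ?r) / 2) \<le> l\<^sup>2 * (1 + e)" .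
    show ?thesis unfolding exp_le_cancel_iff distrib_left[of "real n"] by (rule add_mono[OF 2 1])
  qed
  finally show "expectation (\<lambda>\<omega>. exp (l * (W j \<omega> + W k \<omega>))) \<le> exp (l\<^sup>2 * (1 + e) + R)" .
qed

end

section \<open>Exact recovery at a fixed sample size\<close>

text \<open>\<open>dG\<close> and \<open>dE\<close> bound the deviations of the Gram matrix and of the noise, and \<open>d\<close> the relative
  errors of \<open>omega_hat\<close> (\<open>d_gram\<close>) and of the debiased estimator (\<open>d_rem\<close>).\<close>

locale regression_estimators = regression_moments +
  fixes lam lN s s0 dG dE d :: real
    and bhat :: "real vec \<Rightarrow> real mat \<Rightarrow> real vec" and ghat :: "nat \<Rightarrow> real mat \<Rightarrow> real vec"
    and sig2hat :: "real vec \<Rightarrow> real mat \<Rightarrow> real"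
  assumes bhat: "is_lasso M n p X eps lam bhat"
    and ghat: "is_nodewise_lasso M n p X (\<lambda>_. lN) ghat"
    and sig2hat: "is_variance_estimator M n p X eps sig2hat"
    and lam: "0 < lam" and lN: "0 < lN" and dG: "0 \<le> dG" "dG \<le> lN / 2" and dE: "0 \<le> dE" "dE \<le> lam / 2"
    and s: "\<And>j. j < p \<Longrightarrow> real (row_sparsity p \<Theta> j) \<le> s" and sd: "32 * s * dG \<le> c0"
    and s0d: "32 * s0 * dG \<le> c0"
    and d: "0 < d" "d \<le> 1 / 8"
    and d_gram: "dG + 64 * s * lN\<^sup>2 / c0 \<le> d * c0"
    and d_rem: "32 * lN * (s * dE + s0 * lam) / c0 \<le> d * sqrt (2 * ln p / n) * sqrt (cs * c0)"
begin

abbreviation Y where "Y \<beta> \<omega> \<equiv> response n p X eps \<beta> \<omega>"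
abbreviation DX where "DX \<omega> \<equiv> design n p X \<omega>"
abbreviation bb where "bb \<beta> \<omega> j \<equiv> desparsified n p (\<lambda>_. lN) bhat ghat (Y \<beta> \<omega>) (DX \<omega>) $ j"
abbreviation om where "om \<beta> \<omega> j \<equiv> omega_hat n p (\<lambda>_. lN) ghat sig2hat (Y \<beta> \<omega>) (DX \<omega>) j"
abbreviation recovered where
  "recovered \<tau> \<beta> \<omega> \<equiv> S_hat n p (\<lambda>_. lN) bhat ghat sig2hat \<tau> (Y \<beta> \<omega>) (DX \<omega>) = supp \<beta>"

lemma DX_carrier[simp]: "DX \<omega> \<in> carrier_mat n p" and Y_carrier[simp]: "Y \<beta> \<omega> \<in> carrier_vec n"
  by (simp add: design_def) (intro carrier_vecI, simp add: response_def)

lemma DX_entry: "i < n \<Longrightarrow> k < p \<Longrightarrow> DX \<omega> $$ (i, k) = X i k \<omega>"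
  by (simp add: design_def)

lemma fit_DX: "i < n \<Longrightarrow> fit p (\<lambda>i k. DX \<omega> $$ (i, k)) h i = fit p (dsg \<omega>) h i"
  by (simp add: fit_def DX_entry)

lemma Y_entry: "i < n \<Longrightarrow> \<beta> \<in> carrier_vec p \<Longrightarrow> Y \<beta> \<omega> $ i = fit p (dsg \<omega>) (\<lambda>k. \<beta> $ k) i + eps i \<omega>"
  by (simp add: response_def fit_def scalar_prod_def lessThan_atLeast0 design_def)

lemma objective_DX: "objective n p l y (\<lambda>i k. DX \<omega> $$ (i, k)) h = objective n p l y (dsg \<omega>) h"
  unfolding objective_def by (simp add: fit_DX)

lemma objective_cong: "(\<And>i. i < n \<Longrightarrow> y i = y' i) \<Longrightarrow> objective n p l y x h = objective n p l y' x h"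
  unfolding objective_def by simp

lemma bhat_carrier: "bhat (Y \<beta> \<omega>) (DX \<omega>) \<in> carrier_vec p"
  using bhat unfolding is_lasso_def is_arg_min_def by (meson DX_carrier Y_carrier)

lemma ghat_without: "j < p \<Longrightarrow> ghat j (DX \<omega>) \<in> without p j"
  using ghat unfolding is_nodewise_lasso_def is_arg_min_def by (meson DX_carrier)

definition tj where "tj \<omega> j = tau_hat_sq n (\<lambda>_. lN) ghat (DX \<omega>) j"
definition rj where "rj \<omega> j i = X i j \<omega> - fit p (dsg \<omega>) (\<lambda>k. ghat j (DX \<omega>) $ k) i"

lemma tj_eq: assumes "j < p" shows "tj \<omega> j = (\<Sum>i<n. (rj \<omega> j i)\<^sup>2) / n + lN * (\<Sum>k<p. \<bar>ghat j (DX \<omega>) $ k\<bar>)"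
proof -
  have g: "ghat j (DX \<omega>) \<in> carrier_vec p" using ghat_without[OF assms] by (simp add: without_def)
  have "(col (DX \<omega>) j - DX \<omega> *\<^sub>v ghat j (DX \<omega>)) $ i = rj \<omega> j i" if "i < n" for i
    using that g assms by (simp add: rj_def fit_def scalar_prod_def lessThan_atLeast0 design_def)
  then show ?thesis using g
    by (simp add: tj_def tau_hat_sq_def sq_l2_def l1_def scalar_prod_def lessThan_atLeast0 power2_eq_square design_def)
qed

lemma fit_Theta: assumes "j < p" "i < n"
  shows "fit p (\<lambda>i k. DX \<omega> $$ (i, k)) (\<lambda>k. Theta_hat n p (\<lambda>_. lN) ghat (DX \<omega>) $$ (j, k)) i = rj \<omega> j i / tj \<omega> j"
proof -
  have "ghat j (DX \<omega>) $ j = 0" using ghat_without[OF assms(1)] by (simp add: without_def)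
  then show ?thesis
    using fit_Theta_hat_row[of j p ghat "DX \<omega>" n "\<lambda>_. lN" i] assms
    by (simp add: rj_def tj_def fit_DX DX_entry divide_inverse mult.commute)
qed

lemma om_eq: assumes "j < p"
  shows "om \<beta> \<omega> j = sig2hat (Y \<beta> \<omega>) (DX \<omega>) * ((\<Sum>i<n. (rj \<omega> j i)\<^sup>2) / n) / (tj \<omega> j)\<^sup>2"
proof -
  have "om \<beta> \<omega> j = sig2hat (Y \<beta> \<omega>) (DX \<omega>) * ((\<Sum>i<n. (rj \<omega> j i / tj \<omega> j)\<^sup>2) / n)"
    unfolding omega_hat_entry[OF DX_carrier assms] using fit_Theta[OF assms] by simp
  then show ?thesis by (simp add: power_divide sum_divide_distrib[symmetric])
qed

lemma bb_eq: assumes "j < p" "\<beta> \<in> carrier_vec p"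
  shows "bb \<beta> \<omega> j = bhat (Y \<beta> \<omega>) (DX \<omega>) $ j
    + (\<Sum>i<n. rj \<omega> j i * (fit p (dsg \<omega>) (\<lambda>k. \<beta> $ k) i + eps i \<omega> - fit p (dsg \<omega>) (\<lambda>k. bhat (Y \<beta> \<omega>) (DX \<omega>) $ k) i)) / n / tj \<omega> j"
proof -
  let ?e = "\<lambda>i. Y \<beta> \<omega> $ i - fit p (\<lambda>i k. DX \<omega> $$ (i, k)) (\<lambda>k. bhat (Y \<beta> \<omega>) (DX \<omega>) $ k) i"
  have "bb \<beta> \<omega> j = bhat (Y \<beta> \<omega>) (DX \<omega>) $ j
    + (\<Sum>k<p. Theta_hat n p (\<lambda>_. lN) ghat (DX \<omega>) $$ (j, k) * (\<Sum>i<n. DX \<omega> $$ (i, k) * ?e i)) / n"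
    by (rule desparsified_entry[of "Y \<beta> \<omega>" n "DX \<omega>" p bhat j "\<lambda>_. lN" ghat,
        OF Y_carrier DX_carrier bhat_carrier assms(1)])
  also have "(\<Sum>k<p. Theta_hat n p (\<lambda>_. lN) ghat (DX \<omega>) $$ (j, k) * (\<Sum>i<n. DX \<omega> $$ (i, k) * ?e i))
      = (\<Sum>i<n. ?e i * fit p (\<lambda>i k. DX \<omega> $$ (i, k)) (\<lambda>k. Theta_hat n p (\<lambda>_. lN) ghat (DX \<omega>) $$ (j, k)) i)"
    by (rule sum_mult_fit[symmetric])
  also have "\<dots> = (\<Sum>i<n. rj \<omega> j i * (fit p (dsg \<omega>) (\<lambda>k. \<beta> $ k) i + eps i \<omega> - fit p (dsg \<omega>) (\<lambda>k. bhat (Y \<beta> \<omega>) (DX \<omega>) $ k) i) / tj \<omega> j)"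
    using assms by (intro sum.cong refl) (simp add: fit_Theta fit_DX Y_entry mult.commute)
  also have "\<dots> = (\<Sum>i<n. rj \<omega> j i * (fit p (dsg \<omega>) (\<lambda>k. \<beta> $ k) i + eps i \<omega> - fit p (dsg \<omega>) (\<lambda>k. bhat (Y \<beta> \<omega>) (DX \<omega>) $ k) i)) / tj \<omega> j"
    by (rule sum_divide_distrib[symmetric])
  finally show ?thesis by simp
qed

definition good where
  "good \<beta> \<omega> \<longleftrightarrow> gram_close n p S T (dsg \<omega>) dG \<and> (\<forall>k<p. \<bar>\<Sum>i<n. X i k \<omega> * eps i \<omega>\<bar> < real n * dE)
    \<and> \<bar>sig2hat (Y \<beta> \<omega>) (DX \<omega>) - sig2\<bar> \<le> d * cs"

text \<open>The standard deviation of the average of residual times error, so that this average is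
  \<open>W j \<omega> * uj j\<close>. It is the unit in which all deviations below are
  measured.\<close>

definition uj where "uj j = sqrt (sig2 / T j j) / sqrt n"

lemma uj_pos: "j < p \<Longrightarrow> 0 < uj j" using T_diag_pos[of j] sig2 n by (simp add: uj_def)

lemma uj_sqrt: "sqrt n * uj j = sqrt (sig2 / T j j)" using n by (simp add: uj_def)

lemma nodewise_locale:
  assumes "good \<beta> \<omega>" "j < p"
  shows "nodewise_regression p (\<lambda>j k. \<Sigma> $$ (j, k)) (\<lambda>j k. \<Theta> $$ (j, k)) c0 C0 n j (dsg \<omega>) (\<lambda>k. ghat j (DX \<omega>) $ k) lN dG s"
proof
  show "ghat j (DX \<omega>) $ j = 0" using ghat_without[OF assms(2)] by (simp add: without_def)
  show "gram_close n p S T (dsg \<omega>) dG" using assms(1) by (simp add: good_def)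
  show "real (card {k. k < p \<and> k \<noteq> j \<and> T j k \<noteq> 0}) \<le> s" using s[OF assms(2)] by (simp add: row_sparsity_def)
  fix h :: "nat \<Rightarrow> real" assume h: "h j = 0"
  have am: "is_arg_min (lasso_objective n lN (col (DX \<omega>) j) (DX \<omega>)) (\<lambda>g. g \<in> without p j) (ghat j (DX \<omega>))"
    using ghat assms(2) by (simp add: is_nodewise_lasso_def)
  have c: "col (DX \<omega>) j \<in> carrier_vec n" by (simp add: carrier_vecI design_def)
  have y: "col (DX \<omega>) j $ i = X i j \<omega>" if "i < n" for i using that assms(2) by (simp add: design_def)
  have "objective n p lN (\<lambda>i. col (DX \<omega>) j $ i) (\<lambda>i k. DX \<omega> $$ (i, k)) (\<lambda>k. ghat j (DX \<omega>) $ k)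
      \<le> objective n p lN (\<lambda>i. col (DX \<omega>) j $ i) (\<lambda>i k. DX \<omega> $$ (i, k)) h"
    by (rule is_arg_min_objective[OF am _ c DX_carrier]) (use h assms(2) in \<open>auto simp: without_def\<close>)
  then show "objective n p lN (\<lambda>i. X i j \<omega>) (dsg \<omega>) (\<lambda>k. ghat j (DX \<omega>) $ k) \<le> objective n p lN (\<lambda>i. X i j \<omega>) (dsg \<omega>) h"
    unfolding objective_DX by (simp add: y cong: objective_cong)
qed (use n assms lN dG sd in auto)

text \<open>The bounds concern tau times the estimator and tau times its standard error, where tau
  has cancelled; only its positivity matters when comparing the two. The last bound leaves this
  scale, as the signal in \<open>Psi\<close> is measured by the true
  \<open>sqrt (sig2 * T j j)\<close>.\<close>

lemma good_bounds:
  assumes g: "good \<beta> \<omega>" and \<beta>: "\<beta> \<in> carrier_vec p" "real (card (supp \<beta>)) \<le> s0" and j: "j < p"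
  shows "0 < tj \<omega> j"
    and "\<bar>tj \<omega> j * (bb \<beta> \<omega> j - \<beta> $ j) - W j \<omega> * uj j\<bar> \<le> d * sqrt 2 * sqrt (ln p) * uj j"
    and "(1 - d) * (sqrt n * uj j) \<le> tj \<omega> j * sqrt (om \<beta> \<omega> j)"
    and "tj \<omega> j * sqrt (om \<beta> \<omega> j) \<le> (1 + d) * (sqrt n * uj j)"
    and "sqrt (om \<beta> \<omega> j) * (1 - d) \<le> (1 + d) * sqrt (sig2 * T j j)"
proof -
  interpret N: nodewise_regression p "\<lambda>j k. \<Sigma> $$ (j, k)" "\<lambda>j k. \<Theta> $$ (j, k)" c0 C0 n j "dsg \<omega>" "\<lambda>k. ghat j (DX \<omega>) $ k" lN dG s
    by (rule nodewise_locale[OF g j])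
  have r: "N.r i = rj \<omega> j i" for i by (simp add: N.r_def rj_def)
  have t2: "N.t2 = tj \<omega> j" by (simp add: N.t2_def N.q2_def tj_eq[OF j] r)
  let ?q = "N.q2" and ?T = "T j j"
  have T: "0 < ?T" "?T \<le> 1 / c0" using T_diag_pos[OF j] T_diag_le[OF j] by auto
  have cT: "c0 \<le> 1 / ?T" using T c0 by (simp add: field_simps)
  have q: "\<bar>?q - 1 / ?T\<bar> \<le> d * (1 / ?T)"
    using N.q2_close d_gram mult_left_mono[OF cT, of d] d by linarith
  have ql: "(1 - d) * (1 / ?T) \<le> ?q" and qu: "?q \<le> (1 + d) * (1 / ?T)"
    unfolding left_diff_distrib distrib_right mult_1_left using q by linarith+
  have d1: "0 < 1 - d" using d by simp
  have "0 < (1 - d) * (1 / ?T)" using T d1 by simp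
  with ql have q0: "0 < ?q" by linarith
  have tq: "?q \<le> tj \<omega> j" using N.t2_ge t2 by simp
  show t0: "0 < tj \<omega> j" using tq q0 by linarith
  let ?s = "sig2hat (Y \<beta> \<omega>) (DX \<omega>)"
  have "d * cs \<le> d * sig2" using cs d by (intro mult_left_mono) auto
  moreover have "\<bar>?s - sig2\<bar> \<le> d * cs" using g by (simp add: good_def)
  ultimately have "\<bar>?s - sig2\<bar> \<le> d * sig2" by linarith
  then have sl: "(1 - d) * sig2 \<le> ?s" and su: "?s \<le> (1 + d) * sig2" by (auto simp: abs_le_iff algebra_simps)
  have "0 < (1 - d) * sig2" using sig2 d1 by simp
  with sl have s2: "0 < ?s" by linarith
  have om: "om \<beta> \<omega> j = ?s * ?q / (tj \<omega> j)\<^sup>2" unfolding om_eq[OF j] by (simp add: N.q2_def r)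
  have tom: "tj \<omega> j * sqrt (om \<beta> \<omega> j) = sqrt (?s * ?q)"
    unfolding om using t0 by (simp add: real_sqrt_divide)
  have sq: "sqrt (c * c * (sig2 / ?T)) = c * (sqrt n * uj j)" if "0 \<le> c" for c
    unfolding uj_sqrt real_sqrt_mult[of "c * c"] using that by simp
  have "(1 - d) * (1 - d) * (sig2 / ?T) = ((1 - d) * sig2) * ((1 - d) * (1 / ?T))"
    by (simp add: mult_ac)
  also have "\<dots> \<le> ?s * ?q"
    by (rule mult_mono[OF sl ql less_imp_le[OF s2]]) (use d1 T in simp)
  finally show low: "(1 - d) * (sqrt n * uj j) \<le> tj \<omega> j * sqrt (om \<beta> \<omega> j)"
    unfolding tom sq[OF less_imp_le[OF d1], symmetric] by (rule real_sqrt_le_mono)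
  have "?s * ?q \<le> ((1 + d) * sig2) * ((1 + d) * (1 / ?T))"
    by (rule mult_mono[OF su qu _ less_imp_le[OF q0]]) (use d sig2 in simp)
  also have "\<dots> = (1 + d) * (1 + d) * (sig2 / ?T)" by (simp add: mult_ac)
  finally have "sqrt (?s * ?q) \<le> sqrt ((1 + d) * (1 + d) * (sig2 / ?T))" by (rule real_sqrt_le_mono)
  moreover have "0 \<le> 1 + d" using d by simp
  ultimately show up: "tj \<omega> j * sqrt (om \<beta> \<omega> j) \<le> (1 + d) * (sqrt n * uj j)"
    unfolding tom by (simp only: sq)
  have om0: "0 \<le> sqrt (om \<beta> \<omega> j)" unfolding om using s2 q0 by simp
  show "sqrt (om \<beta> \<omega> j) * (1 - d) \<le> (1 + d) * sqrt (sig2 * T j j)"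
  proof -
    \<comment> \<open>Only a lower bound on the tau estimate is needed to bound the standard error
      from above, and the penalty term can only increase that estimate above the residual mean
      square.\<close>
    have "(1 - d) * (1 / ?T) \<le> tj \<omega> j" using ql tq by linarith
    then have "(1 - d) * (1 / ?T) * sqrt (om \<beta> \<omega> j) \<le> tj \<omega> j * sqrt (om \<beta> \<omega> j)"
      by (rule mult_right_mono[OF _ om0])
    also note up
    finally have "(1 - d) * (1 / ?T) * sqrt (om \<beta> \<omega> j) \<le> (1 + d) * (sqrt n * uj j)" .
    then have "?T * ((1 - d) * (1 / ?T) * sqrt (om \<beta> \<omega> j)) \<le> ?T * ((1 + d) * (sqrt n * uj j))"
      using T by (intro mult_left_mono) auto
    moreover have "?T * ((1 - d) * (1 / ?T) * sqrt (om \<beta> \<omega> j)) = (1 - d) * sqrt (om \<beta> \<omega> j)"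
      using T by simp
    moreover have "?T * ((1 + d) * (sqrt n * uj j)) = (1 + d) * (?T * sqrt (sig2 / ?T))"
      unfolding uj_sqrt by (rule mult.left_commute)
    moreover have "?T * sqrt (sig2 / ?T) = sqrt (sig2 * ?T)"
    proof -
      have "sig2 * ?T = (?T * ?T) * (sig2 / ?T)" using T by simp
      then show ?thesis using T by (simp only: real_sqrt_mult[of "?T * ?T"] real_sqrt_abs2 abs_of_pos)
    qed
    ultimately show ?thesis by (simp only: mult.commute[of _ "1 - d"])
  qed
  have db: "tj \<omega> j * bb \<beta> \<omega> j = tj \<omega> j * bhat (Y \<beta> \<omega>) (DX \<omega>) $ j
    + (\<Sum>i<n. rj \<omega> j i * (fit p (dsg \<omega>) (\<lambda>k. \<beta> $ k) i + eps i \<omega> - fit p (dsg \<omega>) (\<lambda>k. bhat (Y \<beta> \<omega>) (DX \<omega>) $ k) i)) / n"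
    unfolding bb_eq[OF j \<beta>(1)] using t0 by (simp add: distrib_left)
  have am: "is_arg_min (lasso_objective n lam (Y \<beta> \<omega>) (DX \<omega>)) (\<lambda>b. b \<in> carrier_vec p) (bhat (Y \<beta> \<omega>) (DX \<omega>))"
    using bhat by (simp add: is_lasso_def)
  have "objective n p lam (\<lambda>i. Y \<beta> \<omega> $ i) (\<lambda>i k. DX \<omega> $$ (i, k)) (\<lambda>k. bhat (Y \<beta> \<omega>) (DX \<omega>) $ k)
      \<le> objective n p lam (\<lambda>i. Y \<beta> \<omega> $ i) (\<lambda>i k. DX \<omega> $$ (i, k)) (\<lambda>k. \<beta> $ k)"
    by (rule is_arg_min_objective[OF am _ Y_carrier DX_carrier]) auto
  then have bm: "objective n p lam (\<lambda>i. fit p (dsg \<omega>) (\<lambda>k. \<beta> $ k) i + eps i \<omega>) (dsg \<omega>) (\<lambda>k. bhat (Y \<beta> \<omega>) (DX \<omega>) $ k)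
      \<le> objective n p lam (\<lambda>i. fit p (dsg \<omega>) (\<lambda>k. \<beta> $ k) i + eps i \<omega>) (dsg \<omega>) (\<lambda>k. \<beta> $ k)"
    unfolding objective_DX using objective_cong[of "\<lambda>i. Y \<beta> \<omega> $ i" "\<lambda>i. fit p (dsg \<omega>) (\<lambda>k. \<beta> $ k) i + eps i \<omega>"] Y_entry[OF _ \<beta>(1)]
    by simp
  have noise: "\<bar>\<Sum>i<n. X i k \<omega> * eps i \<omega>\<bar> / n \<le> dE" if "k < p" for k
  proof -
    have "\<bar>\<Sum>i<n. X i k \<omega> * eps i \<omega>\<bar> < real n * dE" using g that by (simp add: good_def)
    then show ?thesis using n by (simp add: pos_divide_le_eq mult.commute)
  qed
  have sc: "real (card {k. k < p \<and> \<beta> $ k \<noteq> 0}) \<le> s0" using \<beta> by (simp add: supp_def)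
  have rem: "\<bar>tj \<omega> j * bb \<beta> \<omega> j - tj \<omega> j * \<beta> $ j - (\<Sum>i<n. N.eta i * eps i \<omega>) / n\<bar> \<le> 32 * lN * (s * dE + s0 * lam) / c0"
    using N.debias[OF bm lam noise dE(2) dE(1) sc s0d] unfolding t2 db r by simp
  have W: "W j \<omega> * uj j = (\<Sum>i<n. N.eta i * eps i \<omega>) / n"
  proof -
    have "kj j * sqrt (sig2 / ?T) = 1" using T sig2 by (simp add: kj_def real_sqrt_mult[symmetric])
    then have k: "kj j / sqrt n * uj j = 1 / n" using n by (simp add: uj_def)
    have "W j \<omega> = (kj j / sqrt n) * (\<Sum>i<n. N.eta i * eps i \<omega>)"
      by (simp add: W_def xi_def N.eta_def lin_def sum_distrib_left[symmetric])
    then have "W j \<omega> * uj j = (kj j / sqrt n * uj j) * (\<Sum>i<n. N.eta i * eps i \<omega>)" by simp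
    then show ?thesis unfolding k by simp
  qed
  have "32 * lN * (s * dE + s0 * lam) / c0 \<le> d * sqrt (2 * ln p / n) * sqrt (cs * c0)" by (rule d_rem)
  also have "\<dots> \<le> d * sqrt (2 * ln p / n) * sqrt (sig2 / ?T)"
  proof -
    have "cs * c0 \<le> sig2 * (1 / ?T)" using cs cT c0 sig2 by (intro mult_mono) auto
    then show ?thesis using d p by (intro mult_left_mono) auto
  qed
  also have "\<dots> = d * sqrt 2 * sqrt (ln p) * uj j" by (simp add: uj_def real_sqrt_divide real_sqrt_mult mult_ac)
  finally show "\<bar>tj \<omega> j * (bb \<beta> \<omega> j - \<beta> $ j) - W j \<omega> * uj j\<bar> \<le> d * sqrt 2 * sqrt (ln p) * uj j"
    using rem unfolding W by (simp add: right_diff_distrib)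
qed

lemma threshold_eq: "sqrt (\<tau> * om \<beta> \<omega> j * ln p / n) = sqrt \<tau> * sqrt (ln p) * sqrt (om \<beta> \<omega> j) / sqrt n"
  by (simp add: real_sqrt_mult real_sqrt_divide mult_ac)

lemma recovered_iff:
  assumes "\<beta> \<in> carrier_vec p"
  shows "recovered \<tau> \<beta> \<omega> \<longleftrightarrow> (\<forall>j<p. sqrt (\<tau> * om \<beta> \<omega> j * ln p / n) < \<bar>bb \<beta> \<omega> j\<bar> \<longleftrightarrow> \<beta> $ j \<noteq> 0)"
  using assms by (auto simp: S_hat_def supp_def)

text \<open>The margin \<open>6 * d\<close> for the scores leaves estimation errors of at most
  \<open>1 - 4 * d\<close> thresholds: one \<open>d\<close> pays for the debiasing remainder and one
  for the estimated standard error. A signal is at least \<open>2 - 4 * d\<close> thresholds, so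
  exactly one threshold remains after subtraction.\<close>

lemma good_recovered:
  assumes g: "good \<beta> \<omega>" and \<beta>: "\<beta> \<in> Psi n p \<Theta> sig2 (2 * sqrt 2)" "real (card (supp \<beta>)) \<le> s0"
    and W: "\<And>j. j < p \<Longrightarrow> \<bar>W j \<omega>\<bar> \<le> sqrt (2 * ln p) * (1 - 6 * d)"
  shows "recovered 2 \<beta> \<omega>"
proof -
  have \<beta>c: "\<beta> \<in> carrier_vec p" using \<beta> by (simp add: Psi_def)
  have "sqrt (2 * om \<beta> \<omega> j * ln p / n) < \<bar>bb \<beta> \<omega> j\<bar> \<longleftrightarrow> \<beta> $ j \<noteq> 0" if j: "j < p" for j
  proof -
    note b = good_bounds[OF g \<beta>c \<beta>(2) j]
    let ?t = "tj \<omega> j" and ?o = "sqrt (om \<beta> \<omega> j)" and ?u = "uj j" and ?L = "sqrt 2 * sqrt (ln p)" and ?n = "sqrt n"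
    let ?thr = "sqrt (2 * om \<beta> \<omega> j * ln p / n)"
    have thr: "?thr = ?L * ?o / ?n" by (rule threshold_eq)
    have L0: "0 \<le> ?L" using p by simp
    have n0: "0 < ?n" using n by simp
    have u: "0 < ?u" by (rule uj_pos[OF j])
    have "\<bar>W j \<omega> * ?u\<bar> \<le> ?L * (1 - 6 * d) * ?u"
      using W[OF j] u by (simp add: abs_mult real_sqrt_mult)
    then have "\<bar>?t * (bb \<beta> \<omega> j - \<beta> $ j)\<bar> \<le> ?L * (1 - 6 * d) * ?u + d * ?L * ?u"
      using b(2) by linarith
    also have "\<dots> = ?L * (1 - 5 * d) * ?u" by (simp add: algebra_simps)
    \<comment> \<open>\<open>(1 - 4 * d) * (1 - d)\<close> exceeds \<open>1 - 5 * d\<close> by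
      \<open>4 * d\<^sup>2\<close>; the factor \<open>1 - d\<close> is split off to match the lower
      bound for the estimated standard error.\<close>
    also have "\<dots> \<le> ?L * ((1 - 4 * d) * (1 - d)) * ?u"
      using L0 u by (intro mult_right_mono mult_left_mono) (auto simp: algebra_simps)
    also have "\<dots> = ?L * (1 - 4 * d) * ((1 - d) * (?n * ?u)) / ?n" using n0 by simp
    also have "\<dots> \<le> ?L * (1 - 4 * d) * (?t * ?o) / ?n"
      using b(3) L0 d n0 by (intro divide_right_mono mult_left_mono) auto
    also have "\<dots> = ?t * ((1 - 4 * d) * ?thr)" unfolding thr by simp
    finally have "?t * \<bar>bb \<beta> \<omega> j - \<beta> $ j\<bar> \<le> ?t * ((1 - 4 * d) * ?thr)" using b(1) by (simp add: abs_mult)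
    then have dev: "\<bar>bb \<beta> \<omega> j - \<beta> $ j\<bar> \<le> (1 - 4 * d) * ?thr" using b(1) by simp
    have "0 < (1 - d) * (?n * ?u)" using d u n0 by simp
    with b(3) have "0 < ?t * ?o" by linarith
    then have o0: "0 < ?o" using b(1) by (simp add: zero_less_mult_iff)
    have thr0: "0 \<le> ?thr" using L0 o0 n0 unfolding thr by simp
    show ?thesis
    proof (cases "\<beta> $ j = 0")
      case True
      have "\<bar>bb \<beta> \<omega> j\<bar> \<le> (1 - 4 * d) * ?thr" using dev True by simp
      also have "\<dots> \<le> 1 * ?thr" using thr0 d by (intro mult_right_mono) auto
      finally show ?thesis using True by simp
    next
      case False
      have "j \<in> supp \<beta>" using False j \<beta>c by (simp add: supp_def)
      then have big: "2 * sqrt 2 * sqrt (ln p / n) < \<bar>\<beta> $ j\<bar> / sqrt (sig2 * T j j)" using \<beta>(1) by (simp add: Psi_def)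
      have w: "0 < sqrt (sig2 * T j j)" using sig2 T_diag_pos[OF j] by simp
      have "2 * (?L / ?n) * sqrt (sig2 * T j j) < \<bar>\<beta> $ j\<bar>"
        using big w by (simp add: pos_less_divide_eq real_sqrt_divide)
      \<comment> \<open>Converts the signal from true to estimated standard errors. The ratio of the
        two costs (1 + d) / (1 - d), and \<open>(1 + d) * (2 - 4 * d)\<close> stays below
        \<open>2 * (1 - d)\<close>.\<close>
      moreover have "(2 - 4 * d) * ?o \<le> 2 * sqrt (sig2 * T j j)"
      proof -
        have "(1 + d) * ((2 - 4 * d) * ?o) = ((1 + d) * (2 - 4 * d)) * ?o" by simp
        also have "\<dots> \<le> (2 * (1 - d)) * ?o"
        proof (rule mult_right_mono)
          have "(1 + d) * (2 - 4 * d) = 2 * (1 - d) - 4 * d\<^sup>2" by (simp add: algebra_simps power2_eq_square)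
          then show "(1 + d) * (2 - 4 * d) \<le> 2 * (1 - d)" by simp
        qed (use o0 in simp)
        also have "\<dots> \<le> (1 + d) * (2 * sqrt (sig2 * T j j))" using b(5) by (simp add: algebra_simps)
        finally show ?thesis using d by simp
      qed
      then have "(?L / ?n) * ((2 - 4 * d) * ?o) \<le> (?L / ?n) * (2 * sqrt (sig2 * T j j))"
        using L0 n0 by (intro mult_left_mono) auto
      ultimately have "(2 - 4 * d) * ?thr < \<bar>\<beta> $ j\<bar>" unfolding thr by (simp add: mult_ac)
      then have "?thr < \<bar>bb \<beta> \<omega> j\<bar>" using dev by (simp add: algebra_simps)
      then show ?thesis using False by simp
    qed
  qed
  then show ?thesis unfolding recovered_iff[OF \<beta>c] by blast
qed

text \<open>Exact recovery keeps every null coordinate under its threshold, so one exceeding score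
  refutes it; the upper tail alone suffices for that. The slack \<open>3 * d\<close> bounds
  \<open>d * (sqrt \<tau> + sqrt 2)\<close>, one part from the standard error and one from the
  remainder.\<close>

lemma good_recovered_imp:
  assumes g: "good \<beta> \<omega>" and \<beta>: "\<beta> \<in> carrier_vec p" "real (card (supp \<beta>)) \<le> s0"
    and \<tau>: "0 < \<tau>" "\<tau> < 2" and r: "recovered \<tau> \<beta> \<omega>" and j: "j < p" "j \<notin> supp \<beta>"
  shows "W j \<omega> \<le> sqrt (ln p) * (sqrt \<tau> + 3 * d)"
proof -
  note b = good_bounds[OF g \<beta> j(1)]
  let ?t = "tj \<omega> j" and ?o = "sqrt (om \<beta> \<omega> j)" and ?u = "uj j" and ?L = "sqrt (ln p)" and ?n = "sqrt n"
  have \<beta>0: "\<beta> $ j = 0" using j \<beta> by (simp add: supp_def)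
  have L0: "0 \<le> ?L" using p by simp
  have n0: "0 < ?n" using n by simp
  have u: "0 < ?u" by (rule uj_pos[OF j(1)])
  have "\<bar>bb \<beta> \<omega> j\<bar> \<le> sqrt \<tau> * ?L * ?o / ?n"
  proof -
    have "\<not> sqrt (\<tau> * om \<beta> \<omega> j * ln p / n) < \<bar>bb \<beta> \<omega> j\<bar>"
      using r[unfolded recovered_iff[OF \<beta>(1)]] j(1) \<beta>0 by blast
    then show ?thesis unfolding threshold_eq not_less .
  qed
  then have "?t * \<bar>bb \<beta> \<omega> j\<bar> \<le> ?t * (sqrt \<tau> * ?L * ?o / ?n)" using b(1) by (intro mult_left_mono) auto
  also have "\<dots> = sqrt \<tau> * ?L * (?t * ?o) / ?n" by simp
  also have "\<dots> \<le> sqrt \<tau> * ?L * ((1 + d) * (?n * ?u)) / ?n"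
    using b(4) L0 n0 \<tau> by (intro divide_right_mono mult_left_mono) auto
  also have "\<dots> = sqrt \<tau> * ?L * (1 + d) * ?u" using n0 by simp
  finally have 1: "?t * \<bar>bb \<beta> \<omega> j\<bar> \<le> sqrt \<tau> * ?L * (1 + d) * ?u" .
  have "W j \<omega> * ?u \<le> \<bar>?t * bb \<beta> \<omega> j\<bar> + d * sqrt 2 * ?L * ?u" using b(2) \<beta>0 by simp
  also have "\<bar>?t * bb \<beta> \<omega> j\<bar> = ?t * \<bar>bb \<beta> \<omega> j\<bar>" using b(1) by (simp add: abs_mult)
  finally have "W j \<omega> * ?u \<le> (sqrt \<tau> * ?L * (1 + d) + d * sqrt 2 * ?L) * ?u" using 1 by (simp add: algebra_simps)
  then have "W j \<omega> \<le> sqrt \<tau> * ?L * (1 + d) + d * sqrt 2 * ?L" using u by simp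
  also have "\<dots> = ?L * (sqrt \<tau> + d * (sqrt \<tau> + sqrt 2))" by (simp add: algebra_simps)
  also have "\<dots> \<le> ?L * (sqrt \<tau> + d * 3)"
  proof -
    have "sqrt \<tau> \<le> sqrt 2" using \<tau> by simp
    moreover have "sqrt 2 \<le> 3 / 2" by (rule real_le_lsqrt) (auto simp: power2_eq_square)
    ultimately have "sqrt \<tau> + sqrt 2 \<le> 3" by linarith
    then show ?thesis using L0 d by (intro mult_left_mono add_left_mono) auto
  qed
  finally show ?thesis by (simp add: mult.commute)
qed

section \<open>Measurability and bounds for the recovery probability\<close>

lemma sig2hat_meas: "\<beta> \<in> carrier_vec p \<Longrightarrow> (\<lambda>\<omega>. sig2hat (Y \<beta> \<omega>) (DX \<omega>)) \<in> borel_measurable M"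
  using sig2hat by (simp add: is_variance_estimator_def)

lemma rj_meas: assumes "j < p" "i < n" shows "(\<lambda>\<omega>. rj \<omega> j i) \<in> borel_measurable M"
  unfolding rj_def fit_def using assms ghat X_meas
  by (auto simp: is_nodewise_lasso_def intro!: borel_measurable_diff borel_measurable_sum borel_measurable_times)

lemma tj_meas: assumes "j < p" shows "(\<lambda>\<omega>. tj \<omega> j) \<in> borel_measurable M"
  unfolding tj_eq[OF assms] using rj_meas[OF assms] ghat assms
  by (auto simp: is_nodewise_lasso_def intro!: borel_measurable_add borel_measurable_sum borel_measurable_times
      borel_measurable_divide borel_measurable_power borel_measurable_abs)

lemma om_meas: assumes "j < p" "\<beta> \<in> carrier_vec p" shows "(\<lambda>\<omega>. om \<beta> \<omega> j) \<in> borel_measurable M"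
  unfolding om_eq[OF assms(1)] using rj_meas[OF assms(1)] tj_meas[OF assms(1)] sig2hat_meas[OF assms(2)]
  by (intro borel_measurable_sum borel_measurable_times borel_measurable_divide borel_measurable_power) auto

lemma bb_meas: assumes "j < p" "\<beta> \<in> carrier_vec p" shows "(\<lambda>\<omega>. bb \<beta> \<omega> j) \<in> borel_measurable M"
proof -
  have b: "(\<lambda>\<omega>. bhat (Y \<beta> \<omega>) (DX \<omega>) $ k) \<in> borel_measurable M" if "k < p" for k
    using bhat assms(2) that by (simp add: is_lasso_def)
  have f: "(\<lambda>\<omega>. fit p (dsg \<omega>) (\<lambda>k. bhat (Y \<beta> \<omega>) (DX \<omega>) $ k) i) \<in> borel_measurable M" if "i < n" for i
    unfolding fit_def using b X_meas[OF that] by (intro borel_measurable_sum borel_measurable_times) auto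
  have f2: "(\<lambda>\<omega>. fit p (dsg \<omega>) (\<lambda>k. \<beta> $ k) i) \<in> borel_measurable M" if "i < n" for i
    unfolding fit_def using X_meas[OF that] by (intro borel_measurable_sum borel_measurable_times) auto
  show ?thesis
    unfolding bb_eq[OF assms] using b[OF assms(1)] f f2 rj_meas[OF assms(1)] tj_meas[OF assms(1)] eps_meas
    by (intro borel_measurable_add borel_measurable_divide borel_measurable_sum borel_measurable_times borel_measurable_diff) auto
qed

lemma recovered_meas: assumes "\<beta> \<in> carrier_vec p" shows "{\<omega> \<in> space M. recovered \<tau> \<beta> \<omega>} \<in> events"
proof -
  have "{\<omega> \<in> space M. sqrt (\<tau> * om \<beta> \<omega> j * ln p / n) < \<bar>bb \<beta> \<omega> j\<bar> \<longleftrightarrow> \<beta> $ j \<noteq> 0} \<in> events" if "j < p" for j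
  proof -
    have [measurable]: "(\<lambda>\<omega>. om \<beta> \<omega> j) \<in> borel_measurable M" "(\<lambda>\<omega>. bb \<beta> \<omega> j) \<in> borel_measurable M"
      using om_meas bb_meas that assms by auto
    show ?thesis by measurable
  qed
  then have "{\<omega> \<in> space M. \<forall>j\<in>{..<p}. sqrt (\<tau> * om \<beta> \<omega> j * ln p / n) < \<bar>bb \<beta> \<omega> j\<bar> \<longleftrightarrow> \<beta> $ j \<noteq> 0} \<in> events"
    by (intro sets.sets_Collect_finite_All') (use p in auto)
  then show ?thesis by (simp only: recovered_iff[OF assms] Ball_def lessThan_iff)
qed

definition bad where
  "bad \<beta> = prob {\<omega> \<in> space M. \<not> gram_close n p S T (dsg \<omega>) dG}
    + prob {\<omega> \<in> space M. \<exists>k<p. real n * dE \<le> \<bar>\<Sum>i<n. X i k \<omega> * eps i \<omega>\<bar>}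
    + prob {\<omega> \<in> space M. d * cs < \<bar>sig2hat (Y \<beta> \<omega>) (DX \<omega>) - sig2\<bar>}"

lemma noise_meas: "{\<omega> \<in> space M. \<exists>k<p. real n * dE \<le> \<bar>\<Sum>i<n. X i k \<omega> * eps i \<omega>\<bar>} \<in> events"
proof -
  have "{\<omega> \<in> space M. \<exists>k<p. real n * dE \<le> \<bar>\<Sum>i<n. X i k \<omega> * eps i \<omega>\<bar>}
    = (\<Union>k<p. {\<omega> \<in> space M. real n * dE \<le> \<bar>\<Sum>i<n. X i k \<omega> * eps i \<omega>\<bar>})" by auto
  also have "\<dots> \<in> events" using X_meas eps_meas
    by (intro sets.finite_UN borel_measurable_le borel_measurable_abs borel_measurable_sum
      borel_measurable_times borel_measurable_const) auto
  finally show ?thesis .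
qed

lemma prob_not_good:
  assumes "\<beta> \<in> carrier_vec p"
  shows "{\<omega> \<in> space M. \<not> good \<beta> \<omega>} \<in> events" "prob {\<omega> \<in> space M. \<not> good \<beta> \<omega>} \<le> bad \<beta>"
proof -
  let ?A = "{\<omega> \<in> space M. \<not> gram_close n p S T (dsg \<omega>) dG}"
  let ?B = "{\<omega> \<in> space M. \<exists>k<p. real n * dE \<le> \<bar>\<Sum>i<n. X i k \<omega> * eps i \<omega>\<bar>}"
  let ?C = "{\<omega> \<in> space M. d * cs < \<bar>sig2hat (Y \<beta> \<omega>) (DX \<omega>) - sig2\<bar>}"
  have C: "?C \<in> events" using sig2hat_meas[OF assms] by measurable
  have eq: "{\<omega> \<in> space M. \<not> good \<beta> \<omega>} = (?A \<union> ?B) \<union> ?C" by (auto simp: good_def not_less not_le)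
  show "{\<omega> \<in> space M. \<not> good \<beta> \<omega>} \<in> events" unfolding eq using gram_close_meas noise_meas C by auto
  have "prob ((?A \<union> ?B) \<union> ?C) \<le> prob (?A \<union> ?B) + prob ?C"
    using gram_close_meas noise_meas C by (intro measure_Un_le) auto
  also have "prob (?A \<union> ?B) \<le> prob ?A + prob ?B"
    using gram_close_meas noise_meas by (intro measure_Un_le) auto
  finally show "prob {\<omega> \<in> space M. \<not> good \<beta> \<omega>} \<le> bad \<beta>" unfolding eq bad_def by simp
qed

lemma recovery_lower:
  assumes \<beta>: "\<beta> \<in> Psi n p \<Theta> sig2 (2 * sqrt 2)" "real (card (supp \<beta>)) \<le> s0"
  shows "1 - (bad \<beta> + (\<Sum>j<p. prob {\<omega> \<in> space M. sqrt (2 * ln p) * (1 - 6 * d) \<le> \<bar>W j \<omega>\<bar>}))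
    \<le> prob_exact_recovery M n p X eps (\<lambda>_. lN) bhat ghat sig2hat 2 \<beta>"
proof -
  have \<beta>c: "\<beta> \<in> carrier_vec p" using \<beta> by (simp add: Psi_def)
  let ?x = "sqrt (2 * ln p) * (1 - 6 * d)"
  let ?A = "{\<omega> \<in> space M. \<not> good \<beta> \<omega>}" and ?B = "\<Union>j<p. {\<omega> \<in> space M. ?x \<le> \<bar>W j \<omega>\<bar>}"
  have B: "?B \<in> events" by (intro sets.finite_UN) auto
  note A = prob_not_good[OF \<beta>c]
  have "prob ?B \<le> (\<Sum>j<p. prob {\<omega> \<in> space M. ?x \<le> \<bar>W j \<omega>\<bar>})"
    by (intro measure_UNION_le) auto
  moreover have "prob (?A \<union> ?B) \<le> prob ?A + prob ?B" using A B by (intro measure_Un_le) auto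
  moreover have "prob (space M - (?A \<union> ?B)) = 1 - prob (?A \<union> ?B)" using A B by (intro prob_compl) auto
  moreover have "prob (space M - (?A \<union> ?B)) \<le> prob {\<omega> \<in> space M. recovered 2 \<beta> \<omega>}"
  proof (rule finite_measure_mono[OF _ recovered_meas[OF \<beta>c]])
    show "space M - (?A \<union> ?B) \<subseteq> {\<omega> \<in> space M. recovered 2 \<beta> \<omega>}"
    proof
      fix \<omega> assume \<omega>: "\<omega> \<in> space M - (?A \<union> ?B)"
      have "recovered 2 \<beta> \<omega>" by (rule good_recovered[OF _ \<beta>]) (use \<omega> in \<open>auto simp: not_le intro: less_imp_le\<close>)
      then show "\<omega> \<in> {\<omega> \<in> space M. recovered 2 \<beta> \<omega>}" using \<omega> by blast
    qed
  qed
  ultimately show ?thesis using A(2) unfolding prob_exact_recovery_def by linarith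
qed

lemma recovery_upper:
  assumes \<beta>: "\<beta> \<in> carrier_vec p" "real (card (supp \<beta>)) \<le> s0" and \<tau>: "0 < \<tau>" "\<tau> < 2"
    and J: "J \<subseteq> {..<p} - supp \<beta>" and x: "sqrt (ln p) * (sqrt \<tau> + 3 * d) \<le> x"
  shows "prob_exact_recovery M n p X eps (\<lambda>_. lN) bhat ghat sig2hat \<tau> \<beta>
    \<le> bad \<beta> + prob {\<omega> \<in> space M. \<forall>j\<in>J. W j \<omega> \<le> x}"
proof -
  let ?A = "{\<omega> \<in> space M. \<not> good \<beta> \<omega>}" and ?B = "{\<omega> \<in> space M. \<forall>j\<in>J. W j \<omega> \<le> x}"
  note A = prob_not_good[OF \<beta>(1)]
  have "finite J" using J finite_subset by blast
  then have B: "?B \<in> events" by measurable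
  have "prob {\<omega> \<in> space M. recovered \<tau> \<beta> \<omega>} \<le> prob (?A \<union> ?B)"
  proof (rule finite_measure_mono)
    show "{\<omega> \<in> space M. recovered \<tau> \<beta> \<omega>} \<subseteq> ?A \<union> ?B"
    proof
      fix \<omega> assume \<omega>: "\<omega> \<in> {\<omega> \<in> space M. recovered \<tau> \<beta> \<omega>}"
      show "\<omega> \<in> ?A \<union> ?B"
      proof (cases "good \<beta> \<omega>")
        case True
        have "W j \<omega> \<le> x" if "j \<in> J" for j
          using good_recovered_imp[OF True \<beta> \<tau>, of j] \<omega> J that x by (blast intro: order_trans)
        then show ?thesis using \<omega> by blast
      qed (use \<omega> in blast)
    qed
  qed (use A B in auto)
  also have "\<dots> \<le> prob ?A + prob ?B" using A B by (intro measure_Un_le) auto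
  finally show ?thesis using A(2) unfolding prob_exact_recovery_def by linarith
qed

end

section \<open>Moment bounds and weak correlations\<close>

text \<open>By maximality every vertex lies in the set or is adjacent to it, so \<open>V\<close> is
  covered by \<open>card J\<close> neighbourhoods of at most \<open>1 + q\<close> elements.\<close>

lemma independent_set_exists:
  fixes V :: "'b set" and q :: real
  assumes fin: "finite V" and q: "0 \<le> q" and sym: "\<And>u v. E u v \<Longrightarrow> E v u"
    and deg: "\<And>v. v \<in> V \<Longrightarrow> real (card {u \<in> V. E v u}) \<le> q"
  obtains J where "J \<subseteq> V" "\<And>u v. u \<in> J \<Longrightarrow> v \<in> J \<Longrightarrow> u \<noteq> v \<Longrightarrow> \<not> E u v"
    and "real (card V) \<le> (1 + q) * real (card J)"
proof -
  define I where "I = {J. J \<subseteq> V \<and> (\<forall>u\<in>J. \<forall>v\<in>J. u \<noteq> v \<longrightarrow> \<not> E u v)}"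
  have "finite I" unfolding I_def using fin by simp
  moreover have "I \<noteq> {}" unfolding I_def by blast
  ultimately obtain J where J: "J \<in> I" and max: "\<And>J'. J' \<in> I \<Longrightarrow> J \<subseteq> J' \<Longrightarrow> J' = J"
    using finite_has_maximal[of I] by blast
  have JV: "J \<subseteq> V" and ind: "\<And>u v. u \<in> J \<Longrightarrow> v \<in> J \<Longrightarrow> u \<noteq> v \<Longrightarrow> \<not> E u v" using J by (auto simp: I_def)
  have finJ: "finite J" using JV fin finite_subset by blast
  have "V \<subseteq> (\<Union>j\<in>J. insert j {u \<in> V. E j u})"
  proof
    fix v assume v: "v \<in> V"
    show "v \<in> (\<Union>j\<in>J. insert j {u \<in> V. E j u})"
    proof (rule ccontr)
      assume no: "v \<notin> (\<Union>j\<in>J. insert j {u \<in> V. E j u})"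
      then have "v \<notin> J" and noE: "\<And>j. j \<in> J \<Longrightarrow> \<not> E j v" using v by auto
      have "\<not> E v j" if "j \<in> J" for j using noE[OF that] sym by blast
      then have "insert v J \<in> I" using JV ind v noE by (auto simp: I_def)
      then have "insert v J = J" using max by blast
      with \<open>v \<notin> J\<close> show False by blast
    qed
  qed
  then have "card V \<le> card (\<Union>j\<in>J. insert j {u \<in> V. E j u})"
    using fin finJ by (intro card_mono) auto
  also have "\<dots> \<le> (\<Sum>j\<in>J. card (insert j {u \<in> V. E j u}))" by (rule card_UN_le[OF finJ])
  finally have "real (card V) \<le> (\<Sum>j\<in>J. real (card (insert j {u \<in> V. E j u})))"
    by (metis of_nat_le_iff of_nat_sum)
  also have "\<dots> \<le> (\<Sum>j\<in>J. 1 + q)"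
  proof (rule sum_mono)
    fix j assume j: "j \<in> J"
    have "card (insert j {u \<in> V. E j u}) \<le> Suc (card {u \<in> V. E j u})" by (rule card_insert_le_m1) auto
    then show "real (card (insert j {u \<in> V. E j u})) \<le> 1 + q" using deg[of j] j JV by auto
  qed
  finally show thesis using that[OF JV ind] by (simp add: mult.commute)
qed

lemma nn_integral_le_imp_integrable:
  fixes f :: "'a \<Rightarrow> real"
  assumes "f \<in> borel_measurable M" "\<And>\<omega>. 0 \<le> f \<omega>" "(\<integral>\<^sup>+\<omega>. ennreal (f \<omega>) \<partial>M) \<le> ennreal c" "0 \<le> c"
  shows "integrable M f" "integral\<^sup>L M f \<le> c"
proof -
  have fin: "(\<integral>\<^sup>+\<omega>. ennreal (f \<omega>) \<partial>M) < \<infinity>"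
    using assms(3) by (metis ennreal_less_top infinity_ennreal_def order_le_less_trans)
  show i: "integrable M f"
    using fin assms(1,2) by (subst integrable_iff_bounded) simp
  have "ennreal (integral\<^sup>L M f) = (\<integral>\<^sup>+\<omega>. ennreal (f \<omega>) \<partial>M)"
    using nn_integral_eq_integral[OF i] assms(2) by simp
  then show "integral\<^sup>L M f \<le> c" using assms(3,4) by (metis ennreal_le_iff)
qed

lemma power_le_exp:
  fixes y a :: real
  assumes "0 < a"
  shows "\<bar>y\<bar> ^ 2 \<le> 2 / a ^ 2 * exp (a * \<bar>y\<bar>)" "\<bar>y\<bar> ^ 3 \<le> 6 / a ^ 3 * exp (a * \<bar>y\<bar>)"
proof -
  have e: "(a * \<bar>y\<bar>) ^ k / fact k \<le> exp (a * \<bar>y\<bar>)" for k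
  proof -
    have s: "summable (\<lambda>i. (a * \<bar>y\<bar>) ^ i /\<^sub>R fact i)" by (rule summable_exp_generic)
    have "(\<Sum>i\<in>{k}. (a * \<bar>y\<bar>) ^ i /\<^sub>R fact i) \<le> (\<Sum>i. (a * \<bar>y\<bar>) ^ i /\<^sub>R fact i)"
      by (rule sum_le_suminf[OF s]) (use assms in auto)
    then show ?thesis by (simp add: exp_def divide_inverse mult.commute)
  qed
  have "\<bar>y\<bar> ^ 2 = 2 / a ^ 2 * ((a * \<bar>y\<bar>) ^ 2 / fact 2)" using assms by (simp add: power_mult_distrib fact_numeral)
  also have "\<dots> \<le> 2 / a ^ 2 * exp (a * \<bar>y\<bar>)" using assms by (intro mult_left_mono e) auto
  finally show "\<bar>y\<bar> ^ 2 \<le> 2 / a ^ 2 * exp (a * \<bar>y\<bar>)" .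
  have "\<bar>y\<bar> ^ 3 = 6 / a ^ 3 * ((a * \<bar>y\<bar>) ^ 3 / fact 3)" using assms by (simp add: power_mult_distrib fact_numeral)
  also have "\<dots> \<le> 6 / a ^ 3 * exp (a * \<bar>y\<bar>)" using assms by (intro mult_left_mono e) auto
  finally show "\<bar>y\<bar> ^ 3 \<le> 6 / a ^ 3 * exp (a * \<bar>y\<bar>)" .
qed

section \<open>Moments derived from exponential moments\<close>

context prob_space begin

lemma third_exp_moment_mono: "third_exp_moment b L f \<Longrightarrow> L \<le> L' \<Longrightarrow> third_exp_moment b L' f"
  by (auto simp: third_exp_moment_def)

text \<open>Half of the exponent pays for the square or the cube, and the other half remains as the
  weight.\<close>

lemma exp_moment_imp_moments:
  assumes Z[measurable]: "Z \<in> borel_measurable M" and a: "0 < a"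
    and int: "integrable M (\<lambda>\<omega>. exp (2 * a * \<bar>Z \<omega>\<bar>))" and E: "expectation (\<lambda>\<omega>. exp (2 * a * \<bar>Z \<omega>\<bar>)) \<le> 2"
  shows "integrable M (\<lambda>\<omega>. (Z \<omega>)\<^sup>2 * exp (a * \<bar>Z \<omega>\<bar>))"
    and "expectation (\<lambda>\<omega>. (Z \<omega>)\<^sup>2 * exp (a * \<bar>Z \<omega>\<bar>)) \<le> 4 / a ^ 2"
    and "third_exp_moment a (12 / a ^ 3) Z"
proof -
  have ee: "exp (a * \<bar>y\<bar>) * exp (a * \<bar>y\<bar>) = exp (2 * a * \<bar>y\<bar>)" for y :: real by (simp add: exp_add[symmetric])
  have l2: "y\<^sup>2 * exp (a * \<bar>y\<bar>) \<le> 2 / a ^ 2 * exp (2 * a * \<bar>y\<bar>)" for y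
    using mult_right_mono[OF power_le_exp(1)[OF a, of y], of "exp (a * \<bar>y\<bar>)"] by (simp add: ee mult.assoc)
  have l3: "\<bar>y\<bar> ^ 3 * exp (a * \<bar>y\<bar>) \<le> 6 / a ^ 3 * exp (2 * a * \<bar>y\<bar>)" for y
    using mult_right_mono[OF power_le_exp(2)[OF a, of y], of "exp (a * \<bar>y\<bar>)"] by (simp add: ee mult.assoc)
  show i2: "integrable M (\<lambda>\<omega>. (Z \<omega>)\<^sup>2 * exp (a * \<bar>Z \<omega>\<bar>))"
  proof (rule Bochner_Integration.integrable_bound[of _ "\<lambda>\<omega>. 2 / a ^ 2 * exp (2 * a * \<bar>Z \<omega>\<bar>)"])
    show "AE \<omega> in M. norm ((Z \<omega>)\<^sup>2 * exp (a * \<bar>Z \<omega>\<bar>)) \<le> norm (2 / a ^ 2 * exp (2 * a * \<bar>Z \<omega>\<bar>))"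
      using l2 by (intro AE_I2) (simp add: abs_mult)
  qed (use int in auto)
  have "expectation (\<lambda>\<omega>. (Z \<omega>)\<^sup>2 * exp (a * \<bar>Z \<omega>\<bar>)) \<le> expectation (\<lambda>\<omega>. 2 / a ^ 2 * exp (2 * a * \<bar>Z \<omega>\<bar>))"
    using i2 int l2 by (intro integral_mono) auto
  also have "\<dots> \<le> 2 / a ^ 2 * 2" using E a by (simp add: divide_right_mono)
  finally show "expectation (\<lambda>\<omega>. (Z \<omega>)\<^sup>2 * exp (a * \<bar>Z \<omega>\<bar>)) \<le> 4 / a ^ 2" by simp
  have i3: "integrable M (\<lambda>\<omega>. \<bar>Z \<omega>\<bar> ^ 3 * exp (a * \<bar>Z \<omega>\<bar>))"
  proof (rule Bochner_Integration.integrable_bound[of _ "\<lambda>\<omega>. 6 / a ^ 3 * exp (2 * a * \<bar>Z \<omega>\<bar>)"])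
    show "AE \<omega> in M. norm (\<bar>Z \<omega>\<bar> ^ 3 * exp (a * \<bar>Z \<omega>\<bar>)) \<le> norm (6 / a ^ 3 * exp (2 * a * \<bar>Z \<omega>\<bar>))"
      using l3 a by (intro AE_I2) (simp add: abs_mult power_abs)
  qed (use int in auto)
  have "expectation (\<lambda>\<omega>. \<bar>Z \<omega>\<bar> ^ 3 * exp (a * \<bar>Z \<omega>\<bar>)) \<le> expectation (\<lambda>\<omega>. 6 / a ^ 3 * exp (2 * a * \<bar>Z \<omega>\<bar>))"
    using i3 int l3 by (intro integral_mono) auto
  also have "\<dots> \<le> 6 / a ^ 3 * 2" using E a by (simp add: divide_right_mono)
  finally show "third_exp_moment a (12 / a ^ 3) Z" using i3 by (simp add: third_exp_moment_def)
qed

text \<open>The arithmetic-geometric mean inequality is used twice, for the product in the exponent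
  and for the product of the two exponentials, so that no independence of \<open>U\<close> and
  \<open>V\<close> is required.\<close>

lemma product_exp_moment:
  assumes U[measurable]: "U \<in> borel_measurable M" and V[measurable]: "V \<in> borel_measurable M" and D: "0 < D"
    and EU: "(\<integral>\<^sup>+\<omega>. ennreal (exp ((U \<omega>)\<^sup>2 / D)) \<partial>M) \<le> 2" and EV: "(\<integral>\<^sup>+\<omega>. ennreal (exp ((V \<omega>)\<^sup>2 / D)) \<partial>M) \<le> 2"
  shows "integrable M (\<lambda>\<omega>. exp (2 * (1 / (2 * D)) * \<bar>U \<omega> * V \<omega>\<bar>))"
    and "expectation (\<lambda>\<omega>. exp (2 * (1 / (2 * D)) * \<bar>U \<omega> * V \<omega>\<bar>)) \<le> 2"
proof -
  have EU': "(\<integral>\<^sup>+\<omega>. ennreal (exp ((U \<omega>)\<^sup>2 / D)) \<partial>M) \<le> ennreal 2" using EU by simp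
  have iU: "integrable M (\<lambda>\<omega>. exp ((U \<omega>)\<^sup>2 / D))" "expectation (\<lambda>\<omega>. exp ((U \<omega>)\<^sup>2 / D)) \<le> 2"
    by (rule nn_integral_le_imp_integrable(1)[OF _ _ EU']; simp) (rule nn_integral_le_imp_integrable(2)[OF _ _ EU']; simp)
  have EV': "(\<integral>\<^sup>+\<omega>. ennreal (exp ((V \<omega>)\<^sup>2 / D)) \<partial>M) \<le> ennreal 2" using EV by simp
  have iV: "integrable M (\<lambda>\<omega>. exp ((V \<omega>)\<^sup>2 / D))" "expectation (\<lambda>\<omega>. exp ((V \<omega>)\<^sup>2 / D)) \<le> 2"
    by (rule nn_integral_le_imp_integrable(1)[OF _ _ EV']; simp) (rule nn_integral_le_imp_integrable(2)[OF _ _ EV']; simp)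
  have le: "exp (2 * (1 / (2 * D)) * \<bar>u * v\<bar>) \<le> (exp (u\<^sup>2 / D) + exp (v\<^sup>2 / D)) / 2" for u v :: real
  proof -
    have "2 * (\<bar>u\<bar> * \<bar>v\<bar>) \<le> u\<^sup>2 + v\<^sup>2" using sum_squares_bound[of "\<bar>u\<bar>" "\<bar>v\<bar>"] by simp
    then have "2 * (\<bar>u\<bar> * \<bar>v\<bar>) / (2 * D) \<le> (u\<^sup>2 + v\<^sup>2) / (2 * D)" using D by (intro divide_right_mono) auto
    also have "(u\<^sup>2 + v\<^sup>2) / (2 * D) = (u\<^sup>2 / D) / 2 + (v\<^sup>2 / D) / 2" by (simp add: add_divide_distrib)
    finally have "2 * (1 / (2 * D)) * \<bar>u * v\<bar> \<le> (u\<^sup>2 / D) / 2 + (v\<^sup>2 / D) / 2" by (simp add: abs_mult)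
    then have "exp (2 * (1 / (2 * D)) * \<bar>u * v\<bar>) \<le> exp ((u\<^sup>2 / D) / 2) * exp ((v\<^sup>2 / D) / 2)"
      by (simp add: exp_add[symmetric])
    moreover have sq: "exp (z / 2) ^ 2 = exp z" for z :: real by (simp add: power2_eq_square exp_add[symmetric])
    have "2 * (exp ((u\<^sup>2 / D) / 2) * exp ((v\<^sup>2 / D) / 2)) \<le> exp (u\<^sup>2 / D) + exp (v\<^sup>2 / D)"
      using sum_squares_bound[of "exp ((u\<^sup>2 / D) / 2)" "exp ((v\<^sup>2 / D) / 2)"] unfolding sq by (simp only: mult.assoc)
    moreover have "A \<le> Q / 2" if "A \<le> P" "2 * P \<le> Q" for A P Q :: real using that by simp
    ultimately show ?thesis by blast
  qed
  show i: "integrable M (\<lambda>\<omega>. exp (2 * (1 / (2 * D)) * \<bar>U \<omega> * V \<omega>\<bar>))"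
  proof (rule Bochner_Integration.integrable_bound[of _ "\<lambda>\<omega>. (exp ((U \<omega>)\<^sup>2 / D) + exp ((V \<omega>)\<^sup>2 / D)) / 2"])
    show "AE \<omega> in M. norm (exp (2 * (1 / (2 * D)) * \<bar>U \<omega> * V \<omega>\<bar>)) \<le> norm ((exp ((U \<omega>)\<^sup>2 / D) + exp ((V \<omega>)\<^sup>2 / D)) / 2)"
      using le by (intro AE_I2) (simp add: add_nonneg_nonneg)
  qed (use iU iV in auto)
  have "expectation (\<lambda>\<omega>. exp (2 * (1 / (2 * D)) * \<bar>U \<omega> * V \<omega>\<bar>)) \<le> expectation (\<lambda>\<omega>. (exp ((U \<omega>)\<^sup>2 / D) + exp ((V \<omega>)\<^sup>2 / D)) / 2)"
    using i iU iV le by (intro integral_mono) auto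
  also have "\<dots> \<le> 2" using iU iV by simp
  finally show "expectation (\<lambda>\<omega>. exp (2 * (1 / (2 * D)) * \<bar>U \<omega> * V \<omega>\<bar>)) \<le> 2" .
qed

end

context regression_model begin

text \<open>The sub-Gaussian condition speaks of vectors in the unit ball; this gives the common
  rescaling that brings every form into it.\<close>

lemma forms_sq_norm:
  assumes "u \<in> forms p T"
  shows "(\<Sum>k<p. (u k)\<^sup>2) \<le> (1 + C0 / c0)\<^sup>2"
proof -
  have r: "0 < C0 / c0" using c0 C0 by simp
  from assms consider j where "j < p" "u = unit_coef j" | j where "j < p" "u = eta_coef T j" by (auto simp: forms_def)
  then show ?thesis
  proof cases
    case 1
    have "(\<Sum>k<p. (u k)\<^sup>2) = (\<Sum>k<p. (if k = j then 1 else 0) * (1::real))" unfolding 1 unit_coef_def by (intro sum.cong) auto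
    also have "\<dots> = 1" by (rule sum_delta_mult(2)[OF 1(1)])
    also have "(1::real) \<le> (1 + C0 / c0)\<^sup>2" using r by (intro one_le_power) simp
    finally show ?thesis .
  next
    case 2
    have "(\<Sum>k<p. (u k)\<^sup>2) = (\<Sum>k<p. (T j k)\<^sup>2) / (T j j)\<^sup>2" by (simp add: 2 eta_coef_def power_divide sum_divide_distrib)
    also have "\<dots> \<le> (1 / c0\<^sup>2) / (1 / C0)\<^sup>2"
      using T_row_sq_le[OF 2(1)] T_diag_ge[OF 2(1)] C0 by (intro frac_le power_mono) auto
    also have "\<dots> = (C0 / c0)\<^sup>2" by (simp add: power_divide)
    also have "\<dots> \<le> (1 + C0 / c0)\<^sup>2" using r by (intro power_mono) auto
    finally show ?thesis .
  qed
qed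

lemma forms_variance:
  assumes "u \<in> forms p T" shows "bil p S u u \<le> C0"
proof -
  from assms consider j where "j < p" "u = unit_coef j" | j where "j < p" "u = eta_coef T j" by (auto simp: forms_def)
  then show ?thesis
  proof cases
    case 1 then show ?thesis using diag by (simp add: bil_unit_unit)
  next
    case 2
    have "1 / T j j \<le> C0" using T_diag_ge[OF 2(1)] T_diag_pos[OF 2(1)] C0 by (simp add: field_simps)
    then show ?thesis using 2 by (simp add: bil_eta eta_coef_diag)
  qed
qed

text \<open>One constant \<open>D\<close> dominates the sub-Gaussian constants of the forms and of
  the errors, so products of either kind have the same exponential moment. \<open>B\<close> is a sum
  because it has to serve both the second and the third moment bound.\<close>

lemma moments_sub_Gaussian:
  fixes C Ce Cs :: real
  assumes C: "0 < C" and Ce: "0 < Ce" and cs: "0 < cs" "cs \<le> sig2" "sig2 \<le> Cs"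
    and X_sub: "\<And>i a. i < n \<Longrightarrow> (\<Sum>j<p. (a j)\<^sup>2) \<le> 1 \<Longrightarrow>
        (\<integral>\<^sup>+\<omega>. ennreal (exp (\<bar>\<Sum>j<p. a j * X i j \<omega>\<bar>\<^sup>2 / C)) \<partial>M) \<le> 2"
    and eps_sub: "\<And>i. i < n \<Longrightarrow> (\<integral>\<^sup>+\<omega>. ennreal (exp (\<bar>eps i \<omega>\<bar>\<^sup>2 / Ce)) \<partial>M) \<le> 2"
  defines "D \<equiv> (1 + C0 / c0)\<^sup>2 * C + Ce"
  shows "regression_moments M n p X eps \<Sigma> \<Theta> sig2 c0 C0 1 (1 / (2 * D)) (4 / (1 / (2 * D)) ^ 2 + 12 / (1 / (2 * D)) ^ 3) cs Cs"
proof -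
  let ?N = "1 + C0 / c0"
  have N: "1 \<le> ?N" using c0 C0 by simp
  have D1: "?N\<^sup>2 * C \<le> D" "Ce \<le> D" "0 < D" using N C Ce by (auto simp: D_def add_pos_pos add_nonneg_pos)
  have lin_sub: "(\<integral>\<^sup>+\<omega>. ennreal (exp ((lin p X u i \<omega>)\<^sup>2 / D)) \<partial>M) \<le> 2" if u: "u \<in> forms p T" and i: "i < n" for u i
  proof -
    have "(\<Sum>k<p. (u k / ?N)\<^sup>2) \<le> 1"
    proof -
      have "(\<Sum>k<p. (u k / ?N)\<^sup>2) = (\<Sum>k<p. (u k)\<^sup>2) / ?N\<^sup>2" by (simp add: power_divide sum_divide_distrib)
      also have "\<dots> \<le> 1" using forms_sq_norm[OF u] N by (subst divide_le_eq_1_pos) auto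
      finally show ?thesis .
    qed
    from X_sub[OF i this] have "(\<integral>\<^sup>+\<omega>. ennreal (exp (\<bar>\<Sum>k<p. u k / ?N * X i k \<omega>\<bar>\<^sup>2 / C)) \<partial>M) \<le> 2" .
    moreover have "(\<integral>\<^sup>+\<omega>. ennreal (exp ((lin p X u i \<omega>)\<^sup>2 / D)) \<partial>M)
        \<le> (\<integral>\<^sup>+\<omega>. ennreal (exp (\<bar>\<Sum>k<p. u k / ?N * X i k \<omega>\<bar>\<^sup>2 / C)) \<partial>M)"
    proof (rule nn_integral_mono)
      fix \<omega>
      have "(\<Sum>k<p. u k / ?N * X i k \<omega>) = lin p X u i \<omega> / ?N"
        by (simp add: lin_def fit_def sum_divide_distrib mult.commute)
      then have "\<bar>\<Sum>k<p. u k / ?N * X i k \<omega>\<bar>\<^sup>2 / C = (lin p X u i \<omega>)\<^sup>2 / (?N\<^sup>2 * C)"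
        by (simp add: power_divide)
      moreover have "(lin p X u i \<omega>)\<^sup>2 / D \<le> (lin p X u i \<omega>)\<^sup>2 / (?N\<^sup>2 * C)"
        using D1 N C by (intro divide_left_mono) auto
      ultimately show "ennreal (exp ((lin p X u i \<omega>)\<^sup>2 / D)) \<le> ennreal (exp (\<bar>\<Sum>k<p. u k / ?N * X i k \<omega>\<bar>\<^sup>2 / C))"
        by (intro ennreal_leI) simp
    qed
    ultimately show ?thesis by (rule order_trans[rotated])
  qed
  have eps_D: "(\<integral>\<^sup>+\<omega>. ennreal (exp ((eps i \<omega>)\<^sup>2 / D)) \<partial>M) \<le> 2" if i: "i < n" for i
  proof -
    have "(\<integral>\<^sup>+\<omega>. ennreal (exp ((eps i \<omega>)\<^sup>2 / D)) \<partial>M) \<le> (\<integral>\<^sup>+\<omega>. ennreal (exp (\<bar>eps i \<omega>\<bar>\<^sup>2 / Ce)) \<partial>M)"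
    proof (rule nn_integral_mono)
      fix \<omega>
      have "(eps i \<omega>)\<^sup>2 / D \<le> (eps i \<omega>)\<^sup>2 / Ce" using D1 Ce by (intro divide_left_mono) auto
      then show "ennreal (exp ((eps i \<omega>)\<^sup>2 / D)) \<le> ennreal (exp (\<bar>eps i \<omega>\<bar>\<^sup>2 / Ce))" by (intro ennreal_leI) simp
    qed
    then show ?thesis using eps_sub[OF i] by (rule order_trans)
  qed
  let ?a = "1 / (2 * D)" and ?B = "4 / (1 / (2 * D)) ^ 2 + 12 / (1 / (2 * D)) ^ 3"
  have a: "0 < ?a" using D1 by simp
  have b: "0 < 4 / ?a ^ 2" "0 < 12 / ?a ^ 3" using a by auto
  show ?thesis
  proof unfold_locales
    show "0 < ?B" using b by linarith
    fix i assume i: "i < n"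
    {
      fix u v assume u: "u \<in> forms p T" and v: "v \<in> forms p T"
      have m: "(\<lambda>\<omega>. lin p X u i \<omega> * lin p X v i \<omega>) \<in> borel_measurable M" using lin_M[OF i] by measurable
      note e = exp_moment_imp_moments[OF m a product_exp_moment[OF lin_M[OF i] lin_M[OF i] D1(3) lin_sub[OF u i] lin_sub[OF v i]]]
      show "integrable M (\<lambda>\<omega>. (lin p X u i \<omega> * lin p X v i \<omega>)\<^sup>2 * exp (?a / 1\<^sup>2 * \<bar>lin p X u i \<omega> * lin p X v i \<omega>\<bar>))"
        using e(1) by simp
      show "expectation (\<lambda>\<omega>. (lin p X u i \<omega> * lin p X v i \<omega>)\<^sup>2 * exp (?a / 1\<^sup>2 * \<bar>lin p X u i \<omega> * lin p X v i \<omega>\<bar>)) \<le> ?B * 1\<^sup>2"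
      proof -
        have "expectation (\<lambda>\<omega>. (lin p X u i \<omega> * lin p X v i \<omega>)\<^sup>2 * exp (?a * \<bar>lin p X u i \<omega> * lin p X v i \<omega>\<bar>)) \<le> ?B"
          using e(2) b(2) by linarith
        then show ?thesis by (simp only: power_one div_by_1 mult_1_right)
      qed
    }
    fix u assume u: "u \<in> forms p T"
    have m: "(\<lambda>\<omega>. lin p X u i \<omega> * eps i \<omega>) \<in> borel_measurable M" using lin_M[OF i] eps_meas[OF i] by measurable
    have "third_exp_moment ?a (12 / ?a ^ 3) (\<lambda>\<omega>. lin p X u i \<omega> * eps i \<omega>)"
      by (rule exp_moment_imp_moments(3)[OF m a product_exp_moment[OF lin_M[OF i] eps_meas[OF i] D1(3) lin_sub[OF u i] eps_D[OF i]]])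
    then show "third_exp_moment (?a / 1) (?B * 1) (\<lambda>\<omega>. lin p X u i \<omega> * eps i \<omega>)"
      using third_exp_moment_mono[of ?a "12 / ?a ^ 3" _ ?B] b(1) by simp
  qed (use a cs in auto)
qed

text \<open>All forms are bounded by \<open>2 * K\<close>, as a residual is a column minus its fit.
  With \<open>\<bar>U\<bar> \<le> 2 * K\<close> the weight in the score moment is at most exp (2 a
  |e|); the cube of the error costs another exp (2 a |e|), and the choice of \<open>a\<close> makes
  the total the assumed exp (|e| / Ce).\<close>

lemma moments_bounded:
  fixes K Ce Cs :: real
  assumes K: "1 \<le> K" and Ce: "0 < Ce" and cs: "0 < cs" "cs \<le> sig2" "sig2 \<le> Cs"
    and X_bd: "\<And>i j. i < n \<Longrightarrow> j < p \<Longrightarrow> AE \<omega> in M. \<bar>X i j \<omega>\<bar> \<le> K"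
    and fit_bd: "\<And>i j. i < n \<Longrightarrow> j < p \<Longrightarrow> AE \<omega> in M. \<bar>node_fit M n p X j \<omega> $ i\<bar> \<le> K"
    and eps_exp: "\<And>i. i < n \<Longrightarrow> (\<integral>\<^sup>+\<omega>. ennreal (exp (\<bar>eps i \<omega>\<bar> / Ce)) \<partial>M) \<le> 2"
  defines "a \<equiv> 1 / (4 * Ce)"
  shows "regression_moments M n p X eps \<Sigma> \<Theta> sig2 c0 C0 K a (4 * C0 * exp (4 * a) + 3 * C0 / a ^ 3) cs Cs"
proof -
  have a: "0 < a" using Ce by (simp add: a_def)
  have K0: "0 < K" using K by simp
  have bd: "AE \<omega> in M. \<bar>lin p X u i \<omega>\<bar> \<le> 2 * K" if u: "u \<in> forms p T" and i: "i < n" for u i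
  proof -
    from u consider j where "j < p" "u = unit_coef j" | j where "j < p" "u = eta_coef T j" by (auto simp: forms_def)
    then show ?thesis
    proof cases
      case 1
      show ?thesis using X_bd[OF i 1(1)] by (rule AE_mp) (use 1 K in \<open>auto simp: lin_unit\<close>)
    next
      case 2
      have nf: "node_fit M n p X j \<omega> $ i = fit p (\<lambda>i k. X i k \<omega>) (node_target T j) i" for \<omega>
        using i by (simp add: node_fit_def node_coef_eq[OF 2(1)] design_def fit_def scalar_prod_def lessThan_atLeast0)
      show ?thesis using X_bd[OF i 2(1)] fit_bd[OF i 2(1)]
        by eventually_elim (simp add: 2 lin_eta nf)
    qed
  qed
  let ?B1 = "4 * C0 * exp (4 * a)" and ?B2 = "3 * C0 / a ^ 3"
  have b: "0 < ?B1" "0 < ?B2" using C0 a by auto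
  show ?thesis
  proof unfold_locales
    show "0 < ?B1 + ?B2" using b by linarith
    fix i assume i: "i < n"
    {
      fix u v assume u: "u \<in> forms p T" and v: "v \<in> forms p T"
      have [measurable]: "lin p X u i \<in> borel_measurable M" "lin p X v i \<in> borel_measurable M" using lin_M[OF i] by auto
      let ?f = "\<lambda>\<omega>. (lin p X u i \<omega> * lin p X v i \<omega>)\<^sup>2 * exp (a / K\<^sup>2 * \<bar>lin p X u i \<omega> * lin p X v i \<omega>\<bar>)"
      let ?g = "\<lambda>\<omega>. (4 * K\<^sup>2 * exp (4 * a)) * (lin p X u i \<omega> * lin p X u i \<omega>)"
      have le: "AE \<omega> in M. ?f \<omega> \<le> ?g \<omega>"
        using bd[OF u i] bd[OF v i]
      proof eventually_elim
        case (elim \<omega>)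
        let ?U = "lin p X u i \<omega>" and ?V = "lin p X v i \<omega>"
        have "\<bar>?U * ?V\<bar> \<le> (2 * K) * (2 * K)" unfolding abs_mult using elim K by (intro mult_mono) auto
        then have "a / K\<^sup>2 * \<bar>?U * ?V\<bar> \<le> a / K\<^sup>2 * ((2 * K) * (2 * K))" using a by (intro mult_left_mono) auto
        also have "\<dots> = 4 * a" using K0 by (simp add: power2_eq_square)
        finally have e: "exp (a / K\<^sup>2 * \<bar>?U * ?V\<bar>) \<le> exp (4 * a)" by simp
        have "\<bar>?V\<bar> \<le> \<bar>2 * K\<bar>" using elim K by simp
        then have "?V\<^sup>2 \<le> (2 * K)\<^sup>2" by (rule abs_le_square_iff[THEN iffD1])
        then have "(?U * ?V)\<^sup>2 \<le> ?U\<^sup>2 * (2 * K)\<^sup>2" unfolding power_mult_distrib[of ?U] by (intro mult_left_mono) auto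
        then have "(?U * ?V)\<^sup>2 * exp (a / K\<^sup>2 * \<bar>?U * ?V\<bar>) \<le> (?U\<^sup>2 * (2 * K)\<^sup>2) * exp (4 * a)"
          using e by (intro mult_mono) auto
        then show ?case by (simp add: power2_eq_square mult_ac)
      qed
      have ig: "integrable M ?g" using lin_lin(1)[OF i, of u u] by simp
      show if': "integrable M ?f"
      proof (rule Bochner_Integration.integrable_bound[OF ig])
        show "AE \<omega> in M. norm (?f \<omega>) \<le> norm (?g \<omega>)"
          using le by eventually_elim (simp add: abs_mult power2_eq_square)
      qed measurable
      have "expectation ?f \<le> expectation ?g" by (rule integral_mono_AE[OF if' ig le])
      also have "\<dots> = (4 * K\<^sup>2 * exp (4 * a)) * bil p S u u" using lin_lin[OF i, of u u] by simp
      also have "\<dots> \<le> (4 * K\<^sup>2 * exp (4 * a)) * C0" using forms_variance[OF u] by (intro mult_left_mono) auto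
      also have "\<dots> \<le> (?B1 + ?B2) * K\<^sup>2"
      proof -
        have "0 \<le> ?B2 * K\<^sup>2" by (rule mult_nonneg_nonneg[OF less_imp_le[OF b(2)]]) simp
        moreover have "(4 * K\<^sup>2 * exp (4 * a)) * C0 = ?B1 * K\<^sup>2" by simp
        ultimately show ?thesis unfolding distrib_right by linarith
      qed
      finally show "expectation ?f \<le> (?B1 + ?B2) * K\<^sup>2" .
    }
    fix u assume u: "u \<in> forms p T"
    have mU[measurable]: "lin p X u i \<in> borel_measurable M" "eps i \<in> borel_measurable M" using lin_M[OF i] eps_meas[OF i] by auto
    have ee: "exp (\<bar>y\<bar> / Ce) = exp (4 * a * \<bar>y\<bar>)" for y :: real by (simp add: a_def)
    have e2: "(\<integral>\<^sup>+\<omega>. ennreal (exp (4 * a * \<bar>eps i \<omega>\<bar>)) \<partial>M) \<le> ennreal 2" using eps_exp[OF i] by (simp add: ee)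
    have ie: "integrable M (\<lambda>\<omega>. exp (4 * a * \<bar>eps i \<omega>\<bar>))" "expectation (\<lambda>\<omega>. exp (4 * a * \<bar>eps i \<omega>\<bar>)) \<le> 2"
      by (rule nn_integral_le_imp_integrable(1)[OF _ _ e2]; simp) (rule nn_integral_le_imp_integrable(2)[OF _ _ e2]; simp)
    let ?g = "\<lambda>\<omega>. (6 / (2 * a) ^ 3) * exp (4 * a * \<bar>eps i \<omega>\<bar>)"
    let ?f = "\<lambda>\<omega>. \<bar>lin p X u i \<omega> * eps i \<omega>\<bar> ^ 3 * exp (a / K * \<bar>lin p X u i \<omega> * eps i \<omega>\<bar>)"
    let ?h = "\<lambda>\<omega>. (2 * K) * ((lin p X u i \<omega> * lin p X u i \<omega>) * ?g \<omega>)"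
    have le: "AE \<omega> in M. ?f \<omega> \<le> ?h \<omega>"
      using bd[OF u i]
    proof eventually_elim
      case (elim \<omega>)
      let ?U = "lin p X u i \<omega>" and ?e = "eps i \<omega>"
      have "a / K * \<bar>?U * ?e\<bar> = (a / K * \<bar>?e\<bar>) * \<bar>?U\<bar>" by (simp add: abs_mult)
      also have "\<dots> \<le> (a / K * \<bar>?e\<bar>) * (2 * K)" using elim a K0 by (intro mult_left_mono) auto
      also have "\<dots> = 2 * a * \<bar>?e\<bar>" using K0 by simp
      finally have x: "exp (a / K * \<bar>?U * ?e\<bar>) \<le> exp (2 * a * \<bar>?e\<bar>)" by simp
      have "\<bar>?U * ?e\<bar> ^ 3 = \<bar>?U\<bar> * (?U * ?U) * \<bar>?e\<bar> ^ 3"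
      proof -
        have "\<bar>?U\<bar> ^ 3 = \<bar>?U\<bar> * (?U * ?U)" by (simp add: power3_eq_cube)
        then show ?thesis unfolding abs_mult[of ?U] power_mult_distrib by simp
      qed
      also have "\<dots> \<le> (2 * K) * (?U * ?U) * \<bar>?e\<bar> ^ 3" using elim by (intro mult_right_mono) auto
      finally have "?f \<omega> \<le> ((2 * K) * (?U * ?U) * \<bar>?e\<bar> ^ 3) * exp (2 * a * \<bar>?e\<bar>)"
        using x K0 by (intro mult_mono) auto
      also have "\<dots> = (2 * K) * ((?U * ?U) * (\<bar>?e\<bar> ^ 3 * exp (2 * a * \<bar>?e\<bar>)))" by simp
      also have "\<dots> \<le> ?h \<omega>"
      proof -
        have "\<bar>?e\<bar> ^ 3 * exp (2 * a * \<bar>?e\<bar>) \<le> (6 / (2 * a) ^ 3 * exp (2 * a * \<bar>?e\<bar>)) * exp (2 * a * \<bar>?e\<bar>)"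
          using power_le_exp(2)[of "2 * a" ?e] a by (intro mult_right_mono) auto
        also have "\<dots> = ?g \<omega>" by (simp add: exp_add[symmetric])
        finally show ?thesis using K0 by (intro mult_left_mono) auto
      qed
      finally show ?case .
    qed
    \<comment> \<open>The square of the form depends on the design alone and the exponential on the
      error alone, so their expectation factors. Keeping this square is what makes the bound linear
      in \<open>K\<close> instead of cubic.\<close>
    have mA: "(\<lambda>\<omega>. lin p X u i \<omega> * lin p X u i \<omega>) \<in> borel_measurable MA" using lin_MA[OF i] by measurable
    have mB: "?g \<in> borel_measurable MB" using eps_MB[OF i] by measurable
    have ig: "integrable M ?g" using ie by simp
    note pe = product_expectation[OF mA mB lin_lin(1)[OF i] ig]
    have ih: "integrable M ?h" using pe(2) by (rule integrable_mult_right)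
    have if': "integrable M ?f"
    proof (rule Bochner_Integration.integrable_bound[OF ih])
      show "AE \<omega> in M. norm (?f \<omega>) \<le> norm (?h \<omega>)"
        using le
      proof eventually_elim
        case (elim \<omega>)
        have "norm (?f \<omega>) = ?f \<omega>" by (simp add: abs_mult power_abs)
        also note elim
        also have "?h \<omega> \<le> norm (?h \<omega>)" unfolding real_norm_def by (rule abs_ge_self)
        finally show ?case .
      qed
    qed measurable
    have "expectation ?f \<le> expectation ?h" by (rule integral_mono_AE[OF if' ih le])
    also have "\<dots> = (2 * K) * (bil p S u u * expectation ?g)"
      unfolding pe(1)[unfolded lin_lin(2)[OF i], symmetric] by (rule integral_mult_right_zero)
    also have "\<dots> \<le> (2 * K) * (C0 * (6 / (2 * a) ^ 3 * 2))"
    proof (intro mult_left_mono mult_mono)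
      have "expectation ?g = 6 / (2 * a) ^ 3 * expectation (\<lambda>\<omega>. exp (4 * a * \<bar>eps i \<omega>\<bar>))"
        by (rule integral_mult_right_zero)
      also have "\<dots> \<le> 6 / (2 * a) ^ 3 * 2" using ie(2) a by (intro mult_left_mono) auto
      finally show "expectation ?g \<le> 6 / (2 * a) ^ 3 * 2" .
      show "0 \<le> expectation ?g" using a by (intro integral_nonneg_AE) auto
    qed (use forms_variance[OF u] C0 K0 in auto)
    also have "\<dots> = ?B2 * K" using a by (simp add: power3_eq_cube)
    also have "\<dots> \<le> (?B1 + ?B2) * K" using b K0 by (intro mult_right_mono) auto
    finally show "third_exp_moment (a / K) ((?B1 + ?B2) * K) (\<lambda>\<omega>. lin p X u i \<omega> * eps i \<omega>)"
      using if' by (simp add: third_exp_moment_def)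
  qed (use a cs K in auto)
qed

text \<open>Each such \<open>k\<close> contributes at least (e / C0)^2 to the squared Euclidean norm
  of row \<open>j\<close> of the precision matrix, and this norm is bounded. No sparsity of the row
  is involved.\<close>

lemma card_correlated_le:
  assumes j: "j < p" and e: "0 < e"
  shows "real (card {k. k < p \<and> e < \<bar>T j k / sqrt (T j j * T k k)\<bar>}) \<le> (C0 / c0)\<^sup>2 / e\<^sup>2"
proof -
  let ?K = "{k. k < p \<and> e < \<bar>T j k / sqrt (T j j * T k k)\<bar>}"
  have "real (card ?K) * (e / C0)\<^sup>2 = (\<Sum>k\<in>?K. (e / C0)\<^sup>2)" by simp
  also have "\<dots> \<le> (\<Sum>k\<in>?K. (T j k)\<^sup>2)"
  proof (rule sum_mono)
    fix k assume k: "k \<in> ?K"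
    then have kp: "k < p" and gt: "e < \<bar>T j k / sqrt (T j j * T k k)\<bar>" by auto
    have "(1 / C0) * (1 / C0) \<le> T j j * T k k" using T_diag_ge[OF j] T_diag_ge[OF kp] T_diag_pos[OF j] C0 by (intro mult_mono) auto
    then have "sqrt ((1 / C0) * (1 / C0)) \<le> sqrt (T j j * T k k)" by (rule real_sqrt_le_mono)
    moreover have "sqrt ((1 / C0) * (1 / C0)) = 1 / C0" using C0 by (simp only: real_sqrt_abs2) simp
    ultimately have s: "1 / C0 \<le> sqrt (T j j * T k k)" by (simp only:)
    have s0: "0 < sqrt (T j j * T k k)" using s C0 by (meson less_le_trans zero_less_divide_1_iff)
    have "e * sqrt (T j j * T k k) < \<bar>T j k\<bar>" using gt s0 by (simp add: abs_divide pos_less_divide_eq)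
    moreover have "e * (1 / C0) \<le> e * sqrt (T j j * T k k)" using s e by (intro mult_left_mono) auto
    ultimately have "e / C0 \<le> \<bar>T j k\<bar>" by simp
    then show "(e / C0)\<^sup>2 \<le> (T j k)\<^sup>2" using e C0 by (metis abs_le_square_iff abs_of_pos divide_pos_pos)
  qed
  also have "\<dots> \<le> (\<Sum>k<p. (T j k)\<^sup>2)" by (intro sum_mono2) auto
  also have "\<dots> \<le> 1 / c0\<^sup>2" by (rule T_row_sq_le[OF j])
  finally show ?thesis using e C0 c0 by (simp add: power_divide field_simps)
qed

end

section \<open>Asymptotics\<close>

locale regression_sequence =
  fixes M :: "nat \<Rightarrow> 'a measure" and p s0 :: "nat \<Rightarrow> nat" and X :: "nat \<Rightarrow> nat \<Rightarrow> nat \<Rightarrow> 'a \<Rightarrow> real"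
    and eps :: "nat \<Rightarrow> nat \<Rightarrow> 'a \<Rightarrow> real" and \<Sigma> \<Theta> :: "nat \<Rightarrow> real mat" and sig2 :: "nat \<Rightarrow> real"
    and sig2hat :: "nat \<Rightarrow> real vec \<Rightarrow> real mat \<Rightarrow> real"
    and K \<alpha> q sN :: "nat \<Rightarrow> real" and c0 C0 a B cs Cs :: real
  assumes moments: "\<And>n. 0 < n \<Longrightarrow>
      regression_moments (M n) n (p n) (X n) (eps n) (\<Sigma> n) (\<Theta> n) (sig2 n) c0 C0 (K n) a B cs Cs"
    and sig2hat: "\<And>n. 0 < n \<Longrightarrow> is_variance_estimator (M n) n (p n) (X n) (eps n) (sig2hat n)"
    and sN: "\<And>n j. 0 < n \<Longrightarrow> j < p n \<Longrightarrow> real (row_sparsity (p n) (\<Theta> n) j) \<le> sN n" "\<And>n. 0 \<le> sN n"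
    and \<alpha>: "\<And>n. 0 < n \<Longrightarrow> 0 < \<alpha> n" "filterlim \<alpha> at_top sequentially"
    and p_lim: "filterlim (\<lambda>n. real (p n)) at_top sequentially"
    and e1_lim: "(\<lambda>n. K n * (ln (p n) * sqrt (ln (p n)) / sqrt n)) \<longlonglongrightarrow> 0"
    and e2_lim: "(\<lambda>n. (K n)\<^sup>2 * real (s0 n) * (ln (p n) * sqrt (ln (p n)) / sqrt n)) \<longlonglongrightarrow> 0"
    and e3_lim: "(\<lambda>n. K n * sN n * (ln (p n) * sqrt (ln (p n)) / sqrt n)) \<longlonglongrightarrow> 0"
    and q: "\<And>n \<beta>. 0 < n \<Longrightarrow> \<beta> \<in> considered n (p n) (\<Theta> n) (sig2 n) (s0 n) \<Longrightarrow>
      measure (M n) {\<omega> \<in> space (M n). \<alpha> n * (ln (p n))\<^sup>2 *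
        \<bar>sig2hat n (response n (p n) (X n) (eps n) \<beta> \<omega>) (design n (p n) (X n) \<omega>) - sig2 n\<bar> > 1} \<le> q n"
    and q_lim: "q \<longlonglongrightarrow> 0"
begin

abbreviation L where "L n \<equiv> ln (real (p n))"
abbreviation rt where "rt n \<equiv> sqrt (L n / real n)"

text \<open>\<open>cA\<close> and \<open>cE\<close> are large enough for Bernstein's inequality to beat the union bounds over the
  \<open>4 p\<^sup>2\<close> entries of the Gram matrix and the \<open>p\<close> noise terms. \<open>DL\<close> bounds \<open>dS\<close> times \<open>ln p\<close>: relative
  errors of order \<open>1 / ln p\<close> are what changes \<open>p * exp (- x\<^sup>2 / 2)\<close> by a constant factor at
  \<open>x\<^sup>2 = 2 ln p\<close>.\<close>

definition cA where "cA = 4 * sqrt B"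
definition cV where "cV = (C0 * Cs + a * B) / 2"
definition cE where "cE = 4 * sqrt cV"
text \<open>Tuning parameters are twice the corresponding deviation levels, since the Lasso bounds
  ask for noise of at most half the penalty. The level \<open>dES\<close> has no factor
  \<open>K\<close>, whereas \<open>lamS\<close> has one in order to be of the prescribed
  order.\<close>

definition lamS where "lamS n = 2 * cE * (K n * rt n)"
definition lNS where "lNS n = 2 * cA * (K n * rt n)"
definition dGS where "dGS n = cA * (K n * rt n)"
definition dES where "dES n = cE * rt n"
text \<open>The first two summands solve \<open>d_gram\<close> and \<open>d_rem\<close> for
  \<open>d\<close>. The third makes \<open>dS n * cs\<close> at least the accuracy of the variance
  estimator granted by the assumption on \<open>\<alpha>\<close>.\<close>

definition dS where "dS n = (dGS n + 64 * sN n * (lNS n)\<^sup>2 / c0) / c0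
  + (32 * lNS n * (sN n * dES n + s0 n * lamS n) / c0) / (sqrt (2 * L n / n) * sqrt (cs * c0))
  + 1 / (\<alpha> n * (L n)\<^sup>2 * cs)"
definition e1 where "e1 n = K n * (L n * sqrt (L n) / sqrt n)"
definition e2 where "e2 n = (K n)\<^sup>2 * real (s0 n) * (L n * sqrt (L n) / sqrt n)"
definition e3 where "e3 n = K n * sN n * (L n * sqrt (L n) / sqrt n)"
definition cR where "cR = 64 * cA * cE / (c0 * (sqrt 2 * sqrt (cs * c0)))"
definition DL where "DL n = (cA * e1 n + 256 * cA\<^sup>2 * e1 n * e3 n / c0) / c0 + cR * (e3 n + 2 * e2 n) + 1 / (\<alpha> n * cs)"
definition cW where "cW = sqrt (1 / (c0 * cs)) ^ 3 * B / 2 + 32"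

lemma lims: "e1 \<longlonglongrightarrow> 0" "e2 \<longlonglongrightarrow> 0" "e3 \<longlonglongrightarrow> 0"
  using e1_lim e2_lim e3_lim unfolding e1_def[abs_def] e2_def[abs_def] e3_def[abs_def] by auto

lemma const_pos: "0 < c0" "0 < C0" "0 < a" "0 < B" "0 < cs" "0 < Cs" "1 \<le> K n \<or> n = 0"
proof -
  interpret R: regression_moments "M 1" 1 "p 1" "X 1" "eps 1" "\<Sigma> 1" "\<Theta> 1" "sig2 1" c0 C0 "K 1" a B cs Cs
    by (rule moments) simp
  show "0 < c0" "0 < C0" "0 < a" "0 < B" "0 < cs" "0 < Cs"
    using R.c0 R.C0 R.a R.B R.cs by auto
  show "1 \<le> K n \<or> n = 0"
  proof (cases "n = 0")
    case False
    then interpret Rn: regression_moments "M n" n "p n" "X n" "eps n" "\<Sigma> n" "\<Theta> n" "sig2 n" c0 C0 "K n" a B cs Cs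
      by (intro moments) simp
    show ?thesis using Rn.K by simp
  qed simp
qed

lemma cA_pos: "0 < cA" and cV_pos: "0 < cV" and cE_pos: "0 < cE" and cW_ge: "32 \<le> cW"
proof -
  note c = const_pos(1-6)
  show "0 < cA" using c by (simp add: cA_def)
  show "0 < cV" using c by (simp add: cV_def add_pos_pos)
  then show "0 < cE" by (simp add: cE_def)
  show "32 \<le> cW" using c by (simp add: cW_def)
qed

lemma L_lim: "filterlim L at_top sequentially"
  by (rule filterlim_compose[OF ln_at_top p_lim])

lemma DL_lim: "DL \<longlonglongrightarrow> 0"
proof -
  have "(\<lambda>n. inverse (\<alpha> n)) \<longlonglongrightarrow> 0" by (rule tendsto_inverse_0_at_top[OF \<alpha>(2)])
  then have i: "(\<lambda>n. 1 / (\<alpha> n * cs)) \<longlonglongrightarrow> 0"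
    using tendsto_mult_right_zero[of "\<lambda>n. inverse (\<alpha> n)" sequentially "1 / cs"] by (simp add: field_simps)
  have "(\<lambda>n. (cA * e1 n + 256 * cA\<^sup>2 * e1 n * e3 n / c0) / c0 + cR * (e3 n + 2 * e2 n) + 1 / (\<alpha> n * cs))
      \<longlonglongrightarrow> (cA * 0 + 256 * cA\<^sup>2 * 0 * 0 / c0) / c0 + cR * (0 + 2 * 0) + 0"
    using const_pos(1) by (intro tendsto_intros lims i) auto
  then show ?thesis by (simp add: DL_def[abs_def])
qed

text \<open>The smallness conditions under which every bound at fixed sample size applies. The value
  8 makes sqrt (2 * 8) / 4 = 1, so that even the reduced level in the union bound stays above
  1.\<close>

definition regime where
  "regime n \<longleftrightarrow> 0 < n \<and> 8 \<le> L n \<and> DL n \<le> 1 / 8 \<and> cA * e1 n \<le> 2 * a * B \<and> cE * e1 n \<le> 2 * cV * a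
    \<and> 32 * cA * e3 n \<le> c0 \<and> 32 * cA * e2 n \<le> c0 \<and> 4 * e1 n \<le> a / sqrt (1 / (c0 * cs)) / 2 \<and> 4 * e1 n \<le> 1
    \<and> 8 * cW * e1 n \<le> 1 / 2"

lemma eventually_regime: "eventually regime sequentially"
proof -
  have ev: "eventually (\<lambda>n. f n \<le> c) sequentially" if "f \<longlonglongrightarrow> 0" "0 < c" for f :: "nat \<Rightarrow> real" and c
  proof -
    have "eventually (\<lambda>n. f n < c) sequentially" using that by (rule order_tendstoD(2))
    then show ?thesis by eventually_elim simp
  qed
  have k: "0 < sqrt (1 / (c0 * cs))" using const_pos by simp
  have "eventually (\<lambda>n. 0 < n) sequentially" by (rule eventually_gt_at_top)
  moreover have "eventually (\<lambda>n. 8 \<le> L n) sequentially" using L_lim by (simp add: filterlim_at_top)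
  moreover have "eventually (\<lambda>n. DL n \<le> 1 / 8) sequentially" by (rule ev[OF DL_lim]) simp
  moreover have "eventually (\<lambda>n. cA * e1 n \<le> 2 * a * B) sequentially"
    by (rule ev) (use const_pos tendsto_mult_right_zero[OF lims(1)] in auto)
  moreover have "eventually (\<lambda>n. cE * e1 n \<le> 2 * cV * a) sequentially"
    by (rule ev) (use const_pos cV_pos tendsto_mult_right_zero[OF lims(1)] in auto)
  moreover have "eventually (\<lambda>n. 32 * cA * e3 n \<le> c0) sequentially"
    by (rule ev) (use const_pos tendsto_mult_right_zero[OF lims(3)] in auto)
  moreover have "eventually (\<lambda>n. 32 * cA * e2 n \<le> c0) sequentially"
    by (rule ev) (use const_pos tendsto_mult_right_zero[OF lims(2)] in auto)
  moreover have "eventually (\<lambda>n. 4 * e1 n \<le> a / sqrt (1 / (c0 * cs)) / 2) sequentially"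
    by (rule ev) (use k const_pos tendsto_mult_right_zero[OF lims(1)] in auto)
  moreover have "eventually (\<lambda>n. 4 * e1 n \<le> 1) sequentially"
    by (rule ev) (use tendsto_mult_right_zero[OF lims(1)] in auto)
  moreover have "eventually (\<lambda>n. 8 * cW * e1 n \<le> 1 / 2) sequentially"
    by (rule ev) (use tendsto_mult_right_zero[OF lims(1)] in auto)
  ultimately show ?thesis unfolding regime_def by eventually_elim simp
qed

section \<open>Consequences of the regime at one sample size\<close>

context
  fixes n assumes rg: "regime n"
begin

lemma n0: "0 < n" and L8: "8 \<le> L n" and Kn: "1 \<le> K n"
  using rg const_pos(7)[of n] by (auto simp: regime_def)

lemma rt_pos: "0 < rt n" using n0 L8 by simp

lemma rt_L: "rt n * L n = L n * sqrt (L n) / sqrt n" by (simp add: real_sqrt_divide)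

lemma e_eq: "e1 n = K n * (rt n * L n)" "e2 n = (K n)\<^sup>2 * real (s0 n) * (rt n * L n)" "e3 n = K n * sN n * (rt n * L n)"
  unfolding rt_L e1_def e2_def e3_def by auto

lemma e_nonneg: "0 \<le> e1 n" "0 \<le> e2 n" "0 \<le> e3 n"
  unfolding e_eq using Kn rt_pos L8 sN(2)[of n] by auto

lemma Krt: "K n * rt n \<le> e1 n"
proof -
  have "K n * (rt n * 1) \<le> K n * (rt n * L n)" using Kn rt_pos L8 by (intro mult_left_mono) auto
  then show ?thesis by (simp add: e_eq(1))
qed

lemma sKrt: "sN n * (K n * rt n) \<le> e3 n" "real (s0 n) * (K n * rt n) \<le> e2 n"
proof -
  show "sN n * (K n * rt n) \<le> e3 n"
    using mult_left_mono[OF Krt sN(2)[of n]] by (simp add: e_eq mult_ac)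
  have "real (s0 n) * (K n * rt n) \<le> real (s0 n) * (K n * (K n * (rt n * L n)))"
  proof (intro mult_left_mono)
    have "1 * (rt n * 1) \<le> K n * (rt n * L n)" using Kn rt_pos L8 by (intro mult_mono) auto
    then show "rt n \<le> K n * (rt n * L n)" by simp
  qed (use Kn in auto)
  then show "real (s0 n) * (K n * rt n) \<le> e2 n" by (simp add: e_eq power2_eq_square mult_ac)
qed

lemma dS_pos: "0 < dS n"
proof -
  have "0 \<le> dGS n" "0 \<le> lNS n" "0 \<le> dES n" "0 \<le> lamS n"
    using cA_pos cE_pos Kn rt_pos by (auto simp: dGS_def lNS_def dES_def lamS_def)
  then have "0 \<le> (dGS n + 64 * sN n * (lNS n)\<^sup>2 / c0) / c0"
    "0 \<le> (32 * lNS n * (sN n * dES n + s0 n * lamS n) / c0) / (sqrt (2 * L n / n) * sqrt (cs * c0))"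
    using const_pos sN(2)[of n] L8 by (auto intro!: divide_nonneg_nonneg add_nonneg_nonneg mult_nonneg_nonneg)
  moreover have "0 < 1 / (\<alpha> n * (L n)\<^sup>2 * cs)" using \<alpha>(1)[OF n0] L8 const_pos by simp
  ultimately show ?thesis unfolding dS_def by linarith
qed

lemma dS_L: "dS n * L n \<le> DL n"
proof -
  have 1: "dGS n * L n = cA * e1 n" by (simp add: dGS_def e_eq)
  have 2: "64 * sN n * (lNS n)\<^sup>2 / c0 * L n \<le> 256 * cA\<^sup>2 * e1 n * e3 n / c0"
  proof -
    have "64 * sN n * (lNS n)\<^sup>2 / c0 * L n = (256 * cA\<^sup>2 * (sN n * (K n)\<^sup>2 * (rt n)\<^sup>2) / c0) * L n"
      by (simp add: lNS_def power_mult_distrib)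
    \<comment> \<open>One logarithm is given away so that the term becomes the product
      \<open>e1 n * e3 n\<close>.\<close>
    also have "\<dots> \<le> (256 * cA\<^sup>2 * (sN n * (K n)\<^sup>2 * (rt n)\<^sup>2) / c0) * (L n * L n)"
    proof (rule mult_left_mono)
      have "1 * L n \<le> L n * L n" using L8 by (intro mult_right_mono) auto
      then show "L n \<le> L n * L n" by simp
      show "0 \<le> 256 * cA\<^sup>2 * (sN n * (K n)\<^sup>2 * (rt n)\<^sup>2) / c0"
        using sN(2)[of n] const_pos by (intro divide_nonneg_nonneg mult_nonneg_nonneg) auto
    qed
    also have "\<dots> = 256 * cA\<^sup>2 * e1 n * e3 n / c0"
    proof -
      have "(256 * cA\<^sup>2 * (s * k\<^sup>2 * r\<^sup>2) / c0) * (l * l) = 256 * cA\<^sup>2 * (k * (r * l)) * (k * s * (r * l)) / c0" for s k r l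
        by (simp add: power2_eq_square mult_ac)
      then show ?thesis unfolding e_eq .
    qed
    finally show ?thesis .
  qed
  have 3: "(32 * lNS n * (sN n * dES n + s0 n * lamS n) / c0) / (sqrt (2 * L n / n) * sqrt (cs * c0)) * L n
      = cR * (e3 n + 2 * e2 n)"
  proof -
    let ?r = "rt n"
    have s: "sqrt (2 * L n / n) = sqrt 2 * ?r" by (simp add: real_sqrt_mult[symmetric])
    have z: "0 < sqrt (cs * c0)" "0 < sqrt (2::real)" using const_pos by auto
    \<comment> \<open>Both summands of the numerator carry the rate \<open>r\<close> twice, as
      products of two errors of that order. One of them cancels against the standard error, and the
      other is paired with the logarithm.\<close>
    have gen: "(32 * (2 * cA * (k * r)) * (s * (cE * r) + t * (2 * cE * (k * r))) / c0) / ((h * r) * z) * l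
        = (r * (64 * cA * cE * (k * s * (r * l) + 2 * (k\<^sup>2 * t * (r * l))))) / (r * (c0 * (h * z)))" for k r s t h z l
      by (simp add: power2_eq_square algebra_simps add_divide_distrib)
    have "(32 * lNS n * (sN n * dES n + s0 n * lamS n) / c0) / (sqrt (2 * L n / n) * sqrt (cs * c0)) * L n
        = (?r * (64 * cA * cE * (K n * sN n * (?r * L n) + 2 * ((K n)\<^sup>2 * s0 n * (?r * L n))))) / (?r * (c0 * (sqrt 2 * sqrt (cs * c0))))"
      unfolding s lNS_def dES_def lamS_def by (rule gen)
    also have "\<dots> = (64 * cA * cE * (K n * sN n * (?r * L n) + 2 * ((K n)\<^sup>2 * s0 n * (?r * L n)))) / (c0 * (sqrt 2 * sqrt (cs * c0)))"
      by (rule mult_divide_mult_cancel_left[OF less_imp_neq[OF rt_pos, symmetric]])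
    also have "\<dots> = cR * (e3 n + 2 * e2 n)" by (simp add: cR_def e_eq)
    finally show ?thesis .
  qed
  have 4: "1 / (\<alpha> n * (L n)\<^sup>2 * cs) * L n \<le> 1 / (\<alpha> n * cs)"
  proof -
    have "1 / (\<alpha> n * (L n)\<^sup>2 * cs) * L n = (1 / (\<alpha> n * cs)) * (1 / L n)"
      using L8 by (simp add: power2_eq_square)
    also have "\<dots> \<le> (1 / (\<alpha> n * cs)) * 1"
      using L8 \<alpha>(1)[OF n0] const_pos by (intro mult_left_mono) auto
    finally show ?thesis by simp
  qed
  have "dS n * L n = (dGS n * L n + 64 * sN n * (lNS n)\<^sup>2 / c0 * L n) / c0
      + (32 * lNS n * (sN n * dES n + s0 n * lamS n) / c0) / (sqrt (2 * L n / n) * sqrt (cs * c0)) * L n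
      + 1 / (\<alpha> n * (L n)\<^sup>2 * cs) * L n"
    unfolding dS_def by (simp only: distrib_right times_divide_eq_left add_divide_distrib)
  also have "\<dots> \<le> DL n"
    unfolding DL_def 1 3 using 2 4 const_pos by (intro add_mono divide_right_mono) auto
  finally show ?thesis .
qed

lemma dS_le: "dS n \<le> 1 / 8"
proof -
  have "dS n * 1 \<le> dS n * L n" using dS_pos L8 by (intro mult_left_mono) auto
  then show ?thesis using dS_L rg by (simp add: regime_def)
qed

lemma estimators:
  assumes "is_lasso (M n) n (p n) (X n) (eps n) (lamS n) bh"
    and "is_nodewise_lasso (M n) n (p n) (X n) (\<lambda>_. lNS n) gh"
  shows "regression_estimators (M n) n (p n) (X n) (eps n) (\<Sigma> n) (\<Theta> n) (sig2 n) c0 C0 (K n) a B cs Cs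
    (lamS n) (lNS n) (sN n) (s0 n) (dGS n) (dES n) (dS n) bh gh (sig2hat n)"
proof -
  interpret R: regression_moments "M n" n "p n" "X n" "eps n" "\<Sigma> n" "\<Theta> n" "sig2 n" c0 C0 "K n" a B cs Cs
    by (rule moments[OF n0])
  have Kr: "0 < K n * rt n" using Kn rt_pos by simp
  have c: "0 < c0" "0 < cs" using const_pos by auto
  show ?thesis
  proof unfold_locales
    show "is_lasso (M n) n (p n) (X n) (eps n) (lamS n) bh" "is_nodewise_lasso (M n) n (p n) (X n) (\<lambda>_. lNS n) gh"
      by fact+
    show "is_variance_estimator (M n) n (p n) (X n) (eps n) (sig2hat n)" by (rule sig2hat[OF n0])
    show "0 < lamS n" "0 < lNS n" "0 \<le> dGS n" "dGS n \<le> lNS n / 2" "0 \<le> dES n"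
      using Kr cA_pos cE_pos rt_pos by (auto simp: lamS_def lNS_def dGS_def dES_def)
    have "cE * (1 * rt n) \<le> cE * (K n * rt n)" using cE_pos Kn rt_pos by (intro mult_left_mono mult_right_mono) auto
    then show "dES n \<le> lamS n / 2" by (simp add: dES_def lamS_def)
    show "real (row_sparsity (p n) (\<Theta> n) j) \<le> sN n" if "j < p n" for j using sN(1)[OF n0 that] .
    have "32 * sN n * dGS n = 32 * cA * (sN n * (K n * rt n))" by (simp add: dGS_def)
    also have "\<dots> \<le> 32 * cA * e3 n" using sKrt cA_pos by (intro mult_left_mono) auto
    finally show "32 * sN n * dGS n \<le> c0" using rg by (simp add: regime_def)
    have "32 * real (s0 n) * dGS n = 32 * cA * (real (s0 n) * (K n * rt n))" by (simp add: dGS_def)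
    also have "\<dots> \<le> 32 * cA * e2 n" using sKrt cA_pos by (intro mult_left_mono) auto
    finally show "32 * real (s0 n) * dGS n \<le> c0" using rg by (simp add: regime_def)
    show "0 < dS n" "dS n \<le> 1 / 8" using dS_pos dS_le by auto
    have nn: "0 \<le> lNS n" "0 \<le> dES n" "0 \<le> lamS n" "0 \<le> dGS n"
      using Kr cA_pos cE_pos rt_pos by (auto simp: lamS_def lNS_def dGS_def dES_def)
    let ?a = "(dGS n + 64 * sN n * (lNS n)\<^sup>2 / c0) / c0"
    let ?z = "sqrt (2 * L n / n) * sqrt (cs * c0)"
    let ?b = "(32 * lNS n * (sN n * dES n + s0 n * lamS n) / c0) / ?z"
    have z: "0 < ?z" using c L8 n0 by simp
    have ab: "0 \<le> ?a" "0 \<le> ?b"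
      using nn c sN(2)[of n] L8 by (auto intro!: divide_nonneg_nonneg add_nonneg_nonneg mult_nonneg_nonneg)
    have t: "0 \<le> 1 / (\<alpha> n * (L n)\<^sup>2 * cs)" using \<alpha>(1)[OF n0] c by simp
    have "?a \<le> dS n" using ab t by (simp add: dS_def)
    then show "dGS n + 64 * sN n * (lNS n)\<^sup>2 / c0 \<le> dS n * c0" using c by (simp only: pos_divide_le_eq)
    have "?b \<le> dS n" using ab t by (simp add: dS_def)
    then have "32 * lNS n * (sN n * dES n + s0 n * lamS n) / c0 \<le> dS n * ?z" using z by (simp only: pos_divide_le_eq)
    then show "32 * lNS n * (sN n * dES n + s0 n * lamS n) / c0 \<le> dS n * sqrt (2 * ln (real (p n)) / n) * sqrt (cs * c0)"
      by (simp only: mult.assoc)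
  qed
qed

lemma p_exp: "real (p n) = exp (L n)"
proof -
  have "0 < real (p n)" using L8 by (cases "p n = 0") auto
  then show ?thesis by simp
qed

lemma p_ge_1: "1 \<le> real (p n)"
  using L8 by (cases "p n = 0") auto

text \<open>All levels in use, about sqrt (2 ln p) for the upper tail and sqrt (t ln p) with t < 2
  for the tilts, lie below \<open>2 * sqrt (L n)\<close>; the 8 is the cube of this 2.\<close>

lemma tail_scale:
  assumes "0 \<le> y" "y \<le> 2 * sqrt (L n)"
  shows "y / sqrt n \<le> 2 * e1 n" "K n * (y / sqrt n) \<le> 2 * e1 n" "y ^ 3 * K n / sqrt n \<le> 8 * e1 n"
proof -
  have sn: "0 < sqrt n" using n0 by simp
  have "K n * (y / sqrt n) \<le> K n * (2 * (sqrt (L n) / sqrt n))"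
    using Kn assms sn by (intro mult_left_mono) (auto simp: divide_right_mono)
  also have "\<dots> = 2 * (K n * rt n)" by (simp add: real_sqrt_divide)
  also have "\<dots> \<le> 2 * e1 n" using Krt by simp
  finally show K: "K n * (y / sqrt n) \<le> 2 * e1 n" .
  have "1 * (y / sqrt n) \<le> K n * (y / sqrt n)" using Kn assms sn by (intro mult_right_mono) auto
  then show "y / sqrt n \<le> 2 * e1 n" using K by simp
  have "y ^ 3 \<le> (2 * sqrt (L n)) ^ 3" using assms by (intro power_mono) auto
  also have "\<dots> = 8 * (L n * sqrt (L n))" using L8 by (simp add: power3_eq_cube)
  finally have "y ^ 3 * (K n / sqrt n) \<le> 8 * (L n * sqrt (L n)) * (K n / sqrt n)"
    using Kn sn by (intro mult_right_mono) auto
  then show "y ^ 3 * K n / sqrt n \<le> 8 * e1 n" by (simp add: e1_def mult_ac)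
qed

end

text \<open>The term 10 / p collects 8 / p from the Gram matrix and 2 / p from the noise. The last
  term is \<open>p\<close> times the score tail: \<open>p\<close> cancels against the Gaussian
  exponent, and the slowly growing root in the denominator is all that drives it to 0.\<close>

definition b1 where "b1 n = 10 / real (p n) + q n
  + 10 * exp (512 * cW * e1 n + 12 * DL n) / sqrt (sqrt (L n) / 4)"

lemma b1_lim: "b1 \<longlonglongrightarrow> 0"
proof -
  have 1: "(\<lambda>n. 10 / real (p n)) \<longlonglongrightarrow> 0"
    by (rule tendsto_divide_0[OF tendsto_const filterlim_at_top_imp_at_infinity[OF p_lim]])
  have "((\<lambda>t::real. 1 / sqrt (sqrt t / 4)) \<longlongrightarrow> 0) at_top" by real_asymp
  then have 2: "(\<lambda>n. 1 / sqrt (sqrt (L n) / 4)) \<longlonglongrightarrow> 0" by (rule filterlim_compose[OF _ L_lim])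
  have "(\<lambda>n. 10 / real (p n) + q n + 10 * exp (512 * cW * e1 n + 12 * DL n) * (1 / sqrt (sqrt (L n) / 4)))
      \<longlonglongrightarrow> 0 + 0 + 10 * exp (512 * cW * 0 + 12 * 0) * 0"
    by (intro tendsto_intros 1 2 q_lim lims DL_lim)
  then show ?thesis by (simp add: b1_def[abs_def])
qed

lemma bad_le:
  assumes rg: "regime n" and \<beta>: "\<beta> \<in> considered n (p n) (\<Theta> n) (sig2 n) (s0 n)"
    and bh: "is_lasso (M n) n (p n) (X n) (eps n) (lamS n) bh"
    and gh: "is_nodewise_lasso (M n) n (p n) (X n) (\<lambda>_. lNS n) gh"
  shows "regression_estimators.bad (M n) n (p n) (X n) (eps n) (\<Sigma> n) (\<Theta> n) (sig2 n) cs (dGS n) (dES n) (dS n) (sig2hat n) \<beta>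
    \<le> 10 / real (p n) + q n"
proof -
  interpret R: regression_estimators "M n" n "p n" "X n" "eps n" "\<Sigma> n" "\<Theta> n" "sig2 n" c0 C0 "K n" a B cs Cs
    "lamS n" "lNS n" "sN n" "s0 n" "dGS n" "dES n" "dS n" bh gh "sig2hat n"
    by (rule estimators[OF rg bh gh])
  note n0 = n0[OF rg] and L8 = L8[OF rg] and Kn = Kn[OF rg]
  have rt2: "(rt n)\<^sup>2 = L n / n" using L8 by simp
  have K0: "0 < K n" using Kn by simp
  note p1 = p_ge_1[OF rg]
  \<comment> \<open>The constants \<open>cA\<close> and \<open>cE\<close> make both Bernstein
    exponents equal to \<open>4 * L n\<close>; p^(-4) beats p^2 pairs as well as \<open>p\<close>
    noise terms.\<close>
  have e4: "exp (- (4 * L n)) = 1 / real (p n) ^ 4"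
  proof -
    have "exp (- (4 * l)) = 1 / exp l ^ 4" for l :: real
      by (simp add: exp_minus inverse_eq_divide exp_of_nat_mult[symmetric])
    then show ?thesis by (simp only: p_exp[OF rg, symmetric])
  qed
  have g: "R.prob {\<omega> \<in> space (M n). \<not> gram_close n (p n) R.S R.T (R.dsg \<omega>) (dGS n)} \<le> 8 * (real (p n))\<^sup>2 * (1 / real (p n) ^ 4)"
  proof -
    have x: "0 \<le> dGS n" by (rule R.dG(1))
    have "dGS n \<le> cA * e1 n" unfolding dGS_def using Krt[OF rg] cA_pos by (intro mult_left_mono) auto
    then have x2: "dGS n \<le> 2 * a * B" using rg by (simp add: regime_def)
    have "real n * (dGS n)\<^sup>2 / (4 * (B * (K n)\<^sup>2)) = 4 * L n"
      using n0 K0 const_pos by (simp add: dGS_def cA_def power_mult_distrib rt2)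
    then have "- real n * (dGS n)\<^sup>2 / (4 * (B * (K n)\<^sup>2)) = - (4 * L n)" by simp
    then show ?thesis using R.prob_not_gram_close[OF x x2] by (simp only: e4)
  qed
  have ns: "R.prob {\<omega> \<in> space (M n). \<exists>k<p n. real n * dES n \<le> \<bar>\<Sum>i<n. X n i k \<omega> * eps n i \<omega>\<bar>} \<le> 2 * real (p n) * (1 / real (p n) ^ 4)"
  proof -
    have v1: "R.v1 = cV" by (simp add: R.v1_def cV_def)
    have x: "0 \<le> dES n" by (rule R.dE(1))
    have "cE * (K n * rt n) \<le> cE * e1 n" using Krt[OF rg] cE_pos by (intro mult_left_mono) auto
    also have "\<dots> \<le> 2 * cV * a" using rg by (simp add: regime_def)
    finally have "dES n * K n \<le> 2 * cV * a" by (simp add: dES_def mult_ac)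
    then have x2: "dES n \<le> 2 * R.v1 * (a / K n)" unfolding v1 using K0 by (simp add: pos_le_divide_eq)
    have "real n * (dES n)\<^sup>2 / (4 * R.v1) = 4 * L n"
      unfolding v1 using n0 cV_pos by (simp add: dES_def cE_def power_mult_distrib rt2)
    then have "- real n * (dES n)\<^sup>2 / (4 * R.v1) = - (4 * L n)" by simp
    then show ?thesis using R.prob_noise[OF x x2] by (simp only: e4)
  qed
  have vr: "R.prob {\<omega> \<in> space (M n). dS n * cs < \<bar>sig2hat n (R.Y \<beta> \<omega>) (R.DX \<omega>) - sig2 n\<bar>} \<le> q n"
  proof -
    have \<beta>c: "\<beta> \<in> carrier_vec (p n)" using \<beta> by (auto simp: considered_def Psi_def S_star_def)
    have [measurable]: "(\<lambda>\<omega>. sig2hat n (R.Y \<beta> \<omega>) (R.DX \<omega>)) \<in> borel_measurable (M n)" by (rule R.sig2hat_meas[OF \<beta>c])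
    have "R.prob {\<omega> \<in> space (M n). dS n * cs < \<bar>sig2hat n (R.Y \<beta> \<omega>) (R.DX \<omega>) - sig2 n\<bar>}
        \<le> R.prob {\<omega> \<in> space (M n). \<alpha> n * (L n)\<^sup>2 * \<bar>sig2hat n (R.Y \<beta> \<omega>) (R.DX \<omega>) - sig2 n\<bar> > 1}"
    proof (rule R.finite_measure_mono)
      let ?w = "\<alpha> n * (L n)\<^sup>2"
      have w: "0 < ?w" using \<alpha>(1)[OF n0] L8 by simp
      have nn: "0 \<le> lNS n" "0 \<le> dES n" "0 \<le> lamS n" "0 \<le> dGS n" using R.lN R.dE R.lam R.dG by auto
      have "0 \<le> (dGS n + 64 * sN n * (lNS n)\<^sup>2 / c0) / c0"
        "0 \<le> (32 * lNS n * (sN n * dES n + s0 n * lamS n) / c0) / (sqrt (2 * L n / n) * sqrt (cs * c0))"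
        using nn const_pos sN(2)[of n] L8 by (auto intro!: divide_nonneg_nonneg add_nonneg_nonneg mult_nonneg_nonneg)
      \<comment> \<open>The other summands of \<open>dS\<close> are nonnegative, so its third one
        alone places the event inside the one whose probability \<open>q\<close> bounds.\<close>
      then have "1 / (?w * cs) \<le> dS n" unfolding dS_def by linarith
      then have "1 \<le> dS n * (?w * cs)"
        unfolding pos_divide_le_eq[OF mult_pos_pos[OF w const_pos(5)]] .
      then have d1: "1 \<le> ?w * (dS n * cs)" by (simp only: mult_ac)
      show "{\<omega> \<in> space (M n). dS n * cs < \<bar>sig2hat n (R.Y \<beta> \<omega>) (R.DX \<omega>) - sig2 n\<bar>}
        \<subseteq> {\<omega> \<in> space (M n). ?w * \<bar>sig2hat n (R.Y \<beta> \<omega>) (R.DX \<omega>) - sig2 n\<bar> > 1}"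
      proof clarify
        fix \<omega> assume "dS n * cs < \<bar>sig2hat n (R.Y \<beta> \<omega>) (R.DX \<omega>) - sig2 n\<bar>"
        then have "?w * (dS n * cs) < ?w * \<bar>sig2hat n (R.Y \<beta> \<omega>) (R.DX \<omega>) - sig2 n\<bar>"
          using w by (rule mult_strict_left_mono)
        then show "?w * \<bar>sig2hat n (R.Y \<beta> \<omega>) (R.DX \<omega>) - sig2 n\<bar> > 1" using d1 by linarith
      qed
    qed measurable
    also have "\<dots> \<le> q n" by (rule q[OF n0 \<beta>])
    finally show ?thesis .
  qed
  have "8 * (real (p n))\<^sup>2 * (1 / real (p n) ^ 4) \<le> 8 / real (p n)"
    using p1 by (simp add: field_simps power2_eq_square power4_eq_xxxx)
  moreover have "2 * real (p n) * (1 / real (p n) ^ 4) \<le> 2 / real (p n)"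
  proof -
    have "1 * 1 \<le> real (p n) * real (p n)" using p1 by (intro mult_mono) auto
    moreover have "0 < real (p n)" using p1 by linarith
    ultimately show ?thesis by (simp add: field_simps power4_eq_xxxx)
  qed
  ultimately show ?thesis unfolding R.bad_def using g ns vr by (simp add: add_divide_distrib[symmetric])
qed

lemma Lx_bound:
  assumes rg: "regime n"
  shows "regression_moments.Lx c0 (K n) B cs / 2 + 32 \<le> cW * K n"
    and "regression_moments.bx c0 (K n) a cs = a / K n / sqrt (1 / (c0 * cs))"
proof -
  interpret R: regression_moments "M n" n "p n" "X n" "eps n" "\<Sigma> n" "\<Theta> n" "sig2 n" c0 C0 "K n" a B cs Cs
    by (rule moments[OF n0[OF rg]])
  show "R.bx = a / K n / sqrt (1 / (c0 * cs))" by (simp add: R.bx_def R.kap_def)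
  show "R.Lx / 2 + 32 \<le> cW * K n"
    using Kn[OF rg] by (simp add: R.Lx_def R.kap_def cW_def algebra_simps)
qed

lemma recovery_lower_bound:
  assumes rg: "regime n" and \<beta>: "\<beta> \<in> Psi n (p n) (\<Theta> n) (sig2 n) (2 * sqrt 2) \<inter> sparse_upto (p n) (s0 n)"
    and bh: "is_lasso (M n) n (p n) (X n) (eps n) (lamS n) bh"
    and gh: "is_nodewise_lasso (M n) n (p n) (X n) (\<lambda>_. lNS n) gh"
  shows "1 - b1 n \<le> prob_exact_recovery (M n) n (p n) (X n) (eps n) (\<lambda>_. lNS n) bh gh (sig2hat n) 2 \<beta>"
proof -
  interpret R: regression_estimators "M n" n "p n" "X n" "eps n" "\<Sigma> n" "\<Theta> n" "sig2 n" c0 C0 "K n" a B cs Cs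
    "lamS n" "lNS n" "sN n" "s0 n" "dGS n" "dES n" "dS n" bh gh "sig2hat n"
    by (rule estimators[OF rg bh gh])
  note n0 = n0[OF rg] and L8 = L8[OF rg] and Kn = Kn[OF rg] and d = dS_pos[OF rg] dS_le[OF rg]
  have con: "\<beta> \<in> considered n (p n) (\<Theta> n) (sig2 n) (s0 n)" using \<beta> by (simp add: considered_def)
  have bad: "R.bad \<beta> \<le> 10 / real (p n) + q n" by (rule bad_le[OF rg con bh gh])
  let ?x = "sqrt (2 * L n) * (1 - 6 * dS n)"
  have x_up: "?x \<le> sqrt (2 * L n)" using d L8 by (intro mult_left_le) auto
  \<comment> \<open>\<open>dS n \<le> 1 / 8\<close> gives
    \<open>1 - 6 * dS n \<ge> 1 / 4\<close>.\<close>
  have x_low: "sqrt (2 * L n) * (1 / 4) \<le> ?x" using d L8 by (intro mult_mono) auto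
  have "4 \<le> sqrt (2 * L n)" using L8 by (intro real_le_rsqrt) simp
  then have x1: "1 \<le> ?x" using x_low by linarith
  have "sqrt (L n) \<le> sqrt (2 * L n)" using L8 by simp
  then have x_low': "sqrt (L n) / 4 \<le> ?x" using x_low by linarith
  have "sqrt (2 * L n) \<le> sqrt (4 * L n)" using L8 by simp
  also have "sqrt (4 * L n) = 2 * sqrt (L n)" by (simp add: real_sqrt_mult)
  finally have x_up': "?x \<le> 2 * sqrt (L n)" using x_up by linarith
  have x0: "0 \<le> ?x" using x1 by linarith
  note ts = tail_scale[OF rg x0 x_up']
  have k: "0 < sqrt (1 / (c0 * cs))" using const_pos by simp
  have K0: "0 < K n" using Kn by simp
  have sn: "0 < sqrt n" using n0 by simp
  have two: "k * (2 * x / s) = 2 * (k * (x / s))" "2 * x / s = 2 * (x / s)" for k x s :: real by simp_all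
  have "K n * (2 * ?x / sqrt n) \<le> 4 * e1 n" unfolding two(1) using ts(2) by linarith
  also have "\<dots> \<le> a / sqrt (1 / (c0 * cs)) / 2" using rg by (simp only: regime_def)
  also have "\<dots> \<le> a / sqrt (1 / (c0 * cs))" 
  proof -
    have "z / 2 \<le> z" if "0 < z" for z :: real using that by simp
    then show ?thesis using divide_pos_pos[OF const_pos(3) k] by blast
  qed
  finally have Kx: "K n * (2 * ?x / sqrt n) \<le> a / sqrt (1 / (c0 * cs))" .
  have bx: "2 * ?x / sqrt n \<le> R.bx"
  proof -
    have "y \<le> a / k / s" if "k * y \<le> a / s" "0 < k" for y k s
    proof -
      have "y \<le> a / s / k" using that by (simp only: pos_le_divide_eq mult.commute)
      then show ?thesis by (simp add: mult_ac)
    qed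
    then show ?thesis unfolding Lx_bound(2)[OF rg] using K0 Kx by blast
  qed
  have "2 * ?x / sqrt n \<le> 4 * e1 n" unfolding two(2) using ts(1) by linarith
  also have "\<dots> \<le> 1" using rg by (simp only: regime_def)
  finally have b1': "2 * ?x / sqrt n \<le> 1" .
  have Rb: "8 * (2 * ?x) ^ 3 * (R.Lx / 2 + 32) / sqrt n \<le> 512 * cW * e1 n"
  proof -
    have "8 * (2 * ?x) ^ 3 * (R.Lx / 2 + 32) / sqrt n \<le> 8 * (2 * ?x) ^ 3 * (cW * K n) / sqrt n"
      using Lx_bound(1)[OF rg] x0 sn by (intro divide_right_mono mult_left_mono) auto
    also have "\<dots> = 64 * cW * (?x ^ 3 * K n / sqrt n)" by (simp add: power_mult_distrib)
    also have "\<dots> \<le> 64 * cW * (8 * e1 n)" using ts(3) cW_ge by (intro mult_left_mono) auto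
    finally show ?thesis by simp
  qed
  \<comment> \<open>Lowering the level by the relative amount \<open>6 * dS n\<close> costs
    \<open>12 * dS n * L n\<close> in the exponent, which is at most \<open>12 * DL n\<close> and
    hence bounded. This is where errors of order 1 / ln p become decisive.\<close>
  have xsq: "L n - 12 * DL n \<le> ?x\<^sup>2 / 2"
  proof -
    have "?x\<^sup>2 / 2 = L n * (1 - 6 * dS n)\<^sup>2" using L8 by (simp add: power_mult_distrib)
    also have "\<dots> = L n - 12 * (dS n * L n) + 36 * (L n * (dS n)\<^sup>2)" by (simp add: power2_eq_square algebra_simps)
    finally have "?x\<^sup>2 / 2 = L n - 12 * (dS n * L n) + 36 * (L n * (dS n)\<^sup>2)" .
    moreover have "0 \<le> L n * (dS n)\<^sup>2" using L8 by simp
    ultimately show ?thesis using dS_L[OF rg] by linarith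
  qed
  let ?e = "exp (512 * cW * e1 n + 12 * DL n)"
  have each: "R.prob {\<omega> \<in> space (M n). ?x \<le> \<bar>R.W j \<omega>\<bar>} \<le> 10 * (?e * exp (- L n)) / sqrt (sqrt (L n) / 4)" if j: "j < p n" for j
  proof -
    have "R.prob {\<omega> \<in> space (M n). ?x \<le> \<bar>R.W j \<omega>\<bar>}
        \<le> 2 * (exp (8 * (2 * ?x) ^ 3 * (R.Lx / 2 + 32) / sqrt n - ?x\<^sup>2 / 2) * (5 / sqrt ?x))"
      by (rule R.W_tail[OF j x1 bx b1'])
    also have "\<dots> \<le> 2 * ((?e * exp (- L n)) * (5 / sqrt (sqrt (L n) / 4)))"
    proof (intro mult_left_mono mult_mono)
      show "exp (8 * (2 * ?x) ^ 3 * (R.Lx / 2 + 32) / sqrt n - ?x\<^sup>2 / 2) \<le> ?e * exp (- L n)"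
        unfolding exp_add[symmetric] exp_le_cancel_iff using Rb xsq by linarith
      show "5 / sqrt ?x \<le> 5 / sqrt (sqrt (L n) / 4)"
      proof (intro divide_left_mono real_sqrt_le_mono x_low' mult_pos_pos)
        show "0 < sqrt ?x" unfolding real_sqrt_gt_0_iff using x1 by linarith
        show "0 < sqrt (sqrt (L n) / 4)" using L8 by simp
      qed simp
    qed (use x0 in auto)
    finally show ?thesis by simp
  qed
  have "(\<Sum>j<p n. R.prob {\<omega> \<in> space (M n). ?x \<le> \<bar>R.W j \<omega>\<bar>}) \<le> (\<Sum>j<p n. 10 * (?e * exp (- L n)) / sqrt (sqrt (L n) / 4))"
    using each by (intro sum_mono) auto
  also have "\<dots> = (exp (L n) * exp (- L n)) * (10 * ?e / sqrt (sqrt (L n) / 4))"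
    by (simp add: p_exp[OF rg, symmetric])
  \<comment> \<open>The number of coordinates cancels exactly against the Gaussian exponent, so
    convergence rests on the extra factor 1 / sqrt x of the sharp tail.\<close>
  also have "exp (L n) * exp (- L n) = 1" by (simp add: exp_add[symmetric])
  finally have sum: "(\<Sum>j<p n. R.prob {\<omega> \<in> space (M n). ?x \<le> \<bar>R.W j \<omega>\<bar>}) \<le> 10 * ?e / sqrt (sqrt (L n) / 4)" by simp
  have "1 - (R.bad \<beta> + (\<Sum>j<p n. R.prob {\<omega> \<in> space (M n). ?x \<le> \<bar>R.W j \<omega>\<bar>}))
      \<le> prob_exact_recovery (M n) n (p n) (X n) (eps n) (\<lambda>_. lNS n) bh gh (sig2hat n) 2 \<beta>"
    by (rule R.recovery_lower) (use \<beta> in \<open>auto simp: sparse_upto_def\<close>)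
  then show ?thesis using bad sum unfolding b1_def by linarith
qed

text \<open>The second moment bound with levels \<open>sqrt (t * L n)\<close> for
  \<open>t1 < t2 < t3\<close> and correlation threshold 1 / (ln p)^2. The off-diagonal term tends to
  1, the diagonal one to 0 and the mean to 1, so the bracket tends to 1 - 2 + 1 = 0.\<close>

definition b2 where "b2 \<rho> t1 t2 t3 n = 10 / real (p n) + q n
  + (exp (t2 / L n + 1024 * cW * e1 n)
    + exp (1024 * cW * e1 n) * ((1 + (C0 / c0)\<^sup>2 * L n ^ 4) * exp (- (1 - (sqrt t2 * sqrt t3 - t2 / 2)) * L n)) / (1 - \<rho>)
    - 2 * (exp (- (1024 * cW * e1 n)) - exp (1024 * cW * e1 n - (sqrt t2 - sqrt t1)\<^sup>2 / 2 * L n)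
        - exp (1024 * cW * e1 n - (sqrt t3 - sqrt t2)\<^sup>2 / 2 * L n)) + 1)"

lemma b2_lim:
  assumes t: "0 < t1" "t1 < t2" "t2 < t3" "t3 < 2" and \<rho>: "\<rho> < 1"
  shows "b2 \<rho> t1 t2 t3 \<longlonglongrightarrow> 0"
proof -
  have R: "(\<lambda>n. 1024 * cW * e1 n) \<longlonglongrightarrow> 0" using tendsto_mult_right_zero[OF lims(1)] by auto
  have p0: "(\<lambda>n. 10 / real (p n)) \<longlonglongrightarrow> 0"
    by (rule tendsto_divide_0[OF tendsto_const filterlim_at_top_imp_at_infinity[OF p_lim]])
  have i: "(\<lambda>n. t2 / L n) \<longlonglongrightarrow> 0"
    by (rule tendsto_divide_0[OF tendsto_const filterlim_at_top_imp_at_infinity[OF L_lim]])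
  define k where "k = 1 - (sqrt t2 * sqrt t3 - t2 / 2)"
  have k0: "0 < k"
  proof -
    \<comment> \<open>Gives \<open>k \<ge> 1 - t3 / 2\<close>, positive since \<open>t3 < 2\<close>.
      The exponential decay of rate \<open>k\<close> then outweighs the polynomial in ln p that
      comes from the degree bound.\<close>
    have "2 * sqrt t2 * sqrt t3 \<le> (sqrt t2)\<^sup>2 + (sqrt t3)\<^sup>2" by (rule sum_squares_bound)
    then show ?thesis using t by (simp add: k_def)
  qed
  define Q where "Q = (C0 / c0)\<^sup>2"
  have "((\<lambda>x::real. (1 + Q * x ^ 4) * exp (- k * x)) \<longlongrightarrow> 0) at_top"
    using k0 by real_asymp
  then have A: "(\<lambda>n. (1 + Q * L n ^ 4) * exp (- k * L n)) \<longlonglongrightarrow> 0" by (rule filterlim_compose[OF _ L_lim])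
  have ex: "(\<lambda>n. exp (1024 * cW * e1 n - c * L n)) \<longlonglongrightarrow> 0" if c: "0 < c" for c
  proof -
    have "((\<lambda>x::real. exp (- c * x)) \<longlongrightarrow> 0) at_top" using c by real_asymp
    then have "(\<lambda>n. exp (- c * L n)) \<longlonglongrightarrow> 0" by (rule filterlim_compose[OF _ L_lim])
    then have "(\<lambda>n. exp (1024 * cW * e1 n) * exp (- c * L n)) \<longlonglongrightarrow> exp 0 * 0"
      by (intro tendsto_intros R)
    then show ?thesis by (simp add: exp_add[symmetric])
  qed
  have d: "0 < (sqrt t2 - sqrt t1)\<^sup>2 / 2" "0 < (sqrt t3 - sqrt t2)\<^sup>2 / 2" using t by auto
  have "(\<lambda>n. 10 / real (p n) + q n + (exp (t2 / L n + 1024 * cW * e1 n)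
    + exp (1024 * cW * e1 n) * ((1 + Q * L n ^ 4) * exp (- k * L n)) / (1 - \<rho>)
    - 2 * (exp (- (1024 * cW * e1 n)) - exp (1024 * cW * e1 n - (sqrt t2 - sqrt t1)\<^sup>2 / 2 * L n)
        - exp (1024 * cW * e1 n - (sqrt t3 - sqrt t2)\<^sup>2 / 2 * L n)) + 1))
    \<longlonglongrightarrow> 0 + 0 + (exp (0 + 0) + exp 0 * 0 / (1 - \<rho>) - 2 * (exp (- 0) - 0 - 0) + 1)"
    by (intro tendsto_add tendsto_diff tendsto_mult tendsto_divide tendsto_exp tendsto_minus tendsto_const
        R p0 i q_lim A[simplified] ex d A) (use \<rho> in auto)
  then show ?thesis by (simp add: b2_def[abs_def] k_def Q_def)
qed

lemma recovery_upper_bound: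
  assumes rg: "regime n" and \<beta>: "\<beta> \<in> S_star (p n) (s0 n)"
    and bh: "is_lasso (M n) n (p n) (X n) (eps n) (lamS n) bh"
    and gh: "is_nodewise_lasso (M n) n (p n) (X n) (\<lambda>_. lNS n) gh"
    and \<tau>: "0 < \<tau>" "\<tau> < 2" and t: "0 < t1" "t1 < t2" "t2 < t3" "t3 < 2" and \<rho>: "\<rho> < 1"
    and dt: "sqrt \<tau> + 3 * dS n \<le> sqrt t1" and s\<rho>: "real (s0 n) \<le> \<rho> * real (p n)"
  shows "prob_exact_recovery (M n) n (p n) (X n) (eps n) (\<lambda>_. lNS n) bh gh (sig2hat n) \<tau> \<beta> \<le> b2 \<rho> t1 t2 t3 n"
proof -
  interpret R: regression_estimators "M n" n "p n" "X n" "eps n" "\<Sigma> n" "\<Theta> n" "sig2 n" c0 C0 "K n" a B cs Cs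
    "lamS n" "lNS n" "sN n" "s0 n" "dGS n" "dES n" "dS n" bh gh "sig2hat n"
    by (rule estimators[OF rg bh gh])
  note n0 = n0[OF rg] and L8 = L8[OF rg] and Kn = Kn[OF rg] and d = dS_pos[OF rg] dS_le[OF rg]
  have con: "\<beta> \<in> considered n (p n) (\<Theta> n) (sig2 n) (s0 n)" using \<beta> by (simp add: considered_def)
  have bad: "R.bad \<beta> \<le> 10 / real (p n) + q n" by (rule bad_le[OF rg con bh gh])
  have \<beta>c: "\<beta> \<in> carrier_vec (p n)" and \<beta>s: "card (supp \<beta>) = s0 n" using \<beta> by (auto simp: S_star_def)
  let ?V = "{..<p n} - supp \<beta>"
  \<comment> \<open>The threshold must be small against 1 / ln p, because the tilt is of order sqrt
    (ln p) and enters squared. The price is a degree of order (ln p)^4, negligible against any power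
    of \<open>p\<close>.\<close>
  let ?e = "1 / (L n)\<^sup>2"
  let ?Q = "(C0 / c0)\<^sup>2 * L n ^ 4"
  \<comment> \<open>The index bounds are part of the relation so that it is symmetric for all
    arguments, symmetry of the matrix being known only below \<open>p n\<close>.\<close>
  let ?E = "\<lambda>u v. u < p n \<and> v < p n \<and> ?e < \<bar>R.T u v / sqrt (R.T u u * R.T v v)\<bar>"
  have e0: "0 < ?e" using L8 by simp
  have symE: "?E v u" if "?E u v" for u v using that R.T_sym[of u v] by (simp add: mult.commute)
  have deg: "real (card {u \<in> ?V. ?E v u}) \<le> ?Q" if v: "v \<in> ?V" for v
  proof -
    have "card {u \<in> ?V. ?E v u} \<le> card {k. k < p n \<and> ?e < \<bar>R.T v k / sqrt (R.T v v * R.T k k)\<bar>}"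
      by (intro card_mono) auto
    then have "real (card {u \<in> ?V. ?E v u}) \<le> (C0 / c0)\<^sup>2 / ?e\<^sup>2"
      using R.card_correlated_le[of v ?e] v e0 by (smt (verit, ccfv_SIG) DiffD1 lessThan_iff of_nat_mono)
    also have "\<dots> = ?Q" by (simp add: power_divide)
    finally show ?thesis .
  qed
  have Q0: "0 \<le> ?Q" using L8 by simp
  obtain J where J: "J \<subseteq> ?V" and ind: "\<And>u v. u \<in> J \<Longrightarrow> v \<in> J \<Longrightarrow> u \<noteq> v \<Longrightarrow> \<not> ?E u v"
    and card: "real (card ?V) \<le> (1 + ?Q) * real (card J)"
    using independent_set_exists[of ?V ?Q ?E, OF _ Q0 symE deg] by blast
  have sp: "supp \<beta> \<subseteq> {..<p n}" using \<beta>c by (auto simp: supp_def)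
  have cV: "real (card ?V) = real (p n) - real (s0 n)"
  proof -
    have "card ?V = p n - s0 n" using sp \<beta>s by (simp add: card_Diff_subset finite_subset)
    moreover have "s0 n \<le> p n" using card_mono[OF _ sp] \<beta>s by simp
    ultimately show ?thesis by simp
  qed
  have pp: "0 < real (p n)" using p_ge_1[OF rg] by linarith
  have cV': "(1 - \<rho>) * real (p n) \<le> (1 + ?Q) * real (card J)"
    using card s\<rho> unfolding cV by (simp add: left_diff_distrib)
  have "0 < (1 - \<rho>) * real (p n)" using \<rho> pp by simp
  then have "0 < (1 + ?Q) * real (card J)" using cV' by linarith
  then have Jc: "0 < real (card J)" using Q0 by (simp add: zero_less_mult_iff)
  then have Jne: "J \<noteq> {}" by auto
  \<comment> \<open>Truncation from below, tilt, and truncation from above. Gaps proportional to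
    sqrt (ln p) make the truncated tilted mass negligible, and \<open>?x\<close> already exceeds the
    largest score compatible with recovery.\<close>
  let ?x = "sqrt t1 * sqrt (L n)" and ?l = "sqrt t2 * sqrt (L n)" and ?y = "sqrt t3 * sqrt (L n)"
  have sL: "0 < sqrt (L n)" using L8 by simp
  have xly: "0 \<le> ?x" "?x < ?l" "?l < ?y" using t sL L8 by auto
  have "sqrt t3 \<le> sqrt 4" using t by (intro real_sqrt_le_mono) simp
  then have y: "0 \<le> ?y" "?y \<le> 2 * sqrt (L n)" using t sL by auto
  note ts = tail_scale[OF rg y]
  have k: "0 < sqrt (1 / (c0 * cs))" using const_pos by simp
  have K0: "0 < K n" using Kn by simp
  have sn: "1 \<le> sqrt n" using n0 by simp
  have "K n * (?y / sqrt n) \<le> 4 * e1 n" using ts(2) e_nonneg[OF rg] by simp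
  also have "\<dots> \<le> a / sqrt (1 / (c0 * cs)) / 2" using rg by (simp only: regime_def)
  finally have Ky: "K n * (?y / sqrt n) \<le> a / sqrt (1 / (c0 * cs)) / 2" .
  have yb: "?y / sqrt n \<le> R.bx / 2"
  proof -
    have "y \<le> a / k / s / 2" if "k * y \<le> a / s / 2" "0 < k" for y k s
    proof -
      have "y \<le> a / s / 2 / k" using that by (simp only: pos_le_divide_eq mult.commute)
      then show ?thesis by (simp add: mult_ac)
    qed
    then show ?thesis unfolding Lx_bound(2)[OF rg] using K0 Ky by blast
  qed
  have "?y / sqrt n \<le> 4 * e1 n" using ts(1) e_nonneg[OF rg] by simp
  also have "\<dots> \<le> 1" using rg by (simp only: regime_def)
  finally have y1: "?y / sqrt n \<le> 1" .
  have Lx0: "0 \<le> R.Lx / 2 + 32" using R.Lx_nonneg by simp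
  have core: "?y ^ 3 * (R.Lx / 2 + 32) / sqrt n \<le> 8 * cW * e1 n"
  proof -
    have "?y ^ 3 * (R.Lx / 2 + 32) / sqrt n \<le> ?y ^ 3 * (cW * K n) / sqrt n"
      using Lx_bound(1)[OF rg] y sn by (intro divide_right_mono mult_left_mono) auto
    also have "\<dots> = cW * (?y ^ 3 * K n / sqrt n)" by simp
    also have "\<dots> \<le> cW * (8 * e1 n)" using ts(3) cW_ge by (intro mult_left_mono) auto
    finally show ?thesis by simp
  qed
  have small: "(?y / sqrt n) ^ 3 * (R.Lx / 2 + 32) \<le> 1 / 2"
  proof -
    have "sqrt n ^ 1 \<le> sqrt n ^ 3" using sn by (intro power_increasing) auto
    then have "?y ^ 3 / sqrt n ^ 3 \<le> ?y ^ 3 / sqrt n ^ 1" using y sn by (intro divide_left_mono) auto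
    then have "(?y / sqrt n) ^ 3 * (R.Lx / 2 + 32) \<le> ?y ^ 3 / sqrt n * (R.Lx / 2 + 32)"
      unfolding power_divide using Lx0 by (intro mult_right_mono) auto
    also have "\<dots> = ?y ^ 3 * (R.Lx / 2 + 32) / sqrt n" by simp
    also have "\<dots> \<le> 8 * cW * e1 n" by (rule core)
    also have "\<dots> \<le> 1 / 2" using rg by (simp only: regime_def)
    finally show ?thesis .
  qed
  let ?R = "1024 * cW * e1 n"
  have "128 * ?y ^ 3 * (R.Lx / 2 + 32) / sqrt n = 128 * (?y ^ 3 * (R.Lx / 2 + 32) / sqrt n)" by simp
  then have RR: "128 * ?y ^ 3 * (R.Lx / 2 + 32) / sqrt n \<le> ?R" using core by linarith
  have rho: "R.T j k / sqrt (R.T j j * R.T k k) \<le> ?e" if "j \<in> J" "k \<in> J" "j \<noteq> k" for j k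
    using ind[OF that] that J by (auto simp: not_less intro: order_trans[OF abs_ge_self])
  have JP: "J \<subseteq> {..<p n}" using J by auto
  have wm: "R.prob {\<omega> \<in> space (M n). \<forall>j\<in>J. R.W j \<omega> \<le> ?x}
    \<le> exp (?l\<^sup>2 * ?e + ?R) + exp (?l * ?y - ?l\<^sup>2 / 2 + ?R) / card J
      - 2 * (exp (- ?R) - exp (?R - (?l - ?x)\<^sup>2 / 2) - exp (?R - (?y - ?l)\<^sup>2 / 2)) + 1"
    by (rule R.W_max_lower[OF JP Jne rho xly yb y1 small RR])
  have l2: "?l\<^sup>2 = t2 * L n" using t L8 by (simp add: power_mult_distrib)
  have le: "?l\<^sup>2 * ?e = t2 / L n" unfolding l2 using L8 by (simp add: power2_eq_square)
  have ss: "sqrt (L n) * sqrt (L n) = L n" using L8 by simp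
  have ly: "?l * ?y - ?l\<^sup>2 / 2 + ?R = ?R + (- (1 - (sqrt t2 * sqrt t3 - t2 / 2)) * L n) + L n"
  proof -
    have "?l * ?y = (sqrt t2 * sqrt t3) * (sqrt (L n) * sqrt (L n))" by (simp only: mult_ac)
    then have "?l * ?y = (sqrt t2 * sqrt t3) * L n" unfolding ss .
    then show ?thesis unfolding l2 by (simp add: algebra_simps)
  qed
  have dx: "(?l - ?x)\<^sup>2 / 2 = (sqrt t2 - sqrt t1)\<^sup>2 / 2 * L n" "(?y - ?l)\<^sup>2 / 2 = (sqrt t3 - sqrt t2)\<^sup>2 / 2 * L n"
  proof -
    have gen: "(a' * s - b' * s)\<^sup>2 / 2 = (a' - b')\<^sup>2 / 2 * (s * s)" for a' b' s :: real
      by (simp add: power2_eq_square algebra_simps)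
    show "(?l - ?x)\<^sup>2 / 2 = (sqrt t2 - sqrt t1)\<^sup>2 / 2 * L n" "(?y - ?l)\<^sup>2 / 2 = (sqrt t3 - sqrt t2)\<^sup>2 / 2 * L n"
      unfolding gen ss by (rule refl)+
  qed
  have dg: "exp (?l * ?y - ?l\<^sup>2 / 2 + ?R) / card J
      \<le> exp ?R * ((1 + ?Q) * exp (- (1 - (sqrt t2 * sqrt t3 - t2 / 2)) * L n)) / (1 - \<rho>)"
  proof -
    have "real (p n) / card J \<le> (1 + ?Q) / (1 - \<rho>)"
      using cV' Jc \<rho> by (simp add: pos_divide_le_eq pos_le_divide_eq mult.commute)
    then have "exp ?R * exp (- (1 - (sqrt t2 * sqrt t3 - t2 / 2)) * L n) * (real (p n) / card J)
      \<le> exp ?R * exp (- (1 - (sqrt t2 * sqrt t3 - t2 / 2)) * L n) * ((1 + ?Q) / (1 - \<rho>))"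
      by (intro mult_left_mono) auto
    then show ?thesis unfolding ly exp_add p_exp[OF rg, symmetric] by (simp add: mult_ac)
  qed
  have xx: "sqrt (ln (real (p n))) * (sqrt \<tau> + 3 * dS n) \<le> ?x"
    using dt sL by (simp add: mult.commute[of "sqrt t1"])
  have "prob_exact_recovery (M n) n (p n) (X n) (eps n) (\<lambda>_. lNS n) bh gh (sig2hat n) \<tau> \<beta>
      \<le> R.bad \<beta> + R.prob {\<omega> \<in> space (M n). \<forall>j\<in>J. R.W j \<omega> \<le> ?x}"
    by (rule R.recovery_upper[OF \<beta>c _ \<tau> J xx]) (simp add: \<beta>s)
  also have "\<dots> \<le> b2 \<rho> t1 t2 t3 n"
    using bad wm dg unfolding le dx b2_def by linarith
  finally show ?thesis .
qed

end

section \<open>From the stated assumptions to the sequence of models\<close>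

lemma Max_image_bounds:
  fixes f :: "nat \<Rightarrow> real"
  assumes "0 < p"
  shows "j < p \<Longrightarrow> f j \<le> (MAX j\<in>{..<p}. f j)" and "\<exists>j<p. (MAX j\<in>{..<p}. f j) = f j"
proof -
  show "j < p \<Longrightarrow> f j \<le> (MAX j\<in>{..<p}. f j)" by (intro Max_ge) auto
  have "(MAX j\<in>{..<p}. f j) \<in> f ` {..<p}" using assms by (intro Max_in) auto
  then show "\<exists>j<p. (MAX j\<in>{..<p}. f j) = f j" by auto
qed

lemma tendsto_zero_if_abs_le:
  fixes f g :: "nat \<Rightarrow> real"
  assumes "g \<longlonglongrightarrow> 0" "eventually (\<lambda>n. \<bar>f n\<bar> \<le> g n) sequentially"
  shows "f \<longlonglongrightarrow> 0"
  by (rule Lim_null_comparison[OF _ assms(1)]) (use assms(2) in simp)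

lemma A2_D:
  assumes "A2 p \<Sigma>"
  obtains c0 C0 where "0 < c0" "0 < C0" "\<And>n. 0 < n \<Longrightarrow> c0 < Min {l. eigenvalue (\<Sigma> n) l}"
    "\<And>n j. 0 < n \<Longrightarrow> j < p n \<Longrightarrow> \<Sigma> n $$ (j, j) \<le> C0"
  using assms unfolding A2_def by blast

lemma regression_model_intro:
  assumes "linear_model M n p X eps \<Sigma> \<Theta> sig2" "0 < n" "0 < c0" "c0 < Min {l. eigenvalue \<Sigma> l}" "0 < C0"
    "\<And>j. j < p \<Longrightarrow> \<Sigma> $$ (j, j) \<le> C0" "0 < sig2"
  shows "regression_model M n p X eps \<Sigma> \<Theta> sig2 c0 C0"
proof -
  interpret prob_space M using assms(1) by (simp add: linear_model_def)
  show ?thesis by unfold_locales (use assms in auto)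
qed

text \<open>The constants are fixed before the sample size, with \<open>K0 D n\<close> as the only
  scale that may vary; both design cases leave through the same interface.\<close>

lemma uniform_moments:
  fixes M :: "nat \<Rightarrow> 'a measure"
  assumes model: "\<And>n. n > 0 \<Longrightarrow> linear_model (M n) n (p n) (X n) (eps n) (\<Sigma> n) (\<Theta> n) (sig2 n)"
    and A1: "A1 D M p X" and A2: "A2 p \<Sigma>" and A3: "A3 D M p eps \<Theta> sig2"
  obtains c0 C0 a B cs Cs where
    "\<And>n. 0 < n \<Longrightarrow> regression_moments (M n) n (p n) (X n) (eps n) (\<Sigma> n) (\<Theta> n) (sig2 n) c0 C0 (K0 D n) a B cs Cs"
proof -
  obtain c0 C0 where c: "0 < c0" "0 < C0" "\<And>n. 0 < n \<Longrightarrow> c0 < Min {l. eigenvalue (\<Sigma> n) l}"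
    "\<And>n j. 0 < n \<Longrightarrow> j < p n \<Longrightarrow> \<Sigma> n $$ (j, j) \<le> C0" using A2_D[OF A2] by metis
  obtain cs Cs where s: "0 < cs" "0 < Cs" "\<And>n. 0 < n \<Longrightarrow> cs < sig2 n \<and> sig2 n < Cs"
    using A3 by (cases D) auto
  have rm: "regression_model (M n) n (p n) (X n) (eps n) (\<Sigma> n) (\<Theta> n) (sig2 n) c0 C0" if n: "0 < n" for n
    by (rule regression_model_intro[OF model[OF n] n c(1) c(3)[OF n] c(2) c(4)[OF n]]) (use s(1) s(3)[OF n] in auto)
  have sig: "cs \<le> sig2 n" "sig2 n \<le> Cs" if "0 < n" for n using s(3)[OF that] by auto
  show thesis
  proof (cases D)
    case Sub_Gaussian
    from A1[unfolded Sub_Gaussian A1.simps] obtain C where C: "0 < C"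
      and XC': "\<forall>n>0. \<forall>i<n. \<forall>a :: nat \<Rightarrow> real. (\<Sum>j<p n. (a j)\<^sup>2) \<le> 1 \<longrightarrow>
        (\<integral>\<^sup>+\<omega>. ennreal (exp (\<bar>\<Sum>j<p n. a j * X n i j \<omega>\<bar>\<^sup>2 / C)) \<partial>M n) \<le> 2"
      by (elim exE conjE) (rule that)
    have XC: "(\<integral>\<^sup>+\<omega>. ennreal (exp (\<bar>\<Sum>j<p n. a j * X n i j \<omega>\<bar>\<^sup>2 / C)) \<partial>M n) \<le> 2"
      if "0 < n" "i < n" "(\<Sum>j<p n. (a j)\<^sup>2) \<le> (1::real)" for n i a
      by (rule XC'[rule_format, OF that])
    from A3[unfolded Sub_Gaussian A3.simps, THEN conjunct2, THEN conjunct1] obtain Ce where Ce: "0 < Ce"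
      and eC': "\<forall>n>0. \<forall>i<n. (\<integral>\<^sup>+\<omega>. ennreal (exp (\<bar>eps n i \<omega>\<bar>\<^sup>2 / Ce)) \<partial>M n) \<le> 2"
      by (elim exE conjE) (rule that)
    have eC: "(\<integral>\<^sup>+\<omega>. ennreal (exp (\<bar>eps n i \<omega>\<bar>\<^sup>2 / Ce)) \<partial>M n) \<le> 2" if "0 < n" "i < n" for n i
      by (rule eC'[rule_format, OF that])
    show thesis
    proof (rule that)
      fix n :: nat assume n: "0 < n"
      show "regression_moments (M n) n (p n) (X n) (eps n) (\<Sigma> n) (\<Theta> n) (sig2 n) c0 C0 (K0 D n)
          (1 / (2 * ((1 + C0 / c0)\<^sup>2 * C + Ce)))
          (4 / (1 / (2 * ((1 + C0 / c0)\<^sup>2 * C + Ce))) ^ 2 + 12 / (1 / (2 * ((1 + C0 / c0)\<^sup>2 * C + Ce))) ^ 3) cs Cs"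
        using regression_model.moments_sub_Gaussian[OF rm[OF n] C Ce s(1) sig[OF n] XC[OF n] eC[OF n]]
        by (simp add: Sub_Gaussian)
    qed
  next
    case (Strongly_Bounded K)
    have bd: "1 \<le> K n" "\<And>i j. i < n \<Longrightarrow> j < p n \<Longrightarrow> AE \<omega> in M n. \<bar>X n i j \<omega>\<bar> \<le> K n"
      "\<And>i j. i < n \<Longrightarrow> j < p n \<Longrightarrow> AE \<omega> in M n. \<bar>node_fit (M n) n (p n) (X n) j \<omega> $ i\<bar> \<le> K n" if "0 < n" for n
    proof -
      note F = A1[unfolded Strongly_Bounded A1.simps, THEN spec, THEN mp, OF that]
      note bnd = F[THEN conjunct2, THEN conjunct1]
      show "1 \<le> K n" by (rule F[THEN conjunct1])
      show "AE \<omega> in M n. \<bar>X n i j \<omega>\<bar> \<le> K n" "AE \<omega> in M n. \<bar>node_fit (M n) n (p n) (X n) j \<omega> $ i\<bar> \<le> K n"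
        if "i < n" "j < p n" for i j
        using bnd[THEN spec, THEN mp, OF that(1), THEN spec, THEN mp, OF that(2)] by (rule conjunct1, rule conjunct2)
    qed
    from A3[unfolded Strongly_Bounded A3.simps, THEN conjunct2, THEN conjunct1] obtain Ce where Ce: "0 < Ce"
      and eC': "\<forall>n>0. \<forall>i<n. (\<integral>\<^sup>+\<omega>. ennreal (exp (\<bar>eps n i \<omega>\<bar> / Ce)) \<partial>M n) \<le> 2"
      by (elim exE conjE) (rule that)
    have eC: "(\<integral>\<^sup>+\<omega>. ennreal (exp (\<bar>eps n i \<omega>\<bar> / Ce)) \<partial>M n) \<le> 2" if "0 < n" "i < n" for n i
      by (rule eC'[rule_format, OF that])
    show thesis
    proof (rule that)
      fix n :: nat assume n: "0 < n"
      show "regression_moments (M n) n (p n) (X n) (eps n) (\<Sigma> n) (\<Theta> n) (sig2 n) c0 C0 (K0 D n)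
          (1 / (4 * Ce)) (4 * C0 * exp (4 * (1 / (4 * Ce))) + 3 * C0 / (1 / (4 * Ce)) ^ 3) cs Cs"
        using regression_model.moments_bounded[OF rm[OF n] bd(1)[OF n] Ce s(1) sig[OF n] bd(2)[OF n] bd(3)[OF n] eC[OF n]]
        by (simp add: Strongly_Bounded)
    qed
  qed
qed

text \<open>Only three consequences of the growth conditions are used. In the bounded case the third one,
  on \<open>K0\<close> alone, holds because one of the two sparsities is eventually positive.\<close>

lemma growth_consequences:
  fixes D :: design_case
  assumes pos: "\<And>n. n > 0 \<Longrightarrow> 0 < p n" and K1: "\<And>n. n > 0 \<Longrightarrow> 1 \<le> K0 D n"
    and p_lim: "filterlim (\<lambda>n. real (p n)) at_top sequentially"
    and A3: "A3 D M p eps \<Theta> sig2"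
    and growth_nodewise:
      "(\<lambda>n. MAX j\<in>{..<p n}. (K0 D n)\<^sup>2 * (real (row_sparsity (p n) (\<Theta> n) j))\<^sup>2
              * ln (real (p n) * real n) ^ 3 * (ln (real n))\<^sup>2 / n) \<longlonglongrightarrow> 0"
    and growth_sparsity:
      "(\<lambda>n. K0 D n ^ 4 * (real (s0 n))\<^sup>2 * ln (real (p n)) ^ 3 / n) \<longlonglongrightarrow> 0"
    and nondegenerate: "D \<noteq> Sub_Gaussian \<Longrightarrow>
      eventually (\<lambda>n. 0 < s0 n \<or> (\<exists>j<p n. 0 < row_sparsity (p n) (\<Theta> n) j)) sequentially"
  defines "sN \<equiv> \<lambda>n. if n = 0 then 0 else MAX j\<in>{..<p n}. real (row_sparsity (p n) (\<Theta> n) j)"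
    and "l \<equiv> \<lambda>n. ln (real (p n)) * sqrt (ln (real (p n))) / sqrt n"
  shows "(\<lambda>n. K0 D n * l n) \<longlonglongrightarrow> 0" and "(\<lambda>n. (K0 D n)\<^sup>2 * real (s0 n) * l n) \<longlonglongrightarrow> 0"
    and "(\<lambda>n. K0 D n * sN n * l n) \<longlonglongrightarrow> 0"
proof -
  let ?L = "\<lambda>n. ln (real (p n))"
  have L_ev: "eventually (\<lambda>n. 0 < n \<and> 1 \<le> ?L n \<and> 1 \<le> ln (real n)) sequentially"
  proof -
    have "filterlim ?L at_top sequentially" by (rule filterlim_compose[OF ln_at_top p_lim])
    then have 1: "eventually (\<lambda>n. 1 \<le> ?L n) sequentially" by (simp add: filterlim_at_top)
    have "filterlim (\<lambda>n. ln (real n)) at_top sequentially"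
      by (rule filterlim_compose[OF ln_at_top filterlim_real_sequentially])
    then have 2: "eventually (\<lambda>n. 1 \<le> ln (real n)) sequentially" by (simp add: filterlim_at_top)
    show ?thesis using 1 2 eventually_gt_at_top[of 0] by eventually_elim simp
  qed
  have l2: "(l n)\<^sup>2 = ?L n ^ 3 / n" if "1 \<le> ?L n" for n
    using that by (simp add: l_def power_divide power_mult_distrib power3_eq_cube power2_eq_square)
  have l0: "0 \<le> l n" if "1 \<le> ?L n" for n using that by (simp add: l_def)
  \<comment> \<open>The growth conditions are the squares of the quantities wanted, up to larger
    logarithmic factors.\<close>
  have sqrt_lim: "f \<longlonglongrightarrow> 0" if "(\<lambda>n. (f n)\<^sup>2) \<longlonglongrightarrow> 0" for f :: "nat \<Rightarrow> real"
  proof -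
    have "(\<lambda>n. sqrt ((f n)\<^sup>2)) \<longlonglongrightarrow> sqrt 0" by (rule tendsto_real_sqrt[OF that])
    then show ?thesis by (simp add: tendsto_rabs_zero_iff)
  qed
  show e2: "(\<lambda>n. (K0 D n)\<^sup>2 * real (s0 n) * l n) \<longlonglongrightarrow> 0"
  proof (rule sqrt_lim, rule tendsto_zero_if_abs_le[OF growth_sparsity])
    show "eventually (\<lambda>n. \<bar>((K0 D n)\<^sup>2 * real (s0 n) * l n)\<^sup>2\<bar> \<le> K0 D n ^ 4 * (real (s0 n))\<^sup>2 * ?L n ^ 3 / n) sequentially"
      using L_ev
    proof eventually_elim
      case (elim n)
      have "((K0 D n)\<^sup>2 * real (s0 n) * l n)\<^sup>2 = K0 D n ^ 4 * (real (s0 n))\<^sup>2 * (l n)\<^sup>2"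
        by (simp add: power_mult_distrib power2_eq_square power4_eq_xxxx)
      then show ?case using l2[of n] elim by simp
    qed
  qed
  have sN_at: "\<exists>j<p n. sN n = real (row_sparsity (p n) (\<Theta> n) j)" if "0 < n" for n
    using Max_image_bounds(2)[OF pos[OF that], of "\<lambda>j. real (row_sparsity (p n) (\<Theta> n) j)"] that by (simp add: sN_def)
  show e3: "(\<lambda>n. K0 D n * sN n * l n) \<longlonglongrightarrow> 0"
  proof (rule sqrt_lim, rule tendsto_zero_if_abs_le[OF growth_nodewise])
    show "eventually (\<lambda>n. \<bar>(K0 D n * sN n * l n)\<^sup>2\<bar> \<le> (MAX j\<in>{..<p n}. (K0 D n)\<^sup>2 * (real (row_sparsity (p n) (\<Theta> n) j))\<^sup>2
              * ln (real (p n) * real n) ^ 3 * (ln (real n))\<^sup>2 / n)) sequentially"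
      using L_ev
    proof eventually_elim
      case (elim n)
      obtain j where j: "j < p n" "sN n = real (row_sparsity (p n) (\<Theta> n) j)" using sN_at elim by blast
      have pn: "0 < real (p n)" using pos elim by simp
      have "(K0 D n * sN n * l n)\<^sup>2 = (K0 D n)\<^sup>2 * (sN n)\<^sup>2 * (?L n ^ 3 * 1 / n)"
        using l2[of n] elim by (simp add: power_mult_distrib)
      also have "\<dots> \<le> (K0 D n)\<^sup>2 * (sN n)\<^sup>2 * (ln (real (p n) * real n) ^ 3 * (ln (real n))\<^sup>2 / n)"
      proof (intro mult_left_mono divide_right_mono mult_mono power_mono)
        show "?L n \<le> ln (real (p n) * real n)" using elim pn by (simp add: ln_mult)
        show "1 \<le> (ln (real n))\<^sup>2" using elim by (intro one_le_power) auto
        show "0 \<le> ln (real (p n) * real n) ^ 3" using elim pn by (simp add: ln_mult)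
      qed (use elim in auto)
      also have "\<dots> = (K0 D n)\<^sup>2 * (real (row_sparsity (p n) (\<Theta> n) j))\<^sup>2 * ln (real (p n) * real n) ^ 3 * (ln (real n))\<^sup>2 / n"
        by (simp add: j(2))
      also have "\<dots> \<le> (MAX j\<in>{..<p n}. (K0 D n)\<^sup>2 * (real (row_sparsity (p n) (\<Theta> n) j))\<^sup>2
              * ln (real (p n) * real n) ^ 3 * (ln (real n))\<^sup>2 / n)"
        by (rule Max_image_bounds(1)[OF pos]) (use elim j in auto)
      finally show ?case by simp
    qed
  qed
  show "(\<lambda>n. K0 D n * l n) \<longlonglongrightarrow> 0"
  proof (cases D)
    case Sub_Gaussian
    obtain C1 c1 where C: "0 < C1" "0 < c1" "\<And>n. 0 < n \<Longrightarrow> ln (real (p n) * real n) ^ 7 / n \<le> C1 * real n powr (- c1)"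
      using A3 unfolding Sub_Gaussian A3.simps by blast
    have lim: "(\<lambda>n. C1 * real n powr (- c1)) \<longlonglongrightarrow> 0"
    proof -
      have "(\<lambda>n. real n powr (- c1)) \<longlonglongrightarrow> 0"
        by (rule tendsto_neg_powr[OF _ filterlim_real_sequentially]) (use C in simp)
      then show ?thesis by (rule tendsto_mult_right_zero)
    qed
    show ?thesis
    proof (rule sqrt_lim, rule tendsto_zero_if_abs_le[OF lim])
      show "eventually (\<lambda>n. \<bar>(K0 D n * l n)\<^sup>2\<bar> \<le> C1 * real n powr (- c1)) sequentially"
        using L_ev
      proof eventually_elim
        case (elim n)
        have pn: "0 < real (p n)" using pos elim by simp
        have "?L n ^ 3 \<le> ?L n ^ 7" using elim by (intro power_increasing) auto
        also have "\<dots> \<le> ln (real (p n) * real n) ^ 7" using elim pn by (intro power_mono) (auto simp: ln_mult)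
        finally have "?L n ^ 3 / n \<le> ln (real (p n) * real n) ^ 7 / n" by (intro divide_right_mono) auto
        then show ?case using l2[of n] elim C(3)[of n] by (simp add: Sub_Gaussian)
      qed
    qed
  next
    case (Strongly_Bounded K)
    have nd: "eventually (\<lambda>n. 0 < s0 n \<or> (\<exists>j<p n. 0 < row_sparsity (p n) (\<Theta> n) j)) sequentially"
      using nondegenerate Strongly_Bounded by simp
    have "(\<lambda>n. (K0 D n)\<^sup>2 * real (s0 n) * l n + K0 D n * sN n * l n) \<longlonglongrightarrow> 0 + 0" by (rule tendsto_add[OF e2 e3])
    then have lim: "(\<lambda>n. (K0 D n)\<^sup>2 * real (s0 n) * l n + K0 D n * sN n * l n) \<longlonglongrightarrow> 0" by simp
    show ?thesis
    proof (rule tendsto_zero_if_abs_le[OF lim])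
      show "eventually (\<lambda>n. \<bar>K0 D n * l n\<bar> \<le> (K0 D n)\<^sup>2 * real (s0 n) * l n + K0 D n * sN n * l n) sequentially"
        using L_ev nd
      proof eventually_elim
        case (elim n)
        have K: "1 \<le> K0 D n" using K1 elim by simp
        have ll: "0 \<le> l n" using l0 elim by simp
        have s0: "0 \<le> sN n" using sN_at[of n] elim by auto
        \<comment> \<open>Either sparsity, once positive, is at least 1 as an integer. Hence
          \<open>K0 D n * l n\<close> is dominated by the sum of the two sequences already known to
          vanish.\<close>
        have "1 * 1 \<le> K0 D n * real (s0 n) + sN n"
        proof (cases "0 < s0 n")
          case True
          then have "1 * 1 \<le> K0 D n * real (s0 n)" using K by (intro mult_mono) auto
          then show ?thesis using s0 by simp
        next
          case False
          then obtain j where j: "j < p n" "0 < row_sparsity (p n) (\<Theta> n) j" using elim by auto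
          have "real (row_sparsity (p n) (\<Theta> n) j) \<le> sN n"
            unfolding sN_def using Max_image_bounds(1)[OF pos, of n j "\<lambda>j. real (row_sparsity (p n) (\<Theta> n) j)"] elim j by simp
          then show ?thesis using j False by simp
        qed
        then have "(K0 D n * l n) * 1 \<le> (K0 D n * l n) * (K0 D n * real (s0 n) + sN n)"
          using K ll by (intro mult_left_mono) auto
        then show ?case using K ll by (simp add: power2_eq_square algebra_simps)
      qed
    qed
  qed
qed

text \<open>The assumption is given for some tuning parameters of the right order, while the proof
  selects its own. Both are comparable up to a constant, and the condition on them is a limit equal
  to 0.\<close>

lemma A4_rescale:
  assumes A4: "A4 M p X eps \<Theta> sig2 s0 sig2hat lamN0" and pos: "\<And>n. 0 < n \<Longrightarrow> 0 < p n"
    and le: "\<And>n j. 0 < n \<Longrightarrow> j < p n \<Longrightarrow> 0 \<le> lamN n j" "\<And>n j. 0 < n \<Longrightarrow> j < p n \<Longrightarrow> lamN n j \<le> c * lamN0 n j"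
    and c: "0 \<le> c"
  shows "A4 M p X eps \<Theta> sig2 s0 sig2hat lamN"
proof -
  let ?m = "\<lambda>n. MAX j\<in>{..<p n}. lamN n j * sqrt (row_sparsity (p n) (\<Theta> n) j)"
  let ?mx = "\<lambda>n. MAX j\<in>{..<p n}. lamN0 n j * sqrt (row_sparsity (p n) (\<Theta> n) j)"
  have m: "0 \<le> ?m n \<and> ?m n \<le> c * ?mx n" if n: "0 < n" for n
  proof -
    obtain j where j: "j < p n" "?m n = lamN n j * sqrt (row_sparsity (p n) (\<Theta> n) j)"
      using Max_image_bounds(2)[OF pos[OF n], of "\<lambda>j. lamN n j * sqrt (row_sparsity (p n) (\<Theta> n) j)"] by (elim exE conjE)
    have "lamN n j * sqrt (row_sparsity (p n) (\<Theta> n) j) \<le> c * lamN0 n j * sqrt (row_sparsity (p n) (\<Theta> n) j)"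
      by (rule mult_right_mono[OF le(2)[OF n j(1)]]) simp
    also have "\<dots> = c * (lamN0 n j * sqrt (row_sparsity (p n) (\<Theta> n) j))" by (rule mult.assoc)
    also have "\<dots> \<le> c * ?mx n"
      by (rule mult_left_mono[OF Max_image_bounds(1)[OF pos[OF n] j(1)] c])
    finally have "?m n \<le> c * ?mx n" by (simp only: j(2))
    moreover have "0 \<le> ?m n" unfolding j(2) using le(1)[OF n j(1)] by (intro mult_nonneg_nonneg) auto
    ultimately show ?thesis by (rule conjI[rotated])
  qed
  obtain \<alpha> where \<alpha>: "\<And>n. 0 < n \<Longrightarrow> 0 < \<alpha> n" "filterlim \<alpha> at_top sequentially" "(\<lambda>n. \<alpha> n / p n) \<longlonglongrightarrow> 0"
    and lim: "(\<lambda>n. \<alpha> n * (ln (p n))\<^sup>2 * ?mx n) \<longlonglongrightarrow> 0"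
    and \<alpha>_var: "(\<lambda>n. SUP \<beta> \<in> considered n (p n) (\<Theta> n) (sig2 n) (s0 n).
             measure (M n) {\<omega> \<in> space (M n).
               \<alpha> n * (ln (p n))\<^sup>2 *
                 \<bar>sig2hat n (response n (p n) (X n) (eps n) \<beta> \<omega>) (design n (p n) (X n) \<omega>) - sig2 n\<bar>
               > 1}) \<longlonglongrightarrow> 0"
    using A4 unfolding A4_def by (elim exE conjE) blast
  have lim': "(\<lambda>n. c * (\<alpha> n * (ln (p n))\<^sup>2 * ?mx n)) \<longlonglongrightarrow> 0" by (rule tendsto_mult_right_zero[OF lim])
  have "eventually (\<lambda>n. \<bar>\<alpha> n * (ln (p n))\<^sup>2 * ?m n\<bar> \<le> c * (\<alpha> n * (ln (p n))\<^sup>2 * ?mx n)) sequentially"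
    using eventually_gt_at_top[of 0]
  proof eventually_elim
    case (elim n)
    have w: "0 \<le> \<alpha> n * (ln (p n))\<^sup>2" using \<alpha>(1)[OF elim] by simp
    have "\<bar>\<alpha> n * (ln (p n))\<^sup>2 * ?m n\<bar> = \<alpha> n * (ln (p n))\<^sup>2 * ?m n"
      by (rule abs_of_nonneg[OF mult_nonneg_nonneg[OF w conjunct1[OF m[OF elim]]]])
    also have "\<dots> \<le> \<alpha> n * (ln (p n))\<^sup>2 * (c * ?mx n)" by (rule mult_left_mono[OF conjunct2[OF m[OF elim]] w])
    also have "\<dots> = c * (\<alpha> n * (ln (p n))\<^sup>2 * ?mx n)" by (rule mult.left_commute)
    finally show ?case .
  qed
  then have "(\<lambda>n. \<alpha> n * (ln (p n))\<^sup>2 * ?m n) \<longlonglongrightarrow> 0" by (rule tendsto_zero_if_abs_le[OF lim'])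
  then show ?thesis unfolding A4_def using \<alpha> \<alpha>_var by (intro exI[of _ \<alpha>] conjI allI impI)
qed

theorem proposition3p1:
  fixes M :: "nat \<Rightarrow> 'a measure"
    and p s0 :: "nat \<Rightarrow> nat"
    and X :: "nat \<Rightarrow> nat \<Rightarrow> nat \<Rightarrow> 'a \<Rightarrow> real"
    and eps :: "nat \<Rightarrow> nat \<Rightarrow> 'a \<Rightarrow> real"
    and \<Sigma> \<Theta> :: "nat \<Rightarrow> real mat"
    and sig2 :: "nat \<Rightarrow> real"
    and sig2hat :: "nat \<Rightarrow> real vec \<Rightarrow> real mat \<Rightarrow> real"
    and D :: design_case
  assumes model: "\<And>n. n > 0 \<Longrightarrow>
      linear_model (M n) n (p n) (X n) (eps n) (\<Sigma> n) (\<Theta> n) (sig2 n)"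
    and sig2hat: "\<And>n. n > 0 \<Longrightarrow>
      is_variance_estimator (M n) n (p n) (X n) (eps n) (sig2hat n)"
    and A1: "A1 D M p X"
    and A2: "A2 p \<Sigma>"
    and A3: "A3 D M p eps \<Theta> sig2"
    and A4: "\<exists>lamN. nodewise_tuning_order D p lamN \<and> A4 M p X eps \<Theta> sig2 s0 sig2hat lamN"
    and A5: "A5 p \<Theta>"
    and growth_nodewise:
      "(\<lambda>n. MAX j\<in>{..<p n}. (K0 D n)\<^sup>2 * (real (row_sparsity (p n) (\<Theta> n) j))\<^sup>2
              * ln (real (p n) * real n) ^ 3 * (ln (real n))\<^sup>2 / n) \<longlonglongrightarrow> 0"
    and growth_sparsity:
      "(\<lambda>n. K0 D n ^ 4 * (real (s0 n))\<^sup>2 * ln (real (p n)) ^ 3 / n) \<longlonglongrightarrow> 0"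
    and nondegenerate: "D \<noteq> Sub_Gaussian \<Longrightarrow>
      eventually (\<lambda>n. 0 < s0 n \<or> (\<exists>j<p n. 0 < row_sparsity (p n) (\<Theta> n) j)) sequentially"
  shows "\<exists>lam lamN.
      tuning_order D p lam \<and> nodewise_tuning_order D p lamN \<and>
      A4 M p X eps \<Theta> sig2 s0 sig2hat lamN \<and>
      (\<forall>bhat ghat.
        (\<forall>n>0. is_lasso (M n) n (p n) (X n) (eps n) (lam n) (bhat n) \<and>
               is_nodewise_lasso (M n) n (p n) (X n) (lamN n) (ghat n)) \<longrightarrow>
        (\<lambda>n. INF \<beta> \<in> Psi n (p n) (\<Theta> n) (sig2 n) (2 * sqrt 2) \<inter> sparse_upto (p n) (s0 n).
           prob_exact_recovery (M n) n (p n) (X n) (eps n) (lamN n) (bhat n) (ghat n) (sig2hat n) 2 \<beta>)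
          \<longlonglongrightarrow> 1 \<and>
        ((\<exists>\<rho><1. eventually (\<lambda>n. real (s0 n) \<le> \<rho> * real (p n)) sequentially) \<longrightarrow>
         (\<forall>\<tau>. 0 < \<tau> \<and> \<tau> < 2 \<longrightarrow>
           (\<lambda>n. SUP \<beta> \<in> S_star (p n) (s0 n).
              prob_exact_recovery (M n) n (p n) (X n) (eps n) (lamN n) (bhat n) (ghat n) (sig2hat n) \<tau> \<beta>)
             \<longlonglongrightarrow> 0)))"
proof -
  obtain lamN0 where lamN0: "nodewise_tuning_order D p lamN0" "A4 M p X eps \<Theta> sig2 s0 sig2hat lamN0" using A4 by blast
  obtain cl where cl: "0 < cl" "\<And>n j. 0 < n \<Longrightarrow> j < p n \<Longrightarrow> cl * (K0 D n * sqrt (ln (p n) / n)) \<le> lamN0 n j"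
    using lamN0(1) unfolding nodewise_tuning_order_def by blast
  obtain \<alpha> where \<alpha>: "\<And>n. 0 < n \<Longrightarrow> 0 < \<alpha> n" "filterlim \<alpha> at_top sequentially" "(\<lambda>n. \<alpha> n / p n) \<longlonglongrightarrow> 0"
    and \<alpha>_lam: "(\<lambda>n. \<alpha> n * (ln (p n))\<^sup>2 * (MAX j\<in>{..<p n}. lamN0 n j * sqrt (row_sparsity (p n) (\<Theta> n) j))) \<longlonglongrightarrow> 0"
    and \<alpha>_var: "(\<lambda>n. SUP \<beta> \<in> considered n (p n) (\<Theta> n) (sig2 n) (s0 n).
             measure (M n) {\<omega> \<in> space (M n).
               \<alpha> n * (ln (p n))\<^sup>2 *
                 \<bar>sig2hat n (response n (p n) (X n) (eps n) \<beta> \<omega>) (design n (p n) (X n) \<omega>) - sig2 n\<bar>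
               > 1}) \<longlonglongrightarrow> 0"
    using lamN0(2) unfolding A4_def by blast
  obtain c0 C0 a B cs Cs where mom: "\<And>n. 0 < n \<Longrightarrow>
      regression_moments (M n) n (p n) (X n) (eps n) (\<Sigma> n) (\<Theta> n) (sig2 n) c0 C0 (K0 D n) a B cs Cs"
    using uniform_moments[OF model A1 A2 A3] by metis
  have pos: "0 < p n" if "0 < n" for n using model[OF that] by (simp add: linear_model_def)
  have K1: "1 \<le> K0 D n" if n: "0 < n" for n
  proof -
    interpret R: regression_moments "M n" n "p n" "X n" "eps n" "\<Sigma> n" "\<Theta> n" "sig2 n" c0 C0 "K0 D n" a B cs Cs by (rule mom[OF n])
    show ?thesis by (rule R.K)
  qed
  \<comment> \<open>Divergence of the dimension is implicit in the assumptions: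
    \<open>\<alpha>\<close> diverges and is of smaller order than \<open>p\<close>.\<close>
  have p_lim: "filterlim (\<lambda>n. real (p n)) at_top sequentially"
  proof (rule filterlim_at_top_mono[OF \<alpha>(2)])
    have "eventually (\<lambda>n. \<alpha> n / p n < 1) sequentially" using \<alpha>(3) by (rule order_tendstoD(2)) simp
    then show "eventually (\<lambda>n. \<alpha> n \<le> real (p n)) sequentially"
      using eventually_gt_at_top[of 0]
    proof eventually_elim
      case (elim n)
      then show ?case using pos[of n] by (simp add: pos_divide_less_eq)
    qed
  qed
  define sN where "sN = (\<lambda>n. if n = 0 then 0 else MAX j\<in>{..<p n}. real (row_sparsity (p n) (\<Theta> n) j))"
  define q where "q = (\<lambda>n. SUP \<beta> \<in> considered n (p n) (\<Theta> n) (sig2 n) (s0 n).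
             measure (M n) {\<omega> \<in> space (M n).
               \<alpha> n * (ln (p n))\<^sup>2 *
                 \<bar>sig2hat n (response n (p n) (X n) (eps n) \<beta> \<omega>) (design n (p n) (X n) \<omega>) - sig2 n\<bar>
               > 1})"
  have growth:
    "(\<lambda>n. K0 D n * (ln (p n) * sqrt (ln (p n)) / sqrt n)) \<longlonglongrightarrow> 0"
    "(\<lambda>n. (K0 D n)\<^sup>2 * real (s0 n) * (ln (p n) * sqrt (ln (p n)) / sqrt n)) \<longlonglongrightarrow> 0"
    "(\<lambda>n. K0 D n * sN n * (ln (p n) * sqrt (ln (p n)) / sqrt n)) \<longlonglongrightarrow> 0"
    unfolding sN_def
    by (rule growth_consequences[OF _ _ p_lim A3 growth_nodewise growth_sparsity nondegenerate]; use pos K1 in simp)+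
  interpret RS: regression_sequence M p s0 X eps \<Sigma> \<Theta> sig2 sig2hat "K0 D" \<alpha> q sN c0 C0 a B cs Cs
  proof (rule regression_sequence.intro)
    show "real (row_sparsity (p n) (\<Theta> n) j) \<le> sN n" if "0 < n" "j < p n" for n j
      unfolding sN_def using Max_image_bounds(1)[OF pos, of n j "\<lambda>j. real (row_sparsity (p n) (\<Theta> n) j)"] that by simp
    show "0 \<le> sN n" for n
    proof (cases "n = 0")
      case False
      then show ?thesis unfolding sN_def using Max_image_bounds(2)[OF pos, of n "\<lambda>j. real (row_sparsity (p n) (\<Theta> n) j)"] by auto
    qed (simp add: sN_def)
    show "measure (M n) {\<omega> \<in> space (M n). \<alpha> n * (ln (p n))\<^sup>2 *
        \<bar>sig2hat n (response n (p n) (X n) (eps n) \<beta> \<omega>) (design n (p n) (X n) \<omega>) - sig2 n\<bar> > 1} \<le> q n"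
      if n: "0 < n" and \<beta>: "\<beta> \<in> considered n (p n) (\<Theta> n) (sig2 n) (s0 n)" for n \<beta>
    proof -
      interpret prob_space "M n" using model[OF n] by (simp add: linear_model_def)
      \<comment> \<open>A supremum of reals bounds its members only if they are bounded above; here
        they are probabilities.\<close>
      show ?thesis unfolding q_def
        by (rule cSUP_upper[OF \<beta>]) (auto intro!: bdd_aboveI[of _ 1])
    qed
    show "q \<longlonglongrightarrow> 0" using \<alpha>_var by (simp add: q_def)
  qed (fact mom sig2hat \<alpha>(1) \<alpha>(2) p_lim growth)+
  \<comment> \<open>The parameters depend only on \<open>n\<close>, \<open>p\<close>,
    \<open>K0\<close> and constants of the model class, never on the estimators, so one choice
    serves all selections of minimisers.\<close>
  define lamN where "lamN = (\<lambda>n (j::nat). RS.lNS n)"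
  have t1: "tuning_order D p RS.lamS"
    unfolding tuning_order_def RS.lamS_def
    by (intro exI[of _ "2 * RS.cE"] conjI allI impI order_refl) (use RS.cE_pos in simp_all)
  have t2: "nodewise_tuning_order D p lamN"
    unfolding nodewise_tuning_order_def lamN_def RS.lNS_def
    by (intro exI[of _ "2 * RS.cA"] conjI allI impI order_refl) (use RS.cA_pos in simp_all)
  have rt0: "0 \<le> K0 D n * sqrt (ln (p n) / n)" if "0 < n" for n
    using K1[OF that] pos[OF that] by (intro mult_nonneg_nonneg) auto
  have lam_le: "lamN n j \<le> 2 * RS.cA / cl * lamN0 n j" "0 \<le> lamN n j" if n: "0 < n" and j: "j < p n" for n j
  proof -
    have "2 * RS.cA / cl * (cl * (K0 D n * sqrt (ln (p n) / n))) \<le> 2 * RS.cA / cl * lamN0 n j"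
      using cl(2)[OF n j] RS.cA_pos cl(1) by (intro mult_left_mono) auto
    then show "lamN n j \<le> 2 * RS.cA / cl * lamN0 n j" using cl(1) by (simp add: lamN_def RS.lNS_def)
    show "0 \<le> lamN n j" using rt0[OF n] RS.cA_pos by (simp add: lamN_def RS.lNS_def)
  qed
  have A4': "A4 M p X eps \<Theta> sig2 s0 sig2hat lamN"
    by (rule A4_rescale[OF lamN0(2) _ lam_le(2,1)]) (use pos RS.cA_pos cl(1) in auto)
  have main: "(\<lambda>n. INF \<beta> \<in> Psi n (p n) (\<Theta> n) (sig2 n) (2 * sqrt 2) \<inter> sparse_upto (p n) (s0 n).
           prob_exact_recovery (M n) n (p n) (X n) (eps n) (lamN n) (bhat n) (ghat n) (sig2hat n) 2 \<beta>) \<longlonglongrightarrow> 1 \<and>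
        ((\<exists>\<rho><1. eventually (\<lambda>n. real (s0 n) \<le> \<rho> * real (p n)) sequentially) \<longrightarrow>
         (\<forall>\<tau>. 0 < \<tau> \<and> \<tau> < 2 \<longrightarrow>
           (\<lambda>n. SUP \<beta> \<in> S_star (p n) (s0 n).
              prob_exact_recovery (M n) n (p n) (X n) (eps n) (lamN n) (bhat n) (ghat n) (sig2hat n) \<tau> \<beta>)
             \<longlonglongrightarrow> 0))"
    if est: "\<forall>n>0. is_lasso (M n) n (p n) (X n) (eps n) (RS.lamS n) (bhat n) \<and>
               is_nodewise_lasso (M n) n (p n) (X n) (lamN n) (ghat n)" for bhat ghat
  proof -
    have bh: "is_lasso (M n) n (p n) (X n) (eps n) (RS.lamS n) (bhat n)"
      and gh: "is_nodewise_lasso (M n) n (p n) (X n) (\<lambda>_. RS.lNS n) (ghat n)" if "0 < n" for n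
      using est that by (auto simp: lamN_def)
    let ?pr = "\<lambda>n \<tau> \<beta>. prob_exact_recovery (M n) n (p n) (X n) (eps n) (lamN n) (bhat n) (ghat n) (sig2hat n) \<tau> \<beta>"
    have pr01: "0 \<le> ?pr n \<tau> \<beta>" "?pr n \<tau> \<beta> \<le> 1" if "0 < n" for n \<tau> \<beta>
    proof -
      interpret prob_space "M n" using model[OF that] by (simp add: linear_model_def)
      show "0 \<le> ?pr n \<tau> \<beta>" "?pr n \<tau> \<beta> \<le> 1" by (simp_all add: prob_exact_recovery_def)
    qed
    let ?I = "\<lambda>n. INF \<beta> \<in> Psi n (p n) (\<Theta> n) (sig2 n) (2 * sqrt 2) \<inter> sparse_upto (p n) (s0 n). ?pr n 2 \<beta>"
    have I: "?I \<longlonglongrightarrow> 1"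
    proof (rule tendsto_sandwich[of "\<lambda>n. 1 - RS.b1 n" _ _ "\<lambda>_. 1"])
      show "(\<lambda>n. 1 - RS.b1 n) \<longlonglongrightarrow> 1" using tendsto_diff[OF tendsto_const RS.b1_lim, of 1] by simp
      \<comment> \<open>The zero vector has empty support and meets every signal condition.
        Nonemptiness matters because the infimum of the empty set of reals is an unspecified
        value.\<close>
      have ne: "Psi n (p n) (\<Theta> n) (sig2 n) (2 * sqrt 2) \<inter> sparse_upto (p n) (s0 n) \<noteq> {}" for n
      proof -
        have "supp (0\<^sub>v (p n)) = {}" by (auto simp: supp_def)
        then have "0\<^sub>v (p n) \<in> Psi n (p n) (\<Theta> n) (sig2 n) (2 * sqrt 2) \<inter> sparse_upto (p n) (s0 n)"
          by (simp add: Psi_def sparse_upto_def)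
        then show ?thesis by blast
      qed
      show "eventually (\<lambda>n. 1 - RS.b1 n \<le> ?I n) sequentially"
        using RS.eventually_regime
      proof eventually_elim
        case (elim n)
        have n: "0 < n" by (rule RS.n0[OF elim])
        show ?case
          by (rule cINF_greatest[OF ne])
            (use RS.recovery_lower_bound[OF elim _ bh[OF n] gh[OF n]] in \<open>simp add: lamN_def\<close>)
      qed
      show "eventually (\<lambda>n. ?I n \<le> 1) sequentially"
        using eventually_gt_at_top[of 0]
      proof eventually_elim
        case (elim n)
        obtain \<beta> where \<beta>: "\<beta> \<in> Psi n (p n) (\<Theta> n) (sig2 n) (2 * sqrt 2) \<inter> sparse_upto (p n) (s0 n)" using ne by blast
        have "?I n \<le> ?pr n 2 \<beta>" by (rule cINF_lower[OF _ \<beta>]) (use pr01(1)[OF elim] in \<open>auto intro!: bdd_belowI[of _ 0]\<close>)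
        then show ?case using pr01(2)[OF elim, of 2 \<beta>] by linarith
      qed
    qed simp
    have U: "(\<lambda>n. SUP \<beta> \<in> S_star (p n) (s0 n). ?pr n \<tau> \<beta>) \<longlonglongrightarrow> 0" (is "?U \<longlonglongrightarrow> 0")
      if \<rho>: "\<rho> < 1" "eventually (\<lambda>n. real (s0 n) \<le> \<rho> * real (p n)) sequentially" and \<tau>: "0 < \<tau>" "\<tau> < 2" for \<rho> \<tau>
    proof -
      \<comment> \<open>Three levels strictly between \<tau> and 2: the gap from \<tau> to
        \<open>t1\<close> absorbs the estimation errors, and the other gaps make room for the tilt
        and its truncations.\<close>
      obtain t1 where t1: "\<tau> < t1" "t1 < 2" using dense[OF \<tau>(2)] by blast
      obtain t2 where t2: "t1 < t2" "t2 < 2" using dense[OF t1(2)] by blast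
      obtain t3 where t3: "t2 < t3" "t3 < 2" using dense[OF t2(2)] by blast
      have t10: "0 < t1" using \<tau> t1 by simp
      have dl: "eventually (\<lambda>n. RS.DL n < (sqrt t1 - sqrt \<tau>) / 3) sequentially"
        using RS.DL_lim by (rule order_tendstoD(2)) (use t1 in simp)
      show ?thesis
      proof (rule tendsto_sandwich[of "\<lambda>_. 0" _ _ "RS.b2 \<rho> t1 t2 t3"])
        show "RS.b2 \<rho> t1 t2 t3 \<longlonglongrightarrow> 0" by (rule RS.b2_lim[OF t10 t2(1) t3 \<rho>(1)])
        \<comment> \<open>Vectors with exactly \<open>s0 n\<close> nonzero entries exist only if
          \<open>s0 n \<le> p n\<close>, which the bound with \<rho> < 1 supplies.\<close>
        have ne: "S_star (p n) (s0 n) \<noteq> {}" if n: "0 < n" and s: "real (s0 n) \<le> \<rho> * real (p n)" for n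
        proof -
          have "\<rho> * real (p n) \<le> 1 * real (p n)" using \<rho>(1) by (intro mult_right_mono) auto
          then have sp: "s0 n \<le> p n" using s by simp
          let ?b = "vec (p n) (\<lambda>j. if j < s0 n then 1 else 0 :: real)"
          have "supp ?b = {..<s0 n}" using sp by (auto simp: supp_def split: if_splits)
          then have "?b \<in> S_star (p n) (s0 n)" by (simp add: S_star_def)
          then show ?thesis by blast
        qed
        show "eventually (\<lambda>n. 0 \<le> ?U n) sequentially"
          using \<rho>(2) eventually_gt_at_top[of 0]
        proof eventually_elim
          case (elim n)
          obtain \<beta> where \<beta>: "\<beta> \<in> S_star (p n) (s0 n)" using ne elim by blast
          have "?pr n \<tau> \<beta> \<le> ?U n" by (rule cSUP_upper[OF \<beta>]) (use pr01(2) elim in \<open>auto intro!: bdd_aboveI[of _ 1]\<close>)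
          then show ?case using pr01(1)[of n \<tau> \<beta>] elim by linarith
        qed
        show "eventually (\<lambda>n. ?U n \<le> RS.b2 \<rho> t1 t2 t3 n) sequentially"
          using RS.eventually_regime \<rho>(2) dl
        proof eventually_elim
          case (elim n)
          have n: "0 < n" by (rule RS.n0[OF elim(1)])
          have "RS.dS n * 1 \<le> RS.dS n * ln (real (p n))"
            using RS.dS_pos[OF elim(1)] RS.L8[OF elim(1)] by (intro mult_left_mono) auto
          then have "RS.dS n \<le> RS.DL n" using RS.dS_L[OF elim(1)] by linarith
          then have dt: "sqrt \<tau> + 3 * RS.dS n \<le> sqrt t1" using elim(3) by simp
          show ?case
            by (rule cSUP_least[OF ne[OF n elim(2)]])
              (use RS.recovery_upper_bound[OF elim(1) _ bh[OF n] gh[OF n] \<tau> t10 t2(1) t3 \<rho>(1) dt elim(2)] in \<open>simp add: lamN_def\<close>)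
        qed
      qed simp
    qed
    show ?thesis using I U by blast
  qed
  show ?thesis
    by (rule exI[of _ RS.lamS], rule exI[of _ lamN], rule conjI[OF t1 conjI[OF t2 conjI[OF A4']]],
        rule allI, rule allI, rule impI, rule main)
qed

end
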